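(* Assume Hypothesis (H) below. Let $t_1,\dots,t_d\ge 0$, $T=\sum_kt_k$, and let $(n_k,f^{(k)},B^{(k)})_{k\ge1}$ be a sequence with $n_k\to\infty$, $f^{(k)}\in\mathcal K$, $B^{(k)}\in J$, $\rho(f^{(k)})\to1$; write $n=n_k$, $\rho=\rho(f^{(k)})$, and evaluate all quantities ($\rho_\mu,u,v,Q,\lambda$, the law of the process with immigration) at $(f^{(k)},B^{(k)})$. For a vector $m_n$ and a number $\Psi$ specified below, $$E\Big(\exp\Big\{-\sum_{l=1}^d\tfrac{t_lY^0_{n,l}}{m_{n,l}}\Big\}\Big)-\Psi\to0\quad(k\to\infty)$$ in each of the following cases: (1) $n|1-\rho|\to-\ln r$ with $r\in(0,1)$ and $\rho>1$ for all $k$: $m_n=\frac{\rho_\mu^{-n}-1-n(1-\rho_\mu)}{(1-\rho_\mu)^2}v$, and with $z=\sqrt{1+\frac{4QT}{r^{-1}-1+\ln r}}$, $w=\frac{z-1}{z+1}$, $\Psi=\Big(r^{-1/2}\frac{r^{z/2}+wr^{-z/2}}{1+w}\Big)^{-\lambda'u/Q}$; or $n|1-\rho|\to-\ln r$ with $r\in(0,1)$ and $\rho<1$ for all $k$: $m_n=\frac{\rho_\mu^{n}-1+n(1-\rho_\mu)}{(1-\rho_\mu)^2}v$, and with $z=\sqrt{1+\frac{4QT}{r-1-\ln r}}$, $w=\frac{z+1}{z-1}$, $\Psi=\Big(r^{1/2}\frac{r^{z/2}+wr^{-z/2}}{1+w}\Big)^{-\lambda'u/Q}$; (2) $\rho\neq1$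 for all $k$, $n|1-\rho|\to0$: $m_n=\frac{n^2}{2}v$, $\Psi=(\cosh\sqrt{2QT})^{-\lambda'u/Q}$; (3) $\rho<1$ for all $k$, $n(1-\rho)\to\infty$: $m_n=\frac{n}{1-\rho}v$, $\Psi=e^{-\lambda'uT}$; (4) $\rho>1$ for all $k$, $n(\rho-1)\to\infty$: $m_n=\frac{\rho^n}{(1-\rho)^2}v$, $\Psi=(1+QT)^{-\lambda'u/Q}$.
   Context: Fix $d\ge1$, $X=\mathbb Z_{\ge0}^d$, $C=[0,1]^d$; $s^\alpha=\prod_is_i^{\alpha_i}$; vector inequalities and products $sw$ are componentwise; $\mathbf 1,\mathbf 0,e_k$ as usual. Offspring p.g.f. $f=(f_1,\dots,f_d)'$, $f_k(s)=\sum_{i\in X}p_k(i)s^i$; $M(s)=(\partial f_k(s)/\partial s_l)_{k,l}$, $M=M(\mathbf 1)$; $b^k_{lm}$, $c^k_{lmj}$ the second and third partial derivatives of $f_k$ at $\mathbf 1$. For fixed $a,b,c>0$, $U\in\mathbb N$, $\mathcal K=\mathcal K(a,b,c,U)$ is the class of such $f$ with $[M^U]_{kl}\ge a$ for all $k,l$, $\sum b^k_{lm}\ge b$, $\sum c^k_{lmj}\le c$. $\rho=\rho(f)$ is the Perron root of $M$; $u,v$ its right and left eigenvectors normalized by $\sum_ku_k=1$, $\sum_ku_kv_k=1$; $Q=\frac12\sum_kv_k\sum_{l,m}b^k_{lm}u_lu_m$. $\mu$ is the vector of extinction probabilities of the Galton–Watson process with offspring p.g.f. $f$, and $\rho_\mu$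 the Perron root of $M(\mu)$. Immigration: for fixed $d_1,d_2>0$, $J=J(d_1,d_2)$ is the class of p.g.f.s $B(s)=\sum_{i\in X}p_0(i)s^i$ with $B(\mathbf 1)=1$, $\sum_k\lambda_k\ge d_1$ where $\lambda_k=\partial B(\mathbf 1)/\partial s_k$, and $\sum_{k,l}\partial^2B(\mathbf 1)/\partial s_k\partial s_l\le d_2$; $\lambda=(\lambda_1,\dots,\lambda_d)'$. The process with immigration is $Z^0_0=H_0$, $Z^0_{n+1}=$ (sum of the offspring vectors of the particles of $Z^0_n$, each type-$k$ particle reproducing independently with p.g.f. $f_k$) $+H_{n+1}$, where $H_0,H_1,\dots$ are i.i.d. with p.g.f. $B$, independent of reproduction. $Y^0_n=\sum_{j=0}^nZ^0_j$. Hypothesis (H): for $f\in\mathcal K$, $s\in C$ let $h_0(s)=\mathbf 0$, $h_n(s)=sf(h_{n-1}(s))$, $h^*(s)=\lim_nh_n(s)$ (the unique solution in $C$ of $h=sf(h)$), $v_{h^*}$ the left Perron eigenvector of $M(h^*(s))$ normalized with the right one $u_{h^*}$ by $\sum_ku_{h^*,k}=1$, $\sum_ku_{h^*,k}v_{h^*,k}=1$. (H): for every sequence $(n_k,f^{(k)},s^{(k)})$ with $n_k\to\infty$, $f^{(k)}\in\mathcal K$, $\rho(f^{(k)})\to1$, $s^{(k)}\in C$, $s^{(k)}\to\mathbf 1$, $v_{h^*}'(h^*(s^{(k)})-h_{n_k}(s^{(k)}))\to0$.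
   Formalization: In case (1) with ρ<1 the formal statement assumes T>0, because for T=0 one has z=1 and w=(z+1)/(z−1), hence Ψ, is undefined. *)

theory Defs
  imports "HOL-Probability.Probability"
begin

text \<open>Types of particles: a finite type 'i (so d = CARD('i) >= 1).
  Population / offspring vectors: 'i => nat (the set X).
  An offspring p.g.f. f = (f_k) is represented by the offspring laws p_k
  (p :: 'i => ('i => nat) pmf), f_k(s) = sum_x p_k(x) s^x; an immigration
  p.g.f. B by its law q :: ('i => nat) pmf (B(1) = 1 automatically).\<close>

definition unitv :: "'i \<Rightarrow> 'i \<Rightarrow> nat" where
  "unitv l = (\<lambda>i. if i = l then 1 else 0)"

definition inC :: "('i::finite \<Rightarrow> real) \<Rightarrow> bool" where
  "inC s \<longleftrightarrow> (\<forall>k. 0 \<le> s k \<and> s k \<le> 1)"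

definition falling :: "nat \<Rightarrow> nat \<Rightarrow> real" where
  "falling x k = (\<Prod>j<k. real x - real j)"

text \<open>Partial derivative of order alpha at 1 of the p.g.f. of P
  (= mixed factorial moment, possibly infinite).\<close>
definition pgf_deriv1 :: "('i::finite \<Rightarrow> nat) pmf \<Rightarrow> ('i \<Rightarrow> nat) \<Rightarrow> ennreal" where
  "pgf_deriv1 P \<alpha> = (\<integral>\<^sup>+ x. ennreal (\<Prod>i\<in>UNIV. falling (x i) (\<alpha> i)) \<partial>measure_pmf P)"

definition pgf :: "('i::finite \<Rightarrow> nat) pmf \<Rightarrow> ('i \<Rightarrow> real) \<Rightarrow> real" where
  "pgf P s = (\<integral> x. (\<Prod>i\<in>UNIV. s i ^ x i) \<partial>measure_pmf P)"

text \<open>M(s)_{kl} = d f_k / d s_l (s), for s in C.\<close>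
definition Mmat :: "('i::finite \<Rightarrow> ('i \<Rightarrow> nat) pmf) \<Rightarrow> ('i \<Rightarrow> real) \<Rightarrow> 'i \<Rightarrow> 'i \<Rightarrow> real" where
  "Mmat p s k l = enn2real (\<integral>\<^sup>+ x. ennreal (real (x l) * s l ^ (x l - 1)
       * (\<Prod>i\<in>UNIV - {l}. s i ^ x i)) \<partial>measure_pmf (p k))"

definition meanM :: "('i::finite \<Rightarrow> ('i \<Rightarrow> nat) pmf) \<Rightarrow> 'i \<Rightarrow> 'i \<Rightarrow> real" where
  "meanM p = Mmat p (\<lambda>_. 1)"

definition second_deriv :: "('i::finite \<Rightarrow> ('i \<Rightarrow> nat) pmf) \<Rightarrow> 'i \<Rightarrow> 'i \<Rightarrow> 'i \<Rightarrow> ennreal" where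
  "second_deriv p k l m = pgf_deriv1 (p k) (\<lambda>i. unitv l i + unitv m i)"

definition third_deriv :: "('i::finite \<Rightarrow> ('i \<Rightarrow> nat) pmf) \<Rightarrow> 'i \<Rightarrow> 'i \<Rightarrow> 'i \<Rightarrow> 'i \<Rightarrow> ennreal" where
  "third_deriv p k l m j = pgf_deriv1 (p k) (\<lambda>i. unitv l i + unitv m i + unitv j i)"

fun matpow :: "('i::finite \<Rightarrow> 'i \<Rightarrow> real) \<Rightarrow> nat \<Rightarrow> 'i \<Rightarrow> 'i \<Rightarrow> real" where
  "matpow A 0 = (\<lambda>k l. if k = l then 1 else 0)"
| "matpow A (Suc n) = (\<lambda>k l. \<Sum>j\<in>UNIV. matpow A n k j * A j l)"

definition perron_root :: "('i::finite \<Rightarrow> 'i \<Rightarrow> real) \<Rightarrow> real" where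
  "perron_root A = Sup {cmod z | z. \<exists>x :: 'i \<Rightarrow> complex. x \<noteq> (\<lambda>_. 0) \<and>
        (\<forall>k. (\<Sum>l\<in>UNIV. complex_of_real (A k l) * x l) = z * x k)}"

definition perron_u :: "('i::finite \<Rightarrow> 'i \<Rightarrow> real) \<Rightarrow> 'i \<Rightarrow> real" where
  "perron_u A = (THE u. (\<forall>k. u k > 0) \<and> (\<Sum>k\<in>UNIV. u k) = 1 \<and>
        (\<forall>k. (\<Sum>l\<in>UNIV. A k l * u l) = perron_root A * u k))"

definition perron_v :: "('i::finite \<Rightarrow> 'i \<Rightarrow> real) \<Rightarrow> 'i \<Rightarrow> real" where
  "perron_v A = (THE v. (\<forall>k. v k > 0) \<and> (\<Sum>k\<in>UNIV. perron_u A k * v k) = 1 \<and>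
        (\<forall>l. (\<Sum>k\<in>UNIV. v k * A k l) = perron_root A * v l))"

definition gw_rho :: "('i::finite \<Rightarrow> ('i \<Rightarrow> nat) pmf) \<Rightarrow> real" where
  "gw_rho p = perron_root (meanM p)"

definition gw_u :: "('i::finite \<Rightarrow> ('i \<Rightarrow> nat) pmf) \<Rightarrow> 'i \<Rightarrow> real" where
  "gw_u p = perron_u (meanM p)"

definition gw_v :: "('i::finite \<Rightarrow> ('i \<Rightarrow> nat) pmf) \<Rightarrow> 'i \<Rightarrow> real" where
  "gw_v p = perron_v (meanM p)"

definition gw_Q :: "('i::finite \<Rightarrow> ('i \<Rightarrow> nat) pmf) \<Rightarrow> real" where
  "gw_Q p = 1/2 * (\<Sum>k\<in>UNIV. gw_v p k * (\<Sum>l\<in>UNIV. \<Sum>m\<in>UNIV.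
        enn2real (second_deriv p k l m) * gw_u p l * gw_u p m))"

definition inK :: "real \<Rightarrow> real \<Rightarrow> real \<Rightarrow> nat \<Rightarrow> ('i::finite \<Rightarrow> ('i \<Rightarrow> nat) pmf) \<Rightarrow> bool" where
  "inK a b c U p \<longleftrightarrow> (\<forall>k l. matpow (meanM p) U k l \<ge> a)
     \<and> (\<Sum>k\<in>UNIV. \<Sum>l\<in>UNIV. \<Sum>m\<in>UNIV. second_deriv p k l m) \<ge> ennreal b
     \<and> (\<Sum>k\<in>UNIV. \<Sum>l\<in>UNIV. \<Sum>m\<in>UNIV. \<Sum>j\<in>UNIV. third_deriv p k l m j) \<le> ennreal c"

definition imm_lambda :: "('i::finite \<Rightarrow> nat) pmf \<Rightarrow> 'i \<Rightarrow> real" where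
  "imm_lambda q k = enn2real (pgf_deriv1 q (unitv k))"

definition inJ :: "real \<Rightarrow> real \<Rightarrow> ('i::finite \<Rightarrow> nat) pmf \<Rightarrow> bool" where
  "inJ d1 d2 q \<longleftrightarrow> (\<Sum>k\<in>UNIV. pgf_deriv1 q (unitv k)) \<ge> ennreal d1
     \<and> (\<Sum>k\<in>UNIV. \<Sum>l\<in>UNIV. pgf_deriv1 q (\<lambda>i. unitv k i + unitv l i)) \<le> ennreal d2"

definition lam_u :: "('i::finite \<Rightarrow> ('i \<Rightarrow> nat) pmf) \<Rightarrow> ('i \<Rightarrow> nat) pmf \<Rightarrow> real" where
  "lam_u p q = (\<Sum>k\<in>UNIV. imm_lambda q k * gw_u p k)"

lemma sum_decr:
  fixes z :: "'i::finite \<Rightarrow> nat"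
  assumes "z k > 0"
  shows "(\<Sum>i\<in>UNIV. (z(k := z k - 1)) i) < (\<Sum>i\<in>UNIV. z i)"
proof -
  have le: "\<And>i. (z(k := z k - 1)) i \<le> z i" by simp
  have lt: "(z(k := z k - 1)) k < z k" using assms by simp
  show ?thesis by (rule sum_strict_mono_ex1) (use le lt in auto)
qed

text \<open>Law of the sum of the offspring vectors of a population z: each
  type-k particle reproduces independently with law p k.\<close>
function reproduce :: "('i::finite \<Rightarrow> ('i \<Rightarrow> nat) pmf) \<Rightarrow> ('i \<Rightarrow> nat) \<Rightarrow> ('i \<Rightarrow> nat) pmf" where
  "reproduce p z = (if (\<forall>k. z k = 0) then return_pmf (\<lambda>_. 0)
     else map_pmf (\<lambda>(x, y). (\<lambda>i. x i + y i))
       (pair_pmf (p (SOME k. z k > 0))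
                 (reproduce p (z((SOME k. z k > 0) := z (SOME k. z k > 0) - 1)))))"
  by auto
termination
proof (relation "Wellfounded.measure (\<lambda>(p, z). \<Sum>i\<in>UNIV. z i)", simp)
  fix p :: "'i::finite \<Rightarrow> ('i \<Rightarrow> nat) pmf" and z :: "'i \<Rightarrow> nat"
  assume "\<not> (\<forall>k. z k = 0)"
  then have "\<exists>k. z k > 0" by auto
  then have "z (SOME k. z k > 0) > 0" by (rule someI_ex)
  then show "((p, z((SOME k. z k > 0) := z (SOME k. z k > 0) - 1)), p, z)
      \<in> Wellfounded.measure (\<lambda>(p, z). \<Sum>i\<in>UNIV. z i)"
    using sum_decr by simp
qed

primrec gw :: "('i::finite \<Rightarrow> ('i \<Rightarrow> nat) pmf) \<Rightarrow> ('i \<Rightarrow> nat) \<Rightarrow> nat \<Rightarrow> ('i \<Rightarrow> nat) pmf" where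
  "gw p z0 0 = return_pmf z0"
| "gw p z0 (Suc n) = bind_pmf (gw p z0 n) (reproduce p)"

definition ext_prob :: "('i::finite \<Rightarrow> ('i \<Rightarrow> nat) pmf) \<Rightarrow> 'i \<Rightarrow> real" where
  "ext_prob p k = lim (\<lambda>n. measure_pmf.prob (gw p (unitv k) n) {\<lambda>_. 0})"

definition rho_mu :: "('i::finite \<Rightarrow> ('i \<Rightarrow> nat) pmf) \<Rightarrow> real" where
  "rho_mu p = perron_root (Mmat p (ext_prob p))"

primrec imm_proc :: "('i::finite \<Rightarrow> ('i \<Rightarrow> nat) pmf) \<Rightarrow> ('i \<Rightarrow> nat) pmf \<Rightarrow> nat
     \<Rightarrow> (('i \<Rightarrow> nat) \<times> ('i \<Rightarrow> nat)) pmf" where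
  "imm_proc p q 0 = map_pmf (\<lambda>h. (h, h)) q"
| "imm_proc p q (Suc n) = bind_pmf (imm_proc p q n) (\<lambda>(z, y).
      map_pmf (\<lambda>(x, h). (\<lambda>i. x i + h i, \<lambda>i. y i + x i + h i)) (pair_pmf (reproduce p z) q))"

definition laplace_Y :: "('i::finite \<Rightarrow> ('i \<Rightarrow> nat) pmf) \<Rightarrow> ('i \<Rightarrow> nat) pmf \<Rightarrow> nat
     \<Rightarrow> ('i \<Rightarrow> real) \<Rightarrow> ('i \<Rightarrow> real) \<Rightarrow> real" where
  "laplace_Y p q n t m = measure_pmf.expectation (imm_proc p q n)
      (\<lambda>(z, y). exp (- (\<Sum>l\<in>UNIV. t l * real (y l) / m l)))"

primrec hseq :: "('i::finite \<Rightarrow> ('i \<Rightarrow> nat) pmf) \<Rightarrow> ('i \<Rightarrow> real) \<Rightarrow> nat \<Rightarrow> 'i \<Rightarrow> real" where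
  "hseq p s 0 = (\<lambda>_. 0)"
| "hseq p s (Suc n) = (\<lambda>k. s k * pgf (p k) (hseq p s n))"

definition hstar :: "('i::finite \<Rightarrow> ('i \<Rightarrow> nat) pmf) \<Rightarrow> ('i \<Rightarrow> real) \<Rightarrow> 'i \<Rightarrow> real" where
  "hstar p s = (\<lambda>k. lim (\<lambda>n. hseq p s n k))"

definition hypH :: "'i::finite itself \<Rightarrow> real \<Rightarrow> real \<Rightarrow> real \<Rightarrow> nat \<Rightarrow> bool" where
  "hypH _ a b c U \<longleftrightarrow>
    (\<forall>(nn :: nat \<Rightarrow> nat) (pp :: nat \<Rightarrow> 'i \<Rightarrow> ('i \<Rightarrow> nat) pmf) (ss :: nat \<Rightarrow> 'i \<Rightarrow> real).
       filterlim nn at_top sequentially \<and> (\<forall>j. inK a b c U (pp j))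
       \<and> (\<lambda>j. gw_rho (pp j)) \<longlonglongrightarrow> 1
       \<and> (\<forall>j. inC (ss j)) \<and> (\<forall>k. (\<lambda>j. ss j k) \<longlonglongrightarrow> 1)
     \<longrightarrow> (\<lambda>j. \<Sum>k\<in>UNIV. perron_v (Mmat (pp j) (hstar (pp j) (ss j))) k
              * (hstar (pp j) (ss j) k - hseq (pp j) (ss j) (nn j) k)) \<longlonglongrightarrow> 0)"

end

theory Submission
  imports Defs
begin

text \<open>With s = exp(-t/m) the Laplace transform is the product over j <= n of B(1 - x_j), where
  x_0 = 1 - s and x_(j+1) = (1 - s) + s (1 - f(1 - x_j)). Projecting on the Perron direction,
  \<xi>_j = v'x_j, and using that on the complement of u the matrix M contracts uniformly over the class
  (in the l1-norm weighted by v), one gets the scalar recursion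
  \<xi>_(j+1) = \<rho> \<xi>_j + \<theta> - Q \<xi>_j^2 up to O(\<theta> \<xi>_j + \<xi>_j^3), with \<theta> = v'(1 - s) asymptotic to T/m. The product
  of the 1 + Q \<xi>_j nearly solves a linear recursion of order two with constant coefficients, whose solution
  gives all the limits; the Laplace transform is this product to the power -\<lambda>'u/Q, up to
  o(1). In the supercritical part of case (1) one also needs 1 - \<rho>_\<mu> asymptotic to \<rho> - 1: the defect
  x = 1 - \<mu> is close to ((\<rho> - 1)/Q) u, and \<rho> - \<rho>_\<mu> is 2 Q v'x to first order.\<close>

section \<open>Nonnegative matrices\<close>

text \<open>Everything has to be uniform, because the offspring law changes along the sequence. The
  lower bound \<open>a\<close> on the entries of the \<open>U\<close>-th power is the source of the
  constants: it bounds \<open>u\<close> and \<open>v\<close> from both sides and makes that power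
  dominate a multiple of the rank-one matrix of \<open>u\<close> and \<open>v\<close>.

  The scalar recursion is a discrete Riccati equation \<xi>' = (\<rho> - 1) \<xi> + \<theta> - Q
  \<xi>^2. The substitution Q \<xi> = y'/y makes it y'' = (\<rho> - 1) y' + Q \<theta> y, which is
  why the product of the 1 + Q \<xi>_j appears. Two facts make the errors harmless: the sum of the
  \<xi>_j stays bounded and their maximum tends to 0. An error that is small relative to \<xi>_j
  then adds up to o(1) over all n steps, while a relative error in \<theta> only moves the parameter
  of the linear equation. The scalings m_n are of the order of the double sum of \<rho>^i over i <=
  j <= n, and this bounds the sum of the \<xi>_j.\<close>

definition mv :: "('i::finite \<Rightarrow> 'i \<Rightarrow> real) \<Rightarrow> ('i \<Rightarrow> real) \<Rightarrow> 'i \<Rightarrow> real" where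
  "mv A x = (\<lambda>k. \<Sum>l\<in>UNIV. A k l * x l)"

definition dot :: "('i::finite \<Rightarrow> real) \<Rightarrow> ('i \<Rightarrow> real) \<Rightarrow> real" where
  "dot v x = (\<Sum>k\<in>UNIV. v k * x k)"

abbreviation wnorm :: "('i::finite \<Rightarrow> real) \<Rightarrow> ('i \<Rightarrow> real) \<Rightarrow> real" where
  "wnorm v x \<equiv> dot v (\<lambda>k. \<bar>x k\<bar>)"

lemma mv_diff: "mv A (\<lambda>k. x k - y k) = (\<lambda>k. mv A x k - mv A y k)"
  by (simp add: mv_def right_diff_distrib sum_subtractf)

lemma mv_scale: "mv A (\<lambda>k. c * x k) = (\<lambda>k. c * mv A x k)"
  by (simp add: mv_def sum_distrib_left mult.left_commute)

lemma abs_mv_le: "(\<And>k l. 0 \<le> A k l) \<Longrightarrow> \<bar>mv A x k\<bar> \<le> mv A (\<lambda>k. \<bar>x k\<bar>) k"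
  unfolding mv_def by (rule order_trans[OF sum_abs]) (simp add: abs_mult)

lemma dot_add: "dot v (\<lambda>k. x k + y k) = dot v x + dot v y"
  by (simp add: dot_def distrib_left sum.distrib)

lemma dot_diff: "dot v (\<lambda>k. x k - y k) = dot v x - dot v y"
  by (simp add: dot_def right_diff_distrib sum_subtractf)

lemma dot_scale: "dot v (\<lambda>k. c * x k) = c * dot v x"
  by (simp add: dot_def sum_distrib_left mult.left_commute)

lemma dot_commute: "dot v x = dot x v"
  by (simp add: dot_def mult.commute)

lemma dot_mono: "(\<And>k. 0 \<le> v k) \<Longrightarrow> (\<And>k. x k \<le> y k) \<Longrightarrow> dot v x \<le> dot v y"
  by (simp add: dot_def sum_mono mult_left_mono)

lemma dot_nonneg: "(\<And>k. 0 \<le> v k) \<Longrightarrow> (\<And>k. 0 \<le> x k) \<Longrightarrow> 0 \<le> dot v x"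
  by (simp add: dot_def sum_nonneg)

lemma abs_dot_le: "(\<And>k. 0 \<le> v k) \<Longrightarrow> \<bar>dot v x\<bar> \<le> wnorm v x"
  unfolding dot_def by (rule order_trans[OF sum_abs]) (simp add: abs_mult)

lemma wnorm_triangle: "(\<And>k. 0 \<le> v k) \<Longrightarrow> wnorm v (\<lambda>k. x k + y k) \<le> wnorm v x + wnorm v y"
  by (simp only: dot_add[symmetric]) (intro dot_mono; simp)

lemma wnorm_triangle_diff: "(\<And>k. 0 \<le> v k) \<Longrightarrow> wnorm v (\<lambda>k. x k - y k) \<le> wnorm v x + wnorm v y"
  by (simp only: dot_add[symmetric]) (intro dot_mono; simp)

lemma wnorm_scale: "wnorm v (\<lambda>k. c * x k) = \<bar>c\<bar> * wnorm v x"
  by (simp only: abs_mult dot_scale)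

lemma matpow_mv: "mv (matpow A m) x k = (mv A ^^ m) x k"
proof (induction m arbitrary: x k)
  case 0
  show ?case by (simp add: mv_def if_distrib[of "\<lambda>z. z * _"] sum.delta cong: if_cong)
next
  case (Suc m)
  have "mv (matpow A (Suc m)) x k = (\<Sum>l\<in>UNIV. \<Sum>j\<in>UNIV. matpow A m k j * A j l * x l)"
    by (simp add: mv_def sum_distrib_right)
  also have "\<dots> = (\<Sum>j\<in>UNIV. \<Sum>l\<in>UNIV. matpow A m k j * A j l * x l)"
    by (rule sum.swap)
  also have "\<dots> = mv (matpow A m) (mv A x) k"
    by (simp add: mv_def sum_distrib_left mult.assoc)
  also have "\<dots> = (mv A ^^ Suc m) x k"
    by (simp only: Suc funpow_Suc_right o_def)
  finally show ?case .
qed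

lemma matpow_Suc_left: "matpow A (Suc m) k l = (\<Sum>j\<in>UNIV. A k j * matpow A m j l)"
proof (induction m arbitrary: k l)
  case 0
  show ?case by (simp add: if_distrib[of "\<lambda>z. z * _"] if_distrib[of "\<lambda>z. _ * z"] sum.delta cong: if_cong)
next
  case (Suc m)
  have "matpow A (Suc (Suc m)) k l = (\<Sum>j\<in>UNIV. (\<Sum>i\<in>UNIV. A k i * matpow A m i j) * A j l)"
    by (subst matpow.simps) (simp only: Suc)
  also have "\<dots> = (\<Sum>j\<in>UNIV. \<Sum>i\<in>UNIV. A k i * matpow A m i j * A j l)"
    by (simp add: sum_distrib_right)
  also have "\<dots> = (\<Sum>i\<in>UNIV. \<Sum>j\<in>UNIV. A k i * matpow A m i j * A j l)"
    by (rule sum.swap)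
  also have "\<dots> = (\<Sum>i\<in>UNIV. A k i * matpow A (Suc m) i l)"
    by (simp add: sum_distrib_left mult.assoc)
  finally show ?case .
qed

lemma matpow_transpose: "matpow (\<lambda>k l. A l k) m k l = matpow A m l k"
proof (induction m arbitrary: k l)
  case 0
  show ?case by auto
next
  case (Suc m)
  show ?case
    by (subst matpow_Suc_left) (simp add: Suc mult.commute)
qed

lemma matpow_nonneg: "(\<And>k l. 0 \<le> A k l) \<Longrightarrow> 0 \<le> matpow A m k l"
  by (induction m arbitrary: k l) (auto intro!: sum_nonneg)

text \<open>Only positivity and the two eigenvector equations are assumed; that \<open>r\<close> is
  the spectral radius is derived in \<open>perron_root_eq\<close>. The normalisation
  \<open>dot_vu\<close> makes \<open>dot v\<close> the coordinate along \<open>u\<close>.\<close>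

locale perron_pair =
  fixes A :: "'i::finite \<Rightarrow> 'i \<Rightarrow> real" and r :: real and u v :: "'i \<Rightarrow> real"
  assumes nonneg: "0 \<le> A k l"
    and u_pos: "0 < u k" and v_pos: "0 < v k"
    and dot_vu: "dot v u = 1"
    and right_eigen: "mv A u = (\<lambda>k. r * u k)"
    and left_eigen: "(\<Sum>k\<in>UNIV. v k * A k l) = r * v l"
begin

lemma v_nonneg: "0 \<le> v k" and u_nonneg: "0 \<le> u k"
  using v_pos[of k] u_pos[of k] by simp_all

lemma dot_mv: "dot v (mv A x) = r * dot v x"
proof -
  have "dot v (mv A x) = (\<Sum>k\<in>UNIV. \<Sum>l\<in>UNIV. v k * A k l * x l)"
    by (simp add: dot_def mv_def sum_distrib_left mult.assoc)
  also have "\<dots> = (\<Sum>l\<in>UNIV. \<Sum>k\<in>UNIV. v k * A k l * x l)"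
    by (rule sum.swap)
  also have "\<dots> = (\<Sum>l\<in>UNIV. (r * v l) * x l)"
    by (simp only: sum_distrib_right[symmetric] left_eigen)
  finally show ?thesis by (simp add: dot_def sum_distrib_left mult.assoc)
qed

lemma transpose: "perron_pair (\<lambda>k l. A l k) r v u"
proof
  show "mv (\<lambda>k l. A l k) v = (\<lambda>k. r * v k)"
    using left_eigen by (auto simp: mv_def mult.commute)
  show "(\<Sum>k\<in>UNIV. u k * A l k) = r * u l" for l
    using fun_cong[OF right_eigen, of l] by (simp add: mv_def mult.commute)
qed (use nonneg u_pos v_pos dot_vu in \<open>auto simp: dot_commute\<close>)

lemma r_nonneg: "0 \<le> r"
proof -
  have "0 \<le> dot v (mv A u)"
    by (intro dot_nonneg v_nonneg) (simp add: mv_def sum_nonneg nonneg u_nonneg)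
  then show ?thesis by (simp add: dot_mv dot_vu)
qed

text \<open>The weights are the left eigenvector, so each application of \<open>A\<close> costs no
  more than the factor \<open>r\<close>. An unweighted norm would bring in a further
  constant.\<close>

lemma wnorm_mv: "wnorm v (mv A x) \<le> r * wnorm v x"
proof -
  have "wnorm v (mv A x) \<le> dot v (mv A (\<lambda>k. \<bar>x k\<bar>))"
    by (intro dot_mono v_nonneg abs_mv_le nonneg)
  then show ?thesis by (simp add: dot_mv)
qed

lemma dot_funpow: "dot v ((mv A ^^ m) x) = r ^ m * dot v x"
  by (induction m) (simp_all add: dot_mv mult.assoc)

lemma wnorm_eq_0: "wnorm v x \<le> 0 \<Longrightarrow> x k = 0"
proof -
  assume "wnorm v x \<le> 0"
  then have "wnorm v x = 0"
    using dot_nonneg[of v "\<lambda>k. \<bar>x k\<bar>"] v_nonneg by force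
  then have "v k * \<bar>x k\<bar> = 0"
    unfolding dot_def by (subst (asm) sum_nonneg_eq_0_iff) (auto simp: v_nonneg)
  then show "x k = 0" using v_pos[of k] by simp
qed

text \<open>The value \<open>r\<close> is attained at \<open>u\<close>. For any complex eigenpair
  the moduli y of the eigenvector satisfy |z| y <= A y by the triangle inequality, and pairing with
  \<open>v\<close> turns this into |z| <= r.\<close>

lemma perron_root_eq: "perron_root A = r"
  unfolding perron_root_def
proof (rule cSup_eq_maximum)
  show "r \<in> {cmod z | z. \<exists>x. x \<noteq> (\<lambda>_. 0) \<and> (\<forall>k. (\<Sum>l\<in>UNIV. complex_of_real (A k l) * x l) = z * x k)}"
  proof (intro CollectI exI conjI allI)
    show "r = cmod (of_real r)" using r_nonneg by simp
    show "(\<lambda>k. complex_of_real (u k)) \<noteq> (\<lambda>_. 0)"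
      using u_pos by (metis less_irrefl of_real_eq_0_iff)
    show "(\<Sum>l\<in>UNIV. complex_of_real (A k l) * of_real (u l)) = of_real r * of_real (u k)" for k
    proof -
      have "(\<Sum>l\<in>UNIV. complex_of_real (A k l) * of_real (u l)) = of_real (mv A u k)"
        by (simp add: mv_def)
      then show ?thesis by (simp add: right_eigen)
    qed
  qed
next
  fix c assume "c \<in> {cmod z | z. \<exists>x. x \<noteq> (\<lambda>_. 0) \<and> (\<forall>k. (\<Sum>l\<in>UNIV. complex_of_real (A k l) * x l) = z * x k)}"
  then obtain z x where c: "c = cmod z" and x: "x \<noteq> (\<lambda>_. 0)"
    and eq: "\<And>k. (\<Sum>l\<in>UNIV. complex_of_real (A k l) * x l) = z * x k" by auto
  define y where "y = (\<lambda>k. cmod (x k))"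
  have le: "c * y k \<le> mv A y k" for k
  proof -
    have "c * y k = cmod (\<Sum>l\<in>UNIV. complex_of_real (A k l) * x l)"
      by (simp add: eq c y_def norm_mult)
    also have "\<dots> \<le> (\<Sum>l\<in>UNIV. cmod (complex_of_real (A k l) * x l))" by (rule norm_sum)
    also have "\<dots> = mv A y k" by (simp add: mv_def y_def norm_mult nonneg)
    finally show ?thesis .
  qed
  have "dot v (\<lambda>k. c * y k) \<le> dot v (mv A y)"
    by (intro dot_mono v_nonneg le)
  then have "c * dot v y \<le> r * dot v y" by (simp only: dot_scale dot_mv)
  moreover have "dot v y > 0"
  proof (rule ccontr)
    assume "\<not> ?thesis"
    then have "wnorm v y \<le> 0" by (simp add: y_def)
    from wnorm_eq_0[OF this] have "x = (\<lambda>_. 0)" by (auto simp: y_def)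
    then show False using x by simp
  qed
  ultimately show "c \<le> r" by simp
qed

end

text \<open>A Doeblin condition: a fixed power dominates a multiple of the rank-one projection onto
  \<open>u\<close>. It replaces a spectral gap: \<open>\<beta>\<close> is the amount by which the
  contraction rate on the kernel of \<open>dot v\<close> falls below \<open>r ^ U\<close>.\<close>

locale primitive_pair = perron_pair +
  fixes U :: nat and \<beta> :: real
  assumes beta_pos: "0 < \<beta>" and minorize: "\<beta> * u k * v l \<le> matpow A U k l"
begin

text \<open>On the complement of the Perron vector one may subtract the rank-one part from
  the power of the matrix before passing to absolute values.\<close>
lemma contraction:
  assumes "dot v w = 0"
  shows "wnorm v ((mv A ^^ U) w) \<le> (r ^ U - \<beta>) * wnorm v w"
proof -
  have "\<bar>(mv A ^^ U) w k\<bar> \<le> (mv A ^^ U) (\<lambda>k. \<bar>w k\<bar>) k - \<beta> * wnorm v w * u k" for k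
  proof -
    have "(mv A ^^ U) w k = mv (matpow A U) w k - \<beta> * u k * dot v w"
      by (simp add: assms matpow_mv)
    also have "\<dots> = (\<Sum>l\<in>UNIV. (matpow A U k l - \<beta> * u k * v l) * w l)"
      by (simp add: mv_def dot_def left_diff_distrib sum_subtractf sum_distrib_left mult.assoc)
    finally have "\<bar>(mv A ^^ U) w k\<bar> \<le> (\<Sum>l\<in>UNIV. \<bar>(matpow A U k l - \<beta> * u k * v l) * w l\<bar>)"
      by (simp add: sum_abs)
    also have "\<dots> = (\<Sum>l\<in>UNIV. (matpow A U k l - \<beta> * u k * v l) * \<bar>w l\<bar>)"
      using minorize by (simp add: abs_mult)
    also have "\<dots> = mv (matpow A U) (\<lambda>k. \<bar>w k\<bar>) k - \<beta> * u k * wnorm v w"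
      by (simp add: mv_def dot_def left_diff_distrib sum_subtractf sum_distrib_left mult.assoc)
    finally show ?thesis by (simp add: matpow_mv mult_ac)
  qed
  then have "wnorm v ((mv A ^^ U) w) \<le> dot v (\<lambda>k. (mv A ^^ U) (\<lambda>k. \<bar>w k\<bar>) k - \<beta> * wnorm v w * u k)"
    by (intro dot_mono v_nonneg)
  also have "\<dots> = r ^ U * wnorm v w - \<beta> * wnorm v w"
    by (simp add: dot_diff dot_scale dot_funpow dot_vu)
  finally show ?thesis by (simp add: left_diff_distrib)
qed

lemma wnorm_project:
  "wnorm v (\<lambda>k. e k - dot v e * u k) \<le> 2 * wnorm v e"
proof -
  have "wnorm v (\<lambda>k. e k - dot v e * u k) \<le> wnorm v e + wnorm v (\<lambda>k. dot v e * u k)"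
    by (rule wnorm_triangle_diff) (rule v_nonneg)
  also have "wnorm v (\<lambda>k. dot v e * u k) = \<bar>dot v e\<bar>"
    using u_nonneg by (simp add: wnorm_scale dot_vu)
  also have "\<bar>dot v e\<bar> \<le> wnorm v e" by (rule abs_dot_le) (rule v_nonneg)
  finally show ?thesis by simp
qed

lemma dot_project: "dot v (\<lambda>k. e k - dot v e * u k) = 0"
  by (simp add: dot_diff dot_scale dot_vu)

text \<open>Stability of the Perron vector: an approximate eigenvector with eigenvalue
  \<open>g\<close> near \<open>r\<close> is close to a multiple of \<open>u\<close>. On the kernel
  of \<open>dot v\<close>, \<open>U\<close> steps multiply \<open>w\<close> by \<open>g ^ U\<close>
  up to an error from \<open>e\<close>, whereas \<open>contraction\<close> allows at most
  \<open>r ^ U - \<beta>\<close>; the difference bounds \<open>w\<close>. It is applied with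
  \<open>g = 1\<close> to a fixed point and with the Perron root of a perturbed matrix.\<close>

lemma resolvent:
  assumes eq: "\<And>k. mv A y k = g * y k + e k" and g: "0 \<le> g" "g \<le> 2" and r: "r \<le> 2"
  shows "(g ^ U - r ^ U + \<beta>) * wnorm v (\<lambda>k. y k - dot v y * u k)
    \<le> real U * 2 ^ U * (2 * wnorm v e)"
proof -
  define w where "w = (\<lambda>k. y k - dot v y * u k)"
  define e' where "e' = (\<lambda>k. e k - dot v e * u k)"
  have de: "r * dot v y = g * dot v y + dot v e"
  proof -
    have "mv A y = (\<lambda>k. g * y k + e k)" using eq by auto
    then show ?thesis using dot_mv[of y] by (simp add: dot_add dot_scale)
  qed
  have Aw: "mv A w k = g * w k + e' k" for k
  proof -
    have "mv A w k = g * y k + e k - dot v y * (r * u k)"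
      by (simp add: w_def mv_diff mv_scale eq right_eigen)
    also have "dot v y * (r * u k) = (g * dot v y + dot v e) * u k"
      by (simp add: de[symmetric])
    finally show ?thesis by (simp add: w_def e'_def algebra_simps)
  qed
  \<comment> \<open>The sequence i 2^i solves c(i+1) = 2 c(i) + 2^(i+1), the recursion that results
    from the bound 2 on \<open>r\<close> and \<open>g\<close>; weakening 2^i to 2^(i+1) makes this
    closed form fit.\<close>
  have bound: "wnorm v (\<lambda>k. (mv A ^^ i) w k - g ^ i * w k) \<le> real i * 2 ^ i * wnorm v e'" for i
  proof (induction i)
    case 0
    show ?case by (simp add: dot_def)
  next
    case (Suc i)
    define R where "R = (\<lambda>k. (mv A ^^ i) w k - g ^ i * w k)"
    have e'0: "0 \<le> wnorm v e'" by (intro dot_nonneg v_nonneg) simp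
    have "(mv A ^^ Suc i) w k - g ^ Suc i * w k = mv A R k + g ^ i * e' k" for k
    proof -
      have "mv A R k = mv A ((mv A ^^ i) w) k - g ^ i * mv A w k"
        by (simp add: R_def mv_diff mv_scale)
      then show ?thesis by (simp add: Aw algebra_simps)
    qed
    then have "wnorm v (\<lambda>k. (mv A ^^ Suc i) w k - g ^ Suc i * w k)
        \<le> wnorm v (mv A R) + wnorm v (\<lambda>k. g ^ i * e' k)"
      using wnorm_triangle[of v "mv A R" "\<lambda>k. g ^ i * e' k"] v_nonneg by simp
    also have "\<dots> \<le> r * wnorm v R + g ^ i * wnorm v e'"
      using wnorm_mv[of R] g by (simp add: wnorm_scale)
    also have "\<dots> \<le> 2 * (real i * 2 ^ i * wnorm v e') + 2 ^ Suc i * wnorm v e'"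
    proof (intro add_mono mult_mono)
      show "wnorm v R \<le> real i * 2 ^ i * wnorm v e'" using Suc by (simp add: R_def)
      show "0 \<le> wnorm v R" by (intro dot_nonneg v_nonneg) simp
      have "g ^ i \<le> 2 ^ i" using g by (intro power_mono) auto
      also have "(2::real) ^ i \<le> 2 ^ Suc i" by simp
      finally show "g ^ i \<le> 2 ^ Suc i" .
    qed (use r e'0 in auto)
    finally show ?case by (simp add: algebra_simps)
  qed
  have "g ^ U * wnorm v w = wnorm v (\<lambda>k. (mv A ^^ U) w k - ((mv A ^^ U) w k - g ^ U * w k))"
    using g by (simp add: wnorm_scale)
  also have "\<dots> \<le> wnorm v ((mv A ^^ U) w) + wnorm v (\<lambda>k. (mv A ^^ U) w k - g ^ U * w k)"
    by (rule wnorm_triangle_diff) (rule v_nonneg)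
  also have "\<dots> \<le> (r ^ U - \<beta>) * wnorm v w + real U * 2 ^ U * wnorm v e'"
    by (intro add_mono bound contraction) (simp add: w_def dot_project)
  also have "\<dots> \<le> (r ^ U - \<beta>) * wnorm v w + real U * 2 ^ U * (2 * wnorm v e)"
    unfolding e'_def by (intro add_left_mono mult_left_mono wnorm_project) simp
  finally have "(g ^ U - r ^ U + \<beta>) * wnorm v w \<le> real U * 2 ^ U * (2 * wnorm v e)"
    by (simp add: algebra_simps)
  then show ?thesis unfolding w_def .
qed

text \<open>The part of \<open>y\<close> in the kernel of \<open>dot v\<close> is again an
  eigenvector for \<open>r\<close>, hence multiplied by \<open>r ^ U\<close>, which
  \<open>contraction\<close> permits only for the zero vector.\<close>

lemma eigenvector_unique:
  assumes "mv A y = (\<lambda>k. r * y k)"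
  shows "y k = dot v y * u k"
proof -
  define w where "w = (\<lambda>k. y k - dot v y * u k)"
  have "mv A w = (\<lambda>k. r * w k)"
    by (simp add: w_def mv_diff mv_scale assms right_eigen right_diff_distrib mult.left_commute)
  then have fw: "(mv A ^^ i) w = (\<lambda>k. r ^ i * w k)" for i
    by (induction i) (simp_all add: mv_scale mult.assoc mult.left_commute)
  have "wnorm v ((mv A ^^ U) w) = r ^ U * wnorm v w"
    using r_nonneg by (simp only: fw wnorm_scale) simp
  moreover have "dot v w = 0" unfolding w_def by (rule dot_project)
  ultimately have "r ^ U * wnorm v w \<le> (r ^ U - \<beta>) * wnorm v w"
    using contraction[of w] by simp
  then have "\<beta> * wnorm v w \<le> 0" by (simp add: algebra_simps)
  then have "wnorm v w \<le> 0" using beta_pos by (simp add: mult_le_0_iff)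
  from wnorm_eq_0[OF this, of k] show ?thesis by (simp add: w_def)
qed

lemma primitive_transpose: "primitive_pair (\<lambda>k l. A l k) r v u U \<beta>"
proof -
  interpret T: perron_pair "\<lambda>k l. A l k" r v u by (rule transpose)
  show ?thesis
  proof
    show "\<beta> * v k * u l \<le> matpow (\<lambda>k l. A l k) U k l" for k l
      using minorize[of l k] by (simp add: matpow_transpose[of A] mult_ac)
  qed (rule beta_pos)
qed

text \<open>The definite description selects the given vector because eigenvectors for
  \<open>r\<close> form a line and the coordinate sum fixes the multiple. The transposed matrix
  yields the same for \<open>perron_v_eq\<close>, with the normalisation against
  \<open>u\<close>.\<close>

lemma perron_u_eq:
  assumes "sum u UNIV = 1"
  shows "perron_u A = u"
  unfolding perron_u_def perron_root_eq
proof (rule the_equality)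
  show "(\<forall>k. 0 < u k) \<and> sum u UNIV = 1 \<and> (\<forall>k. (\<Sum>l\<in>UNIV. A k l * u l) = r * u k)"
    using u_pos assms fun_cong[OF right_eigen] by (auto simp: mv_def)
next
  fix y assume y: "(\<forall>k. 0 < y k) \<and> sum y UNIV = 1 \<and> (\<forall>k. (\<Sum>l\<in>UNIV. A k l * y l) = r * y k)"
  then have *: "y k = dot v y * u k" for k
    by (intro eigenvector_unique) (auto simp: mv_def)
  have "sum y UNIV = dot v y * sum u UNIV"
    by (simp only: sum_distrib_left) (intro sum.cong refl *)
  then have "dot v y = 1" using y assms by simp
  then show "y = u" using * by auto
qed

lemma perron_v_eq:
  assumes "sum u UNIV = 1"
  shows "perron_v A = v"
  unfolding perron_v_def perron_root_eq perron_u_eq[OF assms]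
proof (rule the_equality)
  show "(\<forall>k. 0 < v k) \<and> (\<Sum>k\<in>UNIV. u k * v k) = 1 \<and> (\<forall>l. (\<Sum>k\<in>UNIV. v k * A k l) = r * v l)"
    using v_pos dot_vu left_eigen by (auto simp: dot_def mult.commute)
next
  interpret T: primitive_pair "\<lambda>k l. A l k" r v u U \<beta> by (rule primitive_transpose)
  fix y assume y: "(\<forall>k. 0 < y k) \<and> (\<Sum>k\<in>UNIV. u k * y k) = 1 \<and> (\<forall>l. (\<Sum>k\<in>UNIV. y k * A k l) = r * y l)"
  then have "y k = dot u y * v k" for k
    by (intro T.eigenvector_unique) (auto simp: mv_def mult.commute)
  then show "y = v" using y by (auto simp: dot_def)
qed

end

text \<open>Brouwer's theorem on the simplex for the map x -> A x divided by its coordinate sum.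
  Positivity of the \<open>U\<close>-th power serves twice: the denominator cannot vanish, and a
  nonnegative fixed point is strictly positive.\<close>

lemma positive_eigenvector_exists:
  fixes A :: "'i::finite \<Rightarrow> 'i \<Rightarrow> real"
  assumes nonneg: "\<And>k l. 0 \<le> A k l" and pos: "\<And>k l. 0 < matpow A U k l"
    and U: "U > 0"
  shows "\<exists>r u. (\<forall>k. 0 < u k) \<and> sum u UNIV = 1 \<and> mv A u = (\<lambda>k. r * u k)"
proof -
  define S :: "(real^'i) set" where "S = {x. (\<forall>i. 0 \<le> x $ i) \<and> (\<Sum>i\<in>UNIV. x $ i) = 1}"
  define D where "D = (\<lambda>x::real^'i. \<Sum>j\<in>UNIV. mv A (($) x) j)"
  have fpos: "0 < (mv A ^^ U) y k" if y: "\<And>i. 0 \<le> y i" "sum y UNIV = 1" for y k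
  proof -
    have "\<exists>l. 0 < y l"
    proof (rule ccontr)
      assume "\<not> ?thesis"
      then have "y l = 0" for l using y(1)[of l] by (simp add: not_less antisym)
      then show False using y(2) by simp
    qed
    then obtain l where l: "0 < y l" ..
    have "0 < (\<Sum>l\<in>UNIV. matpow A U k l * y l)"
      by (rule sum_pos2[of _ l]) (use l pos y in \<open>auto intro: less_imp_le mult_nonneg_nonneg\<close>)
    then show ?thesis by (simp add: matpow_mv[symmetric] mv_def)
  qed
  have mv0: "0 \<le> mv A (($) x) k" if "x \<in> S" for x k
    using that nonneg by (auto simp: S_def mv_def intro!: sum_nonneg)
  \<comment> \<open>If A x were 0, every positive power would kill x as well. Here
    \<open>U > 0\<close> enters, since the power 0 is the identity.\<close>
  have Dpos: "0 < D x" if x: "x \<in> S" for x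
  proof (rule ccontr)
    assume "\<not> 0 < D x"
    then have "D x = 0" unfolding D_def using mv0[OF x]
      by (meson antisym not_le sum_nonneg)
    then have "mv A (($) x) = (\<lambda>_. 0)"
      unfolding D_def using mv0[OF x] by (auto simp: sum_nonneg_eq_0_iff)
    moreover have "(mv A ^^ m) (\<lambda>_. 0) = (\<lambda>_. 0)" for m
      by (induction m) (simp_all add: mv_def)
    moreover obtain m where "U = Suc m" using U by (cases U) auto
    ultimately have "(mv A ^^ U) (($) x) k = 0" for k
      by (simp del: funpow.simps add: funpow_Suc_right)
    then show False using fpos[of "($) x"] x by (auto simp: S_def)
  qed
  define f where "f = (\<lambda>x::real^'i. \<chi> k. mv A (($) x) k / D x)"
  have "closed S"
    unfolding S_def by (intro closed_Collect_conj closed_Collect_all closed_Collect_le closed_Collect_eq continuous_intros)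
  moreover have "bounded S"
  proof (rule boundedI)
    fix x assume "x \<in> S"
    then show "norm x \<le> 1"
      using norm_le_l1_cart[of x] by (simp add: S_def)
  qed
  ultimately have comp: "compact S" by (simp add: compact_eq_bounded_closed)
  have conv: "convex S"
    by (auto simp: convex_def S_def sum.distrib simp flip: sum_distrib_left)
  have "(\<chi> i. 1 / real CARD('i)) \<in> S" by (simp add: S_def)
  then have ne: "S \<noteq> {}" by blast
  have cont: "continuous_on S f"
    unfolding f_def mv_def D_def
    by (intro continuous_on_vec_lambda continuous_intros) (use Dpos in \<open>force simp: D_def mv_def\<close>)
  have maps: "f \<in> S \<rightarrow> S"
  proof
    fix x assume x: "x \<in> S"
    have "(\<Sum>i\<in>UNIV. f x $ i) = 1"
      using Dpos[OF x] by (simp add: f_def flip: sum_divide_distrib) (simp add: D_def)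
    moreover have "0 \<le> f x $ i" for i
      using Dpos[OF x] mv0[OF x] by (simp add: f_def)
    ultimately show "f x \<in> S" by (simp add: S_def)
  qed
  obtain x where x: "x \<in> S" "f x = x"
    using brouwer[OF comp conv ne cont maps] by blast
  define y where "y = (\<lambda>k. x $ k)"
  have eig: "mv A y = (\<lambda>k. D x * y k)"
  proof
    fix k
    have "mv A y k / D x = y k"
      using arg_cong[OF x(2), of "\<lambda>z. z $ k"] by (simp add: f_def y_def)
    then show "mv A y k = D x * y k" using Dpos[OF x(1)] by (simp add: field_simps)
  qed
  have y: "\<And>i. 0 \<le> y i" "sum y UNIV = 1" using x(1) by (auto simp: S_def y_def)
  have "(mv A ^^ m) y = (\<lambda>k. D x ^ m * y k)" for m
    by (induction m) (simp_all add: eig mv_scale mult.assoc mult.left_commute)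
  then have "0 < D x ^ U * y k" for k using fpos[OF y, of k] by simp
  then have "0 < y k" for k
    using Dpos[OF x(1)] by (simp add: zero_less_mult_iff)
  then show ?thesis using y eig by blast
qed

text \<open>The left eigenvector is a right one of the transposed matrix. Its eigenvalue agrees with
  that of \<open>u\<close> because v'A u can be evaluated from either side and v'u is
  positive.\<close>

lemma perron_pair_exists:
  fixes A :: "'i::finite \<Rightarrow> 'i \<Rightarrow> real"
  assumes nonneg: "\<And>k l. 0 \<le> A k l" and pos: "\<And>k l. 0 < matpow A U k l"
    and U: "U > 0"
  shows "\<exists>r u v. perron_pair A r u v \<and> sum u UNIV = 1"
proof -
  obtain r u where u: "\<And>k. 0 < u k" "sum u UNIV = 1" "mv A u = (\<lambda>k. r * u k)"
    using positive_eigenvector_exists[OF assms] by blast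
  obtain s v where v: "\<And>k. 0 < v k" "mv (\<lambda>k l. A l k) v = (\<lambda>k. s * v k)"
    using positive_eigenvector_exists[of "\<lambda>k l. A l k" U] assms
    by (auto simp: matpow_transpose[of A])
  define c where "c = dot v u"
  have c: "c > 0" unfolding c_def dot_def by (intro sum_pos) (auto simp: u v)
  have "s * c = (\<Sum>l\<in>UNIV. \<Sum>k\<in>UNIV. A k l * v k * u l)"
  proof -
    have "s * c = (\<Sum>l\<in>UNIV. (s * v l) * u l)" by (simp add: c_def dot_def sum_distrib_left mult.assoc)
    also have "\<dots> = (\<Sum>l\<in>UNIV. mv (\<lambda>k l. A l k) v l * u l)" by (simp add: v)
    finally show ?thesis by (simp add: mv_def sum_distrib_right)
  qed
  also have "\<dots> = (\<Sum>k\<in>UNIV. \<Sum>l\<in>UNIV. A k l * v k * u l)" by (rule sum.swap)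
  also have "\<dots> = (\<Sum>k\<in>UNIV. v k * mv A u k)"
    by (simp add: mv_def sum_distrib_left mult_ac)
  also have "\<dots> = r * c" by (simp add: u c_def dot_def sum_distrib_left mult_ac)
  finally have sr: "s = r" using c by simp
  have "perron_pair A r u (\<lambda>k. v k / c)"
  proof
    show "(\<Sum>k\<in>UNIV. v k / c * A k l) = r * (v l / c)" for l
    proof -
      have "(\<Sum>k\<in>UNIV. v k / c * A k l) = mv (\<lambda>k l. A l k) v l / c"
        by (simp add: mv_def sum_divide_distrib mult.commute)
      then show ?thesis by (simp add: v sr)
    qed
    have "dot (\<lambda>k. v k / c) u = dot v u / c" by (simp add: dot_def sum_divide_distrib)
    then show "dot (\<lambda>k. v k / c) u = 1" using c by (simp add: c_def)
  qed (use u v c nonneg in auto)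
  then show ?thesis using u by blast
qed

section \<open>Taylor bounds for generating functions\<close>

definition tot :: "('i::finite \<Rightarrow> nat) \<Rightarrow> real" where
  "tot Z = (\<Sum>i\<in>UNIV. real (Z i))"

definition mean1 :: "('i::finite \<Rightarrow> nat) pmf \<Rightarrow> 'i \<Rightarrow> real" where
  "mean1 P l = measure_pmf.expectation P (\<lambda>Z. real (Z l))"

text \<open>Off the diagonal this is Z_l Z_m, on it Z_l (Z_l - 1): the integrand of the second
  factorial moments, that is, of the second partial derivatives at 1.\<close>

definition fact2 :: "('i::finite \<Rightarrow> nat) \<Rightarrow> 'i \<Rightarrow> 'i \<Rightarrow> real" where
  "fact2 Z l m = real (Z l) * real (Z m) - (if l = m then real (Z l) else 0)"

definition mean2 :: "('i::finite \<Rightarrow> nat) pmf \<Rightarrow> 'i \<Rightarrow> 'i \<Rightarrow> real" where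
  "mean2 P l m = measure_pmf.expectation P (\<lambda>Z. fact2 Z l m)"

text \<open>Integrability is part of the predicate because the expectation of a nonintegrable
  function is 0 by convention, so that the bound alone would say nothing.\<close>

definition moment_le :: "('i::finite \<Rightarrow> nat) pmf \<Rightarrow> nat \<Rightarrow> real \<Rightarrow> bool" where
  "moment_le P r C \<longleftrightarrow> integrable (measure_pmf P) (\<lambda>Z. tot Z ^ r)
     \<and> measure_pmf.expectation P (\<lambda>Z. tot Z ^ r) \<le> C"

lemma tot_nonneg [simp]: "0 \<le> tot Z"
  by (simp add: tot_def sum_nonneg)

lemma le_tot: "real (Z l) \<le> tot Z"
  unfolding tot_def by (rule member_le_sum) auto

lemma tot_cases: "tot Z = 0 \<or> 1 \<le> tot Z"
proof -
  have "tot Z = real (\<Sum>i\<in>UNIV. Z i)" by (simp add: tot_def)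
  then show ?thesis by (cases "\<Sum>i\<in>UNIV. Z i") simp_all
qed

text \<open>The total is an integer, so it is 0 or at least 1. The exponent \<open>i = 0\<close> is
  excluded because of 0^0 = 1.\<close>

lemma tot_power_mono: "1 \<le> i \<Longrightarrow> i \<le> j \<Longrightarrow> tot Z ^ i \<le> tot Z ^ j"
  using tot_cases[of Z] by (auto intro: power_increasing simp: power_0_left)

lemma fact2_nonneg: "0 \<le> fact2 Z l m"
proof -
  have "real n \<le> real n * real n" for n by (cases n) auto
  then show ?thesis by (simp add: fact2_def)
qed

lemma fact2_le: "fact2 Z l m \<le> tot Z ^ 2"
proof -
  have "fact2 Z l m \<le> real (Z l) * real (Z m)" by (simp add: fact2_def)
  also have "\<dots> \<le> tot Z * tot Z" by (intro mult_mono le_tot) auto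
  finally show ?thesis by (simp add: power2_eq_square)
qed

lemma le_tot_power: "1 \<le> r \<Longrightarrow> \<bar>real (Z l)\<bar> \<le> 1 * tot Z ^ r"
  using le_tot[of Z l] tot_power_mono[of 1 r Z] by simp

lemma fact2_le_power: "2 \<le> r \<Longrightarrow> \<bar>fact2 Z l m\<bar> \<le> 1 * tot Z ^ r"
  using fact2_le[of Z l m] tot_power_mono[of 2 r Z] fact2_nonneg[of Z l m] by simp

lemma integrable_le_tot:
  assumes "moment_le P r C" "\<And>Z. \<bar>f Z\<bar> \<le> K * (1 + tot Z ^ r)"
  shows "integrable (measure_pmf P) f"
proof (rule Bochner_Integration.integrable_bound)
  show "integrable (measure_pmf P) (\<lambda>Z. K * (1 + tot Z ^ r))"
    using assms(1) by (auto simp: moment_le_def)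
  show "AE Z in measure_pmf P. norm (f Z) \<le> norm (K * (1 + tot Z ^ r))"
  proof (rule AE_I2)
    fix Z show "norm (f Z) \<le> norm (K * (1 + tot Z ^ r))"
      using assms(2)[of Z] unfolding real_norm_def by linarith
  qed
qed simp

lemma moment_le_mono:
  assumes "moment_le P j C" "1 \<le> i" "i \<le> j"
  shows "moment_le P i C"
proof -
  have "\<bar>tot Z ^ i\<bar> \<le> 1 * (1 + tot Z ^ j)" for Z :: "'a \<Rightarrow> nat"
    using tot_power_mono[OF assms(2,3), of Z] by simp
  then have int: "integrable (measure_pmf P) (\<lambda>Z. tot Z ^ i)"
    by (rule integrable_le_tot[OF assms(1)])
  have "measure_pmf.expectation P (\<lambda>Z. tot Z ^ i) \<le> measure_pmf.expectation P (\<lambda>Z. tot Z ^ j)"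
    using assms(1) by (intro integral_mono int tot_power_mono assms) (auto simp: moment_le_def)
  then show ?thesis using assms(1) int by (simp add: moment_le_def)
qed

lemma moment_le_nonneg: "moment_le P r C \<Longrightarrow> 0 \<le> C"
proof -
  assume "moment_le P r C"
  moreover have "0 \<le> measure_pmf.expectation P (\<lambda>Z. tot Z ^ r)" by simp
  ultimately show ?thesis unfolding moment_le_def by linarith
qed

lemma expectation_le_moment:
  assumes "moment_le P r C" "\<And>Z. \<bar>f Z\<bar> \<le> K * tot Z ^ r" "0 \<le> K"
  shows "integrable (measure_pmf P) f" "\<bar>measure_pmf.expectation P f\<bar> \<le> K * C"
proof -
  have "\<bar>f Z\<bar> \<le> K * (1 + tot Z ^ r)" for Z
    using assms(2)[of Z] assms(3) by (simp add: distrib_left)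
  then show int: "integrable (measure_pmf P) f" by (rule integrable_le_tot[OF assms(1)])
  have "\<bar>measure_pmf.expectation P f\<bar> \<le> measure_pmf.expectation P (\<lambda>Z. \<bar>f Z\<bar>)"
    by (rule integral_abs_bound)
  also have "\<dots> \<le> measure_pmf.expectation P (\<lambda>Z. K * tot Z ^ r)"
    using assms int by (intro integral_mono) (auto simp: moment_le_def)
  also have "\<dots> \<le> K * C"
    using assms by (auto simp: moment_le_def intro: mult_left_mono)
  finally show "\<bar>measure_pmf.expectation P f\<bar> \<le> K * C" .
qed

lemma integrable_mean1: "moment_le P r C \<Longrightarrow> 1 \<le> r \<Longrightarrow> integrable (measure_pmf P) (\<lambda>Z. real (Z l))"
  by (rule expectation_le_moment(1)[OF _ le_tot_power]) auto

lemma integrable_fact2: "moment_le P r C \<Longrightarrow> 2 \<le> r \<Longrightarrow> integrable (measure_pmf P) (\<lambda>Z. fact2 Z l m)"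
  by (rule expectation_le_moment(1)[OF _ fact2_le_power]) auto

lemma mean1_nonneg: "0 \<le> mean1 P l"
  by (simp add: mean1_def)

lemma mean2_nonneg: "0 \<le> mean2 P l m"
  by (simp add: mean2_def fact2_nonneg)

lemma mean1_le: "moment_le P r C \<Longrightarrow> 1 \<le> r \<Longrightarrow> mean1 P l \<le> C"
  using expectation_le_moment(2)[where f = "\<lambda>Z. real (Z l)" and K = 1 and P = P and r = r and C = C]
    le_tot_power[of r _ l] by (simp add: mean1_def)

lemma mean2_le: "moment_le P r C \<Longrightarrow> 2 \<le> r \<Longrightarrow> mean2 P l m \<le> C"
  using expectation_le_moment(2)[where f = "\<lambda>Z. fact2 Z l m" and K = 1 and P = P and r = r and C = C]
    fact2_le_power[of r _ l m] by (simp add: mean2_def)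

text \<open>For a product of factors 1 - y with 0 <= y <= 1, here P is the product,
  A the sum of the y and B the sum of the squares, so (A^2 - B)/2 is the second elementary
  symmetric function: Bonferroni's inequalities, the third-order term being estimated crudely.\<close>
definition bonferroni :: "real \<Rightarrow> real \<Rightarrow> real \<Rightarrow> bool" where
  "bonferroni P A B \<longleftrightarrow> 0 \<le> P \<and> P \<le> 1 \<and> 0 \<le> A \<and> 0 \<le> B \<and> B \<le> A\<^sup>2 \<and> 1 - A \<le> P
     \<and> P \<le> 1 - A + (A\<^sup>2 - B) / 2 \<and> 1 - A + (A\<^sup>2 - B) / 2 - A ^ 3 / 6 \<le> P"

lemma bonferroni_step:
  assumes "bonferroni P A B" "0 \<le> y" "y \<le> 1"
  shows "bonferroni (P * (1 - y)) (A + y) (B + y\<^sup>2)"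
proof -
  define s where "s = (A\<^sup>2 - B) / 2"
  from assms have P: "0 \<le> P" "P \<le> 1" "0 \<le> A" "0 \<le> B" "B \<le> A\<^sup>2" "1 - A \<le> P" "P \<le> 1 - A + s" "1 - A + s - A ^ 3 / 6 \<le> P"
    by (auto simp: bonferroni_def s_def)
  have s': "((A + y)\<^sup>2 - (B + y\<^sup>2)) / 2 = s + A * y" by (simp add: s_def power2_eq_square field_simps)
  have Ay: "0 \<le> A * y" using P assms by simp
  have yP: "y * (1 - A) \<le> y * P" using P assms by (intro mult_left_mono) auto
  have yP2: "y * P \<le> y * (1 - A + s)" using P assms by (intro mult_left_mono) auto
  have eq: "P * (1 - y) = P - y * P" by (simp add: algebra_simps)
  have "0 \<le> P * (1 - y)" "P * (1 - y) \<le> 1" using P assms by (auto intro: mult_le_one)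
  moreover have "0 \<le> A + y" "0 \<le> B + y\<^sup>2" using P assms by auto
  moreover have "B + y\<^sup>2 \<le> (A + y)\<^sup>2" using P(5) Ay by (simp add: power2_sum)
  moreover have "1 - (A + y) \<le> P * (1 - y)"
  proof -
    have "(1 - A) * (1 - y) \<le> P * (1 - y)" using P assms by (intro mult_right_mono) auto
    then show ?thesis using Ay by (simp add: algebra_simps)
  qed
  moreover have "P * (1 - y) \<le> 1 - (A + y) + (s + A * y)"
    using P yP unfolding eq by (simp add: algebra_simps)
  moreover have "1 - (A + y) + (s + A * y) - (A + y) ^ 3 / 6 \<le> P * (1 - y)"
  proof -
    have "y * s \<le> y * (A\<^sup>2 / 2)" using P assms by (intro mult_left_mono) (auto simp: s_def)
    moreover have "0 \<le> A * y\<^sup>2" "0 \<le> y ^ 3" using P assms by auto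
    moreover have "(A + y) ^ 3 = A ^ 3 + 3 * (y * A\<^sup>2) + 3 * (A * y\<^sup>2) + y ^ 3"
      by (simp add: power3_eq_cube power2_eq_square algebra_simps)
    moreover have "y * (1 - A + s) = y - A * y + y * s" by (simp add: algebra_simps)
    ultimately show ?thesis using P(8) yP2 unfolding eq by linarith
  qed
  ultimately show ?thesis unfolding bonferroni_def s' by blast
qed

lemma bonferroni_power:
  assumes "bonferroni P A B" "0 \<le> y" "y \<le> 1"
  shows "bonferroni (P * (1 - y) ^ m) (A + real m * y) (B + real m * y\<^sup>2)"
proof (induction m)
  case 0
  then show ?case using assms by simp
next
  case (Suc m)
  from bonferroni_step[OF this assms(2,3)] show ?case by (simp add: algebra_simps)
qed

lemma bonferroni_prod:
  fixes Z :: "'i \<Rightarrow> nat"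
  assumes "finite F" "\<And>i. 0 \<le> x i \<and> x i \<le> (1::real)"
  shows "bonferroni (\<Prod>i\<in>F. (1 - x i) ^ Z i) (\<Sum>i\<in>F. real (Z i) * x i) (\<Sum>i\<in>F. real (Z i) * (x i)\<^sup>2)"
  using assms(1)
proof (induction F)
  case empty
  show ?case by (simp add: bonferroni_def)
next
  case (insert i F)
  show ?case
    using bonferroni_power[OF insert.IH, of "x i" "Z i"] assms(2)[of i] insert.hyps
    by (simp add: ac_simps)
qed

section \<open>Expansions of generating functions at 1\<close>

lemma prod_power_Lipschitz:
  fixes Z :: "'i \<Rightarrow> nat" and x y :: "'i \<Rightarrow> real"
  assumes "finite F" "\<And>i. 0 \<le> x i \<and> x i \<le> 1" "\<And>i. 0 \<le> y i \<and> y i \<le> 1"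
  shows "\<bar>(\<Prod>i\<in>F. x i ^ Z i) - (\<Prod>i\<in>F. y i ^ Z i)\<bar> \<le> (\<Sum>i\<in>F. real (Z i) * \<bar>x i - y i\<bar>)"
proof -
  have "norm ((\<Prod>i\<in>F. x i ^ Z i) - (\<Prod>i\<in>F. y i ^ Z i)) \<le> (\<Sum>i\<in>F. norm (x i ^ Z i - y i ^ Z i))"
    using assms by (intro norm_prod_diff) (auto simp: power_le_one)
  also have "\<dots> \<le> (\<Sum>i\<in>F. real (Z i) * \<bar>x i - y i\<bar>)"
  proof (rule sum_mono)
    fix i show "norm (x i ^ Z i - y i ^ Z i) \<le> real (Z i) * \<bar>x i - y i\<bar>"
      using norm_power_diff[of "x i" "y i" "Z i"] assms by auto
  qed
  finally show ?thesis by simp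
qed

lemma prod_power_le_1:
  "(\<And>i. 0 \<le> s i \<and> s i \<le> (1::real)) \<Longrightarrow> 0 \<le> (\<Prod>i\<in>F. s i ^ Z i) \<and> (\<Prod>i\<in>F. s i ^ Z i) \<le> 1"
  by (auto intro!: prod_nonneg prod_le_1 power_le_one)

lemma integrable_bounded_pmf:
  "(\<And>Z. \<bar>f Z\<bar> \<le> (B::real)) \<Longrightarrow> integrable (measure_pmf P) f"
  by (rule measure_pmf.integrable_const_bound[where B = B]) auto

lemma integrable_monomial:
  assumes "\<And>i. 0 \<le> s i \<and> s i \<le> (1::real)"
  shows "integrable (measure_pmf P) (\<lambda>Z. \<Prod>i\<in>UNIV. s i ^ Z i)"
proof (rule integrable_bounded_pmf)
  show "\<bar>\<Prod>i\<in>UNIV. s i ^ Z i\<bar> \<le> 1" for Z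
    using prod_power_le_1[of s Z UNIV] assms by simp
qed

lemma pgf_bounds:
  assumes "\<And>i. 0 \<le> s i \<and> s i \<le> 1"
  shows "0 \<le> pgf P s" "pgf P s \<le> 1"
proof -
  have *: "0 \<le> (\<Prod>i\<in>UNIV. s i ^ Z i) \<and> (\<Prod>i\<in>UNIV. s i ^ Z i) \<le> 1" for Z
    by (rule prod_power_le_1) (rule assms)
  show "0 \<le> pgf P s" unfolding pgf_def
    using * by (intro Bochner_Integration.integral_nonneg) blast
  have "pgf P s \<le> measure_pmf.expectation P (\<lambda>_. 1)" unfolding pgf_def
    using * by (intro integral_mono integrable_monomial assms) auto
  then show "pgf P s \<le> 1" by simp
qed

lemma pgf_mono:
  assumes "\<And>i. 0 \<le> s i" "\<And>i. s i \<le> s' i" "\<And>i. s' i \<le> 1"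
  shows "pgf P s \<le> pgf P s'"
  unfolding pgf_def
proof (rule integral_mono)
  show "integrable (measure_pmf P) (\<lambda>Z. \<Prod>i\<in>UNIV. s i ^ Z i)"
    "integrable (measure_pmf P) (\<lambda>Z. \<Prod>i\<in>UNIV. s' i ^ Z i)"
    using assms order_trans by (intro integrable_monomial; blast)+
  show "(\<Prod>i\<in>UNIV. s i ^ Z i) \<le> (\<Prod>i\<in>UNIV. s' i ^ Z i)" for Z
    using assms by (intro prod_mono) (auto intro!: power_mono)
qed

lemma pgf_Lipschitz:
  assumes P: "moment_le P r C" "1 \<le> r"
    and s: "\<And>i. 0 \<le> s i \<and> s i \<le> 1" and s': "\<And>i. 0 \<le> s' i \<and> s' i \<le> 1"
  shows "\<bar>pgf P s - pgf P s'\<bar> \<le> (\<Sum>i\<in>UNIV. mean1 P i * \<bar>s i - s' i\<bar>)"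
proof -
  have "\<bar>pgf P s - pgf P s'\<bar> = \<bar>measure_pmf.expectation P (\<lambda>Z. (\<Prod>i\<in>UNIV. s i ^ Z i) - (\<Prod>i\<in>UNIV. s' i ^ Z i))\<bar>"
    unfolding pgf_def by (simp add: integrable_monomial s s')
  also have "\<dots> \<le> measure_pmf.expectation P (\<lambda>Z. \<bar>(\<Prod>i\<in>UNIV. s i ^ Z i) - (\<Prod>i\<in>UNIV. s' i ^ Z i)\<bar>)"
    by (rule integral_abs_bound)
  also have "\<dots> \<le> measure_pmf.expectation P (\<lambda>Z. \<Sum>i\<in>UNIV. real (Z i) * \<bar>s i - s' i\<bar>)"
    using s s' by (intro integral_mono prod_power_Lipschitz)
      (auto intro!: integrable_abs Bochner_Integration.integrable_diff integrable_monomial integrable_mean1[OF P])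
  also have "\<dots> = (\<Sum>i\<in>UNIV. mean1 P i * \<bar>s i - s' i\<bar>)"
    by (simp add: mean1_def integrable_mean1[OF P])
  finally show ?thesis .
qed

text \<open>Bonferroni's inequalities hold for each fixed population and are then integrated, so
  moment bounds suffice and the generating function is never differentiated.\<close>

lemma pgf_taylor1:
  assumes P: "moment_le P 2 C" and x: "\<And>i. 0 \<le> x i \<and> x i \<le> 1"
  shows "0 \<le> pgf P (\<lambda>i. 1 - x i) - 1 + dot (mean1 P) x"
    and "pgf P (\<lambda>i. 1 - x i) - 1 + dot (mean1 P) x \<le> C * (sum x UNIV)\<^sup>2"
proof -
  define R where "R = (\<lambda>Z. (\<Prod>i\<in>UNIV. (1 - x i) ^ Z i) - 1 + (\<Sum>i\<in>UNIV. real (Z i) * x i))"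
  have mono: "integrable (measure_pmf P) (\<lambda>Z. \<Prod>i\<in>UNIV. (1 - x i) ^ Z i)"
    using x by (intro integrable_monomial) auto
  have lin: "integrable (measure_pmf P) (\<lambda>Z. \<Sum>i\<in>UNIV. real (Z i) * x i)"
    by (intro Bochner_Integration.integrable_sum integrable_mult_left integrable_mean1[OF P]) simp
  have ER: "measure_pmf.expectation P R = pgf P (\<lambda>i. 1 - x i) - 1 + dot (mean1 P) x"
    unfolding R_def pgf_def using mono lin
    by (simp add: dot_def mean1_def integrable_mean1[OF P])
  have R: "0 \<le> R Z \<and> R Z \<le> (sum x UNIV)\<^sup>2 * tot Z ^ 2" for Z
  proof -
    define A where "A = (\<Sum>i\<in>UNIV. real (Z i) * x i)"
    have b: "bonferroni (\<Prod>i\<in>UNIV. (1 - x i) ^ Z i) A (\<Sum>i\<in>UNIV. real (Z i) * (x i)\<^sup>2)"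
      unfolding A_def by (rule bonferroni_prod) (use x in auto)
    have "A \<le> (\<Sum>i\<in>UNIV. tot Z * x i)"
      unfolding A_def using x by (intro sum_mono mult_right_mono le_tot) auto
    then have "A \<le> tot Z * sum x UNIV" by (simp add: sum_distrib_left)
    then have "A\<^sup>2 \<le> (tot Z * sum x UNIV)\<^sup>2"
      using b by (intro power_mono) (auto simp: bonferroni_def)
    then have "A\<^sup>2 / 2 \<le> (sum x UNIV)\<^sup>2 * (tot Z)\<^sup>2"
      using zero_le_power2[of "tot Z * sum x UNIV"] unfolding power_mult_distrib mult.commute[of "(sum x UNIV)\<^sup>2"] by linarith
    then show ?thesis using b unfolding bonferroni_def R_def A_def[symmetric] diff_divide_distrib
      by linarith
  qed
  show "0 \<le> pgf P (\<lambda>i. 1 - x i) - 1 + dot (mean1 P) x"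
    unfolding ER[symmetric] using R by (intro Bochner_Integration.integral_nonneg) auto
  have "measure_pmf.expectation P R \<le> (sum x UNIV)\<^sup>2 * C"
    using expectation_le_moment(2)[OF P, of R "(sum x UNIV)\<^sup>2"] R by fastforce
  then show "pgf P (\<lambda>i. 1 - x i) - 1 + dot (mean1 P) x \<le> C * (sum x UNIV)\<^sup>2"
    by (simp add: ER mult.commute)
qed

definition quad :: "('i::finite \<Rightarrow> 'i \<Rightarrow> real) \<Rightarrow> ('i \<Rightarrow> real) \<Rightarrow> ('i \<Rightarrow> real) \<Rightarrow> real" where
  "quad B x y = (\<Sum>l\<in>UNIV. \<Sum>m\<in>UNIV. B l m * x l * y m)"

lemma quad_eq_dot: "quad B x y = dot (\<lambda>l. dot (B l) y) x"
  unfolding quad_def dot_def sum_distrib_right by (intro sum.cong refl) (simp add: mult_ac)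

text \<open>The diagonal correction in \<open>fact2\<close> is exactly the sum of squares subtracted
  in \<open>bonferroni\<close>. This identifies the second symmetric function there with half the
  quadratic form of the second derivatives.\<close>

lemma quad_fact2:
  "quad (fact2 Z) x x = (\<Sum>i\<in>UNIV. real (Z i) * x i)\<^sup>2 - (\<Sum>i\<in>UNIV. real (Z i) * (x i)\<^sup>2)"
proof -
  have "quad (fact2 Z) x x = (\<Sum>l\<in>UNIV. \<Sum>m\<in>UNIV. (real (Z l) * x l) * (real (Z m) * x m)
      - (if l = m then real (Z l) * (x l)\<^sup>2 else 0))"
    unfolding quad_def fact2_def
    by (intro sum.cong refl) (auto simp: power2_eq_square algebra_simps)
  also have "\<dots> = (\<Sum>l\<in>UNIV. \<Sum>m\<in>UNIV. (real (Z l) * x l) * (real (Z m) * x m)) - (\<Sum>i\<in>UNIV. real (Z i) * (x i)\<^sup>2)"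
    by (simp add: sum_subtractf)
  finally show ?thesis by (simp add: power2_eq_square sum_product)
qed

lemma pgf_taylor2:
  assumes P: "moment_le P 3 C" and x: "\<And>i. 0 \<le> x i \<and> x i \<le> 1"
  shows "\<bar>pgf P (\<lambda>i. 1 - x i) - 1 + dot (mean1 P) x - quad (mean2 P) x x / 2\<bar> \<le> C * sum x UNIV ^ 3"
proof -
  define R where "R = (\<lambda>Z. (\<Prod>i\<in>UNIV. (1 - x i) ^ Z i) - 1 + (\<Sum>i\<in>UNIV. real (Z i) * x i) - quad (fact2 Z) x x / 2)"
  have mono: "integrable (measure_pmf P) (\<lambda>Z. \<Prod>i\<in>UNIV. (1 - x i) ^ Z i)"
    using x by (intro integrable_monomial) auto
  have lin: "integrable (measure_pmf P) (\<lambda>Z. \<Sum>i\<in>UNIV. real (Z i) * x i)"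
    by (intro Bochner_Integration.integrable_sum integrable_mult_left integrable_mean1[OF P]) simp
  have quad: "integrable (measure_pmf P) (\<lambda>Z. quad (fact2 Z) x x)"
    unfolding quad_def
    by (intro Bochner_Integration.integrable_sum integrable_mult_left integrable_fact2[OF P]) simp
  have Elin: "measure_pmf.expectation P (\<lambda>Z. \<Sum>i\<in>UNIV. real (Z i) * x i) = dot (mean1 P) x"
    by (simp add: dot_def mean1_def integrable_mean1[OF P])
  have Equad: "measure_pmf.expectation P (\<lambda>Z. quad (fact2 Z) x x) = quad (mean2 P) x x"
    by (simp add: quad_def mean2_def integrable_fact2[OF P])
  have ER: "measure_pmf.expectation P R = pgf P (\<lambda>i. 1 - x i) - 1 + dot (mean1 P) x - quad (mean2 P) x x / 2"
    unfolding R_def pgf_def using mono lin quad by (simp add: Elin Equad)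
  have R: "\<bar>R Z\<bar> \<le> sum x UNIV ^ 3 * tot Z ^ 3" for Z
  proof -
    define A where "A = (\<Sum>i\<in>UNIV. real (Z i) * x i)"
    have b: "bonferroni (\<Prod>i\<in>UNIV. (1 - x i) ^ Z i) A (\<Sum>i\<in>UNIV. real (Z i) * (x i)\<^sup>2)"
      unfolding A_def by (rule bonferroni_prod) (use x in auto)
    have "A \<le> (\<Sum>i\<in>UNIV. tot Z * x i)"
      unfolding A_def using x by (intro sum_mono mult_right_mono le_tot) auto
    then have "A \<le> tot Z * sum x UNIV" by (simp add: sum_distrib_left)
    then have "A ^ 3 \<le> (tot Z * sum x UNIV) ^ 3"
      using b by (intro power_mono) (auto simp: bonferroni_def)
    moreover have "0 \<le> A ^ 3" using b by (simp add: bonferroni_def)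
    ultimately have "A ^ 3 / 6 \<le> sum x UNIV ^ 3 * tot Z ^ 3"
      unfolding power_mult_distrib mult.commute[of "sum x UNIV ^ 3"] by linarith
    then show ?thesis using b \<open>0 \<le> A ^ 3\<close> unfolding bonferroni_def R_def quad_fact2 A_def[symmetric]
      by (simp add: abs_le_iff diff_divide_distrib)
  qed
  have "0 \<le> sum x UNIV ^ 3" using x by (intro zero_le_power sum_nonneg) auto
  then have "\<bar>measure_pmf.expectation P R\<bar> \<le> sum x UNIV ^ 3 * C"
    using expectation_le_moment(2)[OF P, of R "sum x UNIV ^ 3"] R by blast
  then show ?thesis by (simp add: ER mult.commute)
qed

section \<open>Power moments from factorial moments\<close>

lemma tot_power_le:
  fixes Z :: "'i::finite \<Rightarrow> nat"
  shows "tot Z ^ r \<le> real CARD('i) ^ r * (\<Sum>l\<in>UNIV. real (Z l) ^ r)"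
proof -
  define m where "m = Max (range Z)"
  have "m \<in> range Z" unfolding m_def by (rule Max_in) auto
  then obtain j where j: "m = Z j" by auto
  have "tot Z \<le> (\<Sum>i\<in>(UNIV::'i set). real m)"
    unfolding tot_def m_def by (intro sum_mono) simp
  then have "tot Z \<le> real CARD('i) * real (Z j)" by (simp add: j)
  then have "tot Z ^ r \<le> (real CARD('i) * real (Z j)) ^ r" by (rule power_mono) simp
  also have "\<dots> = real CARD('i) ^ r * real (Z j) ^ r" by (simp add: power_mult_distrib)
  also have "\<dots> \<le> real CARD('i) ^ r * (\<Sum>l\<in>UNIV. real (Z l) ^ r)"
    by (intro mult_left_mono member_le_sum) auto
  finally show ?thesis .
qed

lemma falling_simps:
  "falling x 0 = 1" "falling x (Suc 0) = real x" "falling x 2 = real x * (real x - 1)"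
  "falling x 3 = real x * (real x - 1) * (real x - 2)"
  by (simp_all add: falling_def numeral_2_eq_2 numeral_3_eq_3)

lemma prod_falling_single:
  fixes Z :: "'i::finite \<Rightarrow> nat"
  shows "(\<Prod>i\<in>UNIV. falling (Z i) (if i = l then r else 0)) = falling (Z l) r"
proof -
  have "(\<Prod>i\<in>UNIV. falling (Z i) (if i = l then r else 0)) = (\<Prod>i\<in>UNIV. if i = l then falling (Z i) r else 1)"
    by (intro prod.cong) (auto simp: falling_simps)
  then show ?thesis by simp
qed

lemma prod_falling_unitv2:
  fixes Z :: "'i::finite \<Rightarrow> nat"
  shows "(\<Prod>i\<in>UNIV. falling (Z i) (unitv l i + unitv m i)) = fact2 Z l m"
proof (cases "l = m")
  case True
  have "(\<Prod>i\<in>UNIV. falling (Z i) (unitv l i + unitv m i)) = (\<Prod>i\<in>UNIV. falling (Z i) (if i = l then 2 else 0))"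
    by (intro prod.cong) (auto simp: unitv_def True numeral_2_eq_2)
  then show ?thesis
    by (simp add: prod_falling_single falling_simps fact2_def True algebra_simps)
next
  case False
  have "(\<Prod>i\<in>UNIV. falling (Z i) (unitv l i + unitv m i))
    = (\<Prod>i\<in>UNIV. (if i = l then real (Z i) else 1) * (if i = m then real (Z i) else 1))"
    using False by (intro prod.cong) (auto simp: unitv_def falling_simps)
  then show ?thesis by (simp add: prod.distrib fact2_def False)
qed

text \<open>The classes bound factorial moments, while the Taylor estimates use powers of the total.
  Pure moments suffice, since the total is at most the number of types times the largest coordinate;
  \<open>K1\<close> and \<open>K2\<close> convert a power into a falling factorial.\<close>

lemma moment_le_from_falling:
  fixes P :: "('i::finite \<Rightarrow> nat) pmf"
  assumes D: "\<And>l. pgf_deriv1 P (\<lambda>i. if i = l then r else 0) \<le> ennreal D" "0 \<le> D"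
    and le: "\<And>m::nat. real m ^ r \<le> K1 * falling m r + K2" and K: "0 \<le> K1" "0 \<le> K2"
    and fn: "\<And>m. 0 \<le> falling m r"
  shows "moment_le P r (real CARD('i) ^ Suc r * (K1 * D + K2))"
proof -
  define d where "d = real CARD('i)"
  have d: "0 \<le> d" by (simp add: d_def)
  have single: "(\<integral>\<^sup>+ Z. ennreal (real (Z l) ^ r) \<partial>measure_pmf P) \<le> ennreal (K1 * D + K2)" for l
  proof -
    have "(\<integral>\<^sup>+ Z. ennreal (real (Z l) ^ r) \<partial>measure_pmf P)
        \<le> (\<integral>\<^sup>+ Z. ennreal K1 * ennreal (falling (Z l) r) + ennreal K2 \<partial>measure_pmf P)"
      using K fn by (intro nn_integral_mono)
        (auto simp flip: ennreal_mult ennreal_plus intro!: ennreal_leI le)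
    also have "\<dots> = ennreal K1 * pgf_deriv1 P (\<lambda>i. if i = l then r else 0) + ennreal K2"
      by (simp add: nn_integral_add nn_integral_cmult pgf_deriv1_def prod_falling_single)
    also have "\<dots> \<le> ennreal K1 * ennreal D + ennreal K2"
      by (intro add_mono mult_left_mono D) auto
    finally show ?thesis using K assms(2) by (simp flip: ennreal_mult ennreal_plus)
  qed
  have "(\<integral>\<^sup>+ Z. ennreal (tot Z ^ r) \<partial>measure_pmf P)
      \<le> (\<integral>\<^sup>+ Z. ennreal (d ^ r) * (\<Sum>l\<in>UNIV. ennreal (real (Z l) ^ r)) \<partial>measure_pmf P)"
  proof (rule nn_integral_mono)
    fix Z :: "'i \<Rightarrow> nat"
    show "ennreal (tot Z ^ r) \<le> ennreal (d ^ r) * (\<Sum>l\<in>UNIV. ennreal (real (Z l) ^ r))"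
      using ennreal_leI[OF tot_power_le[of Z r]] d
      by (simp add: d_def ennreal_mult sum_nonneg)
  qed
  also have "\<dots> = ennreal (d ^ r) * (\<Sum>l\<in>UNIV. (\<integral>\<^sup>+ Z. ennreal (real (Z l) ^ r) \<partial>measure_pmf P))"
    by (simp add: nn_integral_cmult nn_integral_sum del: sum_ennreal)
  also have "\<dots> \<le> ennreal (d ^ r) * (\<Sum>l\<in>(UNIV::'i set). ennreal (K1 * D + K2))"
    by (intro mult_left_mono sum_mono single) auto
  also have "\<dots> = ennreal (d ^ Suc r * (K1 * D + K2))"
    using K assms(2) d
    by (simp add: d_def ennreal_of_nat_eq_real_of_nat mult_ac flip: ennreal_mult ennreal_plus)
  finally have le: "(\<integral>\<^sup>+ Z. ennreal (tot Z ^ r) \<partial>measure_pmf P) \<le> ennreal (d ^ Suc r * (K1 * D + K2))" .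
  have "integrable (measure_pmf P) (\<lambda>Z. tot Z ^ r)"
    by (rule integrableI_bounded) (use le in \<open>auto intro: le_less_trans\<close>)
  moreover have "measure_pmf.expectation P (\<lambda>Z. tot Z ^ r) \<le> d ^ Suc r * (K1 * D + K2)"
  proof -
    have "ennreal (measure_pmf.expectation P (\<lambda>Z. tot Z ^ r)) = (\<integral>\<^sup>+ Z. ennreal (tot Z ^ r) \<partial>measure_pmf P)"
      using \<open>integrable _ _\<close> by (intro nn_integral_eq_integral[symmetric]) auto
    then have "ennreal (measure_pmf.expectation P (\<lambda>Z. tot Z ^ r)) \<le> ennreal (d ^ Suc r * (K1 * D + K2))"
      using le by (simp only:)
    then show ?thesis by (subst (asm) ennreal_le_iff) (use K assms(2) d in auto)
  qed
  ultimately show ?thesis by (simp add: moment_le_def d_def)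
qed

lemma pgf_deriv1_unitv2:
  assumes "moment_le P r C" "2 \<le> r"
  shows "pgf_deriv1 P (\<lambda>i. unitv l i + unitv m i) = ennreal (mean2 P l m)"
  unfolding pgf_deriv1_def prod_falling_unitv2 mean2_def
  by (intro nn_integral_eq_integral integrable_fact2[OF assms]) (simp add: fact2_nonneg)

lemma imm_lambda_eq:
  assumes "moment_le q r C" "1 \<le> r"
  shows "imm_lambda q k = mean1 q k"
proof -
  have "unitv k = (\<lambda>i. if i = k then Suc 0 else 0)" by (auto simp: unitv_def)
  then have "pgf_deriv1 q (unitv k) = (\<integral>\<^sup>+ Z. ennreal (real (Z k)) \<partial>measure_pmf q)"
    unfolding pgf_deriv1_def by (simp only: prod_falling_single falling_simps)
  also have "\<dots> = ennreal (mean1 q k)"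
    unfolding mean1_def by (intro nn_integral_eq_integral integrable_mean1[OF assms]) simp
  finally show ?thesis by (simp add: imm_lambda_def mean1_nonneg)
qed

lemma meanM_eq:
  assumes "moment_le (p k) r C" "1 \<le> r"
  shows "meanM p k l = mean1 (p k) l"
proof -
  have "(\<integral>\<^sup>+ Z. ennreal (real (Z l)) \<partial>measure_pmf (p k)) = ennreal (mean1 (p k) l)"
    unfolding mean1_def by (intro nn_integral_eq_integral integrable_mean1[OF assms]) simp
  then show ?thesis by (simp add: meanM_def Mmat_def mean1_nonneg)
qed

text \<open>The numbers come from m^3 <= (9/2) m (m-1) (m-2) + 8: the ratio 27/6 is attained at m =
  3, and 8 covers m = 2, where the falling factorial vanishes. Three factors of the number of types
  come from \<open>tot_power_le\<close>, the fourth from the sum over coordinates.\<close>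

definition third_moment_const :: "'i::finite itself \<Rightarrow> real \<Rightarrow> real" where
  "third_moment_const _ c = real CARD('i) ^ 4 * (9 / 2 * c + 8)"

text \<open>As before, from m^2 <= 2 m (m-1) + 1: the ratio 4/2 is attained at m = 2, and 1 covers m
  = 1.\<close>

definition second_moment_const :: "'i::finite itself \<Rightarrow> real \<Rightarrow> real" where
  "second_moment_const _ c = real CARD('i) ^ 3 * (2 * c + 1)"

lemma inK_moment:
  fixes p :: "'i::finite \<Rightarrow> ('i \<Rightarrow> nat) pmf"
  assumes "inK a b c U p" "0 < c"
  shows "moment_le (p k) 3 (third_moment_const TYPE('i) c)"
proof -
  have "third_deriv p k l l l \<le> ennreal c" for k l
  proof -
    have "third_deriv p k l l l \<le> (\<Sum>j\<in>UNIV. third_deriv p k l l j)" by (rule member_le_sum) auto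
    also have "\<dots> \<le> (\<Sum>m\<in>UNIV. \<Sum>j\<in>UNIV. third_deriv p k l m j)"
      by (rule member_le_sum) auto
    also have "\<dots> \<le> (\<Sum>l\<in>UNIV. \<Sum>m\<in>UNIV. \<Sum>j\<in>UNIV. third_deriv p k l m j)"
      by (rule member_le_sum[of _ _ "\<lambda>l. \<Sum>m\<in>UNIV. \<Sum>j\<in>UNIV. third_deriv p k l m j"]) auto
    also have "\<dots> \<le> (\<Sum>k\<in>UNIV. \<Sum>l\<in>UNIV. \<Sum>m\<in>UNIV. \<Sum>j\<in>UNIV. third_deriv p k l m j)"
      by (rule member_le_sum[of _ _ "\<lambda>k. \<Sum>l\<in>UNIV. \<Sum>m\<in>UNIV. \<Sum>j\<in>UNIV. third_deriv p k l m j"]) auto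
    also have "\<dots> \<le> ennreal c" using assms by (simp add: inK_def)
    finally show ?thesis .
  qed
  moreover have "third_deriv p k l l l = pgf_deriv1 (p k) (\<lambda>i. if i = l then 3 else 0)" for l
    unfolding third_deriv_def
    by (rule arg_cong[of _ _ "pgf_deriv1 (p k)"]) (auto simp: unitv_def)
  ultimately have D: "pgf_deriv1 (p k) (\<lambda>i. if i = l then 3 else 0) \<le> ennreal c" for l by metis
  have *: "0 \<le> falling m 3 \<and> real m ^ 3 \<le> 9 / 2 * falling m 3 + 8" for m :: nat
  proof -
    consider "m = 0" | "m = 1" | "m = 2" | "3 \<le> m" by linarith
    then show ?thesis
    proof cases
      case 4
      \<comment> \<open>Shifting by 3 turns the difference of the two sides into a polynomial with
        nonnegative coefficients.\<close>
      define y where "y = real m - 3"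
      have y: "0 \<le> y" "real m = y + 3" using 4 by (auto simp: y_def)
      have "9 / 2 * ((y + 3) * (y + 3 - 1) * (y + 3 - 2)) + 8 - (y + 3) ^ 3
          = 7 / 2 * y ^ 3 + 18 * y\<^sup>2 + 45 / 2 * y + 8"
        by (simp add: field_simps power3_eq_cube power2_eq_square)
      moreover have "0 \<le> y ^ 3" "0 \<le> y\<^sup>2" using y by auto
      moreover have "0 \<le> (y + 3) * (y + 3 - 1) * (y + 3 - 2)" using y by auto
      ultimately show ?thesis using y(1) unfolding falling_simps y(2) by linarith
    qed (auto simp: falling_simps)
  qed
  have "moment_le (p k) 3 (real CARD('i) ^ Suc 3 * (9 / 2 * c + 8))"
    by (rule moment_le_from_falling[OF D]) (use * assms in auto)
  then show ?thesis by (simp add: third_moment_const_def eval_nat_numeral)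
qed

lemma inJ_moment:
  fixes q :: "('i::finite \<Rightarrow> nat) pmf"
  assumes "inJ d1 d2 q" "0 < d2"
  shows "moment_le q 2 (second_moment_const TYPE('i) d2)"
proof -
  have "pgf_deriv1 q (\<lambda>i. unitv l i + unitv l i) \<le> ennreal d2" for l
  proof -
    have "pgf_deriv1 q (\<lambda>i. unitv l i + unitv l i) \<le> (\<Sum>j\<in>UNIV. pgf_deriv1 q (\<lambda>i. unitv l i + unitv j i))"
      by (rule member_le_sum) auto
    also have "\<dots> \<le> (\<Sum>l\<in>UNIV. \<Sum>j\<in>UNIV. pgf_deriv1 q (\<lambda>i. unitv l i + unitv j i))"
      by (rule member_le_sum[of _ _ "\<lambda>l. \<Sum>j\<in>UNIV. pgf_deriv1 q (\<lambda>i. unitv l i + unitv j i)"]) auto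
    also have "\<dots> \<le> ennreal d2" using assms by (simp add: inJ_def)
    finally show ?thesis .
  qed
  moreover have "(\<lambda>i. unitv l i + unitv l i) = (\<lambda>i. if i = l then 2 else 0)" for l :: 'i
    by (auto simp: unitv_def)
  ultimately have D: "pgf_deriv1 q (\<lambda>i. if i = l then 2 else 0) \<le> ennreal d2" for l by metis
  have *: "0 \<le> falling m 2 \<and> real m ^ 2 \<le> 2 * falling m 2 + 1" for m :: nat
  proof (cases "m = 0")
    case False
    define y where "y = real m - 1"
    have y: "0 \<le> y" "real m = y + 1" using False by (auto simp: y_def)
    have "0 \<le> y\<^sup>2" "0 \<le> (y - 1)\<^sup>2 " by auto
    have "y * (y + 1) \<ge> y + y" if "1 \<le> y" using that mult_right_mono[of 1 y "y"] y by (simp add: distrib_left)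
    moreover have "y = 0 \<or> 1 \<le> y" using False y_def by (cases "m = 1") auto
    ultimately show ?thesis unfolding falling_simps y(2) using y(1)
      by (auto simp: algebra_simps power2_eq_square)
  qed (auto simp: falling_simps)
  have "moment_le q 2 (real CARD('i) ^ Suc 2 * (2 * d2 + 1))"
    by (rule moment_le_from_falling[OF D]) (use * assms in auto)
  then show ?thesis by (simp add: second_moment_const_def eval_nat_numeral)
qed

text \<open>The derivative of a monomial is \<open>Z l\<close> times the monomial of a smaller
  population, so the first-order Bonferroni bounds apply again; the extra factor \<open>Z l\<close>
  raises the remainder to a third moment. For positivity: a vanishing expectation makes the
  derivative vanish almost surely, and if all 1 - x_i are positive this means \<open>Z l = 0\<close>
  almost surely.\<close>

lemma Mmat_taylor:
  assumes P: "moment_le (p k) 3 C" and x: "\<And>i. 0 \<le> x i \<and> x i \<le> 1"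
  shows "Mmat p (\<lambda>i. 1 - x i) k l \<le> mean1 (p k) l"
    and "\<bar>mean1 (p k) l - Mmat p (\<lambda>i. 1 - x i) k l - dot (mean2 (p k) l) x\<bar> \<le> C * (sum x UNIV)\<^sup>2"
    and Mmat_pos: "0 < mean1 (p k) l \<Longrightarrow> (\<And>i. x i < 1) \<Longrightarrow> 0 < Mmat p (\<lambda>i. 1 - x i) k l"
proof -
  define D where "D = (\<lambda>Z::'a \<Rightarrow> nat. real (Z l) * (1 - x l) ^ (Z l - 1) * (\<Prod>i\<in>UNIV - {l}. (1 - x i) ^ Z i))"
  have D: "0 \<le> D Z \<and> D Z \<le> real (Z l) \<and> \<bar>real (Z l) - D Z - dot (fact2 Z l) x\<bar> \<le> (sum x UNIV)\<^sup>2 * tot Z ^ 3" for Z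
  proof -
    \<comment> \<open>One particle of type \<open>l\<close> is removed. When \<open>Z l = 0\<close>
      the truncated subtraction does no harm, because the derivative carries the factor
      \<open>Z l\<close>.\<close>
    define Z' where "Z' = Z(l := Z l - 1)"
    define A where "A = (\<Sum>i\<in>UNIV. real (Z' i) * x i)"
    define Q where "Q = (\<Prod>i\<in>UNIV. (1 - x i) ^ Z' i)"
    have b: "bonferroni Q A (\<Sum>i\<in>UNIV. real (Z' i) * (x i)\<^sup>2)"
      unfolding A_def Q_def by (rule bonferroni_prod) (use x in auto)
    have "Q = (1 - x l) ^ (Z l - 1) * (\<Prod>i\<in>UNIV - {l}. (1 - x i) ^ Z' i)"
      unfolding Q_def by (subst prod.remove[of _ l]) (auto simp: Z'_def)
    also have "(\<Prod>i\<in>UNIV - {l}. (1 - x i) ^ Z' i) = (\<Prod>i\<in>UNIV - {l}. (1 - x i) ^ Z i)"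
      by (intro prod.cong) (auto simp: Z'_def)
    finally have DQ: "D Z = real (Z l) * Q" by (simp add: D_def)
    have dotA: "dot (fact2 Z l) x = real (Z l) * A"
    proof -
      have "real (Z l) * real (Z' m) = fact2 Z l m" for m
        by (cases "Z l") (auto simp: Z'_def fact2_def algebra_simps)
      then show ?thesis by (simp add: A_def dot_def sum_distrib_left flip: mult.assoc)
    qed
    have AtS: "A \<le> tot Z * sum x UNIV"
    proof -
      have "A \<le> (\<Sum>i\<in>UNIV. tot Z * x i)" unfolding A_def
      proof (intro sum_mono mult_right_mono)
        fix i have "real (Z' i) \<le> real (Z i)" by (simp add: Z'_def)
        then show "real (Z' i) \<le> tot Z" using le_tot[of Z i] by simp
      qed (use x in auto)
      then show ?thesis by (simp add: sum_distrib_left)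
    qed
    have "A\<^sup>2 \<le> (tot Z * sum x UNIV)\<^sup>2"
      using b AtS by (intro power_mono) (auto simp: bonferroni_def)
    then have A2: "A\<^sup>2 / 2 \<le> (sum x UNIV)\<^sup>2 * (tot Z)\<^sup>2"
      using zero_le_power2[of "tot Z * sum x UNIV"] unfolding power_mult_distrib mult.commute[of "(sum x UNIV)\<^sup>2"] by linarith
    have eq: "real (Z l) - D Z - dot (fact2 Z l) x = - (real (Z l) * (Q - 1 + A))"
      by (simp add: DQ dotA algebra_simps)
    have "0 \<le> Q - 1 + A" using b by (simp add: bonferroni_def)
    moreover have "Q - 1 + A \<le> A\<^sup>2 / 2"
      using b unfolding bonferroni_def diff_divide_distrib by linarith
    ultimately have "\<bar>real (Z l) - D Z - dot (fact2 Z l) x\<bar> \<le> tot Z * (A\<^sup>2 / 2)"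
      unfolding eq abs_minus_cancel abs_mult using le_tot[of Z l] by (intro mult_mono) linarith+
    also have "\<dots> \<le> tot Z * ((sum x UNIV)\<^sup>2 * (tot Z)\<^sup>2)" by (intro mult_left_mono A2) simp
    finally have "\<bar>real (Z l) - D Z - dot (fact2 Z l) x\<bar> \<le> (sum x UNIV)\<^sup>2 * tot Z ^ 3"
      by (simp add: power3_eq_cube power2_eq_square mult_ac)
    moreover have "real (Z l) * Q \<le> real (Z l) * 1"
      using b by (intro mult_left_mono) (auto simp: bonferroni_def)
    ultimately show ?thesis using b by (simp add: DQ bonferroni_def)
  qed
  have intD: "integrable (measure_pmf (p k)) D"
  proof (rule expectation_le_moment(1)[OF P, of _ 1])
    fix Z show "\<bar>D Z\<bar> \<le> 1 * tot Z ^ 3"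
      using D[of Z] le_tot[of Z l] tot_power_mono[of 1 3 Z] by auto
  qed simp
  have M: "Mmat p (\<lambda>i. 1 - x i) k l = measure_pmf.expectation (p k) D"
  proof -
    have "(\<integral>\<^sup>+ Z. ennreal (D Z) \<partial>measure_pmf (p k)) = ennreal (measure_pmf.expectation (p k) D)"
      using D by (intro nn_integral_eq_integral intD) auto
    moreover have "0 \<le> measure_pmf.expectation (p k) D"
      using D by (intro Bochner_Integration.integral_nonneg) auto
    ultimately show ?thesis by (simp add: Mmat_def D_def)
  qed
  show "Mmat p (\<lambda>i. 1 - x i) k l \<le> mean1 (p k) l"
    unfolding M mean1_def using D by (intro integral_mono intD integrable_mean1[OF P]) auto
  show "0 < Mmat p (\<lambda>i. 1 - x i) k l" if pos: "0 < mean1 (p k) l" "\<And>i. x i < 1"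
  proof (rule ccontr)
    assume "\<not> 0 < Mmat p (\<lambda>i. 1 - x i) k l"
    moreover have "0 \<le> measure_pmf.expectation (p k) D"
      using D by (intro Bochner_Integration.integral_nonneg) auto
    ultimately have "measure_pmf.expectation (p k) D = 0" by (simp add: M)
    then have AE0: "AE Z in measure_pmf (p k). D Z = 0"
      using integral_nonneg_eq_0_iff_AE[OF intD] D by simp
    have zero: "Z l = 0" if "D Z = 0" for Z
    proof -
      have "0 < (1 - x l) ^ (Z l - 1) * (\<Prod>i\<in>UNIV - {l}. (1 - x i) ^ Z i)"
        using pos(2) by (intro mult_pos_pos prod_pos zero_less_power) auto
      moreover have "real (Z l) * ((1 - x l) ^ (Z l - 1) * (\<Prod>i\<in>UNIV - {l}. (1 - x i) ^ Z i)) = 0"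
        using that by (simp only: D_def mult.assoc)
      ultimately show ?thesis by (metis less_irrefl mult_eq_0_iff of_nat_eq_0_iff)
    qed
    have "AE Z in measure_pmf (p k). real (Z l) = 0" using AE0 by eventually_elim (simp add: zero)
    then have "mean1 (p k) l = 0" unfolding mean1_def by (rule integral_eq_zero_AE)
    then show False using pos(1) by simp
  qed
  have "mean1 (p k) l - Mmat p (\<lambda>i. 1 - x i) k l - dot (mean2 (p k) l) x
     = measure_pmf.expectation (p k) (\<lambda>Z. real (Z l) - D Z - dot (fact2 Z l) x)"
  proof -
    have "measure_pmf.expectation (p k) (\<lambda>Z. dot (fact2 Z l) x) = dot (mean2 (p k) l) x"
      by (simp add: dot_def mean2_def integrable_fact2[OF P])
    moreover have "integrable (measure_pmf (p k)) (\<lambda>Z. dot (fact2 Z l) x)"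
      unfolding dot_def
      by (intro Bochner_Integration.integrable_sum integrable_mult_left integrable_fact2[OF P]) simp
    ultimately show ?thesis
      using intD integrable_mean1[OF P, of l] by (simp add: M mean1_def)
  qed
  also have "\<bar>\<dots>\<bar> \<le> (sum x UNIV)\<^sup>2 * C"
    using D by (intro expectation_le_moment(2)[OF P]) auto
  finally show "\<bar>mean1 (p k) l - Mmat p (\<lambda>i. 1 - x i) k l - dot (mean2 (p k) l) x\<bar> \<le> C * (sum x UNIV)\<^sup>2"
    by (simp add: mult.commute)
qed

section \<open>Generating functions of the processes\<close>

declare reproduce.simps [simp del]

lemma expectation_bounds:
  assumes "\<And>x. 0 \<le> f x \<and> f x \<le> (1::real)"
  shows "0 \<le> measure_pmf.expectation M f" "measure_pmf.expectation M f \<le> 1"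
    "ennreal (measure_pmf.expectation M f) = (\<integral>\<^sup>+x. ennreal (f x) \<partial>measure_pmf M)"
proof -
  have int: "integrable (measure_pmf M) f"
    by (rule integrable_bounded_pmf[where B = 1]) (use assms in auto)
  show "0 \<le> measure_pmf.expectation M f"
    using assms by (intro Bochner_Integration.integral_nonneg) auto
  have "measure_pmf.expectation M f \<le> measure_pmf.expectation M (\<lambda>_. 1)"
    using assms by (intro integral_mono int) auto
  then show "measure_pmf.expectation M f \<le> 1" by simp
  show "ennreal (measure_pmf.expectation M f) = (\<integral>\<^sup>+x. ennreal (f x) \<partial>measure_pmf M)"
    using assms by (intro nn_integral_eq_integral[symmetric] int) auto
qed

text \<open>Values in the unit interval allow a detour through nonnegative integrals, where
  iteration needs no integrability argument.\<close>

lemma expectation_bind_pmf: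
  assumes "\<And>x. 0 \<le> f x \<and> f x \<le> (1::real)"
  shows "measure_pmf.expectation (bind_pmf M N) f
    = measure_pmf.expectation M (\<lambda>x. measure_pmf.expectation (N x) f)"
proof -
  note b = expectation_bounds[of f, OF assms]
  have b': "0 \<le> measure_pmf.expectation (N x) f \<and> measure_pmf.expectation (N x) f \<le> 1" for x
    using b by blast
  have "ennreal (measure_pmf.expectation (bind_pmf M N) f)
      = ennreal (measure_pmf.expectation M (\<lambda>x. measure_pmf.expectation (N x) f))"
    by (simp add: b(3) expectation_bounds(3)[OF b'])
  moreover have "0 \<le> measure_pmf.expectation M (\<lambda>x. measure_pmf.expectation (N x) f)"
    by (rule expectation_bounds(1)) (rule b')
  ultimately show ?thesis using b(1) by simp
qed

lemma expectation_pair_pmf_mult: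
  assumes "\<And>x. 0 \<le> f x \<and> f x \<le> (1::real)" "\<And>x. 0 \<le> g x \<and> g x \<le> (1::real)"
  shows "measure_pmf.expectation (pair_pmf M N) (\<lambda>(x, y). f x * g y)
    = measure_pmf.expectation M f * measure_pmf.expectation N g"
proof -
  have fg: "0 \<le> (case z of (x, y) \<Rightarrow> f x * g y) \<and> (case z of (x, y) \<Rightarrow> f x * g y) \<le> 1" for z
    using assms by (auto split: prod.split intro: mult_le_one)
  have "ennreal (measure_pmf.expectation (pair_pmf M N) (\<lambda>(x, y). f x * g y))
      = (\<integral>\<^sup>+x. \<integral>\<^sup>+y. ennreal (f x) * ennreal (g y) \<partial>measure_pmf N \<partial>measure_pmf M)"
    using assms by (subst expectation_bounds(3)[OF fg]) (simp add: nn_integral_pair_pmf' ennreal_mult)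
  also have "\<dots> = ennreal (measure_pmf.expectation M f) * ennreal (measure_pmf.expectation N g)"
    by (simp add: nn_integral_cmult nn_integral_multc expectation_bounds(3)[OF assms(1)] expectation_bounds(3)[OF assms(2)])
  finally have "ennreal (measure_pmf.expectation (pair_pmf M N) (\<lambda>(x, y). f x * g y))
      = ennreal (measure_pmf.expectation M f * measure_pmf.expectation N g)"
    using assms by (simp add: expectation_bounds(1) flip: ennreal_mult)
  moreover have "0 \<le> measure_pmf.expectation (pair_pmf M N) (\<lambda>(x, y). f x * g y)"
    by (rule expectation_bounds(1)) (rule fg)
  moreover have "0 \<le> measure_pmf.expectation M f * measure_pmf.expectation N g"
    using assms by (intro mult_nonneg_nonneg expectation_bounds(1)) auto
  ultimately show ?thesis by simp
qed

definition mon :: "('i::finite \<Rightarrow> real) \<Rightarrow> ('i \<Rightarrow> nat) \<Rightarrow> real" where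
  "mon w z = (\<Prod>i\<in>UNIV. w i ^ z i)"

lemma mon_bounds: "inC w \<Longrightarrow> 0 \<le> mon w z \<and> mon w z \<le> 1"
  unfolding mon_def inC_def by (rule prod_power_le_1) blast

lemma pgf_mon: "pgf P w = measure_pmf.expectation P (mon w)"
  unfolding pgf_def mon_def by simp

lemma mon_add: "mon w (\<lambda>i. x i + y i) = mon w x * mon w y"
  by (simp add: mon_def power_add prod.distrib)

lemma mon_mult: "mon (\<lambda>i. v i * w i) x = mon v x * mon w x"
  by (simp add: mon_def power_mult_distrib prod.distrib)

lemma mon_one [simp]: "mon (\<lambda>_. 1) x = 1"
  by (simp add: mon_def)

lemma mon_unitv: "mon w (unitv k) = w k"
proof -
  have "mon w (unitv k) = (\<Prod>i\<in>UNIV. if i = k then w i else 1)"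
    unfolding mon_def unitv_def by (intro prod.cong) auto
  then show ?thesis by simp
qed

text \<open>Since 0^0 = 1, evaluating a generating function at 0 gives the probability of the empty
  population.\<close>

lemma mon_zero: "mon (\<lambda>_. 0) z = indicator {\<lambda>_. 0} z"
  by (auto simp: mon_def indicator_def fun_eq_iff power_0_left)

definition offspring_pgf :: "('i::finite \<Rightarrow> ('i \<Rightarrow> nat) pmf) \<Rightarrow> ('i \<Rightarrow> real) \<Rightarrow> 'i \<Rightarrow> real" where
  "offspring_pgf p w = (\<lambda>k. pgf (p k) w)"

lemma inC_offspring_pgf: "inC w \<Longrightarrow> inC (offspring_pgf p w)"
  by (simp add: inC_def offspring_pgf_def pgf_bounds)

lemma mon_fun_upd: "z k > 0 \<Longrightarrow> mon w z = w k * mon w (z(k := z k - 1))"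
proof -
  assume z: "z k > 0"
  have "mon w z = w k ^ z k * (\<Prod>i\<in>UNIV - {k}. w i ^ z i)"
    unfolding mon_def by (rule prod.remove) auto
  moreover have "mon w (z(k := z k - 1)) = w k ^ (z k - 1) * (\<Prod>i\<in>UNIV - {k}. (w i) ^ (z(k := z k - 1)) i)"
    unfolding mon_def by (subst prod.remove[of _ k]) auto
  moreover have "(\<Prod>i\<in>UNIV - {k}. (w i) ^ (z(k := z k - 1)) i) = (\<Prod>i\<in>UNIV - {k}. w i ^ z i)"
    by (intro prod.cong) auto
  ultimately show ?thesis using z by (simp add: power_eq_if)
qed

lemma expectation_return_pmf: "measure_pmf.expectation (return_pmf x) f = (f x :: real)"
  by (simp add: return_pmf.rep_eq integral_return)

text \<open>The branching property. The recursion of \<open>reproduce\<close> removes one particle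
  per call, and by independence each call contributes one factor
  \<open>offspring_pgf p w k\<close>.\<close>

lemma reproduce_pgf:
  assumes "inC w"
  shows "measure_pmf.expectation (reproduce p z) (mon w) = mon (offspring_pgf p w) z"
proof (induction p z rule: reproduce.induct)
  case (1 p z)
  show ?case
  proof (cases "\<forall>k. z k = 0")
    case True
    then show ?thesis
      by (subst reproduce.simps) (simp add: expectation_return_pmf mon_def)
  next
    case False
    define k where "k = (SOME k. z k > 0)"
    have k: "z k > 0" unfolding k_def by (rule someI_ex) (use False in auto)
    have IH: "measure_pmf.expectation (reproduce p (z(k := z k - 1))) (mon w)
        = mon (offspring_pgf p w) (z(k := z k - 1))"
      using 1[OF False] unfolding k_def .
    have pk: "measure_pmf.expectation (p k) (mon w) = offspring_pgf p w k"
      by (simp add: pgf_mon offspring_pgf_def)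
    have "reproduce p z = map_pmf (\<lambda>(x, y). (\<lambda>i. x i + y i)) (pair_pmf (p k) (reproduce p (z(k := z k - 1))))"
      by (subst reproduce.simps) (simp only: if_not_P[OF False] k_def)
    then have "measure_pmf.expectation (reproduce p z) (mon w)
        = measure_pmf.expectation (pair_pmf (p k) (reproduce p (z(k := z k - 1)))) (\<lambda>(x, y). mon w x * mon w y)"
      by (simp add: case_prod_unfold mon_add)
    also have "\<dots> = offspring_pgf p w k * mon (offspring_pgf p w) (z(k := z k - 1))"
      using mon_bounds[OF assms]
      by (subst expectation_pair_pmf_mult) (auto simp del: One_nat_def simp: IH pk)
    finally show ?thesis by (simp add: mon_fun_upd[of z k, OF k])
  qed
qed

text \<open>The last generation is integrated out first, which replaces \<open>w\<close> by
  \<open>offspring_pgf p w\<close>; hence \<open>w\<close> varies in the induction.\<close>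

lemma gw_pgf:
  assumes "inC w"
  shows "measure_pmf.expectation (gw p z m) (mon w) = mon ((offspring_pgf p ^^ m) w) z"
  using assms
proof (induction m arbitrary: w)
  case 0
  show ?case by (simp add: expectation_return_pmf)
next
  case (Suc m)
  have "measure_pmf.expectation (gw p z (Suc m)) (mon w)
      = measure_pmf.expectation (gw p z m) (\<lambda>x. measure_pmf.expectation (reproduce p x) (mon w))"
    by (simp add: expectation_bind_pmf mon_bounds Suc.prems)
  also have "\<dots> = measure_pmf.expectation (gw p z m) (mon (offspring_pgf p w))"
    by (simp add: reproduce_pgf Suc.prems)
  also have "\<dots> = mon ((offspring_pgf p ^^ m) (offspring_pgf p w)) z"
    by (rule Suc.IH) (rule inC_offspring_pgf[OF Suc.prems])
  finally show ?case by (simp add: funpow_swap1)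
qed

lemma ext_prob_eq: "ext_prob p k = lim (\<lambda>m. (offspring_pgf p ^^ m) (\<lambda>_. 0) k)"
proof -
  have "measure_pmf.prob (gw p (unitv k) m) {\<lambda>_. 0} = (offspring_pgf p ^^ m) (\<lambda>_. 0) k" for m
  proof -
    have "measure_pmf.prob (gw p (unitv k) m) {\<lambda>_. 0}
        = measure_pmf.expectation (gw p (unitv k) m) (mon (\<lambda>_. 0))"
      unfolding mon_zero[abs_def] by simp
    also have "\<dots> = mon ((offspring_pgf p ^^ m) (\<lambda>_. 0)) (unitv k)"
      by (rule gw_pgf) (simp add: inC_def)
    finally show ?thesis by (simp add: mon_unitv)
  qed
  then show ?thesis by (simp add: ext_prob_def)
qed

text \<open>Joint transform of the population and the running total. In the last step the new
  particles are counted in both, whence v = s w: the immigrants contribute \<open>pgf q v\<close>,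
  and the offspring turn \<open>w\<close> into \<open>offspring_pgf p v\<close>.\<close>

lemma imm_proc_pgf:
  assumes s: "inC s" and w: "inC w"
  shows "measure_pmf.expectation (imm_proc p q m) (\<lambda>(z, y). mon w z * mon s y)
    = (\<Prod>j\<le>m. pgf q (((\<lambda>v k. s k * offspring_pgf p v k) ^^ j) (\<lambda>k. s k * w k)))"
  using w
proof (induction m arbitrary: w)
  case 0
  show ?case by (simp add: pgf_mon mon_mult[symmetric] mult.commute)
next
  case (Suc m)
  define v where "v = (\<lambda>k. s k * w k)"
  have v: "inC v" using s Suc.prems by (auto simp: v_def inC_def intro: mult_le_one)
  have bnd: "0 \<le> (case x of (z, y) \<Rightarrow> mon w z * mon s y) \<and> (case x of (z, y) \<Rightarrow> mon w z * mon s y) \<le> 1" for x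
    using mon_bounds[OF s] mon_bounds[OF Suc.prems] by (auto split: prod.split intro: mult_le_one)
  have inner: "measure_pmf.expectation (case x of (z, y) \<Rightarrow>
        map_pmf (\<lambda>(x, h). (\<lambda>i. x i + h i, \<lambda>i. y i + x i + h i)) (pair_pmf (reproduce p z) q))
        (\<lambda>(z, y). mon w z * mon s y)
      = (case x of (z, y) \<Rightarrow> mon (offspring_pgf p v) z * mon s y) * pgf q v" for x
  proof (cases x)
    case (Pair z y)
    have "measure_pmf.expectation (map_pmf (\<lambda>(x, h). (\<lambda>i. x i + h i, \<lambda>i. y i + x i + h i)) (pair_pmf (reproduce p z) q))
        (\<lambda>(z, y). mon w z * mon s y)
       = measure_pmf.expectation (pair_pmf (reproduce p z) q) (\<lambda>xh. mon s y * (case xh of (x, h) \<Rightarrow> mon v x * mon v h))"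
      by (simp add: case_prod_unfold mon_add v_def mon_mult mult_ac)
    also have "\<dots> = mon s y * (mon (offspring_pgf p v) z * pgf q v)"
      using mon_bounds[OF v] by (simp add: expectation_pair_pmf_mult reproduce_pgf[OF v] pgf_mon)
    finally show ?thesis by (simp add: Pair)
  qed
  have "measure_pmf.expectation (imm_proc p q (Suc m)) (\<lambda>(z, y). mon w z * mon s y)
     = measure_pmf.expectation (imm_proc p q m) (\<lambda>(z, y). mon (offspring_pgf p v) z * mon s y) * pgf q v"
    by (simp add: expectation_bind_pmf[OF bnd] inner)
  also have "\<dots> = (\<Prod>j\<le>m. pgf q (((\<lambda>v k. s k * offspring_pgf p v k) ^^ j) (\<lambda>k. s k * offspring_pgf p v k))) * pgf q v"
    by (subst Suc.IH[OF inC_offspring_pgf[OF v]]) simp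
  \<comment> \<open>The factor split off has index 0: it belongs to the most recent immigrants, who
    have not reproduced yet.\<close>
  also have "\<dots> = (\<Prod>j\<le>Suc m. pgf q (((\<lambda>v k. s k * offspring_pgf p v k) ^^ j) v))"
    by (subst prod.atMost_Suc_shift) (simp del: funpow.simps(2) add: funpow_Suc_right)
  finally show ?case by (simp add: v_def)
qed

definition Phi :: "('i::finite \<Rightarrow> ('i \<Rightarrow> nat) pmf) \<Rightarrow> ('i \<Rightarrow> real) \<Rightarrow> 'i \<Rightarrow> real" where
  "Phi p x k = 1 - pgf (p k) (\<lambda>i. 1 - x i)"

primrec defect_seq :: "(('i \<Rightarrow> real) \<Rightarrow> 'i \<Rightarrow> real) \<Rightarrow> ('i \<Rightarrow> real) \<Rightarrow> nat \<Rightarrow> 'i \<Rightarrow> real" where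
  "defect_seq F \<sigma> 0 = \<sigma>"
| "defect_seq F \<sigma> (Suc j) = (\<lambda>k. \<sigma> k + (1 - \<sigma> k) * F (defect_seq F \<sigma> j) k)"

lemma laplace_Y_eq:
  assumes t: "\<And>l. 0 \<le> t l" and m: "\<And>l. 0 < m l"
  shows "laplace_Y p q n t m
    = (\<Prod>j\<le>n. pgf q (\<lambda>i. 1 - defect_seq (Phi p) (\<lambda>l. 1 - exp (- (t l / m l))) j i))"
proof -
  define s where "s = (\<lambda>l. exp (- (t l / m l)))"
  have s: "inC s" using t m by (auto simp: s_def inC_def intro: divide_nonneg_pos)
  have e: "exp (- (\<Sum>l\<in>UNIV. t l * real (y l) / m l)) = mon s y" for y
    by (simp add: s_def mon_def exp_sum[symmetric] exp_of_nat_mult[symmetric] sum_negf[symmetric] mult_ac)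
  have seq: "((\<lambda>v k. s k * offspring_pgf p v k) ^^ j) s = (\<lambda>i. 1 - defect_seq (Phi p) (\<lambda>l. 1 - s l) j i)" for j
  proof (induction j)
    case (Suc j)
    then show ?case by (auto simp: offspring_pgf_def Phi_def algebra_simps)
  qed simp
  have "laplace_Y p q n t m = measure_pmf.expectation (imm_proc p q n) (\<lambda>(z, y). mon (\<lambda>_. 1) z * mon s y)"
    by (simp add: laplace_Y_def e)
  also have "\<dots> = (\<Prod>j\<le>n. pgf q (((\<lambda>v k. s k * offspring_pgf p v k) ^^ j) (\<lambda>k. s k * 1)))"
    by (rule imm_proc_pgf[OF s]) (simp add: inC_def)
  finally show ?thesis by (simp only: mult_1_right seq) (simp add: s_def)
qed

section \<open>The near-critical recursion\<close>

text \<open>The generating functions are abstracted to a map \<open>F\<close> with linear part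
  \<open>A\<close> and second-order part \<open>b2\<close>. The estimates depend only on
  \<open>\<alpha>\<close>, \<open>\<beta>\<close>, \<open>C\<close> and \<open>U\<close>, which the
  class fixes, whereas \<open>A\<close>, \<open>r\<close>, \<open>u\<close>, \<open>v\<close> and
  \<open>F\<close> vary along the sequence.\<close>

locale near_critical = primitive_pair A r u v U \<beta>
  for A :: "'i::finite \<Rightarrow> 'i \<Rightarrow> real" and r u v U \<beta> +
  fixes F :: "('i \<Rightarrow> real) \<Rightarrow> 'i \<Rightarrow> real" and b2 :: "'i \<Rightarrow> 'i \<Rightarrow> 'i \<Rightarrow> real" and \<alpha> C :: real
  assumes alpha: "0 < \<alpha>" "\<alpha> \<le> 1"
    and u_bounds: "\<alpha> \<le> u k" "u k \<le> 1" and v_bounds: "\<alpha> \<le> v k" "v k \<le> 1 / \<alpha>"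
    and r_le: "r \<le> 2" and C_nonneg: "0 \<le> C"
    and b2_bounds: "0 \<le> b2 k l m" "b2 k l m \<le> C"
    and F_bounds: "inC x \<Longrightarrow> 0 \<le> F x k" "inC x \<Longrightarrow> F x k \<le> 1" "inC x \<Longrightarrow> F x k \<le> mv A x k"
    and F_taylor1: "inC x \<Longrightarrow> mv A x k - F x k \<le> C * (sum x UNIV)\<^sup>2"
    and F_taylor2: "inC x \<Longrightarrow> \<bar>mv A x k - F x k - quad (b2 k) x x / 2\<bar> \<le> C * sum x UNIV ^ 3"
    and F_mono: "inC x \<Longrightarrow> inC y \<Longrightarrow> (\<And>k. x k \<le> y k) \<Longrightarrow> F x k \<le> F y k"
begin

definition Q :: real where "Q = dot v (\<lambda>k. quad (b2 k) u u) / 2"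

lemma sum_le_dot: "(\<And>k. 0 \<le> x k) \<Longrightarrow> sum x UNIV \<le> dot v x / \<alpha>"
proof -
  assume x: "\<And>k. 0 \<le> x k"
  have "\<alpha> * sum x UNIV \<le> dot v x"
    unfolding dot_def sum_distrib_left by (intro sum_mono mult_right_mono v_bounds x)
  then show ?thesis using alpha by (simp add: field_simps)
qed

lemma le_dot: "(\<And>k. 0 \<le> x k) \<Longrightarrow> x k \<le> dot v x / \<alpha>"
  by (rule order_trans[OF _ sum_le_dot]) (auto intro: member_le_sum)

lemma sum_v_le: "sum v UNIV \<le> 1 / \<alpha>"
proof -
  have "\<alpha> * sum v UNIV \<le> dot u v"
    unfolding dot_def sum_distrib_left by (intro sum_mono mult_right_mono u_bounds v_nonneg)
  then show ?thesis using alpha dot_vu by (simp add: dot_commute field_simps)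
qed

lemma dot_v_const: "dot v (\<lambda>_. c) = sum v UNIV * c"
  by (simp add: dot_def sum_distrib_right)

lemma dot_v_le: "(\<And>k. x k \<le> c) \<Longrightarrow> 0 \<le> c \<Longrightarrow> dot v x \<le> c / \<alpha>"
proof -
  assume x: "\<And>k. x k \<le> c" "0 \<le> c"
  have "dot v x \<le> dot v (\<lambda>_. c)" by (intro dot_mono v_nonneg x)
  also have "\<dots> \<le> 1 / \<alpha> * c" unfolding dot_v_const by (intro mult_right_mono sum_v_le x)
  finally show ?thesis by simp
qed

lemma abs_quad_le:
  "\<bar>quad (b2 k) x y\<bar> \<le> C * (\<Sum>l\<in>UNIV. \<bar>x l\<bar>) * (\<Sum>l\<in>UNIV. \<bar>y l\<bar>)"
proof -
  have "\<bar>quad (b2 k) x y\<bar> \<le> (\<Sum>l\<in>UNIV. \<bar>\<Sum>m\<in>UNIV. b2 k l m * x l * y m\<bar>)"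
    unfolding quad_def by (rule sum_abs)
  also have "\<dots> \<le> (\<Sum>l\<in>UNIV. \<Sum>m\<in>UNIV. \<bar>b2 k l m * x l * y m\<bar>)"
    by (intro sum_mono sum_abs)
  also have "\<dots> \<le> (\<Sum>l\<in>UNIV. \<Sum>m\<in>UNIV. C * \<bar>x l\<bar> * \<bar>y m\<bar>)"
    using b2_bounds by (intro sum_mono) (auto simp: abs_mult intro!: mult_right_mono)
  also have "\<dots> = C * (\<Sum>l\<in>UNIV. \<bar>x l\<bar>) * (\<Sum>l\<in>UNIV. \<bar>y l\<bar>)"
    by (simp only: mult.assoc sum_product) (simp only: sum_distrib_left)
  finally show ?thesis .
qed

lemma quad_diff:
  "quad B x x - c\<^sup>2 * quad B u u = quad B x (\<lambda>k. x k - c * u k) + c * quad B (\<lambda>k. x k - c * u k) u"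
  by (simp add: quad_def sum_subtractf[symmetric] sum.distrib[symmetric] sum_distrib_left
      algebra_simps power2_eq_square)

lemma sum_u_le: "sum u UNIV \<le> 1 / \<alpha>"
  using sum_le_dot[of u] u_nonneg dot_vu by simp

text \<open>Replacing \<open>x\<close> by its Perron component changes the quadratic form by about
  the size of \<open>x\<close> times the distance \<open>W\<close> from that component. As
  \<open>W\<close> will be of smaller order, only \<open>Q\<close> times the squared projection
  remains.\<close>

lemma quad_projection:
  assumes x: "\<And>k. 0 \<le> x k" and W: "wnorm v (\<lambda>k. x k - dot v x * u k) \<le> W"
  shows "\<bar>dot v (\<lambda>k. quad (b2 k) x x) / 2 - Q * (dot v x)\<^sup>2\<bar> \<le> C / \<alpha> ^ 3 * dot v x * W"
proof -
  define \<xi> where "\<xi> = dot v x"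
  define w where "w = (\<lambda>k. x k - \<xi> * u k)"
  have xi: "0 \<le> \<xi>" unfolding \<xi>_def by (intro dot_nonneg v_nonneg x)
  define S where "S = (\<Sum>k\<in>UNIV. \<bar>w k\<bar>)"
  have W': "wnorm v w \<le> W" using W by (simp add: w_def \<xi>_def)
  have "S \<le> wnorm v w / \<alpha>" unfolding S_def by (rule sum_le_dot) simp
  also have "\<dots> \<le> W / \<alpha>" using W' alpha by (intro divide_right_mono) auto
  finally have S: "0 \<le> S" "S \<le> W / \<alpha>" by (auto simp: S_def sum_nonneg)
  have W0: "0 \<le> W" using dot_nonneg[of v "\<lambda>k. \<bar>w k\<bar>"] v_nonneg W' by force
  have "\<bar>quad (b2 k) x x - \<xi>\<^sup>2 * quad (b2 k) u u\<bar> \<le> 2 * (C * (\<xi> / \<alpha>) * (W / \<alpha>))" for k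
  proof -
    have "\<bar>quad (b2 k) x w\<bar> \<le> C * (\<Sum>l\<in>UNIV. \<bar>x l\<bar>) * S" unfolding S_def by (rule abs_quad_le)
    also have "\<dots> \<le> C * (\<xi> / \<alpha>) * (W / \<alpha>)"
      using sum_le_dot[of x] x S C_nonneg xi alpha
      by (intro mult_mono) (auto simp: \<xi>_def sum_nonneg)
    finally have 1: "\<bar>quad (b2 k) x w\<bar> \<le> C * (\<xi> / \<alpha>) * (W / \<alpha>)" .
    have "\<bar>quad (b2 k) w u\<bar> \<le> C * S * (\<Sum>l\<in>UNIV. \<bar>u l\<bar>)" unfolding S_def by (rule abs_quad_le)
    also have "\<dots> \<le> C * (W / \<alpha>) * (1 / \<alpha>)"
      using sum_u_le u_nonneg S W0 C_nonneg alpha by (intro mult_mono) (auto intro: sum_nonneg)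
    finally have "\<xi> * \<bar>quad (b2 k) w u\<bar> \<le> \<xi> * (C * (W / \<alpha>) * (1 / \<alpha>))"
      using xi by (rule mult_left_mono)
    then have 2: "\<bar>\<xi> * quad (b2 k) w u\<bar> \<le> C * (\<xi> / \<alpha>) * (W / \<alpha>)"
      using xi by (simp add: abs_mult mult_ac)
    show ?thesis unfolding quad_diff w_def[symmetric] using 1 2 by linarith
  qed
  then have "wnorm v (\<lambda>k. quad (b2 k) x x - \<xi>\<^sup>2 * quad (b2 k) u u) \<le> 2 * (C * (\<xi> / \<alpha>) * (W / \<alpha>)) / \<alpha>"
    using C_nonneg xi W0 alpha by (intro dot_v_le) (auto intro!: mult_nonneg_nonneg)
  moreover have "dot v (\<lambda>k. quad (b2 k) x x) - \<xi>\<^sup>2 * (2 * Q) = dot v (\<lambda>k. quad (b2 k) x x - \<xi>\<^sup>2 * quad (b2 k) u u)"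
    by (simp add: dot_diff dot_scale Q_def)
  moreover have "\<bar>dot v (\<lambda>k. quad (b2 k) x x - \<xi>\<^sup>2 * quad (b2 k) u u)\<bar> \<le> wnorm v (\<lambda>k. quad (b2 k) x x - \<xi>\<^sup>2 * quad (b2 k) u u)"
    by (rule abs_dot_le) (rule v_nonneg)
  ultimately have "\<bar>dot v (\<lambda>k. quad (b2 k) x x) - \<xi>\<^sup>2 * (2 * Q)\<bar> \<le> 2 * (C * (\<xi> / \<alpha>) * (W / \<alpha>)) / \<alpha>" by simp
  then show ?thesis unfolding \<xi>_def[symmetric]
    by (simp add: abs_le_iff power3_eq_cube field_simps)
qed

lemma dot_quad_remainder:
  assumes "inC x"
  shows "\<bar>dot v (\<lambda>k. mv A x k - F x k) - dot v (\<lambda>k. quad (b2 k) x x) / 2\<bar> \<le> C / \<alpha> ^ 4 * dot v x ^ 3"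
proof -
  have x: "\<And>k. 0 \<le> x k" using assms by (simp add: inC_def)
  have "sum x UNIV ^ 3 \<le> (dot v x / \<alpha>) ^ 3"
    by (intro power_mono sum_le_dot sum_nonneg x)
  then have "C * sum x UNIV ^ 3 \<le> C * (dot v x / \<alpha>) ^ 3" using C_nonneg by (rule mult_left_mono)
  then have "\<bar>mv A x k - F x k - quad (b2 k) x x / 2\<bar> \<le> C * (dot v x / \<alpha>) ^ 3" for k
    using F_taylor2[OF assms, of k] by linarith
  moreover have "0 \<le> C * (dot v x / \<alpha>) ^ 3"
    using C_nonneg alpha x by (intro mult_nonneg_nonneg zero_le_power divide_nonneg_nonneg dot_nonneg v_nonneg) auto
  ultimately have "wnorm v (\<lambda>k. mv A x k - F x k - quad (b2 k) x x / 2) \<le> C * (dot v x / \<alpha>) ^ 3 / \<alpha>"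
    by (intro dot_v_le)
  moreover have "dot v (\<lambda>k. mv A x k - F x k - quad (b2 k) x x / 2)
      = dot v (\<lambda>k. mv A x k - F x k) - dot v (\<lambda>k. quad (b2 k) x x) / 2"
    using dot_scale[of v "1/2" "\<lambda>k. quad (b2 k) x x"] by (simp add: dot_diff)
  moreover have "\<bar>dot v (\<lambda>k. mv A x k - F x k - quad (b2 k) x x / 2)\<bar> \<le> wnorm v (\<lambda>k. mv A x k - F x k - quad (b2 k) x x / 2)"
    by (rule abs_dot_le) (rule v_nonneg)
  moreover have "C * (dot v x / \<alpha>) ^ 3 / \<alpha> = C / \<alpha> ^ 4 * dot v x ^ 3"
    by (simp add: power_divide eval_nat_numeral)
  ultimately show ?thesis by linarith
qed

lemma dot_remainder_bounds:
  assumes "inC x"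
  shows "0 \<le> dot v (\<lambda>k. mv A x k - F x k)" "dot v (\<lambda>k. mv A x k - F x k) \<le> C / \<alpha> ^ 3 * (dot v x)\<^sup>2"
proof -
  have x: "\<And>k. 0 \<le> x k" using assms by (simp add: inC_def)
  show "0 \<le> dot v (\<lambda>k. mv A x k - F x k)"
    using F_bounds(3)[OF assms] by (intro dot_nonneg v_nonneg) auto
  have "(sum x UNIV)\<^sup>2 \<le> (dot v x / \<alpha>)\<^sup>2"
    by (intro power_mono sum_le_dot sum_nonneg x)
  then have "C * (sum x UNIV)\<^sup>2 \<le> C * (dot v x / \<alpha>)\<^sup>2" using C_nonneg by (rule mult_left_mono)
  then have "mv A x k - F x k \<le> C * (dot v x / \<alpha>)\<^sup>2" for k
    using F_taylor1[OF assms, of k] by linarith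
  moreover have "0 \<le> C * (dot v x / \<alpha>)\<^sup>2" using C_nonneg by simp
  ultimately have "dot v (\<lambda>k. mv A x k - F x k) \<le> C * (dot v x / \<alpha>)\<^sup>2 / \<alpha>"
    by (intro dot_v_le)
  then show "dot v (\<lambda>k. mv A x k - F x k) \<le> C / \<alpha> ^ 3 * (dot v x)\<^sup>2"
    by (simp add: power_divide eval_nat_numeral)
qed

end

text \<open>The bound on \<open>r ^ U\<close> keeps the contraction factor
  \<open>r ^ U - \<beta>\<close> at most \<open>1 - \<beta> / 2\<close> even when
  \<open>r > 1\<close>; \<open>\<beta> \<le> 1\<close> keeps the latter nonnegative.\<close>

locale defect_recursion = near_critical A r u v U \<beta> F b2 \<alpha> C
  for A :: "'i::finite \<Rightarrow> 'i \<Rightarrow> real" and r u v U \<beta> F b2 \<alpha> C +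
  fixes \<sigma> :: "'i \<Rightarrow> real"
  assumes sigma: "inC \<sigma>" and r_power: "r ^ U \<le> 1 + \<beta> / 2" and beta_le: "\<beta> \<le> 1"
begin

abbreviation x :: "nat \<Rightarrow> 'i \<Rightarrow> real" where "x \<equiv> defect_seq F \<sigma>"
definition \<xi> :: "nat \<Rightarrow> real" where "\<xi> j = dot v (x j)"
definition \<theta> :: real where "\<theta> = dot v \<sigma>"
definition w :: "nat \<Rightarrow> 'i \<Rightarrow> real" where "w j = (\<lambda>k. x j k - \<xi> j * u k)"

lemma inC_x: "inC (x j)"
proof (induction j)
  case 0
  show ?case using sigma by simp
next
  case (Suc j)
  have s: "0 \<le> \<sigma> k" "\<sigma> k \<le> 1" for k using sigma by (auto simp: inC_def)
  have "0 \<le> \<sigma> k + (1 - \<sigma> k) * F (x j) k" for k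
    using s[of k] F_bounds(1)[OF Suc, of k] by simp
  moreover have "\<sigma> k + (1 - \<sigma> k) * F (x j) k \<le> 1" for k
  proof -
    have "(1 - \<sigma> k) * F (x j) k \<le> (1 - \<sigma> k) * 1"
      using s[of k] F_bounds(2)[OF Suc, of k] by (intro mult_left_mono) auto
    then show ?thesis by simp
  qed
  ultimately show ?case by (simp add: inC_def)
qed

lemma x_nonneg: "0 \<le> x j k"
  using inC_x by (simp add: inC_def)

text \<open>The first step goes up and \<open>F\<close> is monotone. Consequently the projections
  and the error bounds \<open>E\<close> increase, so that a bound at the current index covers all
  earlier ones.\<close>

lemma x_incseq: "x j k \<le> x (Suc j) k"
proof (induction j arbitrary: k)
  case 0
  show ?case using sigma F_bounds(1)[OF sigma] by (simp add: inC_def)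
next
  case (Suc j)
  have "F (x j) k \<le> F (x (Suc j)) k" by (intro F_mono inC_x Suc)
  then have "(1 - \<sigma> k) * F (x j) k \<le> (1 - \<sigma> k) * F (x (Suc j)) k"
    using sigma by (intro mult_left_mono) (auto simp: inC_def)
  then show ?case by simp
qed

lemma theta_nonneg: "0 \<le> \<theta>"
  using sigma by (auto simp: \<theta>_def inC_def intro!: dot_nonneg v_nonneg)

lemma xi_0: "\<xi> 0 = \<theta>"
  by (simp add: \<xi>_def \<theta>_def)

lemma xi_mono: "i \<le> j \<Longrightarrow> \<xi> i \<le> \<xi> j"
proof (rule lift_Suc_mono_le[of \<xi>])
  show "\<xi> n \<le> \<xi> (Suc n)" for n
    unfolding \<xi>_def by (intro dot_mono v_nonneg x_incseq)
qed

lemma theta_le_xi: "\<theta> \<le> \<xi> j"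
  using xi_mono[of 0 j] by (simp add: xi_0)

lemma xi_nonneg: "0 \<le> \<xi> j"
  using theta_le_xi[of j] theta_nonneg by simp

definition e :: "nat \<Rightarrow> 'i \<Rightarrow> real" where "e j = (\<lambda>k. x (Suc j) k - mv A (x j) k)"

lemma e_eq: "e j k = \<sigma> k - \<sigma> k * F (x j) k - (mv A (x j) k - F (x j) k)"
  by (simp add: e_def algebra_simps)

lemma dot_e: "dot v (e j) = \<theta> - dot v (\<lambda>k. \<sigma> k * F (x j) k) - dot v (\<lambda>k. mv A (x j) k - F (x j) k)"
  unfolding e_eq[abs_def] \<theta>_def by (simp only: dot_diff)

lemma xi_Suc: "\<xi> (Suc j) = r * \<xi> j + dot v (e j)"
proof -
  have "x (Suc j) = (\<lambda>k. mv A (x j) k + e j k)" by (auto simp: e_def)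
  then show ?thesis unfolding \<xi>_def by (simp only: dot_add dot_mv)
qed

lemma sigma_F: "0 \<le> \<sigma> k * F (x j) k" "\<sigma> k * F (x j) k \<le> \<sigma> k"
  using sigma F_bounds(1,2)[OF inC_x] by (auto simp: inC_def mult_left_le)

lemma xi_Suc_le: "\<xi> (Suc j) \<le> r * \<xi> j + \<theta>"
proof -
  have "0 \<le> dot v (\<lambda>k. \<sigma> k * F (x j) k)" by (intro dot_nonneg v_nonneg sigma_F)
  then show ?thesis using dot_remainder_bounds(1)[OF inC_x, of j] by (simp add: xi_Suc dot_e)
qed

text \<open>Dropping the quadratic loss leaves an affine recursion. This a priori bound controls
  both the maximum and the sum of the projections.\<close>

lemma xi_le_geometric: "\<xi> j \<le> \<theta> * (\<Sum>i\<le>j. r ^ i)"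
proof (induction j)
  case 0
  show ?case by (simp add: xi_0)
next
  case (Suc j)
  have "\<xi> (Suc j) \<le> r * (\<theta> * (\<Sum>i\<le>j. r ^ i)) + \<theta>"
    using xi_Suc_le[of j] mult_left_mono[OF Suc r_nonneg] by linarith
  also have "\<dots> = \<theta> * (\<Sum>i\<le>Suc j. r ^ i)"
    by (subst sum.atMost_Suc_shift) (simp add: sum_distrib_left algebra_simps)
  finally show ?case .
qed

definition E :: "nat \<Rightarrow> real" where "E j = \<theta> + C / \<alpha> ^ 3 * (\<xi> j)\<^sup>2"

lemma E_mono: "i \<le> j \<Longrightarrow> E i \<le> E j"
  unfolding E_def using C_nonneg alpha xi_mono xi_nonneg
  by (intro add_left_mono mult_left_mono power_mono) auto

lemma theta_le_E: "\<theta> \<le> E j" and E_nonneg: "0 \<le> E j"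
  using C_nonneg alpha theta_nonneg by (auto simp: E_def)

lemma wnorm_e: "wnorm v (e j) \<le> E j"
proof -
  have "wnorm v (e j) \<le> dot v (\<lambda>k. \<sigma> k + (mv A (x j) k - F (x j) k))"
  proof (intro dot_mono v_nonneg)
    fix k show "\<bar>e j k\<bar> \<le> \<sigma> k + (mv A (x j) k - F (x j) k)"
      using sigma_F[of k j] F_bounds(3)[OF inC_x, of j k] unfolding e_eq by linarith
  qed
  also have "\<dots> = \<theta> + dot v (\<lambda>k. mv A (x j) k - F (x j) k)" by (simp only: dot_add \<theta>_def)
  also have "\<dots> \<le> E j"
    unfolding E_def \<xi>_def by (intro add_left_mono dot_remainder_bounds inC_x)
  finally show ?thesis .
qed

lemma dot_w: "dot v (w j) = 0"
  unfolding w_def \<xi>_def by (rule dot_project)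

lemma w_Suc: "w (Suc j) k = mv A (w j) k + (e j k - dot v (e j) * u k)"
proof -
  have "mv A (w j) k = mv A (x j) k - \<xi> j * (r * u k)"
    by (simp add: w_def mv_diff mv_scale right_eigen)
  moreover have "x (Suc j) k = mv A (x j) k + e j k" by (simp add: e_def)
  ultimately show ?thesis unfolding w_def xi_Suc by (simp add: algebra_simps)
qed

text \<open>The factor 2^(i+1) - 2 solves c(i+1) = 2 c(i) + 2 with c(0) = 0; one 2 bounds
  \<open>r\<close>, the other comes from \<open>wnorm_project\<close>.\<close>

lemma w_shift: "wnorm v (\<lambda>k. w (j + i) k - (mv A ^^ i) (w j) k) \<le> (2 ^ Suc i - 2) * E (j + i)"
proof (induction i)
  case 0
  show ?case using E_nonneg[of j] by (simp add: dot_def)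
next
  case (Suc i)
  define R where "R = (\<lambda>k. w (j + i) k - (mv A ^^ i) (w j) k)"
  define e' where "e' = (\<lambda>k. e (j + i) k - dot v (e (j + i)) * u k)"
  have "w (j + Suc i) k - (mv A ^^ Suc i) (w j) k = mv A R k + e' k" for k
    by (simp add: R_def e'_def mv_diff w_Suc)
  then have "wnorm v (\<lambda>k. w (j + Suc i) k - (mv A ^^ Suc i) (w j) k) \<le> wnorm v (mv A R) + wnorm v e'"
    using wnorm_triangle[of v "mv A R" e'] v_nonneg by simp
  also have "\<dots> \<le> r * wnorm v R + 2 * wnorm v (e (j + i))"
    using wnorm_mv[of R] wnorm_project[of "e (j + i)"] by (simp add: e'_def)
  also have "\<dots> \<le> 2 * ((2 ^ Suc i - 2) * E (j + i)) + 2 * E (j + i)"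
    using Suc r_le r_nonneg wnorm_e[of "j + i"]
    by (intro add_mono mult_mono) (auto simp: R_def intro!: dot_nonneg v_nonneg)
  also have "\<dots> = (2 ^ Suc (Suc i) - 2) * E (j + i)" by (simp add: algebra_simps)
  also have "\<dots> \<le> (2 ^ Suc (Suc i) - 2) * E (j + Suc i)"
  proof (intro mult_left_mono E_mono)
    have "(1::real) \<le> 2 ^ i" by simp
    then show "(0::real) \<le> 2 ^ Suc (Suc i) - 2" unfolding power_Suc by linarith
  qed simp
  finally show ?case .
qed

text \<open>Contraction is available only over \<open>U\<close> steps, so the induction goes back by
  \<open>U\<close>, and the first \<open>U\<close> indices are estimated directly. The constant L =
  (4 / \<beta>) 2^(U+1) is chosen so that 2^(U+1) + (1 - \<beta> / 2) L is still at most L.\<close>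

lemma w_bound: "wnorm v (w j) \<le> 4 / \<beta> * 2 ^ Suc U * E j"
proof (induction j rule: less_induct)
  case (less j)
  have K: "2 * 2 ^ Suc U * E j \<le> 4 / \<beta> * 2 ^ Suc U * E j"
    using beta_pos beta_le E_nonneg[of j] by (intro mult_right_mono) (auto simp: field_simps)
  show ?case
  proof (cases "j < U")
    case True
    have init: "wnorm v ((mv A ^^ i) (w 0)) \<le> 2 ^ i * (2 * \<theta>)" for i
    proof (induction i)
      case 0
      show ?case using wnorm_project[of \<sigma>] sigma
        by (simp add: w_def \<xi>_def \<theta>_def inC_def abs_of_nonneg)
    next
      case (Suc i)
      have "wnorm v ((mv A ^^ Suc i) (w 0)) \<le> r * wnorm v ((mv A ^^ i) (w 0))"
        using wnorm_mv by simp
      also have "\<dots> \<le> 2 * (2 ^ i * (2 * \<theta>))"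
        using Suc r_le r_nonneg by (intro mult_mono dot_nonneg v_nonneg) auto
      finally show ?case by simp
    qed
    have "wnorm v (w j) \<le> wnorm v (\<lambda>k. w (0 + j) k - (mv A ^^ j) (w 0) k) + wnorm v ((mv A ^^ j) (w 0))"
      using wnorm_triangle[of v "\<lambda>k. w j k - (mv A ^^ j) (w 0) k" "(mv A ^^ j) (w 0)"] v_nonneg by simp
    also have "\<dots> \<le> (2 ^ Suc j - 2) * E j + 2 ^ j * (2 * \<theta>)"
      using w_shift[of 0 j] init[of j] by simp
    also have "2 ^ j * (2 * \<theta>) \<le> 2 ^ U * (2 * E j)"
      using True theta_le_E[of j] theta_nonneg by (intro mult_mono) auto
    finally have "wnorm v (w j) \<le> (2 ^ Suc j - 2) * E j + 2 ^ U * (2 * E j)" by simp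
    also have "\<dots> \<le> 2 ^ Suc U * E j + 2 ^ Suc U * E j"
    proof (intro add_mono mult_right_mono E_nonneg)
      have "(2::real) ^ Suc j \<le> 2 ^ Suc U" using True by (intro power_increasing) auto
      then show "(2::real) ^ Suc j - 2 \<le> 2 ^ Suc U" by linarith
    qed simp
    finally show ?thesis using K by simp
  next
    case False
    define i where "i = j - U"
    have j: "j = i + U" using False by (simp add: i_def)
    show ?thesis
    \<comment> \<open>For \<open>U = 0\<close>, going back by \<open>U\<close> would not decrease
      the index; there the power is the identity and \<open>contraction\<close> forces
      \<open>w j\<close> to vanish.\<close>
    proof (cases "U = 0")
      case True
      have "wnorm v (w j) \<le> (r ^ U - \<beta>) * wnorm v (w j)"
        using contraction[OF dot_w, of j] True by simp
      then have "\<beta> * wnorm v (w j) \<le> 0" using True by (simp add: left_diff_distrib)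
      then have "wnorm v (w j) \<le> 0" using beta_pos by (simp add: mult_le_0_iff)
      also have "0 \<le> 4 / \<beta> * 2 ^ Suc U * E j" using beta_pos E_nonneg[of j] by simp
      finally show ?thesis .
    next
      case False
      have "wnorm v (w j) \<le> wnorm v (\<lambda>k. w (i + U) k - (mv A ^^ U) (w i) k) + wnorm v ((mv A ^^ U) (w i))"
        using wnorm_triangle[of v "\<lambda>k. w j k - (mv A ^^ U) (w i) k" "(mv A ^^ U) (w i)"] v_nonneg j by simp
      also have "\<dots> \<le> (2 ^ Suc U - 2) * E j + (r ^ U - \<beta>) * wnorm v (w i)"
        unfolding j by (intro add_mono w_shift contraction dot_w)
      also have "\<dots> \<le> 2 ^ Suc U * E j + (1 - \<beta> / 2) * (4 / \<beta> * 2 ^ Suc U * E j)"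
      proof (rule add_mono)
        show "(2 ^ Suc U - 2) * E j \<le> 2 ^ Suc U * E j"
          by (intro mult_right_mono E_nonneg) simp
        have "(r ^ U - \<beta>) * wnorm v (w i) \<le> (1 - \<beta> / 2) * wnorm v (w i)"
          using r_power by (intro mult_right_mono dot_nonneg v_nonneg) auto
        also have "\<dots> \<le> (1 - \<beta> / 2) * (4 / \<beta> * 2 ^ Suc U * E i)"
          using less[of i] False beta_le j by (intro mult_left_mono) auto
        also have "\<dots> \<le> (1 - \<beta> / 2) * (4 / \<beta> * 2 ^ Suc U * E j)"
          using beta_le beta_pos E_mono[of i j] j by (intro mult_left_mono) auto
        finally show "(r ^ U - \<beta>) * wnorm v (w i) \<le> (1 - \<beta> / 2) * (4 / \<beta> * 2 ^ Suc U * E j)" .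
      qed
      also have "\<dots> = 4 / \<beta> * 2 ^ Suc U * E j - 2 ^ Suc U * E j"
        using beta_pos by (simp add: field_simps)
      also have "\<dots> \<le> 4 / \<beta> * 2 ^ Suc U * E j" using E_nonneg[of j] by simp
      finally show ?thesis .
    qed
  qed
qed

definition K1 :: real where "K1 = 4 / \<beta> * 2 ^ Suc U"
definition K :: real where "K = 2 / \<alpha> + C / \<alpha> ^ 4 + C / \<alpha> ^ 3 * K1 * (1 + C / \<alpha> ^ 3)"

text \<open>Three errors enter: the product of \<open>\<sigma>\<close> with \<open>F\<close>, the
  cubic Taylor remainder, and the projection inside the quadratic form. The last is governed by
  \<open>w_bound\<close>, where the \<theta> in \<open>E\<close> produces another term \<theta>
  \<xi> and the square another \<xi>^3.\<close>

lemma recursion: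
  "\<bar>\<xi> (Suc j) - r * \<xi> j - \<theta> + Q * (\<xi> j)\<^sup>2\<bar> \<le> K * (\<theta> * \<xi> j + \<xi> j ^ 3)"
proof -
  define C' where "C' = C / \<alpha> ^ 3"
  have pos: "0 \<le> C'" "0 \<le> K1" using C_nonneg alpha beta_pos by (auto simp: C'_def K1_def)
  have mix: "0 \<le> \<theta> * \<xi> j" "0 \<le> \<xi> j ^ 3" using theta_nonneg xi_nonneg by auto
  have 1: "dot v (\<lambda>k. \<sigma> k * F (x j) k) \<le> 2 / \<alpha> * (\<theta> * \<xi> j)"
  proof -
    have "dot v (\<lambda>k. \<sigma> k * F (x j) k) \<le> dot v (\<lambda>k. 2 * \<xi> j / \<alpha> * \<sigma> k)"
    proof (intro dot_mono v_nonneg)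
      fix k
      have "F (x j) k \<le> mv A (x j) k" by (rule F_bounds(3)[OF inC_x])
      also have "\<dots> \<le> dot v (mv A (x j)) / \<alpha>"
        by (rule le_dot) (auto simp: mv_def intro!: sum_nonneg mult_nonneg_nonneg nonneg x_nonneg)
      also have "\<dots> = r * \<xi> j / \<alpha>" by (simp add: dot_mv \<xi>_def)
      also have "\<dots> \<le> 2 * \<xi> j / \<alpha>"
        using r_le xi_nonneg alpha by (intro divide_right_mono mult_right_mono) auto
      finally have "\<sigma> k * F (x j) k \<le> \<sigma> k * (2 * \<xi> j / \<alpha>)"
        using sigma by (intro mult_left_mono) (auto simp: inC_def)
      then show "\<sigma> k * F (x j) k \<le> 2 * \<xi> j / \<alpha> * \<sigma> k" by (simp add: mult.commute)
    qed
    also have "\<dots> = 2 * \<xi> j / \<alpha> * \<theta>" by (simp only: dot_scale \<theta>_def)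
    finally show ?thesis by (simp add: mult_ac)
  qed
  have sF: "0 \<le> dot v (\<lambda>k. \<sigma> k * F (x j) k)" by (intro dot_nonneg v_nonneg sigma_F)
  have 2: "\<bar>dot v (\<lambda>k. mv A (x j) k - F (x j) k) - dot v (\<lambda>k. quad (b2 k) (x j) (x j)) / 2\<bar> \<le> C / \<alpha> ^ 4 * \<xi> j ^ 3"
    unfolding \<xi>_def by (rule dot_quad_remainder[OF inC_x])
  have "\<bar>dot v (\<lambda>k. quad (b2 k) (x j) (x j)) / 2 - Q * (\<xi> j)\<^sup>2\<bar> \<le> C' * \<xi> j * (K1 * E j)"
    unfolding C'_def \<xi>_def
    by (rule quad_projection) (use w_bound[of j] x_nonneg in \<open>auto simp: w_def \<xi>_def K1_def\<close>)
  also have "\<dots> = C' * K1 * (\<theta> * \<xi> j + C' * \<xi> j ^ 3)"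
    unfolding E_def C'_def[symmetric]
    by (simp add: power2_eq_square power3_eq_cube algebra_simps)
  also have "\<dots> \<le> C' * K1 * ((1 + C') * (\<theta> * \<xi> j + \<xi> j ^ 3))"
    using pos mix by (intro mult_left_mono) (auto simp: algebra_simps)
  finally have 3: "\<bar>dot v (\<lambda>k. quad (b2 k) (x j) (x j)) / 2 - Q * (\<xi> j)\<^sup>2\<bar>
    \<le> C' * K1 * (1 + C') * (\<theta> * \<xi> j + \<xi> j ^ 3)" by (simp add: mult.assoc)
  have 4: "2 / \<alpha> * (\<theta> * \<xi> j) \<le> 2 / \<alpha> * (\<theta> * \<xi> j + \<xi> j ^ 3)"
    "C / \<alpha> ^ 4 * \<xi> j ^ 3 \<le> C / \<alpha> ^ 4 * (\<theta> * \<xi> j + \<xi> j ^ 3)"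
    using mix alpha C_nonneg by (intro mult_left_mono; simp)+
  have "K * (\<theta> * \<xi> j + \<xi> j ^ 3) = 2 / \<alpha> * (\<theta> * \<xi> j + \<xi> j ^ 3)
    + C / \<alpha> ^ 4 * (\<theta> * \<xi> j + \<xi> j ^ 3) + C' * K1 * (1 + C') * (\<theta> * \<xi> j + \<xi> j ^ 3)"
    by (simp add: K_def C'_def[symmetric] distrib_right)
  then show ?thesis unfolding xi_Suc dot_e using 1 sF 2 3 4 by linarith
qed

end

section \<open>Riccati recursions\<close>

text \<open>Pairs (y, D) where D is the increment of y and D(j+1) = r D(j) + e y(j): a discrete y''
  = (r - 1) y' + e y. With e = Q \<theta> the first component models the product of the 1 + Q
  \<xi>_i with i < j.\<close>

primrec lin :: "real \<Rightarrow> real \<Rightarrow> nat \<Rightarrow> real \<times> real" where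
  "lin r e 0 = (1, e)"
| "lin r e (Suc j) = (fst (lin r e j) + snd (lin r e j), r * snd (lin r e j) + e * fst (lin r e j))"

text \<open>The roots below are the eigenvalues of the linear recursion, shifted by 1; the exponents
  are shifted because the recursion may be started one step earlier, at (1, 0).\<close>
lemma lin_closed_form:
  assumes s: "s > 0" "s\<^sup>2 = (r - 1)\<^sup>2 + 4 * e"
  defines "p \<equiv> (r - 1 + s) / 2" and "m \<equiv> (r - 1 - s) / 2"
  shows "lin r e j = ((p * (1 + m) ^ Suc j - m * (1 + p) ^ Suc j) / s,
    p * m * ((1 + m) ^ Suc j - (1 + p) ^ Suc j) / s)"
proof (induction j)
  case 0
  have pm: "p - m = s" by (simp add: p_def m_def field_simps)
  have "p * (1 + m) - m * (1 + p) = s" using pm by (simp add: algebra_simps)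
  moreover have "p * m * ((1 + m) - (1 + p)) = s * e"
  proof -
    have "(1 + m) - (1 + p) = - s" using pm by simp
    moreover have "p * m = - e" using s by (simp add: p_def m_def power2_eq_square field_simps)
    ultimately show ?thesis by simp
  qed
  ultimately show ?case using s by (simp add: field_simps)
next
  case (Suc j)
  have pm: "r = 1 + p + m" by (simp add: p_def m_def field_simps)
  have e: "e = - (p * m)" using s by (simp add: p_def m_def power2_eq_square field_simps)
  define P where "P = (1 + p) ^ Suc j"
  define M where "M = (1 + m) ^ Suc j"
  have 1: "p * M - m * P + p * m * (M - P) = p * ((1 + m) * M) - m * ((1 + p) * P)"
    by (simp add: algebra_simps)
  have 2: "r * (p * m * (M - P)) + e * (p * M - m * P) = p * m * ((1 + m) * M - (1 + p) * P)"
    unfolding pm e by (simp add: algebra_simps)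
  have 3: "(1 + p) ^ Suc (Suc j) = (1 + p) * P" "(1 + m) ^ Suc (Suc j) = (1 + m) * M"
    by (simp_all add: P_def M_def)
  show ?case
    unfolding lin.simps Suc fst_conv snd_conv 3 P_def[symmetric] M_def[symmetric]
    by (simp only: times_divide_eq_right add_divide_distrib[symmetric] 1 2)
qed

lemma one_minus_sum_le_prod:
  fixes c :: "nat \<Rightarrow> real"
  assumes "\<And>i. i < n \<Longrightarrow> 0 \<le> c i \<and> c i \<le> 1"
  shows "1 - (\<Sum>i<n. c i) \<le> (\<Prod>i<n. 1 - c i)"
  using assms
proof (induction n)
  case (Suc n)
  define p where "p = (\<Prod>i<n. 1 - c i)"
  have "p \<le> 1" unfolding p_def using Suc.prems by (intro prod_le_1) auto
  then have "p * c n \<le> c n" using Suc.prems[of n] mult_right_mono[of p 1 "c n"] by simp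
  moreover have "1 - (\<Sum>i<n. c i) \<le> p" unfolding p_def using Suc by simp
  ultimately show ?case by (simp add: p_def[symmetric] right_diff_distrib)
qed simp

lemma lin_nonneg: "0 \<le> r \<Longrightarrow> 0 \<le> e \<Longrightarrow> 0 \<le> fst (lin r e j) \<and> 0 \<le> snd (lin r e j)"
  by (induction j) auto

text \<open>Comparison by positivity of the coefficients. The perturbation multiplies only
  \<open>r * D j\<close>; since all terms are nonnegative, the accumulated factor may be attached to
  the others as well.\<close>

lemma lin_upper:
  fixes y D a :: "nat \<Rightarrow> real"
  assumes y: "y 0 = 1" "\<And>j. y (Suc j) = y j + D j" and D0: "D 0 \<le> e'"
    and D: "\<And>j. j < n \<Longrightarrow> D (Suc j) \<le> (1 + a j) * (r * D j) + e' * y j"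
    and pos: "\<And>j. 0 \<le> a j" "0 \<le> r" "0 \<le> e'" and j: "j \<le> n"
  shows "y j \<le> (\<Prod>i<j. 1 + a i) * fst (lin r e' j) \<and> D j \<le> (\<Prod>i<j. 1 + a i) * snd (lin r e' j)"
  using j
proof (induction j)
  case 0
  then show ?case using y D0 by simp
next
  case (Suc j)
  define p where "p = (\<Prod>i<j. 1 + a i)"
  have p: "0 \<le> p" using pos by (auto simp: p_def intro!: prod_nonneg add_nonneg_nonneg)
  have IH: "y j \<le> p * fst (lin r e' j)" "D j \<le> p * snd (lin r e' j)"
    using Suc by (auto simp: p_def)
  have l: "0 \<le> fst (lin r e' j)" "0 \<le> snd (lin r e' j)" using lin_nonneg pos by auto
  have up: "p * c \<le> p * (1 + a j) * c" if "0 \<le> c" for c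
    using mult_left_mono[of c "(1 + a j) * c" p] that p pos(1)[of j]
    by (simp add: mult.assoc distrib_right)
  have "y (Suc j) \<le> p * fst (lin r e' (Suc j))" using IH y(2)[of j] by (simp add: algebra_simps)
  also have "\<dots> \<le> p * (1 + a j) * fst (lin r e' (Suc j))" by (rule up) (use l in simp)
  finally have 1: "y (Suc j) \<le> p * (1 + a j) * fst (lin r e' (Suc j))" .
  have "D (Suc j) \<le> (1 + a j) * (r * D j) + e' * y j" using D Suc.prems by simp
  also have "\<dots> \<le> (1 + a j) * (r * (p * snd (lin r e' j))) + e' * (p * fst (lin r e' j))"
    using IH pos by (intro add_mono mult_left_mono) auto
  also have "e' * (p * fst (lin r e' j)) \<le> e' * (p * (1 + a j) * fst (lin r e' j))"
    using pos up[OF l(1)] by (intro mult_left_mono) auto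
  finally have 2: "D (Suc j) \<le> p * (1 + a j) * snd (lin r e' (Suc j))"
    by (simp add: algebra_simps)
  show ?case using 1 2 by (simp add: p_def)
qed

text \<open>The factors 1 - a_i lie in [0, 1], so attaching them to the unperturbed terms only
  lowers the bound.\<close>

lemma lin_lower:
  fixes y D a :: "nat \<Rightarrow> real"
  assumes y: "y 0 = 1" "\<And>j. y (Suc j) = y j + D j" and D0: "e' \<le> D 0"
    and D: "\<And>j. j < n \<Longrightarrow> (1 - a j) * (r * D j) + e' * y j \<le> D (Suc j)"
    and pos: "\<And>j. 0 \<le> a j" "\<And>j. j < n \<Longrightarrow> a j \<le> 1" "0 \<le> r" "0 \<le> e'" and j: "j \<le> n"
  shows "(\<Prod>i<j. 1 - a i) * fst (lin r e' j) \<le> y j \<and> (\<Prod>i<j. 1 - a i) * snd (lin r e' j) \<le> D j"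
  using j
proof (induction j)
  case 0
  then show ?case using y D0 by simp
next
  case (Suc j)
  define p where "p = (\<Prod>i<j. 1 - a i)"
  have aj: "0 \<le> 1 - a j" "1 - a j \<le> 1" using pos Suc.prems by auto
  have p: "0 \<le> p" using pos Suc.prems by (auto simp: p_def intro!: prod_nonneg)
  have IH: "p * fst (lin r e' j) \<le> y j" "p * snd (lin r e' j) \<le> D j"
    using Suc by (auto simp: p_def)
  have l: "0 \<le> fst (lin r e' j)" "0 \<le> snd (lin r e' j)" using lin_nonneg pos by auto
  have down: "p * (1 - a j) * c \<le> p * c" if "0 \<le> c" for c
    using mult_left_mono[of "(1 - a j) * c" c p] that p pos(1)[of j]
    by (simp add: mult.assoc left_diff_distrib)
  have "p * (1 - a j) * fst (lin r e' (Suc j)) \<le> p * fst (lin r e' (Suc j))"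
    by (rule down) (use l in simp)
  also have "\<dots> \<le> y (Suc j)" using IH y(2)[of j] by (simp add: algebra_simps)
  finally have 1: "p * (1 - a j) * fst (lin r e' (Suc j)) \<le> y (Suc j)" .
  have "p * (1 - a j) * snd (lin r e' (Suc j))
      = (1 - a j) * (r * (p * snd (lin r e' j))) + e' * (p * (1 - a j) * fst (lin r e' j))"
    by (simp add: algebra_simps)
  also have "\<dots> \<le> (1 - a j) * (r * D j) + e' * y j"
    using IH pos aj order_trans[OF down[OF l(1)] IH(1)] by (intro add_mono mult_left_mono) auto
  also have "\<dots> \<le> D (Suc j)" using D Suc.prems by simp
  finally have 2: "p * (1 - a j) * snd (lin r e' (Suc j)) \<le> D (Suc j)" .
  show ?case using 1 2 by (simp add: p_def)
qed

text \<open>Linearisation of the Riccati-type recursion: with y the product of the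
  factors 1 + Q \<xi> and D = Q \<xi> y its increment, the quadratic term cancels.\<close>
lemma riccati_compare:
  fixes \<xi> :: "nat \<Rightarrow> real"
  assumes xi: "\<And>j. 0 \<le> \<xi> j" "\<xi> 0 = \<theta>" "\<And>j. j \<le> n \<Longrightarrow> \<xi> j \<le> h"
    and rec: "\<And>j. \<bar>\<xi> (Suc j) - r * \<xi> j - \<theta> + Q * (\<xi> j)\<^sup>2\<bar> \<le> K * (\<theta> * \<xi> j + \<xi> j ^ 3)"
    and Q: "0 \<le> Q" and K: "0 \<le> K" and r: "1 / 2 \<le> r" and h: "0 \<le> h" "h \<le> 1"
    and S: "(\<Sum>j\<le>n. \<xi> j) \<le> S"
  defines "b \<equiv> Q * h + K * h * (1 + Q)"
    and "a \<equiv> 2 * (Q * \<bar>r - 1\<bar> + Q\<^sup>2 * h + K * h * (1 + Q))"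
  assumes b: "b \<le> 1" and a: "a * S \<le> 1"
  shows "(\<Prod>j\<le>n. 1 + Q * \<xi> j) \<le> exp (a * S) * fst (lin r (Q * \<theta> * (1 + b)) (Suc n))"
    and "(1 - a * S) * fst (lin r (Q * \<theta> * (1 - b)) (Suc n)) \<le> (\<Prod>j\<le>n. 1 + Q * \<xi> j)"
proof -
  define y where "y = (\<lambda>j. \<Prod>i<j. 1 + Q * \<xi> i)"
  define D where "D = (\<lambda>j. Q * \<xi> j * y j)"
  \<comment> \<open>Errors relative to the increment accumulate over the steps and are kept
    proportional to \<open>\<xi> j\<close>, whose sum is bounded. Errors relative to \<theta> are
    collected in \<open>b\<close> and merely shift the parameter of the linear recursion.\<close>
  define c where "c = (\<lambda>j. if j \<le> n then a * \<xi> j else 0)"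
  have theta: "0 \<le> \<theta>" using xi(1)[of 0] xi(2) by simp
  have y0: "0 \<le> y j" for j using xi Q by (auto simp: y_def intro!: prod_nonneg add_nonneg_nonneg)
  have D0: "0 \<le> D j" for j using xi Q y0 by (simp add: D_def)
  have a0: "0 \<le> a" using Q K h by (simp add: a_def)
  have b0: "0 \<le> b" using Q K h by (simp add: b_def)
  have yS: "y (Suc j) = y j + D j" for j by (simp add: y_def D_def algebra_simps)
  \<comment> \<open>Terms of order x^2 and higher are measured against \<open>D j\<close>, terms
    containing \<theta> against \<open>Q * \<theta> * y j\<close>. The factor 2 in \<open>a\<close>
    pays for D <= 2 r D, valid as r >= 1/2.\<close>
  have step: "\<bar>D (Suc j) - r * D j - Q * \<theta> * y j\<bar> \<le> c j * (r * D j) + b * (Q * \<theta> * y j)" if j: "j \<le> n" for j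
  proof -
    define x where "x = \<xi> j"
    define \<delta> where "\<delta> = \<xi> (Suc j) - r * x - \<theta> + Q * x\<^sup>2"
    have x: "0 \<le> x" "x \<le> h" using xi j by (auto simp: x_def)
    have d: "\<bar>\<delta>\<bar> \<le> K * (\<theta> * x + x ^ 3)" using rec[of j] by (simp add: \<delta>_def x_def)
    have "D (Suc j) = Q * (r * x + \<theta> - Q * x\<^sup>2 + \<delta>) * (y j + Q * x * y j)"
      by (simp add: D_def yS \<delta>_def x_def)
    \<comment> \<open>The term -Q x^2 of the recursion meets r Q x^2, which arises from the factor 1
      + Q x. Only (r - 1) Q x^2 survives, and it is small.\<close>
    then have "D (Suc j) - r * D j - Q * \<theta> * y j
        = Q * y j * ((r - 1) * Q * x\<^sup>2 + Q * \<theta> * x - Q\<^sup>2 * x ^ 3 + \<delta> * (1 + Q * x))"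
      by (simp add: D_def x_def[symmetric] power2_eq_square power3_eq_cube algebra_simps)
    moreover have "\<bar>(r - 1) * Q * x\<^sup>2 + Q * \<theta> * x - Q\<^sup>2 * x ^ 3 + \<delta> * (1 + Q * x)\<bar>
        \<le> (a * x / 2) * x + b * \<theta>"
    proof -
      have "\<bar>(r - 1) * Q * x\<^sup>2\<bar> = \<bar>r - 1\<bar> * Q * x * x" using Q x by (simp add: abs_mult power2_eq_square)
      moreover have "\<bar>Q * \<theta> * x\<bar> \<le> Q * h * \<theta>"
        using Q theta x mult_left_mono[of x h "Q * \<theta>"] by (simp add: abs_mult mult_ac)
      moreover have "\<bar>Q\<^sup>2 * x ^ 3\<bar> \<le> Q\<^sup>2 * h * x * x"
        using x mult_right_mono[of x h "Q\<^sup>2 * x * x"] by (simp add: abs_mult power3_eq_cube mult_ac)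
      moreover have "\<bar>\<delta> * (1 + Q * x)\<bar> \<le> K * h * (1 + Q) * x * x + K * h * (1 + Q) * \<theta>"
      proof -
        have "\<theta> * x + x ^ 3 \<le> h * \<theta> + h * (x * x)"
          using x theta mult_right_mono[of x h "x * x"] mult_right_mono[of x h \<theta>] by (simp add: power3_eq_cube mult_ac)
        then have "\<bar>\<delta>\<bar> \<le> K * (h * \<theta> + h * (x * x))" using d K by (meson mult_left_mono order_trans)
        moreover have "\<bar>1 + Q * x\<bar> \<le> 1 + Q" using Q x h mult_left_mono[of x 1 Q] by simp
        ultimately have "\<bar>\<delta>\<bar> * \<bar>1 + Q * x\<bar> \<le> K * (h * \<theta> + h * (x * x)) * (1 + Q)"
          using K h theta by (intro mult_mono) auto
        moreover have "K * (h * \<theta> + h * (x * x)) * (1 + Q) = K * h * (1 + Q) * x * x + K * h * (1 + Q) * \<theta>"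
          by (simp add: algebra_simps)
        ultimately show ?thesis by (simp only: abs_mult)
      qed
      moreover have "(a * x / 2) * x + b * \<theta> = \<bar>r - 1\<bar> * Q * x * x + Q * h * \<theta> + Q\<^sup>2 * h * x * x
          + (K * h * (1 + Q) * x * x + K * h * (1 + Q) * \<theta>)"
        by (simp add: a_def b_def algebra_simps)
      ultimately show ?thesis by linarith
    qed
    then have "\<bar>Q * y j * ((r - 1) * Q * x\<^sup>2 + Q * \<theta> * x - Q\<^sup>2 * x ^ 3 + \<delta> * (1 + Q * x))\<bar>
        \<le> Q * y j * ((a * x / 2) * x + b * \<theta>)"
      unfolding abs_mult[of "Q * y j"] using Q y0[of j] by (simp add: mult_left_mono)
    moreover have "Q * y j * ((a * x / 2) * x + b * \<theta>) = (a * x) * (1 / 2 * D j) + b * (Q * \<theta> * y j)"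
      by (simp add: D_def x_def[symmetric] algebra_simps)
    moreover have "(a * x) * (1 / 2 * D j) \<le> (a * x) * (r * D j)"
      using r a0 x D0 by (intro mult_left_mono mult_right_mono) auto
    ultimately show ?thesis using j by (simp add: c_def x_def)
  qed
  have c0: "0 \<le> c j" for j using a0 xi by (simp add: c_def)
  have sumc: "(\<Sum>i<Suc n. c i) = a * (\<Sum>j\<le>n. \<xi> j)"
    unfolding lessThan_Suc_atMost by (simp add: c_def sum_distrib_left)
  have sumc_le: "(\<Sum>i<Suc n. c i) \<le> a * S" unfolding sumc by (intro mult_left_mono S a0)
  have c1: "c j \<le> 1" if "j < Suc n" for j
  proof -
    have "c j \<le> (\<Sum>i<Suc n. c i)" using that c0 by (intro member_le_sum) auto
    then show ?thesis using sumc_le a by linarith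
  qed
  have prod: "(\<Prod>j\<le>n. 1 + Q * \<xi> j) = y (Suc n)" by (simp add: y_def lessThan_Suc_atMost)
  have e0: "0 \<le> Q * \<theta>" using Q theta by simp
  have D00: "D 0 = Q * \<theta>" by (simp add: D_def y_def xi)
  have "y (Suc n) \<le> (\<Prod>i<Suc n. 1 + c i) * fst (lin r (Q * \<theta> * (1 + b)) (Suc n))"
  proof (rule conjunct1[OF lin_upper[where n = "Suc n" and D = D]])
    show "D 0 \<le> Q * \<theta> * (1 + b)" using mult_nonneg_nonneg[OF e0 b0] by (simp add: D00 distrib_left)
    show "D (Suc j) \<le> (1 + c j) * (r * D j) + Q * \<theta> * (1 + b) * y j" if "j < Suc n" for j
      using step[of j] that by (simp add: algebra_simps abs_le_iff)
  qed (use c0 yS r e0 b0 in \<open>auto simp: y_def\<close>)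
  also have "\<dots> \<le> exp (a * S) * fst (lin r (Q * \<theta> * (1 + b)) (Suc n))"
  proof (rule mult_right_mono)
    have "(\<Prod>i<Suc n. 1 + c i) \<le> (\<Prod>i<Suc n. exp (c i))"
      using c0 by (intro prod_mono conjI add_nonneg_nonneg) auto
    also have "\<dots> = exp (\<Sum>i<Suc n. c i)" by (rule exp_sum[symmetric]) simp
    also have "\<dots> \<le> exp (a * S)" using sumc_le by simp
    finally show "(\<Prod>i<Suc n. 1 + c i) \<le> exp (a * S)" .
  qed (use lin_nonneg r e0 b0 in auto)
  finally show "(\<Prod>j\<le>n. 1 + Q * \<xi> j) \<le> exp (a * S) * fst (lin r (Q * \<theta> * (1 + b)) (Suc n))"
    by (simp only: prod)
  have "(1 - a * S) * fst (lin r (Q * \<theta> * (1 - b)) (Suc n)) \<le> (\<Prod>i<Suc n. 1 - c i) * fst (lin r (Q * \<theta> * (1 - b)) (Suc n))"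
  proof (rule mult_right_mono)
    have "1 - (\<Sum>i<Suc n. c i) \<le> (\<Prod>i<Suc n. 1 - c i)"
      by (rule one_minus_sum_le_prod) (use c0 c1 in auto)
    then show "1 - a * S \<le> (\<Prod>i<Suc n. 1 - c i)" using sumc_le by linarith
    show "0 \<le> fst (lin r (Q * \<theta> * (1 - b)) (Suc n))"
      using lin_nonneg[of r "Q * \<theta> * (1 - b)" "Suc n"] r e0 b by simp
  qed
  also have "\<dots> \<le> y (Suc n)"
  proof (rule conjunct1[OF lin_lower[where n = "Suc n" and D = D]])
    show "Q * \<theta> * (1 - b) \<le> D 0" using mult_nonneg_nonneg[OF e0 b0] by (simp add: D00 right_diff_distrib)
    show "(1 - c j) * (r * D j) + Q * \<theta> * (1 - b) * y j \<le> D (Suc j)" if "j < Suc n" for j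
      using step[of j] that by (simp add: algebra_simps abs_le_iff)
  qed (use c0 c1 yS r e0 b in \<open>auto simp: y_def\<close>)
  finally show "(1 - a * S) * fst (lin r (Q * \<theta> * (1 - b)) (Suc n)) \<le> (\<Prod>j\<le>n. 1 + Q * \<xi> j)"
    by (simp only: prod)
qed

text \<open>The product is squeezed between solutions of the linear recursion with parameters Q
  \<theta> (1 - b) and Q \<theta> (1 + b), which is why \<open>exact\<close> is demanded for every
  null sequence. Replacing ln (1 + Q \<xi>) by Q \<xi> costs at most (Q \<xi>)^2 per factor, in
  total at most Q^2 h S.\<close>

lemma riccati_limit:
  fixes \<xi> :: "nat \<Rightarrow> nat \<Rightarrow> real" and n :: "nat \<Rightarrow> nat" and r Q \<theta> h :: "nat \<Rightarrow> real"
  assumes xi: "\<And>k j. 0 \<le> \<xi> k j" "\<And>k. \<xi> k 0 = \<theta> k" "\<And>k j. j \<le> n k \<Longrightarrow> \<xi> k j \<le> h k"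
    and rec: "\<And>k j. \<bar>\<xi> k (Suc j) - r k * \<xi> k j - \<theta> k + Q k * (\<xi> k j)\<^sup>2\<bar> \<le> K * (\<theta> k * \<xi> k j + \<xi> k j ^ 3)"
    and Q: "\<And>k. 0 \<le> Q k" "Q \<longlonglongrightarrow> Q'" and K: "0 \<le> K" and r: "r \<longlonglongrightarrow> 1" and h: "h \<longlonglongrightarrow> 0"
    and S: "\<And>k. (\<Sum>j\<le>n k. \<xi> k j) \<le> S"
    and exact: "\<And>b. b \<longlonglongrightarrow> 0 \<Longrightarrow> (\<lambda>k. fst (lin (r k) (Q k * \<theta> k * (1 + b k)) (Suc (n k)))) \<longlonglongrightarrow> Y"
    and Y: "0 < Y"
  shows "(\<lambda>k. Q k * (\<Sum>j\<le>n k. \<xi> k j)) \<longlonglongrightarrow> ln Y"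
proof -
  define b where "b = (\<lambda>k. Q k * h k + K * h k * (1 + Q k))"
  define a where "a = (\<lambda>k. 2 * (Q k * \<bar>r k - 1\<bar> + (Q k)\<^sup>2 * h k + K * h k * (1 + Q k)))"
  have h0: "0 \<le> h k" for k using xi(1)[of k 0] xi(3)[of 0 k] by linarith
  have "b \<longlonglongrightarrow> Q' * 0 + K * 0 * (1 + Q')"
    unfolding b_def by (intro tendsto_intros Q h)
  then have b: "b \<longlonglongrightarrow> 0" by simp
  have "a \<longlonglongrightarrow> 2 * (Q' * \<bar>1 - 1\<bar> + Q'\<^sup>2 * 0 + K * 0 * (1 + Q'))"
    unfolding a_def by (intro tendsto_intros Q h r)
  then have a: "a \<longlonglongrightarrow> 0" by simp
  have aS: "(\<lambda>k. a k * S) \<longlonglongrightarrow> 0" using tendsto_mult_right[OF a, of S] by simp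
  have ev: "\<forall>\<^sub>F k in sequentially. b k < 1 \<and> a k * S < 1 \<and> h k < 1 \<and> 1 / 2 < r k"
    using order_tendstoD(2)[OF b, of 1] order_tendstoD(2)[OF aS, of 1] order_tendstoD(2)[OF h, of 1]
      order_tendstoD(1)[OF r, of "1/2"] by (simp add: eventually_conj_iff)
  define P where "P = (\<lambda>k. \<Prod>j\<le>n k. 1 + Q k * \<xi> k j)"
  have P: "P \<longlonglongrightarrow> Y"
  proof (rule tendsto_sandwich)
    show "\<forall>\<^sub>F k in sequentially. (1 - a k * S) * fst (lin (r k) (Q k * \<theta> k * (1 + - b k)) (Suc (n k))) \<le> P k"
      using ev
    proof eventually_elim
      case (elim k)
      have "(1 - a k * S) * fst (lin (r k) (Q k * \<theta> k * (1 - b k)) (Suc (n k))) \<le> P k"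
        unfolding P_def a_def b_def
        by (rule riccati_compare(2)[where h = "h k"])
          (use xi rec Q K S h0 elim in \<open>auto simp: a_def b_def\<close>)
      then show ?case by simp
    qed
    show "\<forall>\<^sub>F k in sequentially. P k \<le> exp (a k * S) * fst (lin (r k) (Q k * \<theta> k * (1 + b k)) (Suc (n k)))"
      using ev
    proof eventually_elim
      case (elim k)
      show ?case
        unfolding P_def a_def b_def
        by (rule riccati_compare(1)[where h = "h k"])
          (use xi rec Q K S h0 elim in \<open>auto simp: a_def b_def\<close>)
    qed
    have nb: "(\<lambda>k. - b k) \<longlonglongrightarrow> 0" using tendsto_minus[OF b] by simp
    have "(\<lambda>k. (1 - a k * S) * fst (lin (r k) (Q k * \<theta> k * (1 + - b k)) (Suc (n k)))) \<longlonglongrightarrow> (1 - 0) * Y"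
      by (intro tendsto_intros aS exact nb)
    then show "(\<lambda>k. (1 - a k * S) * fst (lin (r k) (Q k * \<theta> k * (1 + - b k)) (Suc (n k)))) \<longlonglongrightarrow> Y" by simp
    have "(\<lambda>k. exp (a k * S) * fst (lin (r k) (Q k * \<theta> k * (1 + b k)) (Suc (n k)))) \<longlonglongrightarrow> exp 0 * Y"
      by (intro tendsto_intros aS exact b)
    then show "(\<lambda>k. exp (a k * S) * fst (lin (r k) (Q k * \<theta> k * (1 + b k)) (Suc (n k)))) \<longlonglongrightarrow> Y" by simp
  qed
  have lnP: "(\<lambda>k. ln (P k)) \<longlonglongrightarrow> ln Y" by (rule tendsto_ln[OF P]) (use Y in simp)
  have Qh: "(\<lambda>k. Q k * h k) \<longlonglongrightarrow> 0" using tendsto_mult[OF Q(2) h] by simp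
  have "(\<lambda>k. Q k * (\<Sum>j\<le>n k. \<xi> k j) - ln (P k)) \<longlonglongrightarrow> 0"
  proof (rule Lim_null_comparison)
    have "(\<lambda>k. (Q k)\<^sup>2 * h k * S) \<longlonglongrightarrow> Q'\<^sup>2 * 0 * S" by (intro tendsto_intros Q h)
    then show "(\<lambda>k. (Q k)\<^sup>2 * h k * S) \<longlonglongrightarrow> 0" by simp
    show "\<forall>\<^sub>F k in sequentially. norm (Q k * (\<Sum>j\<le>n k. \<xi> k j) - ln (P k)) \<le> (Q k)\<^sup>2 * h k * S"
      using order_tendstoD(2)[OF Qh zero_less_one]
    proof eventually_elim
      case (elim k)
      have q: "0 \<le> Q k * \<xi> k j" "Q k * \<xi> k j \<le> 1" if "j \<le> n k" for j
        using Q(1)[of k] xi(1)[of k j] mult_left_mono[OF xi(3)[OF that] Q(1)[of k]] elim by (auto intro: mult_nonneg_nonneg)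
      have lnP: "ln (P k) = (\<Sum>j\<le>n k. ln (1 + Q k * \<xi> k j))"
        unfolding P_def
      proof (rule ln_prod)
        fix j assume "j \<in> {..n k}"
        then show "1 + Q k * \<xi> k j \<noteq> 0" using q(1)[of j] by simp
      qed simp
      have "Q k * (\<Sum>j\<le>n k. \<xi> k j) - ln (P k) = (\<Sum>j\<le>n k. Q k * \<xi> k j - ln (1 + Q k * \<xi> k j))"
        unfolding lnP by (simp add: sum_subtractf sum_distrib_left)
      also have "norm \<dots> \<le> (\<Sum>j\<le>n k. (Q k)\<^sup>2 * h k * \<xi> k j)"
        unfolding real_norm_def
      proof (rule order_trans[OF sum_abs], rule sum_mono)
        fix j assume "j \<in> {..n k}"
        then have j: "j \<le> n k" by simp
        have "\<bar>Q k * \<xi> k j - ln (1 + Q k * \<xi> k j)\<bar> \<le> (Q k * \<xi> k j)\<^sup>2"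
          using ln_one_plus_pos_lower_bound[OF q[OF j]] ln_add_one_self_le_self[OF q(1)[OF j]] by simp
        also have "\<dots> = (Q k)\<^sup>2 * \<xi> k j * \<xi> k j" by (simp add: power2_eq_square)
        also have "\<dots> \<le> (Q k)\<^sup>2 * h k * \<xi> k j"
          using xi(1)[of k j] xi(3)[OF j] by (intro mult_right_mono mult_left_mono) auto
        finally show "\<bar>Q k * \<xi> k j - ln (1 + Q k * \<xi> k j)\<bar> \<le> (Q k)\<^sup>2 * h k * \<xi> k j" .
      qed
      also have "\<dots> = (Q k)\<^sup>2 * h k * (\<Sum>j\<le>n k. \<xi> k j)" by (simp add: sum_distrib_left)
      also have "\<dots> \<le> (Q k)\<^sup>2 * h k * S" using h0 S by (intro mult_left_mono) auto
      finally show ?case .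
    qed
  qed
  from tendsto_add[OF this lnP] show ?thesis by simp
qed

section \<open>Limits of the linear recursion in the three regimes\<close>

lemma power_tendsto_exp:
  fixes x :: "nat \<Rightarrow> real" and n :: "nat \<Rightarrow> nat"
  assumes n: "filterlim n at_top sequentially" and x: "(\<lambda>k. real (n k) * x k) \<longlonglongrightarrow> \<nu>"
  shows "(\<lambda>k. (1 + x k) ^ (n k + c)) \<longlonglongrightarrow> exp \<nu>"
proof -
  have nr: "filterlim (\<lambda>k. real (n k)) at_top sequentially"
    using n by (rule filterlim_compose[OF filterlim_real_sequentially])
  have "(\<lambda>k. inverse (real (n k)) * (real (n k) * x k)) \<longlonglongrightarrow> 0 * \<nu>"
    by (intro tendsto_mult x tendsto_inverse_0_at_top nr)
  moreover have "\<forall>\<^sub>F k in sequentially. inverse (real (n k)) * (real (n k) * x k) = x k"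
    using filterlim_at_top_dense[THEN iffD1, OF nr, rule_format, of 0] by eventually_elim simp
  ultimately have x0: "x \<longlonglongrightarrow> 0" by (simp add: tendsto_cong)
  have "(\<lambda>k. real (n k) * x k + real c * x k) \<longlonglongrightarrow> \<nu> + real c * 0"
    by (intro tendsto_intros x x0)
  then have ncx: "(\<lambda>k. real (n k + c) * x k) \<longlonglongrightarrow> \<nu>" by (simp add: distrib_right)
  have xa: "(\<lambda>k. \<bar>x k\<bar>) \<longlonglongrightarrow> 0" using tendsto_rabs[OF x0] by simp
  have "(\<lambda>k. real (n k + c) * ln (1 + x k) - real (n k + c) * x k) \<longlonglongrightarrow> 0"
  proof (rule Lim_null_comparison)
    have "(\<lambda>k. 2 * (\<bar>real (n k + c) * x k\<bar> * \<bar>x k\<bar>)) \<longlonglongrightarrow> 2 * (\<bar>\<nu>\<bar> * 0)"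
      by (intro tendsto_intros ncx xa)
    then show "(\<lambda>k. 2 * (\<bar>real (n k + c) * x k\<bar> * \<bar>x k\<bar>)) \<longlonglongrightarrow> 0" by simp
    show "\<forall>\<^sub>F k in sequentially. norm (real (n k + c) * ln (1 + x k) - real (n k + c) * x k)
        \<le> 2 * (\<bar>real (n k + c) * x k\<bar> * \<bar>x k\<bar>)"
      using order_tendstoD(2)[OF xa, of "1/2", simplified]
    proof eventually_elim
      case (elim k)
      have "norm (real (n k + c) * ln (1 + x k) - real (n k + c) * x k) = real (n k + c) * \<bar>ln (1 + x k) - x k\<bar>"
        by (simp add: right_diff_distrib[symmetric] abs_mult del: of_nat_add)
      also have "\<dots> \<le> real (n k + c) * (2 * (x k)\<^sup>2)"
        using elim by (intro mult_left_mono abs_ln_one_plus_x_minus_x_bound) auto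
      finally show ?case by (simp add: abs_mult power2_eq_square mult_ac)
    qed
  qed
  from tendsto_add[OF this ncx] have "(\<lambda>k. exp (real (n k + c) * ln (1 + x k))) \<longlonglongrightarrow> exp \<nu>"
    by (intro tendsto_exp) simp
  moreover have "\<forall>\<^sub>F k in sequentially. exp (real (n k + c) * ln (1 + x k)) = (1 + x k) ^ (n k + c)"
    using order_tendstoD(2)[OF xa, of "1/2", simplified]
  proof eventually_elim
    case (elim k)
    then have "0 < 1 + x k" by linarith
    then show ?case by (simp only: exp_of_nat_mult exp_ln)
  qed
  ultimately show ?thesis by (simp only: tendsto_cong)
qed

lemma lin_fst:
  assumes s: "s > 0" "s\<^sup>2 = (r - 1)\<^sup>2 + 4 * e"
  shows "fst (lin r e (Suc j)) = (r - 1 + s) / 2 / s * (1 + (r - 1 - s) / 2) ^ (j + 2)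
    - (r - 1 - s) / 2 / s * (1 + (r - 1 + s) / 2) ^ (j + 2)"
proof -
  have "(p * M - m * P) / s = p / s * M - m / s * P" for p m M P :: real
    by (simp add: diff_divide_distrib)
  then show ?thesis unfolding lin_closed_form[OF s] fst_conv add_2_eq_Suc' .
qed

text \<open>Both shifted roots are of order 1/n, so their powers tend to exponentials. The
  coefficients are quotients of roots by their difference; multiplying numerator and denominator by
  n makes both converge.\<close>

lemma lin_limit_critical:
  fixes r e :: "nat \<Rightarrow> real" and n :: "nat \<Rightarrow> nat"
  assumes n: "filterlim n at_top sequentially"
    and r: "(\<lambda>k. real (n k) * (r k - 1)) \<longlonglongrightarrow> l"
    and e: "(\<lambda>k. (real (n k))\<^sup>2 * e k) \<longlonglongrightarrow> E"
    and s: "s > 0" "s\<^sup>2 = l\<^sup>2 + 4 * E"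
  shows "(\<lambda>k. fst (lin (r k) (e k) (Suc (n k)))) \<longlonglongrightarrow>
    ((l + s) / 2 / s) * exp ((l - s) / 2) - ((l - s) / 2 / s) * exp ((l + s) / 2)"
proof -
  define \<Delta> where "\<Delta> = (\<lambda>k. (r k - 1)\<^sup>2 + 4 * e k)"
  define \<sigma> where "\<sigma> = (\<lambda>k. sqrt (\<Delta> k))"
  have n2D: "(\<lambda>k. (real (n k))\<^sup>2 * \<Delta> k) \<longlonglongrightarrow> s\<^sup>2"
  proof -
    have "(\<lambda>k. (real (n k) * (r k - 1))\<^sup>2 + 4 * ((real (n k))\<^sup>2 * e k)) \<longlonglongrightarrow> l\<^sup>2 + 4 * E"
      by (intro tendsto_intros r e)
    moreover have "(real (n k) * (r k - 1))\<^sup>2 + 4 * ((real (n k))\<^sup>2 * e k) = (real (n k))\<^sup>2 * \<Delta> k" for k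
      by (simp add: \<Delta>_def power_mult_distrib distrib_left)
    ultimately show ?thesis by (simp add: s(2))
  qed
  have "(\<lambda>k. sqrt ((real (n k))\<^sup>2 * \<Delta> k)) \<longlonglongrightarrow> sqrt (s\<^sup>2)" by (intro tendsto_intros n2D)
  then have ns: "(\<lambda>k. real (n k) * \<sigma> k) \<longlonglongrightarrow> s"
    using s(1) by (simp only: \<sigma>_def real_sqrt_mult real_sqrt_abs abs_of_nat abs_of_pos)
  have "(\<lambda>k. (real (n k) * (r k - 1) + real (n k) * \<sigma> k) / 2) \<longlonglongrightarrow> (l + s) / 2"
    by (intro tendsto_intros r ns) simp
  then have p: "(\<lambda>k. real (n k) * ((r k - 1 + \<sigma> k) / 2)) \<longlonglongrightarrow> (l + s) / 2"
    by (simp add: algebra_simps)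
  have "(\<lambda>k. (real (n k) * (r k - 1) - real (n k) * \<sigma> k) / 2) \<longlonglongrightarrow> (l - s) / 2"
    by (intro tendsto_intros r ns) simp
  then have m: "(\<lambda>k. real (n k) * ((r k - 1 - \<sigma> k) / 2)) \<longlonglongrightarrow> (l - s) / 2"
    by (simp add: algebra_simps)
  have lim: "(\<lambda>k. real (n k) * ((r k - 1 + \<sigma> k) / 2) / (real (n k) * \<sigma> k) * (1 + (r k - 1 - \<sigma> k) / 2) ^ (n k + 2)
      - real (n k) * ((r k - 1 - \<sigma> k) / 2) / (real (n k) * \<sigma> k) * (1 + (r k - 1 + \<sigma> k) / 2) ^ (n k + 2))
    \<longlonglongrightarrow> ((l + s) / 2 / s) * exp ((l - s) / 2) - ((l - s) / 2 / s) * exp ((l + s) / 2)"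
    by (intro tendsto_intros power_tendsto_exp[OF n] p m ns) (use s in auto)
  have ev: "\<forall>\<^sub>F k in sequentially. 0 < real (n k) * \<sigma> k"
    using order_tendstoD(1)[OF ns s(1)] .
  show ?thesis
  proof (rule Lim_transform_eventually[OF lim])
    show "\<forall>\<^sub>F k in sequentially. real (n k) * ((r k - 1 + \<sigma> k) / 2) / (real (n k) * \<sigma> k) * (1 + (r k - 1 - \<sigma> k) / 2) ^ (n k + 2)
      - real (n k) * ((r k - 1 - \<sigma> k) / 2) / (real (n k) * \<sigma> k) * (1 + (r k - 1 + \<sigma> k) / 2) ^ (n k + 2)
      = fst (lin (r k) (e k) (Suc (n k)))"
      using ev
    proof eventually_elim
      case (elim k)
      then have nk: "real (n k) \<noteq> 0" and sg: "0 < \<sigma> k" by (auto simp: zero_less_mult_iff)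
      have "\<Delta> k > 0" using sg by (simp add: \<sigma>_def)
      then have "(\<sigma> k)\<^sup>2 = (r k - 1)\<^sup>2 + 4 * e k" by (simp add: \<sigma>_def \<Delta>_def)
      from lin_fst[OF sg this, of "n k"] show ?case
        by (simp only: mult_divide_mult_cancel_left[OF nk])
    qed
  qed
qed

text \<open>Rationalisation: it expresses z - 1 through y without cancellation, as is needed when z
  tends to 1.\<close>

lemma sqrt_one_plus_identity:
  assumes "0 \<le> y"
  shows "(sqrt (1 + 4 * y) - 1) * (sqrt (1 + 4 * y) + 1) = 4 * y"
proof -
  have "(sqrt (1 + 4 * y) - 1) * (sqrt (1 + 4 * y) + 1) = (sqrt (1 + 4 * y))\<^sup>2 - 1"
    by (simp add: algebra_simps power2_eq_square)
  then show ?thesis using assms by simp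
qed

text \<open>With \<epsilon> = 1 - r, the quotient Y = e / \<epsilon>^2 tends to 0 and hence z to 1.
  The larger shifted root p is then about e / \<epsilon>, and n p tends to \<open>E\<close>. The
  other mode has a base of modulus at most 1 and a coefficient (z - 1) / (2 z) tending to 0.\<close>

lemma lin_limit_subcritical:
  fixes r e :: "nat \<Rightarrow> real" and n :: "nat \<Rightarrow> nat"
  assumes n: "filterlim n at_top sequentially" and r: "r \<longlonglongrightarrow> 1" "\<And>k. r k < 1"
    and nr: "filterlim (\<lambda>k. real (n k) * (1 - r k)) at_top sequentially"
    and e: "\<forall>\<^sub>F k in sequentially. 0 \<le> e k" "(\<lambda>k. real (n k) / (1 - r k) * e k) \<longlonglongrightarrow> E"
  shows "(\<lambda>k. fst (lin (r k) (e k) (Suc (n k)))) \<longlonglongrightarrow> exp E"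
proof -
  define \<epsilon> where "\<epsilon> = (\<lambda>k. 1 - r k)"
  have eps: "\<epsilon> k > 0" for k using r(2)[of k] by (simp add: \<epsilon>_def)
  have re: "1 - r k = \<epsilon> k" for k by (simp add: \<epsilon>_def)
  define Y where "Y = (\<lambda>k. e k / (\<epsilon> k)\<^sup>2)"
  define z where "z = (\<lambda>k. sqrt (1 + 4 * Y k))"
  have n0: "\<forall>\<^sub>F k in sequentially. 0 < n k"
    using n[unfolded filterlim_at_top, rule_format, of 1] by eventually_elim simp
  have "(\<lambda>k. (real (n k) / (1 - r k) * e k) * inverse (real (n k) * (1 - r k))) \<longlonglongrightarrow> E * 0"
    by (intro tendsto_mult e tendsto_inverse_0_at_top nr)
  moreover have "\<forall>\<^sub>F k in sequentially. (real (n k) / (1 - r k) * e k) * inverse (real (n k) * (1 - r k)) = Y k"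
    using n0
  proof eventually_elim
    case (elim k)
    then show ?case
      using eps[of k] unfolding Y_def re by (simp add: field_simps power2_eq_square)
  qed
  ultimately have Y: "Y \<longlonglongrightarrow> 0" by (auto dest: Lim_transform_eventually)
  have "z \<longlonglongrightarrow> sqrt (1 + 4 * 0)" unfolding z_def by (intro tendsto_intros Y)
  then have z: "z \<longlonglongrightarrow> 1" by simp
  have evY: "\<forall>\<^sub>F k in sequentially. 0 \<le> Y k"
    using e(1) by eventually_elim (simp add: Y_def)
  define p where "p = (\<lambda>k. \<epsilon> k * (z k - 1) / 2)"
  have "(\<lambda>k. 2 * (real (n k) / (1 - r k) * e k) / (z k + 1)) \<longlonglongrightarrow> 2 * E / (1 + 1)"
    by (intro tendsto_intros e z) simp
  moreover have "\<forall>\<^sub>F k in sequentially. 2 * (real (n k) / (1 - r k) * e k) / (z k + 1) = real (n k) * p k"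
    using evY
  proof eventually_elim
    fix k assume Y: "0 \<le> Y k"
    have zp: "z k + 1 \<noteq> 0" using Y by (simp add: z_def add_nonneg_eq_0_iff)
    have "(z k - 1) * (z k + 1) = 4 * Y k" unfolding z_def by (rule sqrt_one_plus_identity[OF Y])
    then have z1: "z k - 1 = 4 * Y k / (z k + 1)" using zp by (simp add: field_simps)
    show "2 * (real (n k) / (1 - r k) * e k) / (z k + 1) = real (n k) * p k"
      using eps[of k] zp unfolding p_def z1 re by (simp add: Y_def power2_eq_square)
  qed
  ultimately have np: "(\<lambda>k. real (n k) * p k) \<longlonglongrightarrow> E" by (auto dest: Lim_transform_eventually)
  have lim: "(\<lambda>k. (1 + z k) / (2 * z k) * (1 + p k) ^ (n k + 2)) \<longlonglongrightarrow> (1 + 1) / (2 * 1) * exp E"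
    by (intro tendsto_intros z power_tendsto_exp[OF n np]) auto
  have small: "(\<lambda>k. (z k - 1) / (2 * z k) * (1 - \<epsilon> k * (z k + 1) / 2) ^ (n k + 2)) \<longlonglongrightarrow> 0"
  proof (rule Lim_null_comparison)
    have "(\<lambda>k. \<bar>(z k - 1) / (2 * z k)\<bar>) \<longlonglongrightarrow> \<bar>(1 - 1) / (2 * 1)\<bar>"
      by (intro tendsto_intros z) auto
    then show "(\<lambda>k. \<bar>(z k - 1) / (2 * z k)\<bar>) \<longlonglongrightarrow> 0" by simp
    show "\<forall>\<^sub>F k in sequentially. norm ((z k - 1) / (2 * z k) * (1 - \<epsilon> k * (z k + 1) / 2) ^ (n k + 2)) \<le> \<bar>(z k - 1) / (2 * z k)\<bar>"
      using evY order_tendstoD(2)[OF z, of 2, simplified] order_tendstoD(1)[OF r(1), of 0, simplified]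
    proof eventually_elim
      case (elim k)
      have "0 \<le> \<epsilon> k * (z k + 1)" using elim eps[of k] by (simp add: z_def)
      moreover have "\<epsilon> k * (z k + 1) \<le> 1 * 3" using elim eps[of k] by (intro mult_mono) (auto simp: \<epsilon>_def z_def)
      ultimately have "\<bar>1 - \<epsilon> k * (z k + 1) / 2\<bar> \<le> 1" by linarith
      then have "\<bar>1 - \<epsilon> k * (z k + 1) / 2\<bar> ^ (n k + 2) \<le> 1" by (intro power_le_one) auto
      then show ?case by (simp only: real_norm_def abs_mult power_abs) (rule mult_left_le; simp)
    qed
  qed
  have "(\<lambda>k. (z k - 1) / (2 * z k) * (1 - \<epsilon> k * (z k + 1) / 2) ^ (n k + 2)
      + (1 + z k) / (2 * z k) * (1 + p k) ^ (n k + 2)) \<longlonglongrightarrow> exp E"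
    using tendsto_add[OF small lim] by simp
  then show ?thesis
  proof (rule Lim_transform_eventually)
    show "\<forall>\<^sub>F k in sequentially. (z k - 1) / (2 * z k) * (1 - \<epsilon> k * (z k + 1) / 2) ^ (n k + 2)
      + (1 + z k) / (2 * z k) * (1 + p k) ^ (n k + 2) = fst (lin (r k) (e k) (Suc (n k)))"
      using evY
    proof eventually_elim
      fix k assume Y: "0 \<le> Y k"
      define s where "s = \<epsilon> k * z k"
      have z1: "z k > 0" using Y by (simp add: z_def)
      have s: "s > 0" using z1 eps[of k] by (simp add: s_def)
      have "s\<^sup>2 = (r k - 1)\<^sup>2 + 4 * e k"
      proof -
        have "s\<^sup>2 = (\<epsilon> k)\<^sup>2 * (1 + 4 * Y k)" using Y by (simp add: s_def power_mult_distrib z_def)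
        also have "\<dots> = (\<epsilon> k)\<^sup>2 + 4 * e k" using eps[of k] by (simp add: Y_def algebra_simps)
        finally show ?thesis by (simp add: \<epsilon>_def power2_commute)
      qed
      note f = lin_fst[OF s this, of "n k"]
      have r1: "r k - 1 = - \<epsilon> k" by (simp add: \<epsilon>_def)
      have 1: "(r k - 1 + s) / 2 / s = (z k - 1) / (2 * z k)"
        using eps[of k] z1 unfolding r1 s_def by (simp add: field_simps)
      have 2: "(r k - 1 - s) / 2 / s = - ((1 + z k) / (2 * z k))"
        using eps[of k] z1 unfolding r1 s_def by (simp add: field_simps)
      have 3: "1 + (r k - 1 - s) / 2 = 1 - \<epsilon> k * (z k + 1) / 2"
        unfolding r1 s_def by (simp add: field_simps)
      have 4: "1 + (r k - 1 + s) / 2 = 1 + p k"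
        unfolding r1 s_def p_def by (simp add: field_simps)
      show "(z k - 1) / (2 * z k) * (1 - \<epsilon> k * (z k + 1) / 2) ^ (n k + 2)
        + (1 + z k) / (2 * z k) * (1 + p k) ^ (n k + 2) = fst (lin (r k) (e k) (Suc (n k)))"
        unfolding f 1 2 3 4 by simp
    qed
  qed
qed

text \<open>Bernoulli's inequality gives only linear growth of the power, but applied to half the
  exponent and squared it yields r^n >= (n (r - 1))^2 / 4.\<close>

lemma mult_inverse_power_tendsto_0:
  fixes r :: "nat \<Rightarrow> real" and n :: "nat \<Rightarrow> nat"
  assumes r: "r \<longlonglongrightarrow> 1" "\<And>k. 1 < r k"
    and nr: "filterlim (\<lambda>k. real (n k) * (r k - 1)) at_top sequentially"
  shows "(\<lambda>k. real (n k) * (r k - 1) / r k ^ n k) \<longlonglongrightarrow> 0"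
proof (rule Lim_null_comparison)
  show "(\<lambda>k. 8 * inverse (real (n k) * (r k - 1))) \<longlonglongrightarrow> 0"
    using tendsto_mult_left[OF tendsto_inverse_0_at_top[OF nr], of 8] by simp
  have "\<forall>\<^sub>F k in sequentially. 2 < real (n k) * (r k - 1)"
    using nr by (simp add: filterlim_at_top_dense)
  then show "\<forall>\<^sub>F k in sequentially. norm (real (n k) * (r k - 1) / r k ^ n k) \<le> 8 * inverse (real (n k) * (r k - 1))"
    using order_tendstoD(2)[OF r(1), of 2, simplified]
  proof eventually_elim
    case (elim k)
    define y where "y = real (n k) * (r k - 1)"
    define m where "m = n k div 2"
    have y: "y > 2" using elim by (simp add: y_def)
    have r1: "r k - 1 > 0" "r k - 1 < 1" using r(2)[of k] elim by auto
    have "1 + real m * (r k - 1) \<le> (1 + (r k - 1)) ^ m"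
      by (rule Bernoulli_inequality) (use r1 in auto)
    moreover have "y / 2 \<le> 1 + real m * (r k - 1)"
    proof -
      have "real (n k) \<le> 2 * real m + 1" unfolding m_def by linarith
      then have "y \<le> (2 * real m + 1) * (r k - 1)" unfolding y_def using r1 by (intro mult_right_mono) auto
      then show ?thesis using r1 by (simp add: distrib_right)
    qed
    ultimately have "(y / 2)\<^sup>2 \<le> (r k ^ m)\<^sup>2" using y by (intro power_mono) auto
    also have "\<dots> \<le> r k ^ n k"
      unfolding power_mult[symmetric] using r1 by (intro power_increasing) (auto simp: m_def)
    finally have "y\<^sup>2 \<le> 4 * r k ^ n k" by (simp add: power_divide)
    moreover have "0 < r k ^ n k" using r1 by simp
    ultimately have "y / r k ^ n k \<le> 8 * inverse y"
      using y by (simp add: field_simps power2_eq_square)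
    then show ?case using y \<open>0 < r k ^ n k\<close> by (simp add: y_def[symmetric])
  qed
qed

text \<open>The growing mode has a coefficient of order Y = e / (r - 1)^2, which exactly offsets r^n
  and leaves \<open>E\<close>; the other mode contributes 1. The roots differ from r - 1 and 0 by q,
  and their n-th powers are unaffected because n q is of order n (r - 1) Y, a null sequence by
  \<open>mult_inverse_power_tendsto_0\<close>.\<close>

lemma lin_limit_supercritical:
  fixes r e :: "nat \<Rightarrow> real" and n :: "nat \<Rightarrow> nat"
  assumes n: "filterlim n at_top sequentially" and r: "r \<longlonglongrightarrow> 1" "\<And>k. 1 < r k"
    and nr: "filterlim (\<lambda>k. real (n k) * (r k - 1)) at_top sequentially"
    and e: "\<forall>\<^sub>F k in sequentially. 0 \<le> e k" "(\<lambda>k. r k ^ n k / (r k - 1)\<^sup>2 * e k) \<longlonglongrightarrow> E"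
  shows "(\<lambda>k. fst (lin (r k) (e k) (Suc (n k)))) \<longlonglongrightarrow> 1 + E"
proof -
  define \<epsilon> where "\<epsilon> = (\<lambda>k. r k - 1)"
  have eps: "\<epsilon> k > 0" for k using r(2)[of k] by (simp add: \<epsilon>_def)
  have re: "r k - 1 = \<epsilon> k" for k by (simp add: \<epsilon>_def)
  have rn: "r k ^ n k > 0" for k using r(2)[of k] by simp
  define Y where "Y = (\<lambda>k. e k / (\<epsilon> k)\<^sup>2)"
  define z where "z = (\<lambda>k. sqrt (1 + 4 * Y k))"
  have YE: "(\<lambda>k. r k ^ n k * Y k) \<longlonglongrightarrow> E" using e(2) by (simp add: Y_def \<epsilon>_def)
  note small = mult_inverse_power_tendsto_0[OF r nr]
  have "(\<lambda>k. (r k ^ n k * Y k) * (real (n k) * (r k - 1) / r k ^ n k)) \<longlonglongrightarrow> E * 0"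
    by (intro tendsto_mult YE small)
  moreover have "(r k ^ n k * Y k) * (real (n k) * (r k - 1) / r k ^ n k) = real (n k) * \<epsilon> k * Y k" for k
    using rn[of k] r(2)[of k] by (simp add: \<epsilon>_def)
  ultimately have nY: "(\<lambda>k. real (n k) * \<epsilon> k * Y k) \<longlonglongrightarrow> 0" by simp
  have "(\<lambda>k. (real (n k) * \<epsilon> k * Y k) * inverse (real (n k) * (r k - 1))) \<longlonglongrightarrow> 0 * 0"
    by (intro tendsto_mult nY tendsto_inverse_0_at_top nr)
  note nY0 = this
  have n0: "\<forall>\<^sub>F k in sequentially. 0 < n k"
    using n[unfolded filterlim_at_top, rule_format, of 1] by eventually_elim simp
  have "\<forall>\<^sub>F k in sequentially. (real (n k) * \<epsilon> k * Y k) * inverse (real (n k) * (r k - 1)) = Y k"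
    using n0
  proof eventually_elim
    case (elim k)
    then show ?case using eps[of k] unfolding re by (simp add: field_simps)
  qed
  from Lim_transform_eventually[OF nY0 this] have Y: "Y \<longlonglongrightarrow> 0" by simp
  have "z \<longlonglongrightarrow> sqrt (1 + 4 * 0)" unfolding z_def by (intro tendsto_intros Y)
  then have z: "z \<longlonglongrightarrow> 1" by simp
  have evY: "\<forall>\<^sub>F k in sequentially. 0 \<le> Y k"
    using e(1) by eventually_elim (simp add: Y_def)
  have id: "z k - 1 = 4 * Y k / (z k + 1)" "z k + 1 > 0" if "0 \<le> Y k" for k
  proof -
    show zp: "z k + 1 > 0" using that by (simp add: z_def add_nonneg_pos)
    have "(z k - 1) * (z k + 1) = 4 * Y k" unfolding z_def by (rule sqrt_one_plus_identity[OF that])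
    then show "z k - 1 = 4 * Y k / (z k + 1)" using zp by (simp add: field_simps)
  qed
  define q where "q = (\<lambda>k. \<epsilon> k * (z k - 1) / 2)"
  have nq: "(\<lambda>k. real (n k) * q k) \<longlonglongrightarrow> 0"
  proof (rule Lim_transform_eventually)
    have "(\<lambda>k. 2 * (real (n k) * \<epsilon> k * Y k) / (z k + 1)) \<longlonglongrightarrow> 2 * 0 / (1 + 1)"
      by (intro tendsto_intros nY z) simp
    then show "(\<lambda>k. 2 * (real (n k) * \<epsilon> k * Y k) / (z k + 1)) \<longlonglongrightarrow> 0" by simp
    show "\<forall>\<^sub>F k in sequentially. 2 * (real (n k) * \<epsilon> k * Y k) / (z k + 1) = real (n k) * q k"
      using evY
    proof eventually_elim
      case (elim k)
      have "2 * (N * \<eta> * y) / Z = N * (\<eta> * (4 * y / Z) / 2)" for N \<eta> y Z :: real by simp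
      then show ?case unfolding q_def id(1)[OF elim] .
    qed
  qed
  have nqr: "(\<lambda>k. real (n k) * (q k / r k)) \<longlonglongrightarrow> 0"
    using tendsto_divide[OF nq r(1)] by simp
  have nqm: "(\<lambda>k. real (n k) * - q k) \<longlonglongrightarrow> 0"
    using tendsto_minus[OF nq] by simp
  have lim: "(\<lambda>k. (z k + 1) / (2 * z k) * (1 + - q k) ^ (n k + 2)
      + 2 * (r k ^ n k * Y k) / ((z k + 1) * z k) * (r k)\<^sup>2 * (1 + q k / r k) ^ (n k + 2))
    \<longlonglongrightarrow> (1 + 1) / (2 * 1) * exp 0 + 2 * E / ((1 + 1) * 1) * 1\<^sup>2 * exp 0"
    by (intro tendsto_intros z power_tendsto_exp[OF n] nqr nqm YE r(1)) auto
  have "\<forall>\<^sub>F k in sequentially. (z k + 1) / (2 * z k) * (1 + - q k) ^ (n k + 2)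
      + 2 * (r k ^ n k * Y k) / ((z k + 1) * z k) * (r k)\<^sup>2 * (1 + q k / r k) ^ (n k + 2)
      = fst (lin (r k) (e k) (Suc (n k)))"
    using evY
  proof eventually_elim
    case (elim k)
    define s where "s = \<epsilon> k * z k"
    have z1: "z k > 0" using elim by (simp add: z_def)
    have s: "s > 0" using z1 eps[of k] by (simp add: s_def)
    have "s\<^sup>2 = (r k - 1)\<^sup>2 + 4 * e k"
    proof -
      have "s\<^sup>2 = (\<epsilon> k)\<^sup>2 * (1 + 4 * Y k)" using elim by (simp add: s_def power_mult_distrib z_def)
      also have "\<dots> = (\<epsilon> k)\<^sup>2 + 4 * e k" using eps[of k] by (simp add: Y_def algebra_simps)
      finally show ?thesis by (simp add: \<epsilon>_def)
    qed
    note f = lin_fst[OF s this, of "n k"]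
    have r1: "r k - 1 = \<epsilon> k" by (simp add: \<epsilon>_def)
    have 1: "(r k - 1 + s) / 2 / s = (z k + 1) / (2 * z k)"
      using eps[of k] z1 unfolding r1 s_def by (simp add: field_simps)
    have 2: "(r k - 1 - s) / 2 / s = - (2 * Y k / ((z k + 1) * z k))"
    proof -
      have "(r k - 1 - s) / 2 / s = - ((z k - 1) / (2 * z k))"
        using eps[of k] z1 unfolding r1 s_def by (simp add: field_simps)
      moreover have "4 * y / Z / (2 * x) = 2 * y / (Z * x)" for y Z x :: real by simp
      ultimately show ?thesis unfolding id(1)[OF elim] by (simp only:)
    qed
    have 3: "1 + (r k - 1 - s) / 2 = 1 + - q k"
      unfolding r1 s_def q_def by (simp add: field_simps)
    \<comment> \<open>Factoring out r leaves 1 + q / r, so close to 1 that its n-th power tends to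
      1.\<close>
    have 4: "1 + (r k - 1 + s) / 2 = r k * (1 + q k / r k)"
    proof -
      have rq: "r k * (1 + q k / r k) = r k + q k" using r(2)[of k] by (simp add: distrib_left)
      have "1 + (\<epsilon> k + \<epsilon> k * z k) / 2 = 1 + \<epsilon> k + \<epsilon> k * (z k - 1) / 2"
        by (simp add: field_simps)
      then show ?thesis unfolding rq unfolding r1 s_def q_def by (simp add: \<epsilon>_def)
    qed
    show ?case
      unfolding f 1 2 3 4 by (simp add: power_mult_distrib power_add power2_eq_square mult_ac)
  qed
  from Lim_transform_eventually[OF lim this] show ?thesis by simp
qed

section \<open>Uniform constants for the class of offspring laws\<close>

context near_critical
begin

lemma Q_nonneg: "0 \<le> Q"
  using b2_bounds u_nonneg v_nonneg by (auto simp: Q_def quad_def intro!: dot_nonneg sum_nonneg)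

lemma Q_le: "Q \<le> C / \<alpha> ^ 3"
proof -
  have u: "(\<Sum>l\<in>UNIV. \<bar>u l\<bar>) \<le> 1 / \<alpha>" using sum_u_le u_nonneg by simp
  have c: "C * (\<Sum>l\<in>UNIV. \<bar>u l\<bar>) * (\<Sum>l\<in>UNIV. \<bar>u l\<bar>) \<le> C * (1 / \<alpha>) * (1 / \<alpha>)"
    using u C_nonneg alpha by (intro mult_mono) (auto intro: sum_nonneg)
  have "quad (b2 k) u u \<le> C * (1 / \<alpha>) * (1 / \<alpha>)" for k
    using abs_quad_le[of k u u] c by linarith
  then have "dot v (\<lambda>k. quad (b2 k) u u) \<le> C * (1 / \<alpha>) * (1 / \<alpha>) / \<alpha>"
    using C_nonneg alpha by (intro dot_v_le) auto
  moreover have "0 \<le> C / \<alpha> ^ 3" using C_nonneg alpha by simp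
  moreover have "C * (1 / \<alpha>) * (1 / \<alpha>) / \<alpha> = C / \<alpha> ^ 3" by (simp add: power3_eq_cube)
  ultimately show ?thesis unfolding Q_def by linarith
qed

text \<open>This keeps \<open>Q\<close> away from 0 uniformly over the class, as the division by
  \<open>Q\<close> in the exponent of the limit requires.\<close>

lemma Q_ge:
  assumes "b \<le> (\<Sum>k\<in>UNIV. \<Sum>l\<in>UNIV. \<Sum>m\<in>UNIV. b2 k l m)"
  shows "\<alpha> ^ 3 * b / 2 \<le> Q"
proof -
  have "\<alpha>\<^sup>2 * (\<Sum>l\<in>UNIV. \<Sum>m\<in>UNIV. b2 k l m) \<le> quad (b2 k) u u" for k
  proof -
    have "\<alpha>\<^sup>2 * b2 k l m \<le> b2 k l m * u l * u m" for l m
    proof -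
      have "\<alpha> * \<alpha> \<le> u l * u m" using u_bounds alpha u_nonneg by (intro mult_mono) auto
      then have "b2 k l m * (\<alpha> * \<alpha>) \<le> b2 k l m * (u l * u m)" using b2_bounds by (intro mult_left_mono) auto
      then show ?thesis by (simp add: power2_eq_square mult_ac)
    qed
    then show ?thesis unfolding quad_def by (simp add: sum_distrib_left sum_mono)
  qed
  then have "\<alpha> * (\<alpha>\<^sup>2 * (\<Sum>l\<in>UNIV. \<Sum>m\<in>UNIV. b2 k l m)) \<le> v k * quad (b2 k) u u" for k
    using v_bounds alpha b2_bounds v_nonneg by (intro mult_mono) (auto intro!: mult_nonneg_nonneg sum_nonneg)
  then have "(\<Sum>k\<in>UNIV. \<alpha> * (\<alpha>\<^sup>2 * (\<Sum>l\<in>UNIV. \<Sum>m\<in>UNIV. b2 k l m))) \<le> 2 * Q"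
    unfolding Q_def dot_def by (simp add: sum_mono)
  moreover have "(\<Sum>k\<in>UNIV. \<alpha> * (\<alpha>\<^sup>2 * (\<Sum>l\<in>UNIV. \<Sum>m\<in>UNIV. b2 k l m)))
      = \<alpha> ^ 3 * (\<Sum>k\<in>UNIV. \<Sum>l\<in>UNIV. \<Sum>m\<in>UNIV. b2 k l m)"
    by (simp add: sum_distrib_left power3_eq_cube power2_eq_square mult_ac)
  moreover have "\<alpha> ^ 3 * b \<le> \<alpha> ^ 3 * (\<Sum>k\<in>UNIV. \<Sum>l\<in>UNIV. \<Sum>m\<in>UNIV. b2 k l m)"
    using assms alpha by (intro mult_left_mono) auto
  ultimately show ?thesis by linarith
qed

end

text \<open>To first order 1 - B(1 - x_j) is \<lambda>'u \<xi>_j. The errors are of size \<theta> +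
  \<xi>_j^2, the \<theta> stemming from the component off \<open>u\<close>; since \<xi>_j^2 <= h
  \<xi>_j, they sum to (n + 1) \<theta> + h S. The condition on \<open>h\<close> keeps every factor
  at least 1/2, where the logarithm is controlled.\<close>

lemma (in defect_recursion) product_estimate:
  assumes q: "moment_le q 2 D" and h: "\<And>j. j \<le> n \<Longrightarrow> \<xi> j \<le> h" "D * h / \<alpha> \<le> 1 / 2"
    and S: "(\<Sum>j\<le>n. \<xi> j) \<le> S"
  defines "L \<equiv> (\<Prod>j\<le>n. pgf q (\<lambda>i. 1 - x j i))"
    and "K2 \<equiv> D / \<alpha>\<^sup>2 + D * K1 * (1 + C / \<alpha> ^ 3) / \<alpha>"
  shows "0 < L"
    and "\<bar>ln L + dot (mean1 q) u * (\<Sum>j\<le>n. \<xi> j)\<bar>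
      \<le> 2 * (D / \<alpha>)\<^sup>2 * (h * S) + K2 * (real (n + 1) * \<theta> + h * S)"
proof -
  define \<beta>' where "\<beta>' = (\<lambda>j. 1 - pgf q (\<lambda>i. 1 - x j i))"
  have D0: "0 \<le> D" by (rule moment_le_nonneg[OF q])
  have K1_0: "0 \<le> K1" using beta_pos by (simp add: K1_def)
  have K2_0: "0 \<le> K2" using D0 K1_0 alpha C_nonneg by (simp add: K2_def)
  have xb: "\<And>i. 0 \<le> x j i \<and> x j i \<le> 1" for j using inC_x[of j] by (simp add: inC_def)
  have t1: "0 \<le> pgf q (\<lambda>i. 1 - x j i) - 1 + dot (mean1 q) (x j)"
    "pgf q (\<lambda>i. 1 - x j i) - 1 + dot (mean1 q) (x j) \<le> D * (sum (x j) UNIV)\<^sup>2" for j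
    by (rule pgf_taylor1[OF q xb])+
  have m1: "0 \<le> mean1 q i" "mean1 q i \<le> D" for i using mean1_nonneg mean1_le[OF q] by auto
  have dotm: "dot (mean1 q) y \<le> D * (sum y UNIV)" if "\<And>i. 0 \<le> y i" for y
    unfolding dot_def sum_distrib_left using that m1 by (intro sum_mono mult_right_mono) auto
  have sx: "sum (x j) UNIV \<le> \<xi> j / \<alpha>" "0 \<le> sum (x j) UNIV" for j
    using sum_le_dot[of "x j"] x_nonneg by (auto simp: \<xi>_def sum_nonneg)
  have b0: "0 \<le> \<beta>' j" for j using pgf_bounds(2)[of "\<lambda>i. 1 - x j i" q] xb by (simp add: \<beta>'_def)
  have b1: "\<beta>' j \<le> D / \<alpha> * \<xi> j" for j
  proof -
    have "\<beta>' j \<le> dot (mean1 q) (x j)" using t1(1)[of j] by (simp add: \<beta>'_def)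
    also have "\<dots> \<le> D * sum (x j) UNIV" by (rule dotm) (rule x_nonneg)
    also have "\<dots> \<le> D * (\<xi> j / \<alpha>)" using sx D0 by (intro mult_left_mono) auto
    finally show ?thesis by simp
  qed
  have b2': "\<beta>' j \<le> 1 / 2" if "j \<le> n" for j
  proof -
    have "D / \<alpha> * \<xi> j \<le> D / \<alpha> * h" using h(1)[OF that] D0 alpha by (intro mult_left_mono) auto
    then show ?thesis using b1[of j] h(2) unfolding times_divide_eq_left by linarith
  qed
  have lin: "\<bar>\<beta>' j - dot (mean1 q) u * \<xi> j\<bar> \<le> K2 * (\<theta> + (\<xi> j)\<^sup>2)" for j
  proof -
    have 1: "\<bar>\<beta>' j - dot (mean1 q) (x j)\<bar> \<le> D * (sum (x j) UNIV)\<^sup>2"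
      using t1[of j] by (simp add: \<beta>'_def)
    have "(sum (x j) UNIV)\<^sup>2 \<le> (\<xi> j / \<alpha>)\<^sup>2" by (intro power_mono sx)
    then have "D * (sum (x j) UNIV)\<^sup>2 \<le> D * (\<xi> j / \<alpha>)\<^sup>2" using D0 by (rule mult_left_mono)
    also have "\<dots> = D / \<alpha>\<^sup>2 * (\<xi> j)\<^sup>2" by (simp add: power_divide)
    also have "\<dots> \<le> D / \<alpha>\<^sup>2 * (\<theta> + (\<xi> j)\<^sup>2)" using D0 theta_nonneg by (intro mult_left_mono) auto
    finally have 2: "D * (sum (x j) UNIV)\<^sup>2 \<le> D / \<alpha>\<^sup>2 * (\<theta> + (\<xi> j)\<^sup>2)" .
    have "dot (mean1 q) (x j) - dot (mean1 q) u * \<xi> j = dot (mean1 q) (w j)"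
      unfolding w_def dot_diff dot_scale by (simp add: mult.commute)
    moreover have "\<bar>dot (mean1 q) (w j)\<bar> \<le> dot (mean1 q) (\<lambda>k. \<bar>w j k\<bar>)"
      by (rule abs_dot_le) (rule m1)
    moreover have "dot (mean1 q) (\<lambda>k. \<bar>w j k\<bar>) \<le> D * (\<Sum>k\<in>UNIV. \<bar>w j k\<bar>)" by (rule dotm) simp
    moreover have "D * (\<Sum>k\<in>UNIV. \<bar>w j k\<bar>) \<le> D * (K1 * E j / \<alpha>)"
    proof (rule mult_left_mono[OF _ D0])
      have "(\<Sum>k\<in>UNIV. \<bar>w j k\<bar>) \<le> wnorm v (w j) / \<alpha>" by (rule sum_le_dot) simp
      also have "\<dots> \<le> K1 * E j / \<alpha>" using w_bound[of j] alpha by (intro divide_right_mono) (auto simp: K1_def)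
      finally show "(\<Sum>k\<in>UNIV. \<bar>w j k\<bar>) \<le> K1 * E j / \<alpha>" .
    qed
    moreover have "D * (K1 * E j / \<alpha>) \<le> D * (K1 * ((1 + C / \<alpha> ^ 3) * (\<theta> + (\<xi> j)\<^sup>2)) / \<alpha>)"
    proof (intro mult_left_mono divide_right_mono)
      have "0 \<le> C / \<alpha> ^ 3 * \<theta>" using C_nonneg alpha theta_nonneg by simp
      then show "E j \<le> (1 + C / \<alpha> ^ 3) * (\<theta> + (\<xi> j)\<^sup>2)" unfolding E_def
        by (simp add: distrib_left distrib_right)
    qed (use D0 K1_0 alpha in auto)
    ultimately have 3: "\<bar>dot (mean1 q) (x j) - dot (mean1 q) u * \<xi> j\<bar> \<le> D * (K1 * ((1 + C / \<alpha> ^ 3) * (\<theta> + (\<xi> j)\<^sup>2)) / \<alpha>)"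
      by linarith
    have "K2 * (\<theta> + (\<xi> j)\<^sup>2) = D / \<alpha>\<^sup>2 * (\<theta> + (\<xi> j)\<^sup>2) + D * (K1 * ((1 + C / \<alpha> ^ 3) * (\<theta> + (\<xi> j)\<^sup>2)) / \<alpha>)"
      by (simp add: K2_def distrib_right mult.assoc)
    then show ?thesis using 1 2 3 by linarith
  qed
  have pos: "0 < pgf q (\<lambda>i. 1 - x j i)" if "j \<le> n" for j using b2'[OF that] by (simp add: \<beta>'_def)
  show "0 < L" unfolding L_def using pos by (intro prod_pos) auto
  have lnL: "ln L = (\<Sum>j\<le>n. ln (1 - \<beta>' j))"
  proof -
    have "ln L = (\<Sum>j\<le>n. ln (pgf q (\<lambda>i. 1 - x j i)))"
      unfolding L_def
    proof (rule ln_prod)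
      fix j assume "j \<in> {..n}"
      then show "pgf q (\<lambda>i. 1 - x j i) \<noteq> 0" using pos[of j] by simp
    qed simp
    then show ?thesis by (simp add: \<beta>'_def)
  qed
  have xi2: "(\<xi> j)\<^sup>2 \<le> h * \<xi> j" if "j \<le> n" for j
    using mult_right_mono[OF h(1)[OF that] xi_nonneg[of j]] by (simp add: power2_eq_square)
  have term_le: "\<bar>ln (1 - \<beta>' j) + dot (mean1 q) u * \<xi> j\<bar> \<le> 2 * (D / \<alpha>)\<^sup>2 * (h * \<xi> j) + K2 * (\<theta> + h * \<xi> j)" if j: "j \<le> n" for j
  proof -
    have "\<bar>ln (1 + (- \<beta>' j)) - (- \<beta>' j)\<bar> \<le> 2 * (- \<beta>' j)\<^sup>2"
      by (rule abs_ln_one_plus_x_minus_x_bound) (use b0[of j] b2'[OF j] in simp)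
    moreover have "(\<beta>' j)\<^sup>2 \<le> (D / \<alpha>)\<^sup>2 * (h * \<xi> j)"
    proof -
      have "(\<beta>' j)\<^sup>2 \<le> (D / \<alpha> * \<xi> j)\<^sup>2" by (intro power_mono b1 b0)
      also have "\<dots> = (D / \<alpha>)\<^sup>2 * (\<xi> j)\<^sup>2" by (rule power_mult_distrib)
      also have "\<dots> \<le> (D / \<alpha>)\<^sup>2 * (h * \<xi> j)" by (intro mult_left_mono xi2 j) simp
      finally show ?thesis .
    qed
    moreover have "K2 * (\<theta> + (\<xi> j)\<^sup>2) \<le> K2 * (\<theta> + h * \<xi> j)"
      using xi2[OF j] K2_0 by (intro mult_left_mono) auto
    ultimately show ?thesis using lin[of j] by simp
  qed
  have h0: "0 \<le> h" using h(1)[of 0] xi_nonneg[of 0] by simp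
  have sum_eq: "(\<Sum>j\<le>N. c * (h * \<xi> j) + K2 * (\<theta> + h * \<xi> j))
      = c * (h * (\<Sum>j\<le>N. \<xi> j)) + K2 * (real (N + 1) * \<theta> + h * (\<Sum>j\<le>N. \<xi> j))" for c and N :: nat
    by (induction N) (simp_all add: algebra_simps)
  have eq: "ln L + dot (mean1 q) u * (\<Sum>j\<le>n. \<xi> j) = (\<Sum>j\<le>n. ln (1 - \<beta>' j) + dot (mean1 q) u * \<xi> j)"
    by (simp add: lnL sum.distrib sum_distrib_left)
  have "\<bar>ln L + dot (mean1 q) u * (\<Sum>j\<le>n. \<xi> j)\<bar>
      \<le> (\<Sum>j\<le>n. 2 * (D / \<alpha>)\<^sup>2 * (h * \<xi> j) + K2 * (\<theta> + h * \<xi> j))"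
    unfolding eq by (rule order_trans[OF sum_abs], rule sum_mono) (use term_le in auto)
  moreover have "2 * (D / \<alpha>)\<^sup>2 * (h * (\<Sum>j\<le>n. \<xi> j)) + K2 * (real (n + 1) * \<theta> + h * (\<Sum>j\<le>n. \<xi> j))
      \<le> 2 * (D / \<alpha>)\<^sup>2 * (h * S) + K2 * (real (n + 1) * \<theta> + h * S)"
    using S h0 K2_0 by (intro add_mono mult_left_mono) auto
  ultimately show "\<bar>ln L + dot (mean1 q) u * (\<Sum>j\<le>n. \<xi> j)\<bar>
      \<le> 2 * (D / \<alpha>)\<^sup>2 * (h * S) + K2 * (real (n + 1) * \<theta> + h * S)"
    unfolding sum_eq by linarith
qed

section \<open>Perron data of the mean matrices\<close>

lemma meanM_nonneg: "0 \<le> meanM p k l"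
  by (simp add: meanM_def Mmat_def)

text \<open>From r^U u = A^U u >= a sum(u) one gets u >= a / 2^U. The same works for
  \<open>v\<close>, whose sum is at least v'u = 1 because u <= 1; the upper bound on
  \<open>v\<close> follows from v_k u_k <= 1. Then u_k v_l <= 1 / \<alpha>, so a \<alpha> u_k v_l is
  at most \<open>a\<close>.\<close>

lemma perron_bounds:
  fixes A :: "'i::finite \<Rightarrow> 'i \<Rightarrow> real"
  assumes "perron_pair A r u v" and su: "sum u UNIV = 1" and a: "0 < a" "\<And>k l. a \<le> matpow A U k l"
    and r: "r \<le> 2"
  defines "\<alpha> \<equiv> a / 2 ^ U"
  shows "\<alpha> \<le> u k" "u k \<le> 1" "\<alpha> \<le> v k" "v k \<le> 1 / \<alpha>" "0 < \<alpha>" "\<alpha> \<le> 1"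
    "a * \<alpha> * u k * v l \<le> matpow A U k l"
proof -
  interpret perron_pair A r u v by fact
  have rU: "r ^ U \<le> 2 ^ U" using r r_nonneg by (intro power_mono) auto
  show al: "0 < \<alpha>" using a by (simp add: \<alpha>_def)
  have lower: "\<alpha> \<le> y k" if P: "(mv B ^^ U) y k = r ^ U * y k" and B: "\<And>k l. a \<le> matpow B U k l"
    and y: "\<And>k. 0 < y k" "1 \<le> sum y UNIV" for B and y :: "'i \<Rightarrow> real" and k
  proof -
    have "a * 1 \<le> a * sum y UNIV" using y a by (intro mult_left_mono) auto
    also have "\<dots> \<le> mv (matpow B U) y k"
      unfolding mv_def sum_distrib_left using B y by (intro sum_mono mult_right_mono) (auto intro: less_imp_le)
    also have "\<dots> = r ^ U * y k" by (simp add: matpow_mv P)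
    also have "\<dots> \<le> 2 ^ U * y k" using rU y(1)[of k] by (intro mult_right_mono) auto
    finally show ?thesis by (simp add: \<alpha>_def field_simps)
  qed
  have eig: "(mv B ^^ i) y = (\<lambda>k. r ^ i * y k)" if "mv B y = (\<lambda>k. r * y k)" for B and y :: "'i \<Rightarrow> real" and i
    by (induction i) (simp_all add: that mv_scale mult.assoc mult.left_commute)
  show ua: "\<alpha> \<le> u k" for k
    by (rule lower[of A]) (use eig[OF right_eigen] a u_pos su in auto)
  have u1: "u k \<le> 1" for k using member_le_sum[of k UNIV u] u_nonneg su by simp
  then show "u k \<le> 1" for k .
  interpret T: perron_pair "\<lambda>k l. A l k" r v u by (rule transpose)
  have "dot v u \<le> sum v UNIV"
    unfolding dot_def using u1 v_nonneg by (intro sum_mono) (simp add: mult_left_le)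
  then have sv: "1 \<le> sum v UNIV" by (simp add: dot_vu)
  show "\<alpha> \<le> v k" for k
    by (rule lower[of "\<lambda>k l. A l k"]) (use eig[OF T.right_eigen] a v_pos sv in \<open>auto simp: matpow_transpose[of A]\<close>)
  show "\<alpha> \<le> 1" using ua u1 order_trans by blast
  have va: "v k \<le> 1 / \<alpha>" for k
  proof -
    have "v k * \<alpha> \<le> v k * u k" using ua v_nonneg by (intro mult_left_mono) auto
    also have "\<dots> \<le> dot v u" unfolding dot_def using u_nonneg v_nonneg by (intro member_le_sum) auto
    finally show ?thesis using al by (simp add: dot_vu field_simps)
  qed
  then show "v k \<le> 1 / \<alpha>" for k .
  have "a * \<alpha> * u k * v l \<le> a * \<alpha> * 1 * (1 / \<alpha>)"
    using u1 va u_nonneg v_nonneg a al by (intro mult_mono) auto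
  also have "\<dots> \<le> matpow A U k l" using a al by simp
  finally show "a * \<alpha> * u k * v l \<le> matpow A U k l" .
qed

text \<open>The minorisation constant built here depends on \<open>p\<close>; its purpose is to make
  the definite descriptions unique. Uniform constants follow in
  \<open>gw_near_critical\<close>.\<close>

lemma gw_perron:
  fixes p :: "'i::finite \<Rightarrow> ('i \<Rightarrow> nat) pmf"
  assumes K: "inK a b c U p" and a: "0 < a" and U: "0 < U"
  shows "perron_pair (meanM p) (gw_rho p) (gw_u p) (gw_v p)" "sum (gw_u p) UNIV = 1"
proof -
  have aM: "a \<le> matpow (meanM p) U k l" for k l using K by (simp add: inK_def)
  have pos: "0 < matpow (meanM p) U k l" for k l using aM[of k l] a by linarith
  obtain r u v where P: "perron_pair (meanM p) r u v" and su: "sum u UNIV = 1"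
    using perron_pair_exists[OF meanM_nonneg pos U] by blast
  interpret perron_pair "meanM p" r u v by fact
  define m where "m = Min (range (\<lambda>(k, l). a / (u k * v l)))"
  have "m \<in> range (\<lambda>(k, l). a / (u k * v l))" unfolding m_def by (rule Min_in) auto
  then have "0 < m" using a u_pos v_pos by auto
  moreover have "m * u k * v l \<le> matpow (meanM p) U k l" for k l
  proof -
    have "m \<le> a / (u k * v l)" unfolding m_def by (rule Min_le) (auto intro: rev_image_eqI[of "(k, l)"])
    then have "m * u k * v l \<le> a" using u_pos[of k] v_pos[of l] by (simp add: field_simps)
    then show ?thesis using aM[of k l] by linarith
  qed
  ultimately interpret primitive_pair "meanM p" r u v U m by unfold_locales
  have "gw_rho p = r" "gw_u p = u" "gw_v p = v"
    by (simp_all add: gw_rho_def gw_u_def gw_v_def perron_root_eq perron_u_eq[OF su] perron_v_eq[OF su])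
  then show "perron_pair (meanM p) (gw_rho p) (gw_u p) (gw_v p)" "sum (gw_u p) UNIV = 1"
    using P su by simp_all
qed

text \<open>The minimum with 1 provides the bound \<open>\<beta> \<le> 1\<close> that
  \<open>defect_recursion\<close> asks for; lowering \<open>\<beta>\<close> preserves the
  minorisation.\<close>

lemma gw_near_critical:
  fixes p :: "'i::finite \<Rightarrow> ('i \<Rightarrow> nat) pmf"
  assumes K: "inK a b c U p" and a: "0 < a" and U: "0 < U" and c: "0 < c" and r: "gw_rho p \<le> 2"
  defines "\<alpha> \<equiv> a / 2 ^ U"
  shows "near_critical (meanM p) (gw_rho p) (gw_u p) (gw_v p) U (min 1 (a * \<alpha>)) (Phi p)
    (\<lambda>k. mean2 (p k)) \<alpha> (third_moment_const TYPE('i) c)"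
proof -
  define C where "C = third_moment_const TYPE('i) c"
  have aM: "a \<le> matpow (meanM p) U k l" for k l using K by (simp add: inK_def)
  note P = gw_perron[OF K a U]
  interpret perron_pair "meanM p" "gw_rho p" "gw_u p" "gw_v p" by (rule P)
  note pb = perron_bounds[OF P a aM r, folded \<alpha>_def]
  have m3: "moment_le (p k) 3 C" for k unfolding C_def by (rule inK_moment[OF K c])
  have m2: "moment_le (p k) 2 C" for k by (rule moment_le_mono[OF m3]) auto
  have dm: "dot (mean1 (p k)) x = mv (meanM p) x k" for k x
    by (simp add: dot_def mv_def meanM_eq[OF m3])
  have mp: "mv (meanM p) x k - Phi p x k = pgf (p k) (\<lambda>i. 1 - x i) - 1 + dot (mean1 (p k)) x" for x k
    by (simp add: Phi_def dm)
  show ?thesis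
    unfolding C_def[symmetric]
  proof
    show "0 < min 1 (a * \<alpha>)" using a pb by simp
    show "min 1 (a * \<alpha>) * gw_u p k * gw_v p l \<le> matpow (meanM p) U k l" for k l
    proof -
      have "min 1 (a * \<alpha>) * (gw_u p k * gw_v p l) \<le> (a * \<alpha>) * (gw_u p k * gw_v p l)"
        using u_nonneg v_nonneg by (intro mult_right_mono) auto
      then show ?thesis using pb(7)[of k l] by (simp add: mult.assoc)
    qed
    show "0 \<le> C" by (rule moment_le_nonneg[OF m3])
    show "0 \<le> mean2 (p k) l m" "mean2 (p k) l m \<le> C" for k l m
      by (auto intro: mean2_nonneg mean2_le[OF m3])
    fix x :: "'i \<Rightarrow> real" and k assume x: "inC x"
    have xb: "\<And>i. 0 \<le> x i \<and> x i \<le> 1" using x by (simp add: inC_def)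
    have xb': "\<And>i. 0 \<le> 1 - x i \<and> 1 - x i \<le> 1" using xb by simp
    show "0 \<le> Phi p x k" "Phi p x k \<le> 1"
      using pgf_bounds[of "\<lambda>i. 1 - x i" "p k"] xb' by (auto simp: Phi_def)
    show "Phi p x k \<le> mv (meanM p) x k" using pgf_taylor1(1)[of "p k" C x, OF m2 xb] mp[of x k] by linarith
    show "mv (meanM p) x k - Phi p x k \<le> C * (sum x UNIV)\<^sup>2"
      unfolding mp by (rule pgf_taylor1(2)[OF m2 xb])
    show "\<bar>mv (meanM p) x k - Phi p x k - quad (mean2 (p k)) x x / 2\<bar> \<le> C * sum x UNIV ^ 3"
      unfolding mp by (rule pgf_taylor2[OF m3 xb])
    fix y :: "'i \<Rightarrow> real" assume y: "inC y" and xy: "\<And>k. x k \<le> y k"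
    have "pgf (p k) (\<lambda>i. 1 - y i) \<le> pgf (p k) (\<lambda>i. 1 - x i)"
      by (rule pgf_mono) (use x y xy in \<open>auto simp: inC_def\<close>)
    then show "Phi p x k \<le> Phi p y k" by (simp add: Phi_def)
  qed (use pb r in auto)
qed

section \<open>The Laplace transform along convergent parameters\<close>

lemma one_minus_exp_bounds:
  fixes y :: real
  assumes "0 \<le> y"
  shows "1 - exp (- y) \<le> y" "y - y\<^sup>2 \<le> 1 - exp (- y)"
proof -
  show "1 - exp (- y) \<le> y" using exp_ge_add_one_self[of "- y"] by simp
  have "exp (- y) \<le> 1 / (1 + y)"
    using exp_ge_add_one_self[of y] assms by (simp add: exp_minus inverse_eq_divide frac_le)
  also have "\<dots> \<le> 1 - y + y\<^sup>2"
  proof -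
    \<comment> \<open>The product equals 1 + y^3.\<close>
    have "1 \<le> (1 - y + y\<^sup>2) * (1 + y)"
      using assms by (simp add: algebra_simps power2_eq_square)
    then show ?thesis using assms by (simp add: pos_divide_le_eq)
  qed
  finally show "y - y\<^sup>2 \<le> 1 - exp (- y)" by simp
qed

text \<open>The scaling vector is a multiple of \<open>v\<close>, so the weights cancel: v_l t_l /
  (m v_l) = t_l / m. Hence \<theta> is T / m up to a second-order term, whatever the
  eigenvector.\<close>

lemma (in near_critical) dot_one_minus_exp:
  fixes t :: "'i \<Rightarrow> real"
  assumes t: "\<And>l. 0 \<le> t l" and m: "0 < m"
  defines "\<sigma> \<equiv> \<lambda>l. 1 - exp (- (t l / (m * v l)))"
  shows "dot v \<sigma> \<le> sum t UNIV / m" "\<bar>m * dot v \<sigma> - sum t UNIV\<bar> \<le> (\<Sum>l\<in>UNIV. (t l)\<^sup>2) / \<alpha> / m" "inC \<sigma>"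
proof -
  define y where "y = (\<lambda>l. t l / (m * v l))"
  have y: "0 \<le> y l" for l using t m v_nonneg by (simp add: y_def)
  have vy: "m * (v l * y l) = t l" for l using m v_pos[of l] by (simp add: y_def)
  note b = one_minus_exp_bounds[OF y]
  show "inC \<sigma>" using y by (simp add: inC_def \<sigma>_def y_def)
  have "dot v \<sigma> \<le> dot v y" unfolding \<sigma>_def y_def[symmetric] using b(1) by (intro dot_mono v_nonneg) (simp add: y_def)
  also have "\<dots> = sum t UNIV / m"
    using vy m by (simp add: dot_def sum_divide_distrib field_simps flip: vy)
  finally show up: "dot v \<sigma> \<le> sum t UNIV / m" .
  have sy: "dot v y = sum t UNIV / m" by fact
  have "dot v (\<lambda>l. y l - (y l)\<^sup>2) \<le> dot v \<sigma>"
    unfolding \<sigma>_def using b(2) by (intro dot_mono v_nonneg) (simp add: y_def)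
  then have low: "sum t UNIV / m - dot v (\<lambda>l. (y l)\<^sup>2) \<le> dot v \<sigma>" by (simp add: dot_diff sy)
  have "dot v (\<lambda>l. (y l)\<^sup>2) \<le> (\<Sum>l\<in>UNIV. (t l)\<^sup>2) / \<alpha> / m / m"
    unfolding dot_def sum_divide_distrib
  proof (rule sum_mono)
    fix l
    have "v l * (y l)\<^sup>2 = (t l)\<^sup>2 / v l / m / m"
      using v_pos[of l] by (simp add: y_def power2_eq_square)
    also have "\<dots> \<le> (t l)\<^sup>2 / \<alpha> / m / m"
      using v_bounds(1)[of l] alpha m by (intro divide_right_mono divide_left_mono) auto
    finally show "v l * (y l)\<^sup>2 \<le> (t l)\<^sup>2 / \<alpha> / m / m" .
  qed
  from mult_left_mono[OF this, of m]
  have "m * dot v (\<lambda>l. (y l)\<^sup>2) \<le> (\<Sum>l\<in>UNIV. (t l)\<^sup>2) / \<alpha> / m"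
    using m by simp
  moreover have "m * dot v \<sigma> \<le> sum t UNIV" using up m by (simp add: field_simps)
  moreover have "sum t UNIV - m * dot v (\<lambda>l. (y l)\<^sup>2) \<le> m * dot v \<sigma>"
    using mult_left_mono[OF low, of m] m by (simp add: right_diff_distrib)
  ultimately show "\<bar>m * dot v \<sigma> - sum t UNIV\<bar> \<le> (\<Sum>l\<in>UNIV. (t l)\<^sup>2) / \<alpha> / m" by linarith
qed

lemma gw_Q_eq:
  fixes p :: "'i::finite \<Rightarrow> ('i \<Rightarrow> nat) pmf"
  assumes K: "inK a b c U p" and a: "0 < a" and U: "0 < U" and c: "0 < c" and r: "gw_rho p \<le> 2"
  shows "gw_Q p = near_critical.Q (gw_u p) (gw_v p) (\<lambda>k. mean2 (p k))"
proof -
  interpret near_critical "meanM p" "gw_rho p" "gw_u p" "gw_v p" U "min 1 (a * (a / 2 ^ U))" "Phi p"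
    "\<lambda>k. mean2 (p k)" "a / 2 ^ U" "third_moment_const TYPE('i) c"
    by (rule gw_near_critical) fact+
  have "enn2real (second_deriv p k l m) = mean2 (p k) l m" for k l m
    unfolding second_deriv_def pgf_deriv1_unitv2[OF inK_moment[OF K c], simplified]
    by (simp add: mean2_nonneg)
  then show ?thesis by (simp add: gw_Q_def Q_def dot_def quad_def)
qed

lemma gw_Q_bounds:
  fixes p :: "'i::finite \<Rightarrow> ('i \<Rightarrow> nat) pmf"
  assumes K: "inK a b c U p" and a: "0 < a" and U: "0 < U" and c: "0 < c" and r: "gw_rho p \<le> 2" and b: "0 < b"
  shows "(a / 2 ^ U) ^ 3 * b / 2 \<le> gw_Q p" "gw_Q p \<le> third_moment_const TYPE('i) c / (a / 2 ^ U) ^ 3"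
proof -
  interpret near_critical "meanM p" "gw_rho p" "gw_u p" "gw_v p" U "min 1 (a * (a / 2 ^ U))" "Phi p"
    "\<lambda>k. mean2 (p k)" "a / 2 ^ U" "third_moment_const TYPE('i) c"
    by (rule gw_near_critical) fact+
  have "second_deriv p k l m = ennreal (mean2 (p k) l m)" for k l m
    unfolding second_deriv_def by (rule pgf_deriv1_unitv2[OF inK_moment[OF K c]]) simp
  then have "ennreal b \<le> ennreal (\<Sum>k\<in>UNIV. \<Sum>l\<in>UNIV. \<Sum>m\<in>UNIV. mean2 (p k) l m)"
    using K by (simp add: inK_def mean2_nonneg sum_nonneg)
  then have "b \<le> (\<Sum>k\<in>UNIV. \<Sum>l\<in>UNIV. \<Sum>m\<in>UNIV. mean2 (p k) l m)"
    by (subst (asm) ennreal_le_iff) (auto intro!: sum_nonneg mean2_nonneg)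
  then show "(a / 2 ^ U) ^ 3 * b / 2 \<le> gw_Q p" unfolding gw_Q_eq[OF K a U c r] by (rule Q_ge)
  show "gw_Q p \<le> third_moment_const TYPE('i) c / (a / 2 ^ U) ^ 3"
    unfolding gw_Q_eq[OF K a U c r] by (rule Q_le)
qed

lemma lam_u_eq:
  assumes "moment_le q r C" "1 \<le> r"
  shows "lam_u p q = dot (mean1 q) (gw_u p)"
  by (simp add: lam_u_def dot_def imm_lambda_eq[OF assms])

lemma lam_u_bounds:
  fixes p :: "'i::finite \<Rightarrow> ('i \<Rightarrow> nat) pmf"
  assumes K: "inK a b c U p" "0 < a" "0 < U" and q: "moment_le q r D" "1 \<le> r"
  shows "0 \<le> lam_u p q" "lam_u p q \<le> D"
proof -
  interpret perron_pair "meanM p" "gw_rho p" "gw_u p" "gw_v p" by (rule gw_perron[OF K])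
  show "0 \<le> lam_u p q"
    unfolding lam_u_eq[OF q] by (intro dot_nonneg mean1_nonneg u_nonneg)
  have "lam_u p q \<le> (\<Sum>k\<in>UNIV. D * gw_u p k)"
    unfolding lam_u_eq[OF q] dot_def using mean1_le[OF q] u_nonneg by (intro sum_mono mult_right_mono) auto
  then show "lam_u p q \<le> D" using gw_perron(2)[OF K] by (simp add: sum_distrib_left[symmetric])
qed

text \<open>The conditions on the scaling have separate tasks: \<open>m1\<close> sends the maximum
  of the projections to 0, \<open>m2\<close> sends (n + 1) \<theta> to 0, and \<open>m3\<close>
  bounds the sum of the projections. All that differs between the regimes is the limit of the linear
  recursion, left to \<open>exact\<close>.\<close>

lemma laplace_limit:
  fixes p :: "nat \<Rightarrow> 'i::finite \<Rightarrow> ('i \<Rightarrow> nat) pmf" and q :: "nat \<Rightarrow> ('i \<Rightarrow> nat) pmf"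
    and t :: "'i \<Rightarrow> real" and n :: "nat \<Rightarrow> nat" and m :: "nat \<Rightarrow> real"
  assumes const: "0 < a" "0 < b" "0 < c" "0 < U" "0 < d2"
    and K: "\<And>k. inK a b c U (p k)" and J: "\<And>k. inJ d1 d2 (q k)"
    and t: "\<And>l. 0 \<le> t l"
    and rho: "(\<lambda>k. gw_rho (p k)) \<longlonglongrightarrow> 1" "\<And>k. gw_rho (p k) \<le> 2"
      "\<And>k. gw_rho (p k) ^ U \<le> 1 + min 1 (a * (a / 2 ^ U)) / 2"
    and m: "\<And>k. 0 < m k"
    and m1: "(\<lambda>k. (\<Sum>i\<le>n k. gw_rho (p k) ^ i) / m k) \<longlonglongrightarrow> 0"
    and m2: "(\<lambda>k. real (n k + 1) / m k) \<longlonglongrightarrow> 0"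
    and m3: "\<And>k. (\<Sum>j\<le>n k. \<Sum>i\<le>j. gw_rho (p k) ^ i) / m k \<le> S"
    and Q: "(\<lambda>k. gw_Q (p k)) \<longlonglongrightarrow> Q'" and lam: "(\<lambda>k. lam_u (p k) (q k)) \<longlonglongrightarrow> l'"
    and exact: "\<And>e. (\<lambda>k. m k * e k) \<longlonglongrightarrow> Q' * sum t UNIV \<Longrightarrow>
        (\<lambda>k. fst (lin (gw_rho (p k)) (e k) (Suc (n k)))) \<longlonglongrightarrow> Y"
    and Y: "0 < Y"
  shows "(\<lambda>k. laplace_Y (p k) (q k) (n k) t (\<lambda>l. m k * gw_v (p k) l)) \<longlonglongrightarrow> Y powr (- l' / Q')"
proof -
  define \<alpha> where "\<alpha> = a / 2 ^ U"
  define \<beta> where "\<beta> = min 1 (a * (a / 2 ^ U))"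
  define C where "C = third_moment_const TYPE('i) c"
  define D where "D = second_moment_const TYPE('i) d2"
  define T where "T = sum t UNIV"
  define \<sigma> where "\<sigma> = (\<lambda>k l. 1 - exp (- (t l / (m k * gw_v (p k) l))))"
  define \<xi> where "\<xi> = (\<lambda>k j. dot (gw_v (p k)) (defect_seq (Phi (p k)) (\<sigma> k) j))"
  define \<theta> where "\<theta> = (\<lambda>k. dot (gw_v (p k)) (\<sigma> k))"
  define R where "R = (\<lambda>k. gw_rho (p k))"
  have T0: "0 \<le> T" unfolding T_def by (intro sum_nonneg t)
  have nc: "near_critical (meanM (p k)) (R k) (gw_u (p k)) (gw_v (p k)) U \<beta> (Phi (p k)) (\<lambda>i. mean2 (p k i)) \<alpha> C" for k
    unfolding \<alpha>_def \<beta>_def C_def R_def by (rule gw_near_critical[OF K const(1,4,3) rho(2)])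
  have dr: "defect_recursion (meanM (p k)) (R k) (gw_u (p k)) (gw_v (p k)) U \<beta> (Phi (p k)) (\<lambda>i. mean2 (p k i)) \<alpha> C (\<sigma> k)" for k
  proof -
    interpret near_critical "meanM (p k)" "R k" "gw_u (p k)" "gw_v (p k)" U \<beta> "Phi (p k)" "\<lambda>i. mean2 (p k i)" \<alpha> C by (rule nc)
    show ?thesis
    proof
      show "inC (\<sigma> k)" unfolding \<sigma>_def by (rule dot_one_minus_exp(3)) (use t m in auto)
      show "R k ^ U \<le> 1 + \<beta> / 2" using rho(3) by (simp add: R_def \<beta>_def)
      show "\<beta> \<le> 1" by (simp add: \<beta>_def)
    qed
  qed
  have xi_eq: "defect_recursion.\<xi> (gw_v (p k)) (Phi (p k)) (\<sigma> k) j = \<xi> k j"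
    and theta_eq: "defect_recursion.\<theta> (gw_v (p k)) (\<sigma> k) = \<theta> k" for k j
    by (simp_all add: defect_recursion.\<xi>_def[OF dr] defect_recursion.\<theta>_def[OF dr] \<xi>_def \<theta>_def)
  have Qeq: "near_critical.Q (gw_u (p k)) (gw_v (p k)) (\<lambda>i. mean2 (p k i)) = gw_Q (p k)" for k
    by (rule gw_Q_eq[OF K const(1,4,3) rho(2), symmetric])
  have Q0: "0 \<le> gw_Q (p k)" for k unfolding Qeq[symmetric] by (rule near_critical.Q_nonneg[OF nc])
  define K1 where "K1 = 4 / \<beta> * 2 ^ Suc U"
  define Kc where "Kc = 2 / \<alpha> + C / \<alpha> ^ 4 + C / \<alpha> ^ 3 * K1 * (1 + C / \<alpha> ^ 3)"
  define h where "h = (\<lambda>k. T * ((\<Sum>i\<le>n k. R k ^ i) / m k))"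
  have al: "0 < \<alpha>" and be: "0 < \<beta>" and C0: "0 \<le> C" and R0: "0 \<le> R k" for k
    using near_critical.alpha(1)[OF nc[of 0]] near_critical.C_nonneg[OF nc[of 0]] const
      perron_pair.r_nonneg[OF gw_perron(1)[OF K const(1,4)]]
    by (auto simp: \<beta>_def R_def)
  have K1_0: "0 \<le> K1" using be by (simp add: K1_def)
  have Kc0: "0 \<le> Kc" using al C0 K1_0 by (simp add: Kc_def)
  have xi0: "0 \<le> \<xi> k j" for k j using defect_recursion.xi_nonneg[OF dr[of k], of j] by (simp add: xi_eq)
  have th: "\<theta> k \<le> T / m k" "\<bar>m k * \<theta> k - T\<bar> \<le> (\<Sum>l\<in>UNIV. (t l)\<^sup>2) / \<alpha> / m k" for k
    using near_critical.dot_one_minus_exp(1,2)[OF nc[of k], of t "m k"] t m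
    by (auto simp: \<theta>_def \<sigma>_def T_def)
  have xi_geo: "\<xi> k j \<le> T * ((\<Sum>i\<le>j. R k ^ i) / m k)" for k j
  proof -
    have "\<xi> k j \<le> \<theta> k * (\<Sum>i\<le>j. R k ^ i)"
      using defect_recursion.xi_le_geometric[OF dr[of k], of j] by (simp add: xi_eq theta_eq)
    also have "\<dots> \<le> T / m k * (\<Sum>i\<le>j. R k ^ i)"
      using th R0 by (intro mult_right_mono sum_nonneg) auto
    finally show ?thesis by simp
  qed
  have xi_h: "\<xi> k j \<le> h k" if "j \<le> n k" for k j
  proof -
    have "(\<Sum>i\<le>j. R k ^ i) \<le> (\<Sum>i\<le>n k. R k ^ i)" using that R0 by (intro sum_mono2) auto
    then have "T * ((\<Sum>i\<le>j. R k ^ i) / m k) \<le> h k"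
      unfolding h_def using T0 m[of k] by (intro mult_left_mono divide_right_mono) auto
    then show ?thesis using xi_geo[of k j] by linarith
  qed
  have h0: "h \<longlonglongrightarrow> 0" using tendsto_mult_left[OF m1, of T] by (simp add: h_def R_def)
  have sumxi: "(\<Sum>j\<le>n k. \<xi> k j) \<le> T * S" for k
  proof -
    have "(\<Sum>j\<le>n k. \<xi> k j) \<le> (\<Sum>j\<le>n k. T * ((\<Sum>i\<le>j. R k ^ i) / m k))" by (intro sum_mono xi_geo)
    also have "\<dots> = T * ((\<Sum>j\<le>n k. \<Sum>i\<le>j. R k ^ i) / m k)"
      by (simp only: sum_distrib_left sum_divide_distrib)
    also have "\<dots> \<le> T * S" using m3[of k] T0 by (intro mult_left_mono) (auto simp: R_def)
    finally show ?thesis .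
  qed
  have inv_m: "(\<lambda>k. 1 / m k) \<longlonglongrightarrow> 0"
  proof (rule Lim_null_comparison[OF _ m2])
    show "\<forall>\<^sub>F k in sequentially. norm (1 / m k) \<le> real (n k + 1) / m k"
    proof (rule always_eventually, rule allI)
      fix k show "norm (1 / m k) \<le> real (n k + 1) / m k" using m[of k] by (simp add: divide_right_mono)
    qed
  qed
  have mtheta: "(\<lambda>k. m k * \<theta> k) \<longlonglongrightarrow> T"
  proof -
    have "(\<lambda>k. m k * \<theta> k - T) \<longlonglongrightarrow> 0"
    proof (rule Lim_null_comparison)
      show "\<forall>\<^sub>F k in sequentially. norm (m k * \<theta> k - T) \<le> (\<Sum>l\<in>UNIV. (t l)\<^sup>2) / \<alpha> * (1 / m k)"
        using th(2) by (intro always_eventually allI) simp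
      show "(\<lambda>k. (\<Sum>l\<in>UNIV. (t l)\<^sup>2) / \<alpha> * (1 / m k)) \<longlonglongrightarrow> 0"
        by (rule tendsto_mult_right_zero[OF inv_m])
    qed
    then show ?thesis by (simp add: Lim_null[symmetric])
  qed
  have lnY: "(\<lambda>k. gw_Q (p k) * (\<Sum>j\<le>n k. \<xi> k j)) \<longlonglongrightarrow> ln Y"
  proof (rule riccati_limit[where \<theta> = \<theta> and r = R and h = h and K = Kc and S = "T * S" and Q' = Q'])
    show "\<xi> k 0 = \<theta> k" for k by (simp add: \<xi>_def \<theta>_def)
    show "\<bar>\<xi> k (Suc j) - R k * \<xi> k j - \<theta> k + gw_Q (p k) * (\<xi> k j)\<^sup>2\<bar> \<le> Kc * (\<theta> k * \<xi> k j + \<xi> k j ^ 3)" for k j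
      using defect_recursion.recursion[OF dr[of k], of j]
      by (simp add: xi_eq theta_eq Qeq Kc_def K1_def defect_recursion.K_def[OF dr] defect_recursion.K1_def[OF dr])
    show "R \<longlonglongrightarrow> 1" using rho by (simp add: R_def)
    \<comment> \<open>A relative perturbation of \<theta> that tends to 0 does not change the limit
      of m e, so \<open>exact\<close> covers it.\<close>
    fix b' :: "nat \<Rightarrow> real" assume b': "b' \<longlonglongrightarrow> 0"
    have "(\<lambda>k. gw_Q (p k) * (m k * \<theta> k) * (1 + b' k)) \<longlonglongrightarrow> Q' * T * (1 + 0)"
      by (intro tendsto_intros Q mtheta b')
    then have "(\<lambda>k. m k * (gw_Q (p k) * \<theta> k * (1 + b' k))) \<longlonglongrightarrow> Q' * sum t UNIV"
      by (simp add: mult_ac T_def)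
    from exact[OF this] show "(\<lambda>k. fst (lin (R k) (gw_Q (p k) * \<theta> k * (1 + b' k)) (Suc (n k)))) \<longlonglongrightarrow> Y"
      by (simp add: R_def)
  qed (use xi0 xi_h Q0 Q Kc0 h0 sumxi Y in auto)
  have Qpos: "0 < Q'"
  proof -
    have "\<alpha> ^ 3 * b / 2 \<le> gw_Q (p k)" for k
      unfolding \<alpha>_def by (rule gw_Q_bounds(1)[OF K const(1,4,3) rho(2) const(2)])
    then have "\<alpha> ^ 3 * b / 2 \<le> Q'" by (intro LIMSEQ_le_const[OF Q]) auto
    moreover have "0 < \<alpha> ^ 3 * b / 2" using al const by simp
    ultimately show ?thesis by linarith
  qed
  have "(\<lambda>k. lam_u (p k) (q k) * ((gw_Q (p k) * (\<Sum>j\<le>n k. \<xi> k j)) / gw_Q (p k))) \<longlonglongrightarrow> l' * (ln Y / Q')"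
    by (intro tendsto_intros lam lnY Q) (use Qpos in simp)
  moreover have Qne: "gw_Q (p k) \<noteq> 0" for k
  proof -
    have "\<alpha> ^ 3 * b / 2 \<le> gw_Q (p k)"
      unfolding \<alpha>_def by (rule gw_Q_bounds(1)[OF K const(1,4,3) rho(2) const(2)])
    moreover have "0 < \<alpha> ^ 3 * b / 2" using al const by simp
    ultimately show ?thesis by linarith
  qed
  ultimately have lamxi: "(\<lambda>k. lam_u (p k) (q k) * (\<Sum>j\<le>n k. \<xi> k j)) \<longlonglongrightarrow> l' * (ln Y / Q')" by simp
  define L where "L = (\<lambda>k. \<Prod>j\<le>n k. pgf (q k) (\<lambda>i. 1 - defect_seq (Phi (p k)) (\<sigma> k) j i))"
  have Leq: "laplace_Y (p k) (q k) (n k) t (\<lambda>l. m k * gw_v (p k) l) = L k" for k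
    unfolding L_def \<sigma>_def
  proof (rule laplace_Y_eq)
    show "0 < m k * gw_v (p k) l" for l
      using m[of k] perron_pair.v_pos[OF gw_perron(1)[OF K const(1,4)], of k l] by simp
  qed (rule t)
  have qm: "moment_le (q k) 2 D" for k unfolding D_def by (rule inJ_moment[OF J const(5)])
  define K2 where "K2 = D / \<alpha>\<^sup>2 + D * K1 * (1 + C / \<alpha> ^ 3) / \<alpha>"
  define err where "err = (\<lambda>k. 2 * (D / \<alpha>)\<^sup>2 * (h k * (T * S)) + K2 * (T * (real (n k + 1) / m k) + h k * (T * S)))"
  have "err \<longlonglongrightarrow> 2 * (D / \<alpha>)\<^sup>2 * (0 * (T * S)) + K2 * (T * 0 + 0 * (T * S))"
    unfolding err_def by (intro tendsto_intros h0 m2)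
  then have err0: "err \<longlonglongrightarrow> 0" by simp
  have "(\<lambda>k. D * h k / \<alpha>) \<longlonglongrightarrow> D * 0 / \<alpha>" by (intro tendsto_intros h0) (use al in simp)
  then have ev: "\<forall>\<^sub>F k in sequentially. D * h k / \<alpha> < 1 / 2" by (intro order_tendstoD(2)) auto
  have K1_eq: "defect_recursion.K1 U \<beta> = K1" by (simp add: K1_def defect_recursion.K1_def[OF dr])
  have est: "\<forall>\<^sub>F k in sequentially. 0 < L k \<and> norm (ln (L k) + lam_u (p k) (q k) * (\<Sum>j\<le>n k. \<xi> k j)) \<le> err k"
    using ev
  proof eventually_elim
    case (elim k)
    interpret defect_recursion "meanM (p k)" "R k" "gw_u (p k)" "gw_v (p k)" U \<beta> "Phi (p k)" "\<lambda>i. mean2 (p k i)" \<alpha> C "\<sigma> k"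
      by (rule dr)
    have D0: "0 \<le> D" by (rule moment_le_nonneg[OF qm])
    have K20: "0 \<le> K2" using D0 K1_0 al C0 by (simp add: K2_def)
    have "\<bar>ln (L k) + dot (mean1 (q k)) (gw_u (p k)) * (\<Sum>j\<le>n k. \<xi> k j)\<bar>
        \<le> 2 * (D / \<alpha>)\<^sup>2 * (h k * (T * S)) + K2 * (real (n k + 1) * \<theta> k + h k * (T * S))"
      unfolding L_def K2_def K1_eq[symmetric] theta_eq[symmetric] xi_eq[symmetric]
      by (rule product_estimate(2)[OF qm]) (use xi_h elim sumxi in \<open>auto simp: xi_eq\<close>)
    moreover have "0 < L k" unfolding L_def
      by (rule product_estimate(1)[OF qm, where h = "h k" and S = "T * S"]) (use xi_h elim sumxi in \<open>auto simp: xi_eq\<close>)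
    moreover have "K2 * (real (n k + 1) * \<theta> k + h k * (T * S)) \<le> K2 * (T * (real (n k + 1) / m k) + h k * (T * S))"
    proof (intro mult_left_mono[OF _ K20] add_right_mono)
      have "real (n k + 1) * \<theta> k \<le> real (n k + 1) * (T / m k)" using th by (intro mult_left_mono) auto
      then show "real (n k + 1) * \<theta> k \<le> T * (real (n k + 1) / m k)" by (simp only: times_divide_eq_right times_divide_eq_left mult.commute)
    qed
    moreover have "lam_u (p k) (q k) = dot (mean1 (q k)) (gw_u (p k))" by (rule lam_u_eq[OF qm]) simp
    ultimately show ?case by (simp add: err_def)
  qed
  have "(\<lambda>k. ln (L k) + lam_u (p k) (q k) * (\<Sum>j\<le>n k. \<xi> k j)) \<longlonglongrightarrow> 0"
    by (rule Lim_null_comparison[OF _ err0]) (use est in eventually_elim, simp)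
  from tendsto_diff[OF this lamxi] have "(\<lambda>k. exp (ln (L k))) \<longlonglongrightarrow> exp (0 - l' * (ln Y / Q'))"
    by (intro tendsto_exp) simp
  moreover have "\<forall>\<^sub>F k in sequentially. exp (ln (L k)) = L k" using est by eventually_elim simp
  ultimately have "L \<longlonglongrightarrow> exp (0 - l' * (ln Y / Q'))" by (rule Lim_transform_eventually)
  then show ?thesis using Y by (simp add: Leq powr_def)
qed

section \<open>Perturbation of the Perron root\<close>

text \<open>Iterating downwards from the constant 1 produces the largest fixed point, and indeed the
  largest subsolution, since a subsolution stays below every iterate. Maximality is what later
  excludes the trivial fixed point 0.\<close>

lemma extinction_defect:
  fixes p :: "'i::finite \<Rightarrow> ('i \<Rightarrow> nat) pmf"
  assumes P: "\<And>k. moment_le (p k) 3 C"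
  shows "\<exists>x. inC x \<and> ext_prob p = (\<lambda>k. 1 - x k) \<and> (\<forall>k. Phi p x k = x k)
    \<and> (\<forall>z. inC z \<and> (\<forall>k. z k \<le> Phi p z k) \<longrightarrow> (\<forall>k. z k \<le> x k))"
proof -
  define xs where "xs = (\<lambda>m k. 1 - (offspring_pgf p ^^ m) (\<lambda>_. 0) k)"
  have inC_f: "inC ((offspring_pgf p ^^ m) (\<lambda>_. 0))" for m
    by (induction m) (auto simp: inC_offspring_pgf, simp add: inC_def)
  have xs_inC: "inC (xs m)" for m using inC_f[of m] by (simp add: inC_def xs_def)
  have xs_Suc: "xs (Suc m) k = Phi p (xs m) k" for m k
    by (simp add: xs_def Phi_def offspring_pgf_def)
  have Phi_mono: "Phi p y k \<le> Phi p z k" if "inC y" "inC z" "\<And>k. y k \<le> z k" for y z k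
    unfolding Phi_def using that by (intro diff_left_mono pgf_mono) (auto simp: inC_def)
  have dec: "xs (Suc m) k \<le> xs m k" for m k
  proof (induction m arbitrary: k)
    case 0
    show ?case using xs_inC[of "Suc 0"] by (simp add: xs_def[of] inC_def)
  next
    case (Suc m)
    have "Phi p (xs (Suc m)) k \<le> Phi p (xs m) k" by (intro Phi_mono xs_inC Suc)
    then show ?case by (simp only: xs_Suc)
  qed
  have "\<exists>l. (\<lambda>m. xs m k) \<longlonglongrightarrow> l" for k
  proof -
    have "decseq (\<lambda>m. xs m k)" using dec by (simp add: decseq_Suc_iff)
    then show ?thesis using xs_inC by (auto simp: inC_def intro: decseq_convergent[of _ 0])
  qed
  then obtain x where x: "\<And>k. (\<lambda>m. xs m k) \<longlonglongrightarrow> x k" by metis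
  have inC_x: "inC x"
    unfolding inC_def
  proof (intro allI conjI)
    fix k
    show "0 \<le> x k" by (rule LIMSEQ_le_const[OF x]) (use xs_inC in \<open>auto simp: inC_def\<close>)
    show "x k \<le> 1" by (rule LIMSEQ_le_const2[OF x]) (use xs_inC in \<open>auto simp: inC_def\<close>)
  qed
  have "ext_prob p k = 1 - x k" for k
  proof -
    have "(\<lambda>m. 1 - xs m k) \<longlonglongrightarrow> 1 - x k" by (intro tendsto_intros x)
    then show ?thesis unfolding ext_prob_eq by (intro limI) (simp add: xs_def)
  qed
  moreover have "Phi p x k = x k" for k
  proof -
    have "(\<lambda>m. Phi p (xs m) k - Phi p x k) \<longlonglongrightarrow> 0"
    proof (rule Lim_null_comparison)
      show "\<forall>\<^sub>F m in sequentially. norm (Phi p (xs m) k - Phi p x k) \<le> (\<Sum>i\<in>UNIV. mean1 (p k) i * \<bar>x i - xs m i\<bar>)"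
      proof (intro always_eventually allI)
        fix m
        have "\<bar>pgf (p k) (\<lambda>i. 1 - xs m i) - pgf (p k) (\<lambda>i. 1 - x i)\<bar>
            \<le> (\<Sum>i\<in>UNIV. mean1 (p k) i * \<bar>(1 - xs m i) - (1 - x i)\<bar>)"
          by (rule pgf_Lipschitz[OF P]) (use xs_inC[of m] inC_x in \<open>auto simp: inC_def\<close>)
        then show "norm (Phi p (xs m) k - Phi p x k) \<le> (\<Sum>i\<in>UNIV. mean1 (p k) i * \<bar>x i - xs m i\<bar>)"
          by (simp add: Phi_def abs_minus_commute)
      qed
      have "(\<lambda>m. \<Sum>i\<in>UNIV. mean1 (p k) i * \<bar>x i - xs m i\<bar>) \<longlonglongrightarrow> (\<Sum>i\<in>UNIV. mean1 (p k) i * \<bar>x i - x i\<bar>)"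
        by (intro tendsto_intros x)
      then show "(\<lambda>m. \<Sum>i\<in>UNIV. mean1 (p k) i * \<bar>x i - xs m i\<bar>) \<longlonglongrightarrow> 0" by simp
    qed
    then have "(\<lambda>m. xs (Suc m) k) \<longlonglongrightarrow> Phi p x k" by (simp add: xs_Suc Lim_null[symmetric])
    moreover have "(\<lambda>m. xs (Suc m) k) \<longlonglongrightarrow> x k" by (rule LIMSEQ_Suc[OF x])
    ultimately show ?thesis by (rule LIMSEQ_unique)
  qed
  moreover have "z k \<le> x k" if z: "inC z" "\<And>k. z k \<le> Phi p z k" for z k
  proof -
    have "z k \<le> xs m k" for m k
    proof (induction m arbitrary: k)
      case 0
      show ?case using z by (simp add: xs_def inC_def)
    next
      case (Suc m)
      have "Phi p z k \<le> xs (Suc m) k" unfolding xs_Suc by (intro Phi_mono z xs_inC Suc)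
      then show ?case using z(2)[of k] by linarith
    qed
    then show ?thesis by (intro LIMSEQ_le_const[OF x]) auto
  qed
  ultimately show ?thesis using inC_x by (intro exI[of _ x]) auto
qed

text \<open>Pairing x = F x <= A x with \<open>v\<close> gives v'x <= r v'x, so v'x = 0 when r <
  1.\<close>

lemma (in near_critical) subcritical_fixpoint:
  assumes "inC x" "\<And>k. F x k = x k" "r < 1"
  shows "x k = 0"
proof -
  have x: "\<And>k. 0 \<le> x k" using assms by (simp add: inC_def)
  have "dot v x \<le> dot v (mv A x)"
    using F_bounds(3)[OF assms(1)] assms(2) by (intro dot_mono v_nonneg) metis
  then have "(1 - r) * dot v x \<le> 0" by (simp add: dot_mv left_diff_distrib)
  then have "dot v x \<le> 0" using assms(3) by (simp add: mult_le_0_iff)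
  then have "x k \<le> 0" using le_dot[of x k] x alpha by (auto simp: divide_nonpos_pos intro: order_trans)
  then show ?thesis using x[of k] by simp
qed

text \<open>A small multiple of \<open>u\<close>: the linear gain (r - 1) z outweighs the quadratic
  Taylor loss.\<close>

lemma (in near_critical) supercritical_subsolution:
  assumes r: "1 < r"
  shows "\<exists>z. inC z \<and> (\<forall>k. 0 < z k) \<and> (\<forall>k. z k \<le> F z k)"
proof -
  \<comment> \<open>Chosen so that the loss C (d / \<alpha>)^2 is at most d (r - 1) \<alpha>; adding
    1 to \<open>C\<close> avoids division by 0.\<close>
  define d where "d = (r - 1) * \<alpha> ^ 3 / (C + 1)"
  define z where "z = (\<lambda>k. d * u k)"
  have d: "0 < d" "d \<le> 1"
  proof -
    show "0 < d" using r alpha C_nonneg by (simp add: d_def)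
    have "(r - 1) * \<alpha> ^ 3 \<le> 1 * 1" using r r_le alpha by (intro mult_mono) (auto intro: power_le_one)
    then show "d \<le> 1" using C_nonneg by (simp add: d_def)
  qed
  have inCz: "inC z"
  proof -
    have "d * u k \<le> 1 * 1" for k using d u_bounds(2)[of k] u_nonneg[of k] by (intro mult_mono) auto
    then show ?thesis using d u_nonneg by (simp add: z_def inC_def)
  qed
  have "0 < z k" for k using d u_pos[of k] by (simp add: z_def)
  moreover have "z k \<le> F z k" for k
  proof -
    have "sum z UNIV \<le> d / \<alpha>"
    proof -
      have "sum z UNIV = d * sum u UNIV" by (simp add: z_def sum_distrib_left)
      also have "\<dots> \<le> d * (1 / \<alpha>)" using d by (intro mult_left_mono sum_u_le) auto
      finally show ?thesis by simp
    qed
    moreover have "0 \<le> sum z UNIV" using d u_nonneg by (auto simp: z_def intro!: sum_nonneg)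
    ultimately have "C * (sum z UNIV)\<^sup>2 \<le> C * (d / \<alpha>)\<^sup>2"
      using C_nonneg by (intro mult_left_mono power_mono) auto
    also have "\<dots> \<le> d * ((r - 1) * \<alpha>)"
    proof -
      have "C * d \<le> (r - 1) * \<alpha> ^ 3"
      proof -
        have "C * d \<le> (C + 1) * d" using d by (intro mult_right_mono) auto
        also have "\<dots> = (r - 1) * \<alpha> ^ 3" using C_nonneg by (simp add: d_def)
        finally show ?thesis .
      qed
      then have "C * d / \<alpha>\<^sup>2 \<le> (r - 1) * \<alpha>"
        using alpha by (simp add: field_simps power3_eq_cube power2_eq_square)
      then have "d * (C * d / \<alpha>\<^sup>2) \<le> d * ((r - 1) * \<alpha>)" using d by (intro mult_left_mono) auto
      then show ?thesis by (simp add: power_divide power2_eq_square mult_ac)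
    qed
    also have "\<dots> \<le> d * ((r - 1) * u k)"
      using d r u_bounds(1)[of k] by (intro mult_left_mono) auto
    finally have "mv A z k - F z k \<le> d * ((r - 1) * u k)"
      using F_taylor1[OF inCz, of k] by linarith
    moreover have "mv A z k = d * (r * u k)" by (simp add: z_def mv_scale right_eigen)
    ultimately show ?thesis by (simp add: z_def algebra_simps)
  qed
  ultimately show ?thesis using inCz by blast
qed

text \<open>The assumption \<open>F_Lip\<close> says that A - F does not decrease from
  \<open>z\<close> to \<open>x\<close>. This allows comparing \<open>x\<close>, not yet known to be
  small, with small vectors below it.\<close>

locale supercritical_fixpoint = near_critical A r u v U \<beta> F b2 \<alpha> C
  for A :: "'i::finite \<Rightarrow> 'i \<Rightarrow> real" and r u v U \<beta> F b2 \<alpha> C +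
  fixes x :: "'i \<Rightarrow> real" and b :: real
  assumes x: "inC x" "\<And>k. F x k = x k" "\<And>k. 0 < x k"
    and F_Lip: "\<And>z k. inC z \<Longrightarrow> (\<And>k. z k \<le> x k) \<Longrightarrow> F x k - F z k \<le> mv A x k - mv A z k"
    and b: "0 < b" "b \<le> (\<Sum>k\<in>UNIV. \<Sum>l\<in>UNIV. \<Sum>m\<in>UNIV. b2 k l m)"
    and r_gt: "1 < r" and r_power: "r ^ U \<le> 1 + \<beta> / 2"
begin

definition \<epsilon> :: real where "\<epsilon> = r - 1"
definition \<xi> :: real where "\<xi> = dot v x"
definition w :: "'i \<Rightarrow> real" where "w = (\<lambda>k. x k - \<xi> * u k)"
definition W0 :: real where "W0 = 4 / \<beta> * (real U * 2 ^ U)"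
text \<open>For y below this level the cubic Taylor remainder, bounded by C y^3 / \<alpha>^7, is at
  most \<alpha> b y^2 / 4.\<close>

definition \<delta> :: real where "\<delta> = min 1 (\<alpha> ^ 8 * b / (4 * (C + 1)))"
definition X0 :: real where "X0 = 16 / (\<alpha> ^ 3 * b)"

lemma eps_pos: "0 < \<epsilon>" and x_nonneg: "0 \<le> x k" and xi_pos: "0 < \<xi>" and W0_nonneg: "0 \<le> W0"
  and X0_pos: "0 < X0"
proof -
  show "0 < \<epsilon>" using r_gt by (simp add: \<epsilon>_def)
  show "0 \<le> x k" for k using x(3)[of k] by simp
  show "0 < \<xi>" unfolding \<xi>_def dot_def using x(3) v_pos by (intro sum_pos) auto
  show "0 \<le> W0" using beta_pos by (simp add: W0_def)
  show "0 < X0" using alpha b by (simp add: X0_def)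
qed

lemma dot_remainder: "dot v (\<lambda>k. mv A x k - F x k) = \<epsilon> * \<xi>"
  unfolding x(2) by (simp add: dot_diff dot_mv \<xi>_def \<epsilon>_def left_diff_distrib)

text \<open>The fixed point satisfies A x = x + (A x - F x), an approximate eigenvector equation
  with \<open>g = 1\<close>. The defect is nonnegative, so its norm is its pairing with
  \<open>v\<close>, which is \<epsilon> \<xi>.\<close>

lemma wnorm_w: "wnorm v w \<le> W0 * (\<epsilon> * \<xi>)"
proof -
  have "(1 ^ U - r ^ U + \<beta>) * wnorm v (\<lambda>k. x k - dot v x * u k)
      \<le> real U * 2 ^ U * (2 * wnorm v (\<lambda>k. mv A x k - F x k))"
    by (rule resolvent) (use x(2) r_le in auto)
  moreover have "wnorm v (\<lambda>k. mv A x k - F x k) = \<epsilon> * \<xi>"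
    using dot_remainder F_bounds(3)[OF x(1)] by simp
  moreover have "\<beta> / 2 * wnorm v w \<le> (1 ^ U - r ^ U + \<beta>) * wnorm v w"
    using r_power by (intro mult_right_mono dot_nonneg v_nonneg) auto
  ultimately have "\<beta> / 2 * wnorm v w \<le> real U * 2 ^ U * (2 * (\<epsilon> * \<xi>))"
    by (simp add: w_def \<xi>_def)
  then show ?thesis using beta_pos by (simp add: W0_def field_simps)
qed

text \<open>Expanding at \<open>x\<close> itself is of no use before \<open>x\<close> is known to be
  small. Instead a constant vector y below \<open>x\<close> with y <= \<delta> is expanded: its
  quadratic term gives a lower bound of order y^2, and monotonicity of A - F gives the upper bound
  \<epsilon> \<xi>. If y is comparable to \<xi>, dividing by \<xi> finishes the proof.\<close>

lemma xi_le:
  assumes small: "W0 * \<epsilon> \<le> \<alpha>\<^sup>2 / 2" "\<epsilon> < \<alpha>\<^sup>2 * b * \<delta>\<^sup>2 / 4"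
  shows "\<xi> \<le> X0 * \<epsilon>"
proof -
  define y where "y = min (\<xi> * \<alpha> / 2) \<delta>"
  define z where "z = (\<lambda>_::'i. y)"
  have dl: "0 < \<delta>" "\<delta> \<le> 1" using alpha b C_nonneg by (auto simp: \<delta>_def)
  have y: "0 < y" "y \<le> \<delta>" "y \<le> \<xi> * \<alpha> / 2" using dl xi_pos alpha by (auto simp: y_def)
  have inCz: "inC z" using y dl by (simp add: z_def inC_def)
  have zx: "z k \<le> x k" for k
  proof -
    have "\<bar>w k\<bar> \<le> wnorm v w / \<alpha>" by (rule le_dot[of "\<lambda>k. \<bar>w k\<bar>"]) simp
    also have "\<dots> \<le> W0 * (\<epsilon> * \<xi>) / \<alpha>" using wnorm_w alpha by (intro divide_right_mono) auto
    also have "\<dots> \<le> \<alpha>\<^sup>2 / 2 * \<xi> / \<alpha>"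
      using mult_right_mono[OF small(1), of \<xi>] xi_pos alpha by (intro divide_right_mono) (auto simp: mult.assoc)
    also have "\<dots> = \<xi> * \<alpha> / 2" using alpha by (simp add: power2_eq_square)
    finally have "\<bar>w k\<bar> \<le> \<xi> * \<alpha> / 2" .
    moreover have "\<xi> * \<alpha> \<le> \<xi> * u k" using xi_pos u_bounds by (intro mult_left_mono) auto
    moreover have "x k = \<xi> * u k + w k" by (simp add: w_def)
    ultimately show ?thesis using y by (simp add: z_def)
  qed
  have "dot v (\<lambda>k. mv A z k - F z k) \<le> dot v (\<lambda>k. mv A x k - F x k)"
  proof (intro dot_mono v_nonneg)
    fix k show "mv A z k - F z k \<le> mv A x k - F x k"
      using F_Lip[OF inCz zx, of k] by linarith
  qed
  then have up: "dot v (\<lambda>k. mv A z k - F z k) \<le> \<epsilon> * \<xi>" by (simp only: dot_remainder)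
  have quadz: "quad (b2 k) z z = y\<^sup>2 * (\<Sum>l\<in>UNIV. \<Sum>m\<in>UNIV. b2 k l m)" for k
    by (simp add: quad_def z_def sum_distrib_left power2_eq_square mult_ac)
  have quad_low: "\<alpha> * b * y\<^sup>2 \<le> dot v (\<lambda>k. quad (b2 k) z z)"
  proof -
    have "\<alpha> * b * y\<^sup>2 \<le> \<alpha> * (\<Sum>k\<in>UNIV. \<Sum>l\<in>UNIV. \<Sum>m\<in>UNIV. b2 k l m) * y\<^sup>2"
      using alpha b by (intro mult_right_mono mult_left_mono) auto
    also have "\<dots> = (\<Sum>k\<in>UNIV. \<alpha> * (y\<^sup>2 * (\<Sum>l\<in>UNIV. \<Sum>m\<in>UNIV. b2 k l m)))"
      by (simp add: sum_distrib_left sum_distrib_right mult_ac)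
    also have "\<dots> \<le> dot v (\<lambda>k. quad (b2 k) z z)"
      unfolding dot_def quadz using v_bounds b2_bounds
      by (intro sum_mono mult_right_mono) (auto intro!: mult_nonneg_nonneg sum_nonneg)
    finally show ?thesis .
  qed
  have cubic_up: "C / \<alpha> ^ 4 * dot v z ^ 3 \<le> \<alpha> * b / 4 * y\<^sup>2"
  proof -
    have "dot v z \<le> y / \<alpha>" by (rule dot_v_le) (use y in \<open>auto simp: z_def\<close>)
    then have "dot v z ^ 3 \<le> (y / \<alpha>) ^ 3" using y by (intro power_mono dot_nonneg v_nonneg) (auto simp: z_def)
    then have "C / \<alpha> ^ 4 * dot v z ^ 3 \<le> C / \<alpha> ^ 4 * (y / \<alpha>) ^ 3"
      using C_nonneg alpha by (intro mult_left_mono) auto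
    also have "\<dots> = C * y / \<alpha> ^ 7 * y\<^sup>2" by (simp add: power_divide eval_nat_numeral)
    also have "\<dots> \<le> \<alpha> * b / 4 * y\<^sup>2"
    proof (rule mult_right_mono)
      have "C * y \<le> (C + 1) * (\<alpha> ^ 8 * b / (4 * (C + 1)))"
        using y C_nonneg by (intro mult_mono) (auto simp: \<delta>_def)
      also have "\<dots> = \<alpha> ^ 8 * b / 4" using C_nonneg by (simp add: field_simps)
      also have "\<dots> = \<alpha> ^ 7 * (\<alpha> * b / 4)" by (simp add: eval_nat_numeral)
      finally show "C * y / \<alpha> ^ 7 \<le> \<alpha> * b / 4" using alpha by (simp add: pos_divide_le_eq mult.commute)
    qed simp
    finally show ?thesis .
  qed
  have "c / 4 \<le> e" if "c \<le> q" "R \<le> d" "d = c / 4" "\<bar>D - q / 2\<bar> \<le> R" "D \<le> e" for c q R d D e :: real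
    using that by linarith
  from this[OF quad_low cubic_up _ dot_quad_remainder[OF inCz] up]
  have low: "\<alpha> * b / 4 * y\<^sup>2 \<le> \<epsilon> * \<xi>" by simp
  have xi1: "\<xi> \<le> 1 / \<alpha>" unfolding \<xi>_def by (rule dot_v_le) (use x(1) in \<open>auto simp: inC_def\<close>)
  \<comment> \<open>At y = \<delta> the lower bound would be a fixed positive constant, whereas
    \<xi> <= 1 / \<alpha> makes the upper bound of order \<epsilon>.\<close>
  have "y \<noteq> \<delta>"
  proof
    assume "y = \<delta>"
    then have "\<alpha> * b / 4 * \<delta>\<^sup>2 \<le> \<epsilon> * (1 / \<alpha>)"
      using low[unfolded \<open>y = \<delta>\<close>] mult_left_mono[OF xi1, of \<epsilon>] eps_pos by linarith
    then have "\<alpha>\<^sup>2 * b * \<delta>\<^sup>2 / 4 \<le> \<epsilon>" using alpha by (simp add: field_simps power2_eq_square)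
    then show False using small(2) by simp
  qed
  then have y_eq: "y = \<xi> * \<alpha> / 2" by (auto simp: y_def min_def split: if_splits)
  have "(\<alpha> ^ 3 * b / 16 * \<xi>) * \<xi> \<le> \<epsilon> * \<xi>"
    using low[unfolded y_eq] by (simp add: power2_eq_square power3_eq_cube mult_ac)
  then have "\<alpha> ^ 3 * b / 16 * \<xi> \<le> \<epsilon>" using xi_pos by simp
  then show ?thesis using alpha b by (simp add: X0_def field_simps)
qed

text \<open>Pairing the fixed point equation with \<open>v\<close> gives \<epsilon> \<xi> = Q
  \<xi>^2 up to third order; positivity of \<xi> permits division by it.\<close>

lemma Q_xi:
  assumes xi: "\<xi> \<le> X0 * \<epsilon>"
  shows "\<bar>\<epsilon> - Q * \<xi>\<bar> \<le> (C / \<alpha> ^ 3 * W0 * X0 + C / \<alpha> ^ 4 * X0\<^sup>2) * \<epsilon>\<^sup>2"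
proof -
  have 1: "\<bar>\<epsilon> * \<xi> - dot v (\<lambda>k. quad (b2 k) x x) / 2\<bar> \<le> C / \<alpha> ^ 4 * \<xi> ^ 3"
    using dot_quad_remainder[OF x(1)] unfolding dot_remainder \<xi>_def[symmetric] .
  have 2: "\<bar>dot v (\<lambda>k. quad (b2 k) x x) / 2 - Q * \<xi>\<^sup>2\<bar> \<le> C / \<alpha> ^ 3 * \<xi> * (W0 * (\<epsilon> * \<xi>))"
    unfolding \<xi>_def
    by (rule quad_projection) (use wnorm_w x_nonneg in \<open>auto simp: w_def \<xi>_def\<close>)
  have "(\<epsilon> - Q * \<xi>) * \<xi> = \<epsilon> * \<xi> - Q * \<xi>\<^sup>2" by (simp add: power2_eq_square algebra_simps)
  then have "\<bar>\<epsilon> - Q * \<xi>\<bar> * \<xi> = \<bar>\<epsilon> * \<xi> - Q * \<xi>\<^sup>2\<bar>"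
    using xi_pos by (metis abs_mult abs_of_pos)
  also have "\<dots> \<le> (C / \<alpha> ^ 3 * W0 * \<epsilon> * \<xi> + C / \<alpha> ^ 4 * \<xi>\<^sup>2) * \<xi>"
    using 1 2 by (simp add: power2_eq_square power3_eq_cube algebra_simps)
  finally have "\<bar>\<epsilon> - Q * \<xi>\<bar> \<le> C / \<alpha> ^ 3 * W0 * \<epsilon> * \<xi> + C / \<alpha> ^ 4 * \<xi>\<^sup>2" using xi_pos by simp
  also have "\<dots> \<le> C / \<alpha> ^ 3 * W0 * \<epsilon> * (X0 * \<epsilon>) + C / \<alpha> ^ 4 * (X0 * \<epsilon>)\<^sup>2"
    using xi xi_pos C_nonneg alpha W0_nonneg eps_pos by (intro add_mono mult_left_mono power_mono) auto
  finally show ?thesis by (simp add: power2_eq_square algebra_simps)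
qed

text \<open>\<open>K3 * \<epsilon>\<close> bounds the drop of the Perron root, and
  \<open>K4 * \<epsilon>\<close> the distance between the eigenvector of the perturbed matrix and
  \<open>u\<close>.\<close>

definition K3 :: real where "K3 = 2 * C * X0 / \<alpha> ^ 3"
definition K4 :: real where "K4 = 2 * W0 * K3"

text \<open>The difference A - B is of first order in x, and r - g is obtained by pairing
  (A - B) y with the left eigenvector of A.\<close>
lemma perturbed_root:
  fixes B :: "'i \<Rightarrow> 'i \<Rightarrow> real" and y :: "'i \<Rightarrow> real"
  assumes xi: "\<xi> \<le> X0 * \<epsilon>" and S: "sum x UNIV \<le> 1"
    and H: "\<And>k l. B k l \<le> A k l" "\<And>k l. \<bar>A k l - B k l - dot (b2 k l) x\<bar> \<le> C * (sum x UNIV)\<^sup>2"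
    and y: "\<And>k. 0 < y k" "mv B y = (\<lambda>k. g * y k)" "dot v y = 1" and g: "0 \<le> g"
    and small: "K3 * \<epsilon> \<le> 1" "real U * (K3 * \<epsilon>) \<le> \<beta> / 4"
  shows "\<bar>r - g - 2 * Q * \<xi>\<bar> \<le> (C * (X0 / \<alpha>)\<^sup>2 / \<alpha> + C * (X0 / \<alpha>) * (K4 / \<alpha>) + C / \<alpha> * (W0 * X0 / \<alpha>)) / \<alpha> * \<epsilon>\<^sup>2"
proof -
  define S where "S = sum x UNIV"
  have S0: "0 \<le> S" "S \<le> 1" "S \<le> \<xi> / \<alpha>"
    using S sum_le_dot[of x] x_nonneg by (auto simp: S_def sum_nonneg \<xi>_def)
  have S1: "S \<le> X0 / \<alpha> * \<epsilon>"
  proof -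
    have "\<xi> / \<alpha> \<le> X0 * \<epsilon> / \<alpha>" using xi alpha by (intro divide_right_mono) auto
    then show ?thesis using S0 by simp
  qed
  define e where "e = (\<lambda>k. \<Sum>l\<in>UNIV. (A k l - B k l) * y l)"
  have y0: "0 \<le> y k" for k using y(1)[of k] by simp
  have sy: "sum y UNIV \<le> 1 / \<alpha>" using sum_le_dot[of y] y0 y(3) by simp
  have sy0: "0 \<le> sum y UNIV" using y0 by (intro sum_nonneg) auto
  have e0: "0 \<le> e k" for k unfolding e_def using H(1) y0 by (intro sum_nonneg mult_nonneg_nonneg) auto
  have Ay: "mv A y k = g * y k + e k" for k
  proof -
    have "mv A y k = mv B y k + e k"
      by (simp add: mv_def e_def sum.distrib[symmetric] algebra_simps)
    then show ?thesis by (simp add: y(2))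
  qed
  have de: "dot v e = r - g"
  proof -
    have "mv A y = (\<lambda>k. g * y k + e k)" using Ay by auto
    then have "r * dot v y = g * dot v y + dot v e" using dot_mv[of y] by (simp add: dot_add dot_scale)
    then show ?thesis by (simp add: y(3))
  qed
  have b2x: "\<bar>dot (b2 k l) x\<bar> \<le> C * S" for k l
  proof -
    have "dot (b2 k l) x \<le> (\<Sum>m\<in>UNIV. C * x m)"
      unfolding dot_def using b2_bounds x_nonneg by (intro sum_mono mult_right_mono) auto
    moreover have "0 \<le> dot (b2 k l) x" using b2_bounds x_nonneg by (intro dot_nonneg) auto
    ultimately show ?thesis by (simp add: S_def sum_distrib_left)
  qed
  have Hle: "A k l - B k l \<le> 2 * C * S" for k l
  proof -
    have "C * S\<^sup>2 \<le> C * S"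
      using C_nonneg S0 by (intro mult_left_mono) (auto simp: power2_eq_square mult_left_le)
    then show ?thesis using H(2)[of k l] b2x[of k l] by (simp add: S_def[symmetric])
  qed
  have "e k \<le> 2 * C * S / \<alpha>" for k
  proof -
    have "e k \<le> (\<Sum>l\<in>UNIV. 2 * C * S * y l)"
      unfolding e_def using Hle y0 by (intro sum_mono mult_right_mono) auto
    also have "\<dots> = 2 * C * S * sum y UNIV" by (simp add: sum_distrib_left)
    also have "\<dots> \<le> 2 * C * S * (1 / \<alpha>)" using C_nonneg S0 sy by (intro mult_left_mono) auto
    finally show ?thesis by simp
  qed
  then have "dot v e \<le> 2 * C * S / \<alpha> / \<alpha>"
    using C_nonneg S0 alpha by (intro dot_v_le) auto
  also have "\<dots> \<le> 2 * C * (X0 / \<alpha> * \<epsilon>) / \<alpha> / \<alpha>"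
    using C_nonneg S1 alpha by (intro divide_right_mono mult_left_mono) auto
  also have "\<dots> = K3 * \<epsilon>" by (simp add: K3_def power3_eq_cube)
  finally have rg: "r - g \<le> K3 * \<epsilon>" by (simp add: de)
  have rg0: "0 \<le> r - g" unfolding de[symmetric] by (intro dot_nonneg v_nonneg e0)
  \<comment> \<open>Together with \<open>r ^ U \<le> 1 + \<beta> / 2\<close> this leaves at least
    \<beta> / 4 for the factor g^U - r^U + \<beta> in \<open>resolvent\<close>.\<close>
  have gU: "1 - \<beta> / 4 \<le> g ^ U"
  proof -
    have "1 + real U * (- (K3 * \<epsilon>)) \<le> (1 + (- (K3 * \<epsilon>))) ^ U"
      by (rule Bernoulli_inequality) (use small in auto)
    also have "\<dots> \<le> g ^ U" using small rg r_gt by (intro power_mono) auto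
    finally show ?thesis using small by simp
  qed
  define w' where "w' = (\<lambda>k. y k - u k)"
  have w': "wnorm v w' \<le> K4 * \<epsilon>"
  proof -
    have "(g ^ U - r ^ U + \<beta>) * wnorm v (\<lambda>k. y k - dot v y * u k) \<le> real U * 2 ^ U * (2 * wnorm v e)"
      by (rule resolvent) (use Ay g rg0 r_le in auto)
    moreover have "wnorm v e = r - g" using e0 de by simp
    moreover have "\<beta> / 4 * wnorm v w' \<le> (g ^ U - r ^ U + \<beta>) * wnorm v w'"
      using gU r_power by (intro mult_right_mono dot_nonneg v_nonneg) auto
    ultimately have "\<beta> / 4 * wnorm v w' \<le> real U * 2 ^ U * (2 * (r - g))" by (simp add: w'_def y(3))
    also have "\<dots> \<le> real U * 2 ^ U * (2 * (K3 * \<epsilon>))" using rg by (intro mult_left_mono) auto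
    finally show ?thesis using beta_pos by (simp add: K4_def W0_def field_simps)
  qed
  have W: "(\<Sum>k\<in>UNIV. \<bar>w' k\<bar>) \<le> K4 / \<alpha> * \<epsilon>" "(\<Sum>k\<in>UNIV. \<bar>w k\<bar>) \<le> W0 * X0 / \<alpha> * \<epsilon>\<^sup>2"
  proof -
    have "(\<Sum>k\<in>UNIV. \<bar>w' k\<bar>) \<le> wnorm v w' / \<alpha>" by (rule sum_le_dot) simp
    also have "\<dots> \<le> K4 * \<epsilon> / \<alpha>" using w' alpha by (intro divide_right_mono) auto
    finally show "(\<Sum>k\<in>UNIV. \<bar>w' k\<bar>) \<le> K4 / \<alpha> * \<epsilon>" by simp
    have "(\<Sum>k\<in>UNIV. \<bar>w k\<bar>) \<le> wnorm v w / \<alpha>" by (rule sum_le_dot) simp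
    also have "\<dots> \<le> W0 * (\<epsilon> * \<xi>) / \<alpha>" using wnorm_w alpha by (intro divide_right_mono) auto
    also have "\<dots> \<le> W0 * (\<epsilon> * (X0 * \<epsilon>)) / \<alpha>"
      using xi eps_pos W0_nonneg alpha by (intro divide_right_mono mult_left_mono) auto
    finally show "(\<Sum>k\<in>UNIV. \<bar>w k\<bar>) \<le> W0 * X0 / \<alpha> * \<epsilon>\<^sup>2" by (simp add: power2_eq_square mult_ac)
  qed
  define K where "K = C * (X0 / \<alpha>)\<^sup>2 / \<alpha> + C * (X0 / \<alpha>) * (K4 / \<alpha>) + C / \<alpha> * (W0 * X0 / \<alpha>)"
  have term_le: "\<bar>e k - \<xi> * quad (b2 k) u u\<bar> \<le> K * \<epsilon>\<^sup>2" for k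
  proof -
    \<comment> \<open>The three terms are the Taylor remainder of the derivative matrix, the
      replacement of \<open>y\<close> by \<open>u\<close>, and the replacement of \<open>x\<close>
      by \<xi> \<open>u\<close>; each is of order \<epsilon>^2.\<close>
    have split: "e k - \<xi> * quad (b2 k) u u = (\<Sum>l\<in>UNIV. (A k l - B k l - dot (b2 k l) x) * y l)
        + (\<Sum>l\<in>UNIV. dot (b2 k l) x * w' l) + quad (b2 k) u w"
    proof -
      have "quad (b2 k) u w = (\<Sum>l\<in>UNIV. dot (b2 k l) x * u l) - \<xi> * quad (b2 k) u u"
        by (simp add: quad_eq_dot w_def dot_diff dot_scale)
          (simp add: dot_def sum_subtractf right_diff_distrib left_diff_distrib sum_distrib_left mult_ac)
      moreover have "e k = (\<Sum>l\<in>UNIV. (A k l - B k l - dot (b2 k l) x) * y l + dot (b2 k l) x * w' l + dot (b2 k l) x * u l)"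
        unfolding e_def w'_def by (intro sum.cong refl) (simp add: algebra_simps)
      ultimately show ?thesis by (simp add: sum.distrib)
    qed
    have "\<bar>\<Sum>l\<in>UNIV. (A k l - B k l - dot (b2 k l) x) * y l\<bar> \<le> (\<Sum>l\<in>UNIV. C * S\<^sup>2 * y l)"
      by (rule order_trans[OF sum_abs], rule sum_mono)
        (use H(2) y0 in \<open>auto simp: abs_mult S_def intro!: mult_right_mono\<close>)
    also have "\<dots> = C * S\<^sup>2 * sum y UNIV" by (simp add: sum_distrib_left)
    also have "\<dots> \<le> C * (X0 / \<alpha> * \<epsilon>)\<^sup>2 * (1 / \<alpha>)"
      using C_nonneg S0 S1 sy sy0 by (intro mult_mono power_mono) auto
    also have "\<dots> = C * (X0 / \<alpha>)\<^sup>2 / \<alpha> * \<epsilon>\<^sup>2"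
      by (simp add: power2_eq_square mult_ac)
    finally have 1: "\<bar>\<Sum>l\<in>UNIV. (A k l - B k l - dot (b2 k l) x) * y l\<bar> \<le> C * (X0 / \<alpha>)\<^sup>2 / \<alpha> * \<epsilon>\<^sup>2" .
    have "\<bar>\<Sum>l\<in>UNIV. dot (b2 k l) x * w' l\<bar> \<le> (\<Sum>l\<in>UNIV. C * S * \<bar>w' l\<bar>)"
      by (rule order_trans[OF sum_abs], rule sum_mono)
        (use b2x in \<open>auto simp: abs_mult intro!: mult_right_mono\<close>)
    also have "\<dots> = C * S * (\<Sum>l\<in>UNIV. \<bar>w' l\<bar>)" by (simp add: sum_distrib_left)
    also have "\<dots> \<le> C * (X0 / \<alpha> * \<epsilon>) * (K4 / \<alpha> * \<epsilon>)"
      using C_nonneg S0 S1 W X0_pos alpha eps_pos by (intro mult_mono) (auto intro: sum_nonneg)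
    finally have 2: "\<bar>\<Sum>l\<in>UNIV. dot (b2 k l) x * w' l\<bar> \<le> C * (X0 / \<alpha>) * (K4 / \<alpha>) * \<epsilon>\<^sup>2"
      by (simp add: power2_eq_square mult_ac)
    have "\<bar>quad (b2 k) u w\<bar> \<le> C * (\<Sum>l\<in>UNIV. \<bar>u l\<bar>) * (\<Sum>l\<in>UNIV. \<bar>w l\<bar>)" by (rule abs_quad_le)
    also have "\<dots> \<le> C * (1 / \<alpha>) * (W0 * X0 / \<alpha> * \<epsilon>\<^sup>2)"
      using C_nonneg W sum_u_le u_nonneg alpha by (intro mult_mono) (auto intro: sum_nonneg)
    finally have 3: "\<bar>quad (b2 k) u w\<bar> \<le> C / \<alpha> * (W0 * X0 / \<alpha>) * \<epsilon>\<^sup>2" by (simp add: mult_ac)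
    have "K * \<epsilon>\<^sup>2 = C * (X0 / \<alpha>)\<^sup>2 / \<alpha> * \<epsilon>\<^sup>2 + C * (X0 / \<alpha>) * (K4 / \<alpha>) * \<epsilon>\<^sup>2 + C / \<alpha> * (W0 * X0 / \<alpha>) * \<epsilon>\<^sup>2"
      by (simp add: K_def distrib_right)
    then show ?thesis unfolding split using 1 2 3 by linarith
  qed
  have K0: "0 \<le> K * \<epsilon>\<^sup>2" using term_le[of undefined] by linarith
  have "\<bar>dot v (\<lambda>k. e k - \<xi> * quad (b2 k) u u)\<bar> \<le> wnorm v (\<lambda>k. e k - \<xi> * quad (b2 k) u u)"
    by (rule abs_dot_le) (rule v_nonneg)
  also have "\<dots> \<le> K * \<epsilon>\<^sup>2 / \<alpha>" by (rule dot_v_le) (use term_le K0 in auto)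
  finally show ?thesis by (simp add: dot_diff dot_scale de Q_def K_def mult_ac)
qed

definition Kfin :: real where
  "Kfin = (C * (X0 / \<alpha>)\<^sup>2 / \<alpha> + C * (X0 / \<alpha>) * (K4 / \<alpha>) + C / \<alpha> * (W0 * X0 / \<alpha>)) / \<alpha>
     + 2 * (C / \<alpha> ^ 3 * W0 * X0 + C / \<alpha> ^ 4 * X0\<^sup>2)"

text \<open>Write 1 - g = (r - g) - \<epsilon>. The first term is 2 Q \<xi> and Q \<xi> is
  \<epsilon>, both up to \<epsilon>^2, so 1 - g is \<epsilon> up to that order.\<close>

lemma root_estimate:
  fixes B :: "'i \<Rightarrow> 'i \<Rightarrow> real"
  assumes small: "W0 * \<epsilon> \<le> \<alpha>\<^sup>2 / 2" "\<epsilon> < \<alpha>\<^sup>2 * b * \<delta>\<^sup>2 / 4" "X0 * \<epsilon> / \<alpha> < 1"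
      "K3 * \<epsilon> \<le> 1" "real U * (K3 * \<epsilon>) \<le> \<beta> / 4"
    and B: "\<And>k l. 0 \<le> B k l" "\<And>k l. 0 < A k l \<Longrightarrow> (\<And>i. x i < 1) \<Longrightarrow> 0 < B k l"
    and H: "\<And>k l. B k l \<le> A k l" "\<And>k l. \<bar>A k l - B k l - dot (b2 k l) x\<bar> \<le> C * (sum x UNIV)\<^sup>2"
    and U: "0 < U"
  shows "\<bar>1 - perron_root B - \<epsilon>\<bar> \<le> Kfin * \<epsilon>\<^sup>2"
proof -
  have xi: "\<xi> \<le> X0 * \<epsilon>" by (rule xi_le) (use small in auto)
  have "sum x UNIV \<le> \<xi> / \<alpha>" unfolding \<xi>_def by (rule sum_le_dot) (rule x_nonneg)
  also have "\<dots> \<le> X0 * \<epsilon> / \<alpha>" using xi alpha by (intro divide_right_mono) auto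
  also have "\<dots> < 1" by (rule small)
  finally have S: "sum x UNIV < 1" .
  have x1: "x i < 1" for i
    using member_le_sum[of i UNIV x] x_nonneg S by simp
  \<comment> \<open>Where \<open>A\<close> has a positive entry so has \<open>B\<close>, hence
    positivity of the powers carries over and \<open>B\<close> has its own Perron pair.\<close>
  have Bpos: "0 < matpow B m k l" if "0 < matpow A m k l" for m k l
    using that
  proof (induction m arbitrary: l)
    case 0
    then show ?case by simp
  next
    case (Suc m)
    have "\<exists>j. 0 < matpow A m k j * A j l"
    proof (rule ccontr)
      assume "\<not> ?thesis"
      then have "matpow A (Suc m) k l \<le> 0" by (auto intro!: sum_nonpos simp: not_less)
      then show False using Suc.prems by simp
    qed
    then obtain j where "0 < matpow A m k j * A j l" ..
    moreover have m0: "0 \<le> matpow A m k j" by (rule matpow_nonneg) (rule nonneg)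
    ultimately have j: "0 < matpow A m k j" "0 < A j l"
      using m0 nonneg[of j l] by (auto simp: zero_less_mult_iff)
    have "0 < matpow B m k j * B j l" using Suc.IH[OF j(1)] B(2)[OF j(2) x1] by simp
    then show ?case unfolding matpow.simps
      by (intro sum_pos2[of _ j]) (auto intro!: mult_nonneg_nonneg matpow_nonneg B(1))
  qed
  have "0 < matpow B U k l" for k l
  proof (rule Bpos)
    have "0 < \<beta> * u k * v l" using beta_pos u_pos v_pos by simp
    then show "0 < matpow A U k l" using minorize[of k l] by linarith
  qed
  then obtain g y' v' where P: "perron_pair B g y' v'"
    using perron_pair_exists[of B U] B(1) U by blast
  interpret B: perron_pair B g y' v' by fact
  \<comment> \<open>The eigenvector of \<open>B\<close> is normalised against the left eigenvector
    of \<open>A\<close>, so that it can be compared with \<open>u\<close>.\<close>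
  define c where "c = dot v y'"
  have c: "0 < c" unfolding c_def dot_def using v_pos B.u_pos by (intro sum_pos) auto
  define y where "y = (\<lambda>k. 1 / c * y' k)"
  have root: "\<bar>r - g - 2 * Q * \<xi>\<bar> \<le> (C * (X0 / \<alpha>)\<^sup>2 / \<alpha> + C * (X0 / \<alpha>) * (K4 / \<alpha>) + C / \<alpha> * (W0 * X0 / \<alpha>)) / \<alpha> * \<epsilon>\<^sup>2"
  proof (rule perturbed_root[where B = B and y = y])
    show "mv B y = (\<lambda>k. g * y k)" unfolding y_def mv_scale B.right_eigen by auto
    show "dot v y = 1" unfolding y_def dot_scale c_def[symmetric] using c by simp
    show "0 < y k" for k using c B.u_pos[of k] by (simp add: y_def)
  qed (use xi S H B.r_nonneg small in auto)
  have "\<bar>1 - g - \<epsilon>\<bar> \<le> (K' + 2 * K'') * \<epsilon>\<^sup>2"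
    if "\<bar>r - g - 2 * Q * \<xi>\<bar> \<le> K' * \<epsilon>\<^sup>2" "\<bar>\<epsilon> - Q * \<xi>\<bar> \<le> K'' * \<epsilon>\<^sup>2" for K' K''
  proof -
    have "(K' + 2 * K'') * \<epsilon>\<^sup>2 = K' * \<epsilon>\<^sup>2 + 2 * (K'' * \<epsilon>\<^sup>2)" by (simp add: algebra_simps)
    then show ?thesis using that unfolding \<epsilon>_def by linarith
  qed
  from this[OF root Q_xi[OF xi]] show ?thesis unfolding B.perron_root_eq Kfin_def .
qed

end

lemma rho_mu_subcritical:
  fixes p :: "'i::finite \<Rightarrow> ('i \<Rightarrow> nat) pmf"
  assumes K: "inK a b c U p" and const: "0 < a" "0 < U" "0 < c" and r: "gw_rho p < 1"
  shows "rho_mu p = gw_rho p"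
proof -
  obtain x where x: "inC x" "ext_prob p = (\<lambda>k. 1 - x k)" "\<And>k. Phi p x k = x k"
    using extinction_defect[of p, OF inK_moment[OF K const(3)]] by blast
  have "x k = 0" for k
    by (rule near_critical.subcritical_fixpoint[OF gw_near_critical[OF K const] x(1,3) r]) (use r in simp)
  then have "ext_prob p = (\<lambda>_. 1)" by (simp add: x(2))
  then show ?thesis by (simp add: rho_mu_def gw_rho_def meanM_def)
qed

lemma rho_mu_supercritical:
  fixes p :: "nat \<Rightarrow> 'i::finite \<Rightarrow> ('i \<Rightarrow> nat) pmf"
  assumes const: "0 < a" "0 < U" "0 < c" "0 < b" and K: "\<And>k. inK a b c U (p k)"
    and rho: "(\<lambda>k. gw_rho (p k)) \<longlonglongrightarrow> 1" "\<And>k. 1 < gw_rho (p k)"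
  shows "(\<lambda>k. (1 - rho_mu (p k)) / (gw_rho (p k) - 1)) \<longlonglongrightarrow> 1"
proof -
  define \<alpha> where "\<alpha> = a / 2 ^ U"
  define \<beta> where "\<beta> = min 1 (a * (a / 2 ^ U))"
  define C where "C = third_moment_const TYPE('i) c"
  define \<epsilon> where "\<epsilon> = (\<lambda>k. gw_rho (p k) - 1)"
  have al: "0 < \<alpha>" and be: "0 < \<beta>" using const by (auto simp: \<alpha>_def \<beta>_def)
  have C0: "0 \<le> C" using moment_le_nonneg[OF inK_moment[OF K const(3)]] by (simp add: C_def)
  have e0: "\<epsilon> \<longlonglongrightarrow> 0" using tendsto_diff[OF rho(1) tendsto_const[of 1]] by (simp add: \<epsilon>_def)
  have epos: "0 < \<epsilon> k" for k using rho(2)[of k] by (simp add: \<epsilon>_def)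
  \<comment> \<open>The constants of \<open>supercritical_fixpoint\<close> are restated outside the
    locale: they depend on the class only and have to be fixed before the index
    \<open>k\<close>.\<close>
  define W0 where "W0 = 4 / \<beta> * (real U * 2 ^ U)"
  define \<delta> where "\<delta> = min 1 (\<alpha> ^ 8 * b / (4 * (C + 1)))"
  define X0 where "X0 = 16 / (\<alpha> ^ 3 * b)"
  define K3 where "K3 = 2 * C * X0 / \<alpha> ^ 3"
  define K4 where "K4 = 2 * W0 * K3"
  define Kf where "Kf = (C * (X0 / \<alpha>)\<^sup>2 / \<alpha> + C * (X0 / \<alpha>) * (K4 / \<alpha>) + C / \<alpha> * (W0 * X0 / \<alpha>)) / \<alpha>
     + 2 * (C / \<alpha> ^ 3 * W0 * X0 + C / \<alpha> ^ 4 * X0\<^sup>2)"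
  have dl: "0 < \<delta>" using al const C0 by (simp add: \<delta>_def)
  have small: "\<forall>\<^sub>F k in sequentially. c * \<epsilon> k < d" if "0 < d" for c d
  proof -
    have "(\<lambda>k. c * \<epsilon> k) \<longlonglongrightarrow> c * 0" by (intro tendsto_intros e0)
    then show ?thesis using that by (intro order_tendstoD(2)) auto
  qed
  have pow: "\<forall>\<^sub>F k in sequentially. gw_rho (p k) ^ U < 1 + \<beta> / 2"
  proof -
    have "(\<lambda>k. gw_rho (p k) ^ U) \<longlonglongrightarrow> 1 ^ U" by (intro tendsto_intros rho)
    then show ?thesis using be by (intro order_tendstoD(2)) auto
  qed
  have s: "\<forall>\<^sub>F k in sequentially. W0 * \<epsilon> k < \<alpha>\<^sup>2 / 2"
    "\<forall>\<^sub>F k in sequentially. 1 * \<epsilon> k < \<alpha>\<^sup>2 * b * \<delta>\<^sup>2 / 4"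
    "\<forall>\<^sub>F k in sequentially. X0 / \<alpha> * \<epsilon> k < 1" "\<forall>\<^sub>F k in sequentially. K3 * \<epsilon> k < 1"
    "\<forall>\<^sub>F k in sequentially. real U * K3 * \<epsilon> k < \<beta> / 4" "\<forall>\<^sub>F k in sequentially. 1 * \<epsilon> k < 1"
    by (rule small; use al be const dl in simp)+
  have "\<forall>\<^sub>F k in sequentially. norm ((1 - rho_mu (p k)) / (gw_rho (p k) - 1) - 1) \<le> Kf * \<epsilon> k"
    using s(1) s(2) s(3) s(4) s(5) s(6) pow
  proof eventually_elim
    case (elim k)
    have r2: "gw_rho (p k) \<le> 2" using elim by (simp add: \<epsilon>_def)
    have P3: "moment_le (p k j) 3 C" for j unfolding C_def by (rule inK_moment[OF K const(3)])
    obtain x where x: "inC x" "ext_prob (p k) = (\<lambda>j. 1 - x j)" "\<And>j. Phi (p k) x j = x j"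
      and max: "\<forall>z. inC z \<and> (\<forall>j. z j \<le> Phi (p k) z j) \<longrightarrow> (\<forall>j. z j \<le> x j)"
      using extinction_defect[of "p k" C, OF P3] by blast
    interpret nc: near_critical "meanM (p k)" "gw_rho (p k)" "gw_u (p k)" "gw_v (p k)" U \<beta> "Phi (p k)" "\<lambda>i. mean2 (p k i)" \<alpha> C
      unfolding \<alpha>_def \<beta>_def C_def by (rule gw_near_critical[OF K const(1-3) r2])
    obtain z where z: "inC z" "\<And>j. 0 < z j" "\<And>j. z j \<le> Phi (p k) z j"
      using nc.supercritical_subsolution[OF rho(2)] by blast
    \<comment> \<open>A strictly positive subsolution lies below the maximal one, which rules out
      the fixed point 0.\<close>
    have xpos: "0 < x j" for j using z(2)[of j] max z by (meson less_le_trans)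
    have xb: "\<And>i. 0 \<le> x i \<and> x i \<le> 1" using x(1) by (simp add: inC_def)
    have sf: "supercritical_fixpoint (meanM (p k)) (gw_rho (p k)) (gw_u (p k)) (gw_v (p k)) U \<beta> (Phi (p k)) (\<lambda>i. mean2 (p k i)) \<alpha> C x b"
    proof
      show "inC x" "\<And>j. Phi (p k) x j = x j" "\<And>j. 0 < x j" "0 < b" "1 < gw_rho (p k)" by (fact x xpos const rho)+
      show "gw_rho (p k) ^ U \<le> 1 + \<beta> / 2" using elim by simp
      have "second_deriv (p k) i l m = ennreal (mean2 (p k i) l m)" for i l m
        unfolding second_deriv_def by (rule pgf_deriv1_unitv2[OF P3]) simp
      then have "ennreal b \<le> ennreal (\<Sum>i\<in>UNIV. \<Sum>l\<in>UNIV. \<Sum>m\<in>UNIV. mean2 (p k i) l m)"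
        using K[of k] by (simp add: inK_def mean2_nonneg sum_nonneg)
      then show "b \<le> (\<Sum>i\<in>UNIV. \<Sum>l\<in>UNIV. \<Sum>m\<in>UNIV. mean2 (p k i) l m)"
        by (subst (asm) ennreal_le_iff) (auto intro!: sum_nonneg mean2_nonneg)
      fix z j assume z: "inC z" "\<And>j. z j \<le> x j"
      have "\<bar>pgf (p k j) (\<lambda>i. 1 - z i) - pgf (p k j) (\<lambda>i. 1 - x i)\<bar> \<le> (\<Sum>i\<in>UNIV. mean1 (p k j) i * \<bar>(1 - z i) - (1 - x i)\<bar>)"
        by (rule pgf_Lipschitz[OF P3]) (use z x in \<open>auto simp: inC_def\<close>)
      also have "\<dots> = (\<Sum>i\<in>UNIV. meanM (p k) j i * x i - meanM (p k) j i * z i)"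
        using z(2) by (intro sum.cong refl) (simp add: meanM_eq[OF P3] right_diff_distrib)
      also have "\<dots> = mv (meanM (p k)) x j - mv (meanM (p k)) z j"
        by (simp add: mv_def sum_subtractf)
      finally show "Phi (p k) x j - Phi (p k) z j \<le> mv (meanM (p k)) x j - mv (meanM (p k)) z j"
        by (simp add: Phi_def)
    qed
    have eqs: "supercritical_fixpoint.W0 U \<beta> = W0" "supercritical_fixpoint.X0 \<alpha> b = X0" "supercritical_fixpoint.\<delta> \<alpha> C b = \<delta>"
      "supercritical_fixpoint.\<epsilon> (gw_rho (p k)) = \<epsilon> k"
      by (simp_all add: supercritical_fixpoint.W0_def[OF sf] supercritical_fixpoint.X0_def[OF sf]
          supercritical_fixpoint.\<delta>_def[OF sf] supercritical_fixpoint.\<epsilon>_def[OF sf] W0_def X0_def \<delta>_def \<epsilon>_def)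
    have eqK3: "supercritical_fixpoint.K3 \<alpha> C b = K3"
      by (simp add: supercritical_fixpoint.K3_def[OF sf] eqs K3_def)
    have eqK4: "supercritical_fixpoint.K4 U \<beta> \<alpha> C b = K4"
      by (simp add: supercritical_fixpoint.K4_def[OF sf] eqs eqK3 K4_def)
    have eqKf: "supercritical_fixpoint.Kfin U \<beta> \<alpha> C b = Kf"
      by (simp add: supercritical_fixpoint.Kfin_def[OF sf] eqs eqK4 Kf_def)
    have "\<bar>1 - perron_root (Mmat (p k) (\<lambda>i. 1 - x i)) - \<epsilon> k\<bar> \<le> Kf * (\<epsilon> k)\<^sup>2"
      unfolding eqs(4)[symmetric] eqKf[symmetric]
    proof (rule supercritical_fixpoint.root_estimate[OF sf])
      show "0 \<le> Mmat (p k) (\<lambda>i. 1 - x i) j l" for j l by (simp add: Mmat_def)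
      show "0 < Mmat (p k) (\<lambda>i. 1 - x i) j l" if "0 < meanM (p k) j l" "\<And>i. x i < 1" for j l
        by (rule Mmat_pos[where p = "p k" and k = j, OF P3 xb])
          (use that in \<open>auto simp: meanM_eq[where p = "p k" and k = j, OF P3]\<close>)
      show "Mmat (p k) (\<lambda>i. 1 - x i) j l \<le> meanM (p k) j l" for j l
        unfolding meanM_eq[where p = "p k" and k = j, OF P3, simplified]
        by (rule Mmat_taylor(1)[where p = "p k" and k = j, OF P3 xb])
      show "\<bar>meanM (p k) j l - Mmat (p k) (\<lambda>i. 1 - x i) j l - dot (mean2 (p k j) l) x\<bar> \<le> C * (sum x UNIV)\<^sup>2" for j l
        unfolding meanM_eq[where p = "p k" and k = j, OF P3, simplified]
        by (rule Mmat_taylor(2)[where p = "p k" and k = j, OF P3 xb])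
    qed (use elim const in \<open>auto simp: eqs eqK3 mult.assoc\<close>)
    then have "\<bar>1 - rho_mu (p k) - \<epsilon> k\<bar> \<le> Kf * (\<epsilon> k)\<^sup>2" by (simp add: rho_mu_def x(2))
    then have "\<bar>1 - rho_mu (p k) - \<epsilon> k\<bar> / \<epsilon> k \<le> Kf * (\<epsilon> k)\<^sup>2 / \<epsilon> k"
      using epos[of k] by (intro divide_right_mono) auto
    moreover have "(1 - rho_mu (p k)) / \<epsilon> k - 1 = (1 - rho_mu (p k) - \<epsilon> k) / \<epsilon> k"
      using epos[of k] by (simp add: field_simps)
    moreover have er: "gw_rho (p k) - 1 = \<epsilon> k" by (simp add: \<epsilon>_def)
    ultimately show ?case using epos[of k]
      unfolding er by (simp add: abs_divide power2_eq_square)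
  qed
  moreover have "(\<lambda>k. Kf * \<epsilon> k) \<longlonglongrightarrow> 0" using tendsto_mult_left[OF e0, of Kf] by simp
  ultimately have "(\<lambda>k. (1 - rho_mu (p k)) / (gw_rho (p k) - 1) - 1) \<longlonglongrightarrow> 0"
    by (rule Lim_null_comparison)
  then show ?thesis by (simp add: Lim_null[symmetric])
qed

section \<open>The limit regimes\<close>

lemma tendsto_subseq_criterion:
  fixes X :: "nat \<Rightarrow> real"
  assumes "\<And>s :: nat \<Rightarrow> nat. strict_mono s \<Longrightarrow> \<exists>s'. strict_mono s' \<and> (\<lambda>k. X (s (s' k))) \<longlonglongrightarrow> L"
  shows "X \<longlonglongrightarrow> L"
proof (rule tendstoI, rule ccontr)
  fix e :: real assume e: "0 < e" and "\<not> (\<forall>\<^sub>F n in sequentially. dist (X n) L < e)"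
  then obtain s :: "nat \<Rightarrow> nat" where s: "strict_mono s" "\<And>k. \<not> dist (X (s k)) L < e"
    using not_eventually_sequentiallyD by blast
  obtain s' where "(\<lambda>k. X (s (s' k))) \<longlonglongrightarrow> L" using assms[OF s(1)] by blast
  from tendstoD[OF this e] have "\<forall>\<^sub>F k in sequentially. False" using s(2) by simp
  then show False by simp
qed

lemma bounded_subseq_converges:
  fixes f :: "nat \<Rightarrow> real"
  assumes "\<And>k. \<bar>f k\<bar> \<le> B"
  shows "\<exists>l s. strict_mono s \<and> (\<lambda>k. f (s k)) \<longlonglongrightarrow> l"
proof -
  have "bounded (range f)" by (rule boundedI[of _ B]) (use assms in auto)
  from bounded_imp_convergent_subsequence[OF this] show ?thesis
    by (force simp: o_def)
qed

text \<open>Since Q and the immigration parameter stay bounded, it suffices to treat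
  sequences along which they converge.\<close>
lemma laplace_asymptotics:
  fixes p :: "nat \<Rightarrow> 'i::finite \<Rightarrow> ('i \<Rightarrow> nat) pmf" and q :: "nat \<Rightarrow> ('i \<Rightarrow> nat) pmf"
    and t :: "'i \<Rightarrow> real" and n :: "nat \<Rightarrow> nat" and m :: "nat \<Rightarrow> real" and Y :: "real \<Rightarrow> real"
  assumes const: "0 < a" "0 < b" "0 < c" "0 < U" "0 < d2"
    and K: "\<And>k. inK a b c U (p k)" and J: "\<And>k. inJ d1 d2 (q k)"
    and t: "\<And>l. 0 \<le> t l"
    and rho: "(\<lambda>k. gw_rho (p k)) \<longlonglongrightarrow> 1"
    and m: "\<forall>\<^sub>F k in sequentially. 0 < m k"
    and m1: "(\<lambda>k. (\<Sum>i\<le>n k. gw_rho (p k) ^ i) / m k) \<longlonglongrightarrow> 0"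
    and m2: "(\<lambda>k. real (n k + 1) / m k) \<longlonglongrightarrow> 0"
    and m3: "\<forall>\<^sub>F k in sequentially. (\<Sum>j\<le>n k. \<Sum>i\<le>j. gw_rho (p k) ^ i) / m k \<le> S"
    and exact: "\<And>s e Q. strict_mono s \<Longrightarrow> 0 < Q \<Longrightarrow> (\<lambda>k. m (s k) * e k) \<longlonglongrightarrow> Q * sum t UNIV \<Longrightarrow>
        (\<lambda>k. fst (lin (gw_rho (p (s k))) (e k) (Suc (n (s k))))) \<longlonglongrightarrow> Y Q"
    and Y: "\<And>Q. 0 < Q \<Longrightarrow> 0 < Y Q" "\<And>Q. 0 < Q \<Longrightarrow> isCont Y Q"
  shows "(\<lambda>k. laplace_Y (p k) (q k) (n k) t (\<lambda>l. m k * gw_v (p k) l)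
    - Y (gw_Q (p k)) powr (- lam_u (p k) (q k) / gw_Q (p k))) \<longlonglongrightarrow> 0"
proof (rule tendsto_subseq_criterion)
  fix s :: "nat \<Rightarrow> nat" assume s: "strict_mono s"
  define \<beta> where "\<beta> = min 1 (a * (a / 2 ^ U))"
  define \<alpha> where "\<alpha> = a / 2 ^ U"
  define C where "C = third_moment_const TYPE('i) c"
  define D where "D = second_moment_const TYPE('i) d2"
  have be: "0 < \<beta>" and al: "0 < \<alpha>" using const by (auto simp: \<beta>_def \<alpha>_def)
  have "(\<lambda>k. gw_rho (p k) ^ U) \<longlonglongrightarrow> 1 ^ U" by (intro tendsto_intros rho)
  then have "\<forall>\<^sub>F k in sequentially. gw_rho (p k) ^ U < 1 + \<beta> / 2"
    using be by (intro order_tendstoD(2)) auto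
  then have "\<forall>\<^sub>F k in sequentially. gw_rho (p k) ^ U < 1 + \<beta> / 2 \<and> gw_rho (p k) < 2 \<and> 0 < m k
      \<and> (\<Sum>j\<le>n k. \<Sum>i\<le>j. gw_rho (p k) ^ i) / m k \<le> S"
    using order_tendstoD(2)[OF rho, of 2] m m3 by (simp add: eventually_conj_iff)
  then obtain N where N: "\<And>k. N \<le> k \<Longrightarrow> gw_rho (p k) ^ U < 1 + \<beta> / 2 \<and> gw_rho (p k) < 2 \<and> 0 < m k
      \<and> (\<Sum>j\<le>n k. \<Sum>i\<le>j. gw_rho (p k) ^ i) / m k \<le> S"
    unfolding eventually_sequentially by blast
  \<comment> \<open>Dropping the first \<open>N\<close> terms makes the eventual bounds hold at
    every index, as \<open>laplace_limit\<close> demands.\<close>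
  define s0 where "s0 = (\<lambda>k. s (k + N))"
  have s0N: "N \<le> s0 k" for k using seq_suble[OF s, of "k + N"] by (simp add: s0_def)
  have Qb: "\<alpha> ^ 3 * b / 2 \<le> gw_Q (p (s0 k))" "gw_Q (p (s0 k)) \<le> C / \<alpha> ^ 3" for k
  proof -
    have r2: "gw_rho (p (s0 k)) \<le> 2" using N[OF s0N[of k]] by simp
    show "\<alpha> ^ 3 * b / 2 \<le> gw_Q (p (s0 k))" "gw_Q (p (s0 k)) \<le> C / \<alpha> ^ 3"
      unfolding \<alpha>_def C_def by (rule gw_Q_bounds[OF K const(1,4,3) r2 const(2)])+
  qed
  have pos: "0 < \<alpha> ^ 3 * b / 2" using al const by simp
  have "\<bar>gw_Q (p (s0 k))\<bar> \<le> C / \<alpha> ^ 3" for k using Qb[of k] pos by linarith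
  \<comment> \<open>Two successive extractions: first \<open>Q\<close> converges, then the
    immigration parameter.\<close>
  then obtain Q' s1 where s1: "strict_mono s1" and Q1: "(\<lambda>k. gw_Q (p (s0 (s1 k)))) \<longlonglongrightarrow> Q'"
    using bounded_subseq_converges[of "\<lambda>k. gw_Q (p (s0 k))"] by blast
  have qm: "moment_le (q k) 2 D" for k unfolding D_def by (rule inJ_moment[OF J const(5)])
  have "\<bar>lam_u (p k) (q k)\<bar> \<le> D" for k
    using lam_u_bounds[OF K const(1,4) qm, of k k] by simp
  then obtain l' s2 where s2: "strict_mono s2" and l2: "(\<lambda>k. lam_u (p (s0 (s1 (s2 k)))) (q (s0 (s1 (s2 k))))) \<longlonglongrightarrow> l'"
    using bounded_subseq_converges[of "\<lambda>k. lam_u (p (s0 (s1 k))) (q (s0 (s1 k)))"] by blast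
  define s' where "s' = (\<lambda>k. s1 (s2 k) + N)"
  define f where "f = (\<lambda>k. s (s' k))"
  have s': "strict_mono s'" using s1 s2 by (simp add: s'_def strict_mono_def)
  have f: "strict_mono f" using s s' by (simp add: f_def strict_mono_def)
  have fN: "N \<le> f k" for k unfolding f_def s'_def using s0N by (simp add: s0_def)
  have Q2: "(\<lambda>k. gw_Q (p (f k))) \<longlonglongrightarrow> Q'"
    using LIMSEQ_subseq_LIMSEQ[OF Q1 s2] by (simp add: f_def s'_def s0_def o_def)
  have lam2: "(\<lambda>k. lam_u (p (f k)) (q (f k))) \<longlonglongrightarrow> l'"
    using l2 by (simp add: f_def s'_def s0_def)
  have "\<alpha> ^ 3 * b / 2 \<le> gw_Q (p (f k))" for k
    using Qb(1)[of "s1 (s2 k)"] by (simp add: f_def s'_def s0_def)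
  then have "\<alpha> ^ 3 * b / 2 \<le> Q'" by (intro LIMSEQ_le_const[OF Q2]) auto
  then have Qpos: "0 < Q'" using pos by linarith
  have sub: "(\<lambda>k. X (f k)) \<longlonglongrightarrow> L" if "X \<longlonglongrightarrow> L" for X :: "nat \<Rightarrow> real" and L
    using LIMSEQ_subseq_LIMSEQ[OF that f] by (simp add: o_def)
  have "(\<lambda>k. laplace_Y (p (f k)) (q (f k)) (n (f k)) t (\<lambda>l. m (f k) * gw_v (p (f k)) l)) \<longlonglongrightarrow> Y Q' powr (- l' / Q')"
  proof (rule laplace_limit[where Q' = Q' and l' = l' and Y = "Y Q'" and n = "\<lambda>k. n (f k)" and m = "\<lambda>k. m (f k)"
        and p = "\<lambda>k. p (f k)" and q = "\<lambda>k. q (f k)" and a = a and b = b and c = c and U = U and S = S and ?d1.0 = d1 and ?d2.0 = d2])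
    show "gw_rho (p (f k)) \<le> 2" "0 < m (f k)"
      "(\<Sum>j\<le>n (f k). \<Sum>i\<le>j. gw_rho (p (f k)) ^ i) / m (f k) \<le> S"
      "gw_rho (p (f k)) ^ U \<le> 1 + min 1 (a * (a / 2 ^ U)) / 2" for k
      using N[OF fN[of k]] by (auto simp: \<beta>_def)
    show "(\<lambda>k. fst (lin (gw_rho (p (f k))) (e k) (Suc (n (f k))))) \<longlonglongrightarrow> Y Q'"
      if "(\<lambda>k. m (f k) * e k) \<longlonglongrightarrow> Q' * sum t UNIV" for e
      by (rule exact[OF f Qpos that])
    show "(\<lambda>k. gw_rho (p (f k))) \<longlonglongrightarrow> 1" by (rule sub[OF rho])
    show "(\<lambda>k. (\<Sum>i\<le>n (f k). gw_rho (p (f k)) ^ i) / m (f k)) \<longlonglongrightarrow> 0" by (rule sub[OF m1])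
    show "(\<lambda>k. real (n (f k) + 1) / m (f k)) \<longlonglongrightarrow> 0" by (rule sub[OF m2])
  qed (use const K J t Q2 lam2 Y Qpos in auto)
  moreover have "(\<lambda>k. Y (gw_Q (p (f k))) powr (- lam_u (p (f k)) (q (f k)) / gw_Q (p (f k)))) \<longlonglongrightarrow> Y Q' powr (- l' / Q')"
    using Y[OF Qpos] Qpos
    by (intro tendsto_powr isCont_tendsto_compose[OF Y(2)[OF Qpos] Q2] tendsto_divide tendsto_minus lam2 Q2) auto
  ultimately have "(\<lambda>k. laplace_Y (p (f k)) (q (f k)) (n (f k)) t (\<lambda>l. m (f k) * gw_v (p (f k)) l)
      - Y (gw_Q (p (f k))) powr (- lam_u (p (f k)) (q (f k)) / gw_Q (p (f k)))) \<longlonglongrightarrow> 0"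
    using tendsto_diff by fastforce
  then show "\<exists>s'. strict_mono s' \<and> (\<lambda>k. laplace_Y (p (s (s' k))) (q (s (s' k))) (n (s (s' k))) t (\<lambda>l. m (s (s' k)) * gw_v (p (s (s' k))) l)
      - Y (gw_Q (p (s (s' k)))) powr (- lam_u (p (s (s' k))) (q (s (s' k))) / gw_Q (p (s (s' k))))) \<longlonglongrightarrow> 0"
    using s' unfolding f_def by blast
qed

lemma gw_Q_eventually_pos:
  fixes p :: "nat \<Rightarrow> 'i::finite \<Rightarrow> ('i \<Rightarrow> nat) pmf"
  assumes const: "0 < a" "0 < b" "0 < c" "0 < U" and K: "\<And>k. inK a b c U (p k)"
    and rho: "(\<lambda>k. gw_rho (p k)) \<longlonglongrightarrow> 1"
  shows "\<forall>\<^sub>F k in sequentially. 0 < gw_Q (p k)"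
  using order_tendstoD(2)[OF rho, of 2, simplified]
proof eventually_elim
  case (elim k)
  have "(a / 2 ^ U) ^ 3 * b / 2 \<le> gw_Q (p k)"
    by (rule gw_Q_bounds(1)[OF K]) (use const elim in auto)
  moreover have "0 < (a / 2 ^ U) ^ 3 * b / 2" using const by simp
  ultimately show ?case by linarith
qed

text \<open>The value at time 1 of the solution of y'' = l y' + x y with y(0) = 1 and y'(0) =
  0.\<close>

definition riccati_profile :: "real \<Rightarrow> real \<Rightarrow> real" where
  "riccati_profile l x = (let s = sqrt (l\<^sup>2 + 4 * x) in
     ((l + s) / 2 / s) * exp ((l - s) / 2) - ((l - s) / 2 / s) * exp ((l + s) / 2))"

lemma riccati_profile_pos:
  assumes "0 < x"
  shows "0 < riccati_profile l x"
proof -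
  define s where "s = sqrt (l\<^sup>2 + 4 * x)"
  have "sqrt (l\<^sup>2) < s" unfolding s_def using assms by (intro real_sqrt_less_mono) simp
  then have s: "\<bar>l\<bar> < s" by simp
  have "0 < ((l + s) / 2 / s) * exp ((l - s) / 2)" using s by (intro mult_pos_pos divide_pos_pos) auto
  moreover have "0 < ((s - l) / 2 / s) * exp ((l + s) / 2)" using s by (intro mult_pos_pos divide_pos_pos) auto
  moreover have "((l - s) / 2 / s) = - ((s - l) / 2 / s)" by (simp add: minus_divide_left)
  ultimately show ?thesis unfolding riccati_profile_def Let_def s_def[symmetric] by simp
qed

lemma isCont_riccati_profile:
  assumes "0 < x"
  shows "isCont (riccati_profile l) x"
proof -
  have "l\<^sup>2 + 4 * x > 0" using assms by (simp add: add_nonneg_pos)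
  then have "l\<^sup>2 + 4 * x \<noteq> 0" by linarith
  then show ?thesis unfolding riccati_profile_def[abs_def] Let_def
    by (intro continuous_intros) auto
qed

text \<open>It covers all regimes in which n (\<rho> - 1) converges. The scaling is then \<mu> n^2
  to leading order, so e = Q \<theta> satisfies n^2 e -> Q T / \<mu>, the second argument of the
  profile.\<close>

lemma critical_case:
  fixes p :: "nat \<Rightarrow> 'i::finite \<Rightarrow> ('i \<Rightarrow> nat) pmf" and q :: "nat \<Rightarrow> ('i \<Rightarrow> nat) pmf"
    and t :: "'i \<Rightarrow> real" and n :: "nat \<Rightarrow> nat" and m :: "nat \<Rightarrow> real"
  assumes const: "0 < a" "0 < b" "0 < c" "0 < U" "0 < d2"
    and K: "\<And>k. inK a b c U (p k)" and J: "\<And>k. inJ d1 d2 (q k)"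
    and t: "\<And>l. 0 \<le> t l" "0 < sum t UNIV"
    and rho: "(\<lambda>k. gw_rho (p k)) \<longlonglongrightarrow> 1" and n: "filterlim n at_top sequentially"
    and l: "(\<lambda>k. real (n k) * (gw_rho (p k) - 1)) \<longlonglongrightarrow> l"
    and m: "(\<lambda>k. m k / (real (n k))\<^sup>2) \<longlonglongrightarrow> \<mu>" "0 < \<mu>"
  shows "(\<lambda>k. laplace_Y (p k) (q k) (n k) t (\<lambda>l. m k * gw_v (p k) l)
    - riccati_profile l (gw_Q (p k) * sum t UNIV / \<mu>) powr (- lam_u (p k) (q k) / gw_Q (p k))) \<longlonglongrightarrow> 0"
proof (rule laplace_asymptotics[OF const K J t(1) rho, where S = "exp (\<bar>l\<bar> + 1) * (1 / \<mu> + 1)"])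
  have R0: "0 \<le> gw_rho (p k)" for k
    by (rule perron_pair.r_nonneg[OF gw_perron(1)[OF K const(1,4)]])
  have n1: "\<forall>\<^sub>F k in sequentially. 1 \<le> n k" using n by (simp add: filterlim_at_top)
  have ninf: "filterlim (\<lambda>k. real (n k)) at_top sequentially"
    using n by (rule filterlim_compose[OF filterlim_real_sequentially])
  have ninv: "(\<lambda>k. inverse (real (n k))) \<longlonglongrightarrow> 0" by (rule tendsto_inverse_0_at_top[OF ninf])
  have mq: "\<forall>\<^sub>F k in sequentially. 0 < m k / (real (n k))\<^sup>2" by (rule order_tendstoD(1)[OF m])
  show mpos: "\<forall>\<^sub>F k in sequentially. 0 < m k"
    using mq by eventually_elim (auto simp: zero_less_divide_iff)
  have nm: "(\<lambda>k. inverse (m k / (real (n k))\<^sup>2)) \<longlonglongrightarrow> inverse \<mu>" using m by (intro tendsto_inverse) auto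
  have n1m: "(\<lambda>k. (1 + inverse (real (n k))) * inverse (real (n k)) * inverse (m k / (real (n k))\<^sup>2)) \<longlonglongrightarrow> (1 + 0) * 0 * inverse \<mu>"
    by (intro tendsto_intros ninv nm)
  have n1m_eq: "\<forall>\<^sub>F k in sequentially. (1 + inverse (real (n k))) * inverse (real (n k)) * inverse (m k / (real (n k))\<^sup>2) = real (n k + 1) / m k"
    using n1 mpos by eventually_elim (simp add: field_simps power2_eq_square)
  show m2: "(\<lambda>k. real (n k + 1) / m k) \<longlonglongrightarrow> 0"
    using Lim_transform_eventually[OF n1m n1m_eq] by simp
  have n2m: "(\<lambda>k. (1 + inverse (real (n k)))\<^sup>2 * inverse (m k / (real (n k))\<^sup>2)) \<longlonglongrightarrow> (1 + 0)\<^sup>2 * inverse \<mu>"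
    by (intro tendsto_intros ninv nm)
  have n2m_eq: "\<forall>\<^sub>F k in sequentially. (1 + inverse (real (n k)))\<^sup>2 * inverse (m k / (real (n k))\<^sup>2) = (real (n k + 1))\<^sup>2 / m k"
    using n1 mpos by eventually_elim (simp add: field_simps power2_eq_square)
  have "(\<lambda>k. (real (n k + 1))\<^sup>2 / m k) \<longlonglongrightarrow> 1 / \<mu>"
    using Lim_transform_eventually[OF n2m n2m_eq] by (simp add: inverse_eq_divide)
  then have n2m_le: "\<forall>\<^sub>F k in sequentially. (real (n k + 1))\<^sup>2 / m k < 1 / \<mu> + 1"
    by (rule order_tendstoD(2)) simp
  have labs: "(\<lambda>k. \<bar>real (n k) * (gw_rho (p k) - 1)\<bar>) \<longlonglongrightarrow> \<bar>l\<bar>" by (rule tendsto_rabs[OF l])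
  \<comment> \<open>By 1 + x <= exp x, all powers up to n are at most exp (n |\<rho> - 1|), whose
    exponent tends to |l|. This is the origin of the exponential in \<open>S\<close>.\<close>
  have pw: "\<forall>\<^sub>F k in sequentially. \<forall>i\<le>n k. gw_rho (p k) ^ i \<le> exp (\<bar>l\<bar> + 1)"
    using order_tendstoD(2)[OF labs, of "\<bar>l\<bar> + 1", simplified]
  proof eventually_elim
    case (elim k)
    show ?case
    proof (intro allI impI)
      fix i assume i: "i \<le> n k"
      have "gw_rho (p k) ^ i \<le> exp \<bar>gw_rho (p k) - 1\<bar> ^ i"
      proof (intro power_mono R0)
        show "gw_rho (p k) \<le> exp \<bar>gw_rho (p k) - 1\<bar>"
          using exp_ge_add_one_self[of "\<bar>gw_rho (p k) - 1\<bar>"] by linarith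
      qed
      also have "\<dots> = exp (real i * \<bar>gw_rho (p k) - 1\<bar>)" by (rule exp_of_nat_mult[symmetric])
      also have "\<dots> \<le> exp (real (n k) * \<bar>gw_rho (p k) - 1\<bar>)" using i by (simp add: mult_right_mono)
      also have "\<dots> \<le> exp (\<bar>l\<bar> + 1)" using elim by (simp add: abs_mult)
      finally show "gw_rho (p k) ^ i \<le> exp (\<bar>l\<bar> + 1)" .
    qed
  qed
  show "(\<lambda>k. (\<Sum>i\<le>n k. gw_rho (p k) ^ i) / m k) \<longlonglongrightarrow> 0"
  proof (rule Lim_null_comparison)
    show "(\<lambda>k. exp (\<bar>l\<bar> + 1) * (real (n k + 1) / m k)) \<longlonglongrightarrow> 0"
      by (rule tendsto_mult_right_zero[OF m2])
    show "\<forall>\<^sub>F k in sequentially. norm ((\<Sum>i\<le>n k. gw_rho (p k) ^ i) / m k) \<le> exp (\<bar>l\<bar> + 1) * (real (n k + 1) / m k)"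
      using pw mpos
    proof eventually_elim
      case (elim k)
      have "(\<Sum>i\<le>n k. gw_rho (p k) ^ i) \<le> (\<Sum>i\<le>n k. exp (\<bar>l\<bar> + 1))" using elim by (intro sum_mono) auto
      then have "(\<Sum>i\<le>n k. gw_rho (p k) ^ i) / m k \<le> exp (\<bar>l\<bar> + 1) * real (n k + 1) / m k"
        using elim by (intro divide_right_mono) (auto simp: mult.commute)
      moreover have "0 \<le> (\<Sum>i\<le>n k. gw_rho (p k) ^ i) / m k"
        using elim R0 by (intro divide_nonneg_pos sum_nonneg) auto
      ultimately show ?case by simp
    qed
  qed
  show "\<forall>\<^sub>F k in sequentially. (\<Sum>j\<le>n k. \<Sum>i\<le>j. gw_rho (p k) ^ i) / m k \<le> exp (\<bar>l\<bar> + 1) * (1 / \<mu> + 1)"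
    using pw mpos n2m_le
  proof eventually_elim
    case (elim k)
    have "(\<Sum>i\<le>j. gw_rho (p k) ^ i) \<le> real (n k + 1) * exp (\<bar>l\<bar> + 1)" if "j \<le> n k" for j
    proof -
      have "(\<Sum>i\<le>j. gw_rho (p k) ^ i) \<le> (\<Sum>i\<le>n k. gw_rho (p k) ^ i)" using that R0 by (intro sum_mono2) auto
      also have "\<dots> \<le> (\<Sum>i\<le>n k. exp (\<bar>l\<bar> + 1))" using elim by (intro sum_mono) auto
      finally show ?thesis by simp
    qed
    then have "(\<Sum>j\<le>n k. \<Sum>i\<le>j. gw_rho (p k) ^ i) \<le> (\<Sum>j\<le>n k. real (n k + 1) * exp (\<bar>l\<bar> + 1))"
      by (intro sum_mono) auto
    also have "\<dots> = exp (\<bar>l\<bar> + 1) * (real (n k + 1))\<^sup>2" by (simp add: power2_eq_square)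
    finally have "(\<Sum>j\<le>n k. \<Sum>i\<le>j. gw_rho (p k) ^ i) / m k \<le> exp (\<bar>l\<bar> + 1) * (real (n k + 1))\<^sup>2 / m k"
      using elim by (intro divide_right_mono) auto
    also have "\<dots> = exp (\<bar>l\<bar> + 1) * ((real (n k + 1))\<^sup>2 / m k)" by simp
    also have "\<dots> \<le> exp (\<bar>l\<bar> + 1) * (1 / \<mu> + 1)" using elim by (intro mult_left_mono) auto
    finally show ?case .
  qed
  fix Q :: real assume Q: "0 < Q"
  have x: "0 < Q * sum t UNIV / \<mu>" using Q t m by simp
  show "0 < riccati_profile l (Q * sum t UNIV / \<mu>)" by (rule riccati_profile_pos[OF x])
  have "isCont (\<lambda>Q. Q * sum t UNIV / \<mu>) Q" using m by (intro continuous_intros) auto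
  from isCont_o2[OF this isCont_riccati_profile[OF x]]
  show "isCont (\<lambda>Q. riccati_profile l (Q * sum t UNIV / \<mu>)) Q" .
  fix s :: "nat \<Rightarrow> nat" and e :: "nat \<Rightarrow> real"
  assume s: "strict_mono s" and e: "(\<lambda>k. m (s k) * e k) \<longlonglongrightarrow> Q * sum t UNIV"
  have sub: "(\<lambda>k. X (s k)) \<longlonglongrightarrow> L" if "X \<longlonglongrightarrow> L" for X :: "nat \<Rightarrow> real" and L
    using LIMSEQ_subseq_LIMSEQ[OF that s] by (simp add: o_def)
  have ev: "\<forall>\<^sub>F k in sequentially. 0 < m (s k)"
    using eventually_subseq[OF s mpos] .
  have "(\<lambda>k. inverse (m (s k) / (real (n (s k)))\<^sup>2) * (m (s k) * e k)) \<longlonglongrightarrow> inverse \<mu> * (Q * sum t UNIV)"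
    by (intro tendsto_mult sub[OF nm] e)
  moreover have "\<forall>\<^sub>F k in sequentially. inverse (m (s k) / (real (n (s k)))\<^sup>2) * (m (s k) * e k) = (real (n (s k)))\<^sup>2 * e k"
    using ev by eventually_elim (simp add: field_simps)
  ultimately have n2e: "(\<lambda>k. (real (n (s k)))\<^sup>2 * e k) \<longlonglongrightarrow> inverse \<mu> * (Q * sum t UNIV)"
    by (rule Lim_transform_eventually)
  define \<sigma> where "\<sigma> = sqrt (l\<^sup>2 + 4 * (Q * sum t UNIV / \<mu>))"
  have p: "0 < l\<^sup>2 + 4 * (Q * sum t UNIV / \<mu>)" using x by (simp add: add_nonneg_pos)
  have "(\<lambda>k. fst (lin (gw_rho (p (s k))) (e k) (Suc (n (s k))))) \<longlonglongrightarrow>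
      ((l + \<sigma>) / 2 / \<sigma>) * exp ((l - \<sigma>) / 2) - ((l - \<sigma>) / 2 / \<sigma>) * exp ((l + \<sigma>) / 2)"
  proof (rule lin_limit_critical)
    show "filterlim (\<lambda>k. n (s k)) at_top sequentially"
      by (rule filterlim_compose[OF n filterlim_subseq[OF s]])
    show "(\<lambda>k. real (n (s k)) * (gw_rho (p (s k)) - 1)) \<longlonglongrightarrow> l" by (rule sub[OF l])
    show "(\<lambda>k. (real (n (s k)))\<^sup>2 * e k) \<longlonglongrightarrow> Q * sum t UNIV / \<mu>"
      using n2e by (simp add: field_simps)
    show "0 < \<sigma>" "\<sigma>\<^sup>2 = l\<^sup>2 + 4 * (Q * sum t UNIV / \<mu>)" using p by (auto simp: \<sigma>_def)
  qed
  then show "(\<lambda>k. fst (lin (gw_rho (p (s k))) (e k) (Suc (n (s k))))) \<longlonglongrightarrow> riccati_profile l (Q * sum t UNIV / \<mu>)"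
    by (simp add: riccati_profile_def Let_def \<sigma>_def)
qed

text \<open>The geometric sums are at most 1 / (1 - \<rho>), so their double sum is at most (n + 1)
  / (1 - \<rho>), no more than twice the scaling once n >= 1; hence \<open>S = 2\<close>.\<close>

lemma subcritical_case:
  fixes p :: "nat \<Rightarrow> 'i::finite \<Rightarrow> ('i \<Rightarrow> nat) pmf" and q :: "nat \<Rightarrow> ('i \<Rightarrow> nat) pmf"
    and t :: "'i \<Rightarrow> real" and n :: "nat \<Rightarrow> nat"
  assumes const: "0 < a" "0 < b" "0 < c" "0 < U" "0 < d2"
    and K: "\<And>k. inK a b c U (p k)" and J: "\<And>k. inJ d1 d2 (q k)"
    and t: "\<And>l. 0 \<le> t l" "0 < sum t UNIV"
    and rho: "(\<lambda>k. gw_rho (p k)) \<longlonglongrightarrow> 1" "\<And>k. gw_rho (p k) < 1"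
    and n: "filterlim n at_top sequentially"
    and nr: "filterlim (\<lambda>k. real (n k) * (1 - gw_rho (p k))) at_top sequentially"
  shows "(\<lambda>k. laplace_Y (p k) (q k) (n k) t (\<lambda>l. real (n k) / (1 - gw_rho (p k)) * gw_v (p k) l)
    - exp (gw_Q (p k) * sum t UNIV) powr (- lam_u (p k) (q k) / gw_Q (p k))) \<longlonglongrightarrow> 0"
proof (rule laplace_asymptotics[OF const K J t(1) rho(1), where S = 2])
  have R0: "0 \<le> gw_rho (p k)" for k
    by (rule perron_pair.r_nonneg[OF gw_perron(1)[OF K const(1,4)]])
  have ep: "0 < 1 - gw_rho (p k)" for k using rho(2)[of k] by simp
  have n1: "\<forall>\<^sub>F k in sequentially. 1 \<le> n k" using n by (simp add: filterlim_at_top)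
  have ninf: "filterlim (\<lambda>k. real (n k)) at_top sequentially"
    using n by (rule filterlim_compose[OF filterlim_real_sequentially])
  have ninv: "(\<lambda>k. inverse (real (n k))) \<longlonglongrightarrow> 0" by (rule tendsto_inverse_0_at_top[OF ninf])
  have geo: "0 \<le> (\<Sum>i\<le>j. gw_rho (p k) ^ i)" "(\<Sum>i\<le>j. gw_rho (p k) ^ i) \<le> 1 / (1 - gw_rho (p k))" for j k
  proof -
    show "0 \<le> (\<Sum>i\<le>j. gw_rho (p k) ^ i)" using R0 by (intro sum_nonneg) auto
    have "(1 - gw_rho (p k)) * (\<Sum>i\<le>j. gw_rho (p k) ^ i) = 1 - gw_rho (p k) ^ Suc j"
      by (rule sum_gp_basic)
    also have "\<dots> \<le> 1" using R0[of k] by simp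
    finally show "(\<Sum>i\<le>j. gw_rho (p k) ^ i) \<le> 1 / (1 - gw_rho (p k))"
      using ep[of k] by (simp add: pos_le_divide_eq mult.commute)
  qed
  show mpos: "\<forall>\<^sub>F k in sequentially. 0 < real (n k) / (1 - gw_rho (p k))"
    using n1 by eventually_elim (use ep in simp)
  show "(\<lambda>k. (\<Sum>i\<le>n k. gw_rho (p k) ^ i) / (real (n k) / (1 - gw_rho (p k)))) \<longlonglongrightarrow> 0"
  proof (rule Lim_null_comparison[OF _ ninv])
    show "\<forall>\<^sub>F k in sequentially. norm ((\<Sum>i\<le>n k. gw_rho (p k) ^ i) / (real (n k) / (1 - gw_rho (p k)))) \<le> inverse (real (n k))"
      using n1 mpos
    proof eventually_elim
      case (elim k)
      have "(\<Sum>i\<le>n k. gw_rho (p k) ^ i) / (real (n k) / (1 - gw_rho (p k))) \<le> 1 / (1 - gw_rho (p k)) / (real (n k) / (1 - gw_rho (p k)))"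
        using elim geo by (intro divide_right_mono) auto
      also have "\<dots> = inverse (real (n k))" using ep[of k] elim by (simp add: field_simps)
      finally have "(\<Sum>i\<le>n k. gw_rho (p k) ^ i) / (real (n k) / (1 - gw_rho (p k))) \<le> inverse (real (n k))" .
      moreover have "0 \<le> (\<Sum>i\<le>n k. gw_rho (p k) ^ i) / (real (n k) / (1 - gw_rho (p k)))"
        using elim geo by (intro divide_nonneg_pos) auto
      ultimately show ?case by (simp only: real_norm_def abs_of_nonneg)
    qed
  qed
  have "(\<lambda>k. (1 + inverse (real (n k))) * (1 - gw_rho (p k))) \<longlonglongrightarrow> (1 + 0) * (1 - 1)"
    by (intro tendsto_intros ninv rho)
  moreover have "\<forall>\<^sub>F k in sequentially. (1 + inverse (real (n k))) * (1 - gw_rho (p k)) = real (n k + 1) / (real (n k) / (1 - gw_rho (p k)))"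
    using n1 by eventually_elim (simp add: field_simps)
  ultimately show "(\<lambda>k. real (n k + 1) / (real (n k) / (1 - gw_rho (p k)))) \<longlonglongrightarrow> 0"
    by (auto dest: Lim_transform_eventually)
  show "\<forall>\<^sub>F k in sequentially. (\<Sum>j\<le>n k. \<Sum>i\<le>j. gw_rho (p k) ^ i) / (real (n k) / (1 - gw_rho (p k))) \<le> 2"
    using n1 mpos
  proof eventually_elim
    case (elim k)
    have "(\<Sum>j\<le>n k. \<Sum>i\<le>j. gw_rho (p k) ^ i) \<le> (\<Sum>j\<le>n k. 1 / (1 - gw_rho (p k)))"
      by (intro sum_mono geo)
    also have "\<dots> = real (n k + 1) / (1 - gw_rho (p k))" by simp
    also have "\<dots> \<le> 2 * real (n k) / (1 - gw_rho (p k))" using elim ep[of k] by (intro divide_right_mono) auto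
    finally have "(\<Sum>j\<le>n k. \<Sum>i\<le>j. gw_rho (p k) ^ i) \<le> 2 * (real (n k) / (1 - gw_rho (p k)))" by simp
    then show ?case using elim by (simp only: pos_divide_le_eq)
  qed
  fix Q :: real assume Q: "0 < Q"
  show "0 < exp (Q * sum t UNIV)" by simp
  show "isCont (\<lambda>Q. exp (Q * sum t UNIV)) Q" by (intro continuous_intros)
  fix s :: "nat \<Rightarrow> nat" and e :: "nat \<Rightarrow> real"
  assume s: "strict_mono s" and e: "(\<lambda>k. real (n (s k)) / (1 - gw_rho (p (s k))) * e k) \<longlonglongrightarrow> Q * sum t UNIV"
  show "(\<lambda>k. fst (lin (gw_rho (p (s k))) (e k) (Suc (n (s k))))) \<longlonglongrightarrow> exp (Q * sum t UNIV)"
  proof (rule lin_limit_subcritical)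
    show "filterlim (\<lambda>k. n (s k)) at_top sequentially"
      by (rule filterlim_compose[OF n filterlim_subseq[OF s]])
    show "(\<lambda>k. gw_rho (p (s k))) \<longlonglongrightarrow> 1"
      using LIMSEQ_subseq_LIMSEQ[OF rho(1) s] by (simp add: o_def)
    show "filterlim (\<lambda>k. real (n (s k)) * (1 - gw_rho (p (s k)))) at_top sequentially"
      by (rule filterlim_compose[OF nr filterlim_subseq[OF s]])
    have "0 < Q * sum t UNIV" using Q t by simp
    from order_tendstoD(1)[OF e this] eventually_subseq[OF s mpos]
    show "\<forall>\<^sub>F k in sequentially. 0 \<le> e k"
      by eventually_elim (meson less_le zero_less_mult_pos)
  qed (use rho e in auto)
qed

text \<open>The double geometric sum is at most \<rho>^2 times the scaling and eventually \<rho> <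
  2, hence \<open>S = 4\<close>. The other two ratios are at most \<rho> (\<rho> - 1).\<close>

lemma supercritical_case:
  fixes p :: "nat \<Rightarrow> 'i::finite \<Rightarrow> ('i \<Rightarrow> nat) pmf" and q :: "nat \<Rightarrow> ('i \<Rightarrow> nat) pmf"
    and t :: "'i \<Rightarrow> real" and n :: "nat \<Rightarrow> nat"
  assumes const: "0 < a" "0 < b" "0 < c" "0 < U" "0 < d2"
    and K: "\<And>k. inK a b c U (p k)" and J: "\<And>k. inJ d1 d2 (q k)"
    and t: "\<And>l. 0 \<le> t l" "0 < sum t UNIV"
    and rho: "(\<lambda>k. gw_rho (p k)) \<longlonglongrightarrow> 1" "\<And>k. 1 < gw_rho (p k)"
    and n: "filterlim n at_top sequentially"
    and nr: "filterlim (\<lambda>k. real (n k) * (gw_rho (p k) - 1)) at_top sequentially"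
  shows "(\<lambda>k. laplace_Y (p k) (q k) (n k) t (\<lambda>l. gw_rho (p k) ^ n k / (gw_rho (p k) - 1)\<^sup>2 * gw_v (p k) l)
    - (1 + gw_Q (p k) * sum t UNIV) powr (- lam_u (p k) (q k) / gw_Q (p k))) \<longlonglongrightarrow> 0"
proof (rule laplace_asymptotics[OF const K J t(1) rho(1), where S = 4])
  define R where "R = (\<lambda>k. gw_rho (p k))"
  have R: "1 < R k" for k using rho by (simp add: R_def)
  have Rlim: "R \<longlonglongrightarrow> 1" using rho by (simp add: R_def)
  have ep: "0 < R k - 1" for k using R[of k] by simp
  have mpos: "0 < R k ^ n k / (R k - 1)\<^sup>2" for k using R[of k] by simp
  then show "\<forall>\<^sub>F k in sequentially. 0 < gw_rho (p k) ^ n k / (gw_rho (p k) - 1)\<^sup>2"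
    by (simp add: R_def)
  have geo: "(\<Sum>i\<le>j. R k ^ i) \<le> R k ^ Suc j / (R k - 1)" for j k
  proof -
    have "(1 - R k) * (\<Sum>i\<le>j. R k ^ i) = 1 - R k ^ Suc j" by (rule sum_gp_basic)
    then have "(\<Sum>i\<le>j. R k ^ i) * (R k - 1) \<le> R k ^ Suc j" by (simp add: algebra_simps)
    then show ?thesis using ep[of k] by (simp only: pos_le_divide_eq)
  qed
  have geo0: "0 \<le> (\<Sum>i\<le>j. R k ^ i)" for j k using R[of k] by (intro sum_nonneg) auto
  have m1_le: "(\<Sum>i\<le>n k. R k ^ i) / (R k ^ n k / (R k - 1)\<^sup>2) \<le> R k * (R k - 1)" for k
  proof -
    have "(\<Sum>i\<le>n k. R k ^ i) / (R k ^ n k / (R k - 1)\<^sup>2) \<le> R k ^ Suc (n k) / (R k - 1) / (R k ^ n k / (R k - 1)\<^sup>2)"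
      using mpos[of k] by (intro divide_right_mono geo) auto
    also have "\<dots> = R k * (R k - 1)"
      using R[of k] ep[of k] by (simp add: power2_eq_square)
    finally show ?thesis .
  qed
  have lim0: "(\<lambda>k. R k * (R k - 1)) \<longlonglongrightarrow> 0"
    using tendsto_mult[OF Rlim tendsto_diff[OF Rlim tendsto_const[of 1]]] by simp
  show "(\<lambda>k. (\<Sum>i\<le>n k. gw_rho (p k) ^ i) / (gw_rho (p k) ^ n k / (gw_rho (p k) - 1)\<^sup>2)) \<longlonglongrightarrow> 0"
    unfolding R_def[symmetric, THEN fun_cong]
  proof (rule Lim_null_comparison[OF always_eventually lim0], rule allI)
    fix k
    have "0 \<le> (\<Sum>i\<le>n k. R k ^ i) / (R k ^ n k / (R k - 1)\<^sup>2)"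
      by (intro divide_nonneg_pos geo0 mpos)
    then show "norm ((\<Sum>i\<le>n k. R k ^ i) / (R k ^ n k / (R k - 1)\<^sup>2)) \<le> R k * (R k - 1)"
      using m1_le[of k] by (simp only: real_norm_def abs_of_nonneg)
  qed
  show "(\<lambda>k. real (n k + 1) / (gw_rho (p k) ^ n k / (gw_rho (p k) - 1)\<^sup>2)) \<longlonglongrightarrow> 0"
    unfolding R_def[symmetric, THEN fun_cong]
  proof (rule Lim_null_comparison[OF always_eventually lim0], rule allI)
    fix k
    have "(\<Sum>i\<le>n k. 1) \<le> (\<Sum>i\<le>n k. R k ^ i)" using R[of k] by (intro sum_mono one_le_power) simp
    then have "real (n k + 1) / (R k ^ n k / (R k - 1)\<^sup>2) \<le> (\<Sum>i\<le>n k. R k ^ i) / (R k ^ n k / (R k - 1)\<^sup>2)"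
      using mpos[of k] by (intro divide_right_mono) auto
    moreover have "0 \<le> real (n k + 1) / (R k ^ n k / (R k - 1)\<^sup>2)"
      by (intro divide_nonneg_pos mpos) simp
    ultimately show "norm (real (n k + 1) / (R k ^ n k / (R k - 1)\<^sup>2)) \<le> R k * (R k - 1)"
      using m1_le[of k] by (simp only: real_norm_def abs_of_nonneg)
  qed
  show "\<forall>\<^sub>F k in sequentially. (\<Sum>j\<le>n k. \<Sum>i\<le>j. gw_rho (p k) ^ i) / (gw_rho (p k) ^ n k / (gw_rho (p k) - 1)\<^sup>2) \<le> 4"
    using order_tendstoD(2)[OF Rlim, of 2, simplified]
    unfolding R_def[symmetric, THEN fun_cong]
  proof eventually_elim
    case (elim k)
    have "(\<Sum>j\<le>n k. \<Sum>i\<le>j. R k ^ i) \<le> (\<Sum>j\<le>n k. R k ^ Suc j / (R k - 1))" by (intro sum_mono geo)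
    also have "\<dots> = R k / (R k - 1) * (\<Sum>j\<le>n k. R k ^ j)" by (simp add: sum_distrib_left)
    also have "\<dots> \<le> R k / (R k - 1) * (R k ^ Suc (n k) / (R k - 1))"
      using R[of k] ep[of k] by (intro mult_left_mono geo) auto
    finally have "(\<Sum>j\<le>n k. \<Sum>i\<le>j. R k ^ i) / (R k ^ n k / (R k - 1)\<^sup>2)
        \<le> R k / (R k - 1) * (R k ^ Suc (n k) / (R k - 1)) / (R k ^ n k / (R k - 1)\<^sup>2)"
      using mpos[of k] by (intro divide_right_mono) auto
    also have "\<dots> = R k * R k" using R[of k] ep[of k] by (simp add: power2_eq_square)
    also have "\<dots> \<le> 2 * 2" using elim R[of k] by (intro mult_mono) auto
    finally show ?case by simp
  qed
  fix Q :: real assume Q: "0 < Q"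
  show "0 < 1 + Q * sum t UNIV" using Q t by (simp add: add_pos_pos)
  show "isCont (\<lambda>Q. 1 + Q * sum t UNIV) Q" by (intro continuous_intros)
  fix s :: "nat \<Rightarrow> nat" and e :: "nat \<Rightarrow> real"
  assume s: "strict_mono s" and e: "(\<lambda>k. gw_rho (p (s k)) ^ n (s k) / (gw_rho (p (s k)) - 1)\<^sup>2 * e k) \<longlonglongrightarrow> Q * sum t UNIV"
  show "(\<lambda>k. fst (lin (gw_rho (p (s k))) (e k) (Suc (n (s k))))) \<longlonglongrightarrow> 1 + Q * sum t UNIV"
  proof (rule lin_limit_supercritical)
    show "filterlim (\<lambda>k. n (s k)) at_top sequentially"
      by (rule filterlim_compose[OF n filterlim_subseq[OF s]])
    show "(\<lambda>k. gw_rho (p (s k))) \<longlonglongrightarrow> 1"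
      using LIMSEQ_subseq_LIMSEQ[OF rho(1) s] by (simp add: o_def)
    show "filterlim (\<lambda>k. real (n (s k)) * (gw_rho (p (s k)) - 1)) at_top sequentially"
      by (rule filterlim_compose[OF nr filterlim_subseq[OF s]])
    have "0 < Q * sum t UNIV" using Q t by simp
    from order_tendstoD(1)[OF e this]
    show "\<forall>\<^sub>F k in sequentially. 0 \<le> e k"
    proof eventually_elim
      case (elim k)
      have "0 < gw_rho (p (s k)) ^ n (s k) / (gw_rho (p (s k)) - 1)\<^sup>2"
        using mpos[of "s k"] by (simp add: R_def)
      from zero_less_mult_pos[OF elim this] show ?case by simp
    qed
  qed (use rho e in auto)
qed

section \<open>Closed forms of the limits\<close>

lemma laplace_Y_zero:
  assumes "\<And>k. t k = 0"
  shows "laplace_Y p q n t m = 1"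
  by (simp add: laplace_Y_def assms case_prod_unfold)

lemma ln_less_minus_one:
  fixes x :: real
  assumes "0 < x" "x \<noteq> 1"
  shows "ln x < x - 1"
  using ln_le_minus_one[of x] ln_eq_minus_one[of x] assms by (cases "ln x = x - 1") auto

text \<open>With x = l^2 y the square root in the profile is l z. For l = -ln r the exponentials
  become powers of r.\<close>

lemma riccati_profile_scaled:
  fixes l y :: real
  assumes "0 < l" "0 < y"
  defines "z \<equiv> sqrt (1 + 4 * y)"
  shows "riccati_profile l (l\<^sup>2 * y) = (1 + z) / (2 * z) * exp (l * (1 - z) / 2) + (z - 1) / (2 * z) * exp (l * (1 + z) / 2)"
    and "riccati_profile (- l) (l\<^sup>2 * y) = (z - 1) / (2 * z) * exp (- l * (1 + z) / 2) + (1 + z) / (2 * z) * exp (l * (z - 1) / 2)"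
proof -
  have z: "0 < z" using assms by (simp add: z_def)
  have "sqrt (l\<^sup>2 + 4 * (l\<^sup>2 * y)) = sqrt (l\<^sup>2 * (1 + 4 * y))" by (simp add: algebra_simps)
  also have "\<dots> = l * z" using assms by (simp add: z_def real_sqrt_mult)
  finally have s: "sqrt (l\<^sup>2 + 4 * (l\<^sup>2 * y)) = l * z" .
  have "(l + l * z) / 2 / (l * z) = (1 + z) / (2 * z)" "(l - l * z) / 2 / (l * z) = - ((z - 1) / (2 * z))"
    "(- l + l * z) / 2 / (l * z) = (z - 1) / (2 * z)" "(- l - l * z) / 2 / (l * z) = - ((1 + z) / (2 * z))"
    using assms z by (simp_all add: field_simps)
  moreover have "(l - l * z) / 2 = l * (1 - z) / 2" "(l + l * z) / 2 = l * (1 + z) / 2"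
    "(- l - l * z) / 2 = - l * (1 + z) / 2" "(- l + l * z) / 2 = l * (z - 1) / 2"
    by (simp_all add: algebra_simps)
  ultimately show "riccati_profile l (l\<^sup>2 * y) = (1 + z) / (2 * z) * exp (l * (1 - z) / 2) + (z - 1) / (2 * z) * exp (l * (1 + z) / 2)"
    and "riccati_profile (- l) (l\<^sup>2 * y) = (z - 1) / (2 * z) * exp (- l * (1 + z) / 2) + (1 + z) / (2 * z) * exp (l * (z - 1) / 2)"
    unfolding riccati_profile_def Let_def power2_minus s by (simp_all only: minus_mult_left[symmetric] diff_minus_eq_add)
qed

text \<open>The weights 1 / (1 + w) and w / (1 + w) equal (1 + z) / (2 z) and (z - 1) / (2 z), the
  coefficients of the two exponentials.\<close>

lemma riccati_profile_supercritical:
  fixes r y :: real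
  assumes r: "0 < r" "r < 1" and y: "0 < y"
  shows "riccati_profile (- ln r) ((ln r)\<^sup>2 * y) = (let z = sqrt (1 + 4 * y); w = (z - 1) / (z + 1)
    in r powr (- 1 / 2) * (r powr (z / 2) + w * r powr (- z / 2)) / (1 + w))"
proof -
  define z where "z = sqrt (1 + 4 * y)"
  define w where "w = (z - 1) / (z + 1)"
  have "sqrt 1 < z" unfolding z_def using y by (intro real_sqrt_less_mono) simp
  then have z: "1 < z" by simp
  have L: "0 < - ln r" using r by simp
  have "1 + w = 2 * z / (z + 1)" using z by (simp add: w_def field_simps)
  then have w1: "1 / (1 + w) = (1 + z) / (2 * z)" "w / (1 + w) = (z - 1) / (2 * z)"
    using z by (simp_all add: w_def add.commute)
  have "r powr (- 1 / 2) * (r powr (z / 2) + w * r powr (- z / 2)) / (1 + w)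
      = 1 / (1 + w) * (r powr (- 1 / 2) * r powr (z / 2)) + w / (1 + w) * (r powr (- 1 / 2) * r powr (- z / 2))"
    by (simp add: distrib_left add_divide_distrib mult_ac)
  also have "\<dots> = (1 + z) / (2 * z) * exp (- ln r * (1 - z) / 2) + (z - 1) / (2 * z) * exp (- ln r * (1 + z) / 2)"
    unfolding w1 using r by (simp add: powr_def exp_add[symmetric] field_simps)
  also have "\<dots> = riccati_profile (- ln r) ((- ln r)\<^sup>2 * y)"
    using riccati_profile_scaled(1)[OF L y] by (simp add: z_def)
  finally show ?thesis by (simp add: Let_def z_def w_def)
qed

text \<open>Here the two coefficients change places. Since y > 0 gives z > 1, the quotient
  \<open>w\<close> has a nonzero denominator.\<close>

lemma riccati_profile_subcritical:
  fixes r y :: real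
  assumes r: "0 < r" "r < 1" and y: "0 < y"
  shows "riccati_profile (ln r) ((ln r)\<^sup>2 * y) = (let z = sqrt (1 + 4 * y); w = (z + 1) / (z - 1)
    in r powr (1 / 2) * (r powr (z / 2) + w * r powr (- z / 2)) / (1 + w))"
proof -
  define z where "z = sqrt (1 + 4 * y)"
  define w where "w = (z + 1) / (z - 1)"
  have "sqrt 1 < z" unfolding z_def using y by (intro real_sqrt_less_mono) simp
  then have z: "1 < z" by simp
  have L: "0 < - ln r" using r by simp
  have "1 + w = 2 * z / (z - 1)" using z by (simp add: w_def field_simps)
  then have w1: "1 / (1 + w) = (z - 1) / (2 * z)" "w / (1 + w) = (1 + z) / (2 * z)"
    using z by (simp_all add: w_def add.commute)
  have "r powr (1 / 2) * (r powr (z / 2) + w * r powr (- z / 2)) / (1 + w)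
      = 1 / (1 + w) * (r powr (1 / 2) * r powr (z / 2)) + w / (1 + w) * (r powr (1 / 2) * r powr (- z / 2))"
    by (simp add: distrib_left add_divide_distrib mult_ac)
  also have "\<dots> = (z - 1) / (2 * z) * exp (- (- ln r) * (1 + z) / 2) + (1 + z) / (2 * z) * exp (- ln r * (z - 1) / 2)"
    unfolding w1 using r by (simp add: powr_def exp_add[symmetric] field_simps)
  also have "\<dots> = riccati_profile (- (- ln r)) ((- ln r)\<^sup>2 * y)"
    using riccati_profile_scaled(2)[OF L y] by (simp add: z_def)
  finally show ?thesis by (simp add: Let_def z_def w_def)
qed

lemma riccati_profile_zero:
  assumes "0 < x"
  shows "riccati_profile 0 x = cosh (sqrt x)"
proof -
  have "sqrt (4 * x) = 2 * sqrt x" by (simp add: real_sqrt_mult)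
  then show ?thesis using assms by (simp add: riccati_profile_def Let_def cosh_def field_simps)
qed

lemma power_one_minus_tendsto:
  fixes \<delta> :: "nat \<Rightarrow> real"
  assumes "filterlim n at_top sequentially" "(\<lambda>k. real (n k) * \<delta> k) \<longlonglongrightarrow> L"
  shows "(\<lambda>k. (1 - \<delta> k) ^ n k) \<longlonglongrightarrow> exp (- L)"
proof -
  have "(\<lambda>k. real (n k) * - \<delta> k) \<longlonglongrightarrow> - L" using tendsto_minus[OF assms(2)] by simp
  from power_tendsto_exp[OF assms(1) this, of 0] show ?thesis by simp
qed

lemma tendsto_profile_cong:
  fixes p :: "nat \<Rightarrow> 'i::finite \<Rightarrow> ('i \<Rightarrow> nat) pmf"
  assumes "\<forall>\<^sub>F k in sequentially. 0 < gw_Q (p k)"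
    and "(\<lambda>k. X k - f (gw_Q (p k)) powr g k) \<longlonglongrightarrow> (0::real)"
    and "\<And>Q. 0 < Q \<Longrightarrow> f Q = h Q"
  shows "(\<lambda>k. X k - h (gw_Q (p k)) powr g k) \<longlonglongrightarrow> 0"
proof (rule Lim_transform_eventually[OF assms(2)])
  show "\<forall>\<^sub>F k in sequentially. X k - f (gw_Q (p k)) powr g k = X k - h (gw_Q (p k)) powr g k"
    using assms(1) by eventually_elim (simp add: assms(3))
qed

text \<open>The second clause asks for \<open>T > 0\<close> because its \<open>w\<close> divides by
  z - 1, which is 0 at T = 0. With division by zero yielding 0, the base of the power would be r
  there, whereas the transform is 1.\<close>

theorem theorem5:
  fixes a b c d1 d2 :: real and U :: nat
    and t :: "'i::finite \<Rightarrow> real" and T :: real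
    and n :: "nat \<Rightarrow> nat"
    and p :: "nat \<Rightarrow> 'i \<Rightarrow> ('i \<Rightarrow> nat) pmf"
    and q :: "nat \<Rightarrow> ('i \<Rightarrow> nat) pmf"
  assumes "a > 0" "b > 0" "c > 0" "U > 0" "d1 > 0" "d2 > 0"
    and "hypH TYPE('i) a b c U"
    and "\<forall>k. t k \<ge> 0"
    and "T = (\<Sum>k\<in>UNIV. t k)"
    and "filterlim n at_top sequentially"
    and "\<forall>j. inK a b c U (p j)"
    and "\<forall>j. inJ d1 d2 (q j)"
    and "(\<lambda>j. gw_rho (p j)) \<longlonglongrightarrow> 1"
  shows
   "(\<forall>r. 0 < r \<and> r < 1 \<and> (\<forall>j. gw_rho (p j) > 1)
        \<and> (\<lambda>j. real (n j) * \<bar>1 - gw_rho (p j)\<bar>) \<longlonglongrightarrow> - ln r \<longrightarrow>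
      (\<lambda>j. laplace_Y (p j) (q j) (n j) t
              (\<lambda>l. (inverse (rho_mu (p j) ^ n j) - 1 - real (n j) * (1 - rho_mu (p j)))
                     / (1 - rho_mu (p j))\<^sup>2 * gw_v (p j) l)
           - (let z = sqrt (1 + 4 * gw_Q (p j) * T / (inverse r - 1 + ln r));
                  w = (z - 1) / (z + 1)
              in (r powr (-1/2) * (r powr (z/2) + w * r powr (-z/2)) / (1 + w))
                   powr (- lam_u (p j) (q j) / gw_Q (p j)))) \<longlonglongrightarrow> 0)
  \<and> (\<forall>r. 0 < r \<and> r < 1 \<and> T > 0 \<and> (\<forall>j. gw_rho (p j) < 1)
        \<and> (\<lambda>j. real (n j) * \<bar>1 - gw_rho (p j)\<bar>) \<longlonglongrightarrow> - ln r \<longrightarrow>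
      (\<lambda>j. laplace_Y (p j) (q j) (n j) t
              (\<lambda>l. (rho_mu (p j) ^ n j - 1 + real (n j) * (1 - rho_mu (p j)))
                     / (1 - rho_mu (p j))\<^sup>2 * gw_v (p j) l)
           - (let z = sqrt (1 + 4 * gw_Q (p j) * T / (r - 1 - ln r));
                  w = (z + 1) / (z - 1)
              in (r powr (1/2) * (r powr (z/2) + w * r powr (-z/2)) / (1 + w))
                   powr (- lam_u (p j) (q j) / gw_Q (p j)))) \<longlonglongrightarrow> 0)
  \<and> ((\<forall>j. gw_rho (p j) \<noteq> 1) \<and> (\<lambda>j. real (n j) * \<bar>1 - gw_rho (p j)\<bar>) \<longlonglongrightarrow> 0 \<longrightarrow>
      (\<lambda>j. laplace_Y (p j) (q j) (n j) t (\<lambda>l. (real (n j))\<^sup>2 / 2 * gw_v (p j) l)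
           - cosh (sqrt (2 * gw_Q (p j) * T)) powr (- lam_u (p j) (q j) / gw_Q (p j)))
        \<longlonglongrightarrow> 0)
  \<and> ((\<forall>j. gw_rho (p j) < 1)
        \<and> filterlim (\<lambda>j. real (n j) * (1 - gw_rho (p j))) at_top sequentially \<longrightarrow>
      (\<lambda>j. laplace_Y (p j) (q j) (n j) t (\<lambda>l. real (n j) / (1 - gw_rho (p j)) * gw_v (p j) l)
           - exp (- lam_u (p j) (q j) * T)) \<longlonglongrightarrow> 0)
  \<and> ((\<forall>j. gw_rho (p j) > 1)
        \<and> filterlim (\<lambda>j. real (n j) * (gw_rho (p j) - 1)) at_top sequentially \<longrightarrow>
      (\<lambda>j. laplace_Y (p j) (q j) (n j) t
              (\<lambda>l. gw_rho (p j) ^ n j / (1 - gw_rho (p j))\<^sup>2 * gw_v (p j) l)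
           - (1 + gw_Q (p j) * T) powr (- lam_u (p j) (q j) / gw_Q (p j))) \<longlonglongrightarrow> 0)"
proof (cases "T = 0")
  \<comment> \<open>At T = 0 all t_l vanish and the transform is 1. The regimes below work with Q T
    > 0, so the closed forms are evaluated directly; in the first clause z = 1 and w = 0.\<close>
  case True
  then have t0: "t k = 0" for k
    using assms(8,9) by (simp add: sum_nonneg_eq_0_iff)
  have [simp]: "r powr - (1 / 2) * r powr (1 / 2) = 1" if "0 < r" for r :: real
    using that by (simp add: powr_add[symmetric])
  show ?thesis
    by (auto simp: laplace_Y_zero[OF t0] True)
next
  case False
  have T: "0 < T" using False assms(8,9) sum_nonneg[of UNIV t] by force
  have K: "\<And>k. inK a b c U (p k)" and J: "\<And>k. inJ d1 d2 (q k)" and t: "\<And>l. 0 \<le> t l"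
    and sT: "0 < sum t UNIV" using assms T by auto
  note const = assms(1,2,3,4,6)
  note n = assms(10) and rho = assms(13)
  have Qev: "\<forall>\<^sub>F k in sequentially. 0 < gw_Q (p k)"
    by (rule gw_Q_eventually_pos[OF assms(1-4) K rho])
  note crit = critical_case[OF const K J t sT rho n, folded assms(9)]
  show ?thesis
  proof (intro conjI allI impI)
    fix r :: real
    assume "0 < r \<and> r < 1 \<and> (\<forall>j. gw_rho (p j) > 1)
        \<and> (\<lambda>j. real (n j) * \<bar>1 - gw_rho (p j)\<bar>) \<longlonglongrightarrow> - ln r"
    then have r: "0 < r" "r < 1" and gt: "\<And>j. gw_rho (p j) > 1"
      and lim: "(\<lambda>j. real (n j) * \<bar>1 - gw_rho (p j)\<bar>) \<longlonglongrightarrow> - ln r" by auto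
    define \<kappa> where "\<kappa> = inverse r - 1 + ln r"
    \<comment> \<open>Strictness of ln x < x - 1, taken at x = 1/r, makes the leading constant of
      the scaling positive.\<close>
    have kap: "0 < \<kappa>" using ln_less_minus_one[of "inverse r"] r by (simp add: \<kappa>_def ln_inverse)
    have lnr: "ln r \<noteq> 0" using r by simp
    have l: "(\<lambda>j. real (n j) * (gw_rho (p j) - 1)) \<longlonglongrightarrow> - ln r"
    proof -
      have "\<bar>1 - gw_rho (p j)\<bar> = gw_rho (p j) - 1" for j using gt[of j] by simp
      then show ?thesis using lim by simp
    qed
    \<comment> \<open>For \<rho> > 1 the scaling is written with \<open>rho_mu\<close>. Since 1 -
      \<open>rho_mu\<close> is asymptotic to \<rho> - 1, n times it also tends to -ln r, and the
      n-th power of \<open>rho_mu\<close> tends to r.\<close>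
    define \<delta> where "\<delta> = (\<lambda>j. 1 - rho_mu (p j))"
    have "(\<lambda>j. real (n j) * (gw_rho (p j) - 1) * (\<delta> j / (gw_rho (p j) - 1))) \<longlonglongrightarrow> - ln r * 1"
      unfolding \<delta>_def by (intro tendsto_mult l rho_mu_supercritical[OF const(1,4,3,2) K rho gt])
    moreover have "real (n j) * (gw_rho (p j) - 1) * (\<delta> j / (gw_rho (p j) - 1)) = real (n j) * \<delta> j" for j
      using gt[of j] by simp
    ultimately have nd: "(\<lambda>j. real (n j) * \<delta> j) \<longlonglongrightarrow> - ln r" by simp
    have "(\<lambda>j. (1 - \<delta> j) ^ n j) \<longlonglongrightarrow> r"
      using power_one_minus_tendsto[OF n nd] r by simp
    then have "(\<lambda>j. (inverse ((1 - \<delta> j) ^ n j) - 1 - real (n j) * \<delta> j) / (real (n j) * \<delta> j)\<^sup>2)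
        \<longlonglongrightarrow> (inverse r - 1 - - ln r) / (- ln r)\<^sup>2"
      using r lnr by (intro tendsto_intros nd) auto
    then have m: "(\<lambda>j. (inverse (rho_mu (p j) ^ n j) - 1 - real (n j) * (1 - rho_mu (p j)))
        / (1 - rho_mu (p j))\<^sup>2 / (real (n j))\<^sup>2) \<longlonglongrightarrow> \<kappa> / (ln r)\<^sup>2"
      by (simp add: \<delta>_def \<kappa>_def power_mult_distrib mult.commute)
    have mpos: "0 < \<kappa> / (ln r)\<^sup>2" using kap lnr by simp
    \<comment> \<open>Dividing by \<kappa> / (ln r)^2 gives (ln r)^2 times Q T / \<kappa>, so the
      closed form applies with y = Q T / \<kappa>.\<close>
    have profile: "riccati_profile (- ln r) (Q * T / (\<kappa> / (ln r)\<^sup>2))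
        = (let z = sqrt (1 + 4 * Q * T / \<kappa>); w = (z - 1) / (z + 1)
           in r powr (- 1 / 2) * (r powr (z / 2) + w * r powr (- z / 2)) / (1 + w))" if "0 < Q" for Q
    proof -
      have "0 < Q * T / \<kappa>" using that T kap by simp
      from riccati_profile_supercritical[OF r this] show ?thesis by (simp add: mult_ac)
    qed
    show "(\<lambda>j. laplace_Y (p j) (q j) (n j) t
              (\<lambda>l. (inverse (rho_mu (p j) ^ n j) - 1 - real (n j) * (1 - rho_mu (p j)))
                     / (1 - rho_mu (p j))\<^sup>2 * gw_v (p j) l)
           - (let z = sqrt (1 + 4 * gw_Q (p j) * T / (inverse r - 1 + ln r));
                  w = (z - 1) / (z + 1)
              in (r powr (-1/2) * (r powr (z/2) + w * r powr (-z/2)) / (1 + w))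
                   powr (- lam_u (p j) (q j) / gw_Q (p j)))) \<longlonglongrightarrow> 0"
      using tendsto_profile_cong[OF Qev crit[OF l m mpos] profile] by (simp only: Let_def \<kappa>_def)
  next
    fix r :: real
    assume "0 < r \<and> r < 1 \<and> T > 0 \<and> (\<forall>j. gw_rho (p j) < 1)
        \<and> (\<lambda>j. real (n j) * \<bar>1 - gw_rho (p j)\<bar>) \<longlonglongrightarrow> - ln r"
    then have r: "0 < r" "r < 1" and lt: "\<And>j. gw_rho (p j) < 1"
      and lim: "(\<lambda>j. real (n j) * \<bar>1 - gw_rho (p j)\<bar>) \<longlonglongrightarrow> - ln r" by auto
    define \<kappa> where "\<kappa> = r - 1 - ln r"
    have kap: "0 < \<kappa>" using ln_less_minus_one[of r] r by (simp add: \<kappa>_def)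
    have lnr: "ln r \<noteq> 0" using r by simp
    have mu: "rho_mu (p j) = gw_rho (p j)" for j by (rule rho_mu_subcritical[OF K const(1,4,3) lt])
    have nd: "(\<lambda>j. real (n j) * (1 - gw_rho (p j))) \<longlonglongrightarrow> - ln r"
    proof -
      have "\<bar>1 - gw_rho (p j)\<bar> = 1 - gw_rho (p j)" for j using lt[of j] by simp
      then show ?thesis using lim by simp
    qed
    have "(\<lambda>j. - (real (n j) * (1 - gw_rho (p j)))) \<longlonglongrightarrow> - (- ln r)" by (intro tendsto_intros nd)
    then have l: "(\<lambda>j. real (n j) * (gw_rho (p j) - 1)) \<longlonglongrightarrow> ln r" by (simp add: algebra_simps)
    have "(\<lambda>j. gw_rho (p j) ^ n j) \<longlonglongrightarrow> r"
      using power_one_minus_tendsto[OF n nd] r by simp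
    then have "(\<lambda>j. (gw_rho (p j) ^ n j - 1 + real (n j) * (1 - gw_rho (p j))) / (real (n j) * (1 - gw_rho (p j)))\<^sup>2)
        \<longlonglongrightarrow> (r - 1 + - ln r) / (- ln r)\<^sup>2"
      using r lnr by (intro tendsto_intros nd) auto
    then have m: "(\<lambda>j. (rho_mu (p j) ^ n j - 1 + real (n j) * (1 - rho_mu (p j)))
        / (1 - rho_mu (p j))\<^sup>2 / (real (n j))\<^sup>2) \<longlonglongrightarrow> \<kappa> / (ln r)\<^sup>2"
      by (simp add: mu \<kappa>_def power_mult_distrib mult.commute)
    have mpos: "0 < \<kappa> / (ln r)\<^sup>2" using kap lnr by simp
    have profile: "riccati_profile (ln r) (Q * T / (\<kappa> / (ln r)\<^sup>2))
        = (let z = sqrt (1 + 4 * Q * T / \<kappa>); w = (z + 1) / (z - 1)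
           in r powr (1 / 2) * (r powr (z / 2) + w * r powr (- z / 2)) / (1 + w))" if "0 < Q" for Q
    proof -
      have "0 < Q * T / \<kappa>" using that T kap by simp
      from riccati_profile_subcritical[OF r this] show ?thesis by (simp add: mult_ac)
    qed
    show "(\<lambda>j. laplace_Y (p j) (q j) (n j) t
              (\<lambda>l. (rho_mu (p j) ^ n j - 1 + real (n j) * (1 - rho_mu (p j)))
                     / (1 - rho_mu (p j))\<^sup>2 * gw_v (p j) l)
           - (let z = sqrt (1 + 4 * gw_Q (p j) * T / (r - 1 - ln r));
                  w = (z + 1) / (z - 1)
              in (r powr (1/2) * (r powr (z/2) + w * r powr (-z/2)) / (1 + w))
                   powr (- lam_u (p j) (q j) / gw_Q (p j)))) \<longlonglongrightarrow> 0"
      using tendsto_profile_cong[OF Qev crit[OF l m mpos] profile] by (simp only: Let_def \<kappa>_def)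
  next
    assume "(\<forall>j. gw_rho (p j) \<noteq> 1) \<and> (\<lambda>j. real (n j) * \<bar>1 - gw_rho (p j)\<bar>) \<longlonglongrightarrow> 0"
    then have lim: "(\<lambda>j. real (n j) * \<bar>1 - gw_rho (p j)\<bar>) \<longlonglongrightarrow> 0" by simp
    have l: "(\<lambda>j. real (n j) * (gw_rho (p j) - 1)) \<longlonglongrightarrow> 0"
      by (rule tendsto_rabs_zero_cancel) (use lim in \<open>simp add: abs_mult abs_minus_commute\<close>)
    have "\<forall>\<^sub>F j in sequentially. 1 \<le> n j" using n by (simp add: filterlim_at_top)
    then have "\<forall>\<^sub>F j in sequentially. 1 / 2 = (real (n j))\<^sup>2 / 2 / (real (n j))\<^sup>2"
      by eventually_elim simp
    from Lim_transform_eventually[OF tendsto_const this]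
    have m: "(\<lambda>j. (real (n j))\<^sup>2 / 2 / (real (n j))\<^sup>2) \<longlonglongrightarrow> 1 / 2" .
    have profile: "riccati_profile 0 (Q * T / (1 / 2)) = cosh (sqrt (2 * Q * T))" if "0 < Q" for Q
      using riccati_profile_zero[of "2 * Q * T"] that T by (simp add: mult_ac)
    show "(\<lambda>j. laplace_Y (p j) (q j) (n j) t (\<lambda>l. (real (n j))\<^sup>2 / 2 * gw_v (p j) l)
           - cosh (sqrt (2 * gw_Q (p j) * T)) powr (- lam_u (p j) (q j) / gw_Q (p j))) \<longlonglongrightarrow> 0"
      using tendsto_profile_cong[OF Qev crit[OF l m] profile] by simp
  next
    assume "(\<forall>j. gw_rho (p j) < 1)
        \<and> filterlim (\<lambda>j. real (n j) * (1 - gw_rho (p j))) at_top sequentially"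
    then have lt: "\<And>j. gw_rho (p j) < 1"
      and nr: "filterlim (\<lambda>j. real (n j) * (1 - gw_rho (p j))) at_top sequentially" by auto
    have "\<forall>\<^sub>F j in sequentially. laplace_Y (p j) (q j) (n j) t (\<lambda>l. real (n j) / (1 - gw_rho (p j)) * gw_v (p j) l)
        - exp (gw_Q (p j) * T) powr (- lam_u (p j) (q j) / gw_Q (p j))
      = laplace_Y (p j) (q j) (n j) t (\<lambda>l. real (n j) / (1 - gw_rho (p j)) * gw_v (p j) l)
        - exp (- lam_u (p j) (q j) * T)"
      \<comment> \<open>In exp (Q T) raised to -\<lambda>'u / Q the \<open>Q\<close> cancels as soon
        as it is nonzero, which holds eventually.\<close>
      using Qev by eventually_elim (simp add: powr_def)
    from Lim_transform_eventually[OF subcritical_case[OF const K J t sT rho lt n nr, folded assms(9)] this]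
    show "(\<lambda>j. laplace_Y (p j) (q j) (n j) t (\<lambda>l. real (n j) / (1 - gw_rho (p j)) * gw_v (p j) l)
           - exp (- lam_u (p j) (q j) * T)) \<longlonglongrightarrow> 0" .
  next
    assume "(\<forall>j. gw_rho (p j) > 1)
        \<and> filterlim (\<lambda>j. real (n j) * (gw_rho (p j) - 1)) at_top sequentially"
    then have gt: "\<And>j. gw_rho (p j) > 1"
      and nr: "filterlim (\<lambda>j. real (n j) * (gw_rho (p j) - 1)) at_top sequentially" by auto
    from supercritical_case[OF const K J t sT rho gt n nr, folded assms(9)]
    show "(\<lambda>j. laplace_Y (p j) (q j) (n j) t
              (\<lambda>l. gw_rho (p j) ^ n j / (1 - gw_rho (p j))\<^sup>2 * gw_v (p j) l)
           - (1 + gw_Q (p j) * T) powr (- lam_u (p j) (q j) / gw_Q (p j))) \<longlonglongrightarrow> 0"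
      by (simp only: power2_commute[of 1])
  qed
qed

end
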